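(* Let $m,n,n_1,\ldots,n_m$ be positive integers, and for $1\le i\le m$ let $U_i$ be a real $n_i\times n$ matrix with $\mathrm{rank}(U_i)=n_i$. Set $N=\sum_{i=1}^m n_i$ and let $U$ be the $N\times n$ matrix with block rows $U_1,\ldots,U_m$. Let $c_1,\ldots,c_m$ be positive numbers and $A$ an $n\times n$ real symmetric positive definite matrix. Set $A_i=U_iAU_i^*$ for $1\le i\le m$ and $C_A=\mathrm{diag}(c_1A_1^{-1},\ldots,c_mA_m^{-1})$, and suppose that $$U^*C_AU=A^{-1}.$$ Let $W$ be a real $N\times(N-n)$ matrix with $\mathrm{rank}(W)=N-n$ such that $$\sqrt{C_A}\,UAU^*\sqrt{C_A}+WW^*=I_N,$$ and let $W_i$ (of size $n_i\times(N-n)$), $1\le i\le m$, be the block rows of $W$. For $\rho>0$ set $$p_i=\frac{1}{c_i\left(1+\frac{1-c_i}{\rho c_i}\right)},\qquad \Gamma_\rho=\frac{(\det A)^{1/2}}{\rho^{\frac{N-n}{2\rho}}}\prod_{i=1}^m\frac{(c_ip_i)^{\frac{n_i}{2p_i}}}{(\det A_i)^{\frac{1}{2p_i}}}.$$ Let $f_i$ be a nonnegative measurable function on $\mathbb{R}^{n_i}$ for $1\le i\le m$ and define $$F(x,y)=\prod_{i=1}^m f_i\Big(U_ix+\frac{1}{\sqrt{c_i}}\sqrt{A_i}\,W_iy\Big),\qquad (x,y)\in\mathbb{R}^n\times\mathbb{R}^{N-n}.$$ (i) For $\rho\ge1$, $$\int_{\mathbb{R}^n}\left(\int_{\mathbb{R}^{N-n}}F^\rho(x,y)\,dy\right)^{1/\rho}dx\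 \ge\ \Gamma_\rho\prod_{i=1}^m\|f_i\|_{p_i}\ \ge\ \left(\int_{\mathbb{R}^{N-n}}\left(\int_{\mathbb{R}^n}F(x,y)\,dx\right)^{\rho}dy\right)^{1/\rho}.$$ (ii) For $0<\rho\le1$, $$\int_{\mathbb{R}^n}\left(\int_{\mathbb{R}^{N-n}}F^\rho(x,y)\,dy\right)^{1/\rho}dx\ \le\ \Gamma_\rho\prod_{i=1}^m\|f_i\|_{p_i}\ \le\ \left(\int_{\mathbb{R}^{N-n}}\left(\int_{\mathbb{R}^n}F(x,y)\,dx\right)^{\rho}dy\right)^{1/\rho}.$$ Moreover, equality holds throughout in (i) and (ii) if $\rho=1$ (for any choice of the $f_i$'s), or if $f_i(x)=\exp(-c_i\langle x,A_i^{-1}x\rangle)$ for $x\in\mathbb{R}^{n_i}$, $1\le i\le m$ (for any $\rho>0$).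
   Context: $M^*$ denotes the transpose of a real matrix $M$; $\sqrt{M}$ is the positive semi-definite square root of a symmetric positive semi-definite $M$. For $p>0$, $\|f\|_p=\left(\int f^p\,dx\right)^{1/p}$ (possibly $\infty$), and $\infty\cdot0=0$ in products of norms. If $N=n$, integration over $\mathbb{R}^{N-n}=\mathbb{R}^0$ is evaluation at a point. *)

theory Defs
  imports "HOL-Analysis.Analysis" "Jordan_Normal_Form.Gauss_Jordan_Elimination"
    "Jordan_Normal_Form.DL_Rank"
begin

text \<open>Vectors and matrices are those of Jordan_Normal_Form, whose dimensions are terms; the
  same-named notions of HOL-Analysis, whose dimensions are types, are hidden.\<close>

hide_const (open) Finite_Cartesian_Product.vec Finite_Cartesian_Product.mat
  Finite_Cartesian_Product.row Finite_Cartesian_Product.rows Finite_Cartesian_Product.column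
  Determinants.det
no_notation Finite_Cartesian_Product.vec_nth (infixl \<open>$\<close> 90)
no_notation inner (infix \<open>\<bullet>\<close> 70)

text \<open>Lebesgue measure on \<open>\<real>\<^sup>k\<close>, including the sets that are not Borel. For \<open>k = 0\<close> the index set
  is empty and the measure is the unit mass at the only vector of dimension 0, so that integration
  is evaluation there.\<close>

definition lborel_vec :: "nat \<Rightarrow> real vec measure" where
  "lborel_vec k = embed_measure (\<Pi>\<^sub>M i\<in>{..<k}. lborel) (vec k)"

definition lebesgue_vec :: "nat \<Rightarrow> real vec measure" where
  "lebesgue_vec k = completion (lborel_vec k)"

lemma inj_on_vec: "inj_on (vec k) (space (\<Pi>\<^sub>M i\<in>{..<k}. (lborel :: real measure)))"
proof (rule inj_onI)
  fix a b :: "nat \<Rightarrow> real"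
  assume "a \<in> space (\<Pi>\<^sub>M i\<in>{..<k}. lborel)" "b \<in> space (\<Pi>\<^sub>M i\<in>{..<k}. lborel)" "vec k a = vec k b"
  then show "a = b"
    by (auto simp: space_PiM vec_eq_iff intro!: PiE_ext[of a "{..<k}" _ b])
qed

lemma space_lborel_vec [simp]: "space (lborel_vec k) = carrier_vec k"
proof -
  have "v \<in> vec k ` space (\<Pi>\<^sub>M i\<in>{..<k}. (lborel :: real measure))" if "v \<in> carrier_vec k" for v
  proof (rule image_eqI)
    show "v = vec k (restrict (\<lambda>i. v $ i) {..<k})"
      using that by auto
  qed (auto simp: space_PiM)
  then show ?thesis
    by (auto simp: lborel_vec_def space_embed_measure)
qed

lemma space_lebesgue_vec [simp]: "space (lebesgue_vec k) = carrier_vec k"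
  by (simp add: lebesgue_vec_def)

lemma nn_integral_lebesgue_vec_0: "(\<integral>\<^sup>+ y. g y \<partial>lebesgue_vec 0) = g (vec 0 h)"
proof -
  let ?P = "\<Pi>\<^sub>M i\<in>{..<0::nat}. (lborel :: real measure)"
  have P: "?P = count_space {\<lambda>_. undefined}"
    by (simp add: PiM_empty)
  have inj: "inj_on (vec 0) (space ?P)"
    by (rule inj_on_vec)
  have carrier: "carrier_vec 0 = {vec 0 h :: real vec}"
    by (auto simp: vec_eq_iff)
  have g: "g \<in> borel_measurable (lborel_vec 0)"
  proof (rule measurableI)
    fix X :: "ennreal set"
    have "g -` X \<inter> space (lborel_vec 0) = {} \<or> g -` X \<inter> space (lborel_vec 0) = space (lborel_vec 0)"
      unfolding space_lborel_vec carrier by auto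
    then show "g -` X \<inter> space (lborel_vec 0) \<in> sets (lborel_vec 0)"
      by (metis sets.empty_sets sets.top)
  qed simp
  have "(\<integral>\<^sup>+ y. g y \<partial>lebesgue_vec 0) = (\<integral>\<^sup>+ y. g y \<partial>lborel_vec 0)"
    unfolding lebesgue_vec_def by (rule nn_integral_completion)
  also have "\<dots> = (\<integral>\<^sup>+ w. g (vec 0 w) \<partial>?P)"
    using nn_integral_embed_measure'[OF inj, of g] g unfolding lborel_vec_def by simp
  also have "\<dots> = g (vec 0 (\<lambda>_. undefined))"
    unfolding P by (simp add: nn_integral_count_space_finite)
  also have "vec 0 (\<lambda>_. undefined) = (vec 0 h :: real vec)"
    by (simp add: vec_eq_iff)
  finally show ?thesis .
qed

lemma emeasure_lborel_vec_box:
  assumes "\<And>i. i < k \<Longrightarrow> a i \<le> b i"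
  shows "emeasure (lborel_vec k) {v \<in> carrier_vec k. \<forall>i<k. v $ i \<in> {a i..b i}}
    = ennreal (\<Prod>i<k. b i - a i)"
proof -
  interpret product_sigma_finite "\<lambda>_::nat. lborel :: real measure" ..
  let ?P = "PiE {..<k} (\<lambda>i. {a i..b i})"
  have "{v \<in> carrier_vec k. \<forall>i<k. v $ i \<in> {a i..b i}} = vec k ` ?P" (is "?B = _")
  proof (intro equalityI subsetI)
    fix v assume v: "v \<in> ?B"
    show "v \<in> vec k ` ?P"
    proof (rule image_eqI)
      show "v = vec k (restrict (\<lambda>i. v $ i) {..<k})"
        using v by (intro eq_vecI) (simp_all add: carrier_vecD)
      show "restrict (\<lambda>i. v $ i) {..<k} \<in> ?P"
        using v by (intro restrict_PiE_iff[THEN iffD2] ballI) simp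
    qed
  next
    fix v assume "v \<in> vec k ` ?P"
    then obtain w where w: "w \<in> ?P" "v = vec k w" by blast
    have "v $ i \<in> {a i..b i}" if "i < k" for i
      using PiE_mem[OF w(1), of i] that w(2) by simp
    then show "v \<in> ?B" using w(2) by simp
  qed
  then have "emeasure (lborel_vec k) ?B = emeasure (\<Pi>\<^sub>M i\<in>{..<k}. lborel) ?P"
    unfolding lborel_vec_def
    using emeasure_embed_measure_image'[OF inj_on_vec, of ?P k]
      sets_PiM_I_finite[of "{..<k}" "\<lambda>i. {a i..b i}" "\<lambda>_. lborel"] by simp
  also have "\<dots> = (\<Prod>i<k. emeasure lborel {a i..b i})"
    by (rule emeasure_PiM) simp_all
  also have "\<dots> = (\<Prod>i<k. ennreal (b i - a i))"
    using assms by (intro prod.cong) simp_all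
  also have "\<dots> = ennreal (\<Prod>i<k. b i - a i)"
    using assms by (intro prod_ennreal) simp
  finally show ?thesis .
qed

text \<open>Real powers on \<open>[0,\<infinity>]\<close>; only used for exponents \<open>p > 0\<close>, where \<open>0\<^sup>p = 0\<close> and
  \<open>\<infinity>\<^sup>p = \<infinity>\<close>.\<close>

definition ennreal_powr :: "ennreal \<Rightarrow> real \<Rightarrow> ennreal" where
  "ennreal_powr x p = (if x = \<infinity> then \<infinity> else ennreal (enn2real x powr p))"

text \<open>\<open>\<parallel>f\<parallel>\<^sub>p\<close> for a nonnegative function \<open>f\<close> on \<open>\<real>\<^sup>k\<close> and \<open>p > 0\<close>. In \<open>ennreal\<close> products
  \<open>\<infinity> * 0 = 0\<close> holds by definition.\<close>

definition Lp_norm :: "nat \<Rightarrow> real \<Rightarrow> (real vec \<Rightarrow> real) \<Rightarrow> ennreal" where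
  "Lp_norm k p f = ennreal_powr (\<integral>\<^sup>+ x. ennreal (f x powr p) \<partial>lebesgue_vec k) (1 / p)"

definition sym_pos_def :: "nat \<Rightarrow> real mat \<Rightarrow> bool" where
  "sym_pos_def k A \<longleftrightarrow> A \<in> carrier_mat k k \<and> A\<^sup>T = A \<and>
     (\<forall>v\<in>carrier_vec k. v \<noteq> 0\<^sub>v k \<longrightarrow> 0 < v \<bullet> (A *\<^sub>v v))"

definition sym_pos_semidef :: "nat \<Rightarrow> real mat \<Rightarrow> bool" where
  "sym_pos_semidef k A \<longleftrightarrow> A \<in> carrier_mat k k \<and> A\<^sup>T = A \<and>
     (\<forall>v\<in>carrier_vec k. 0 \<le> v \<bullet> (A *\<^sub>v v))"

text \<open>Unspecified unless \<open>A\<close> is symmetric positive semi-definite, in which case the square root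
  exists and is unique.\<close>

definition sqrt_mat :: "real mat \<Rightarrow> real mat" where
  "sqrt_mat A = (THE B. sym_pos_semidef (dim_row A) B \<and> B * B = A)"

text \<open>\<^const>\<open>mat_inverse\<close> returns \<open>None\<close> on singular matrices; \<open>minv\<close> is used on invertible
  ones only.\<close>

definition minv :: "real mat \<Rightarrow> real mat" where
  "minv A = the (mat_inverse A)"

text \<open>The matrix with \<open>k\<close> columns whose block rows are \<open>B 0, \<dots>, B (m - 1)\<close>.\<close>

definition stack_rows :: "nat \<Rightarrow> nat \<Rightarrow> (nat \<Rightarrow> real mat) \<Rightarrow> real mat" where
  "stack_rows k m B = mat_of_rows k (concat (map (\<lambda>i. rows (B i)) [0..<m]))"

abbreviation mat_rank :: "real mat \<Rightarrow> nat" where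
  "mat_rank A \<equiv> vec_space.rank (dim_row A) A"

end

theory Submission
 imports Defs
begin

abbreviation (input) Rn where "Rn \<equiv> carrier_vec"
abbreviation (input) Mat where "Mat \<equiv> carrier_mat"
abbreviation (input) leb where "leb \<equiv> lborel_vec"
abbreviation (input) borel_fun where "borel_fun k \<equiv> borel_measurable (lborel_vec k)"

text \<open>
 Writing \<open>x = \<surd>A x'\<close> and splitting a Gaussian factor off each \<open>f\<^sub>i\<close>, the three quantities become, up to one common
 constant, nested integrals of \<open>\<Prod>\<^sub>i \<phi>\<^sub>i (V\<^sub>i x + W\<^sub>i y)\<close> for the Gaussian measure, where the square matrix with blocks
 \<open>V\<^sub>i, W\<^sub>i\<close> is orthogonal. Raising the inner integral to a power and using duality, both comparisons reduce to a
 single inequality between \<open>E \<Prod>\<^sub>i h\<^sub>i (L\<^sub>i \<xi>) powr \<alpha>\<^sub>i\<close> and \<open>\<Prod>\<^sub>i (E h\<^sub>i (L\<^sub>i \<xi>)) powr \<alpha>\<^sub>i\<close>, in which the inner integral is one more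
 function \<open>h\<^sub>0\<close>, with exponent of either sign. Its direction is decided by the sign of the quadratic form
 \<open>\<Sum>\<^sub>i\<^sub>j \<alpha>\<^sub>i \<alpha>\<^sub>j L\<^sub>i\<^sup>T v\<^sub>i \<bullet> L\<^sub>j\<^sup>T v\<^sub>j - \<Sum>\<^sub>i \<alpha>\<^sub>i \<bar>L\<^sub>i\<^sup>T v\<^sub>i\<bar>\<^sup>2\<close>, the second-order term of the time derivative along the heat flow. The flow
 is discretised: a step of size \<open>\<epsilon>\<close> costs \<open>O(\<epsilon>\<^sup>3)\<close> and \<open>1/\<epsilon>\<^sup>2\<close> steps are needed. Smooth bounded functions are treated
 first and measurable ones by closing under pointwise limits.\<close>

section \<open>Lebesgue measure on vectors\<close>

text \<open>The equality case decides what is split off: removing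
  \<open>exp (- (u \<bullet> u))\<close> turns the Gaussian functions of the statement into the
  constant 1, and all constants then come from the change of variables alone. The exponents are
  forced in a similar way. Once \<open>y\<close> is rescaled by \<open>1 / sqrt \<rho>\<close>, the
  covariance of \<open>V i x + W i y\<close> is, up to normalisation, \<open>s i\<close> times the
  identity, and \<open>p i\<close> is the reciprocal of \<open>s i\<close>. With the weights
  \<open>s i\<close>, orthogonality trades the diagonal part of the quadratic form for the double
  sum, and what remains is \<open>1 - r\<close> times a square; so one computation serves both
  directions, which change places at exponent 1. The obstacle is uniformity: the accumulated error
  vanishes only if the error constant of a step is the same all along the flow. Therefore the smooth
  class is given by fixed bounds that Gaussian averaging preserves, and all functions stay above a
  positive number as long as a negative exponent may occur.\<close>

lemma lborel_vec_eq_distr: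
 "leb k = distr (\<Pi>\<^sub>M i\<in>{..<k}. lborel) (leb k) (vec k)"
 unfolding lborel_vec_def by (rule embed_measure_eq_distr'[OF inj_on_vec])

lemma measurable_vec_PiM: "vec k \<in> (\<Pi>\<^sub>M i\<in>{..<k}. lborel) \<rightarrow>\<^sub>M leb k"
 unfolding lborel_vec_def by (rule measurable_embed_measure2'[OF inj_on_vec])

lemma measurable_vec_index:
 assumes "i < k"
 shows "(%v. v $ i) \<in> borel_fun k"
 unfolding lborel_vec_def
proof (rule measurable_embed_measure1)
 have "(%x. x i) \<in> borel_measurable (\<Pi>\<^sub>M i\<in>{..<k}. (lborel :: real measure))"
  using assms measurable_component_singleton[of i "{..<k}" "%_. lborel :: real measure"] by simp
 then show "(%x. vec k x $ i) \<in> borel_measurable (\<Pi>\<^sub>M i\<in>{..<k}. (lborel :: real measure))"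
  using assms by simp
qed

lemma measurable_vec_index':
 assumes "f \<in> M \<rightarrow>\<^sub>M leb k" "i < k"
 shows "(%om. f om $ i) \<in> borel_measurable M"
 using measurable_compose[OF assms(1) measurable_vec_index[OF assms(2)]] .

lemma measurable_lborel_vecI:
 assumes "!!om. om \<in> space M ==> f om \<in> Rn k"
  and "!!i. i < k ==> (%om. f om $ i) \<in> borel_measurable M"
 shows "f \<in> M \<rightarrow>\<^sub>M leb k"
proof -
 have "(%om. \<lambda>i\<in>{..<k}. f om $ i) \<in> M \<rightarrow>\<^sub>M (\<Pi>\<^sub>M i\<in>{..<k}. (lborel :: real measure))"
  using assms(2) by (intro measurable_restrict) simp
 from measurable_compose[OF this measurable_vec_PiM]
 have "(%om. vec k (\<lambda>i\<in>{..<k}. f om $ i)) \<in> M \<rightarrow>\<^sub>M leb k" .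
 moreover have "vec k (\<lambda>i\<in>{..<k}. f om $ i) = f om" if "om \<in> space M" for om
  using assms(1)[OF that] by (intro eq_vecI) auto
 ultimately show ?thesis
  by (simp cong: measurable_cong)
qed

lemma measurable_lborel_vecD:
 "f \<in> M \<rightarrow>\<^sub>M leb k ==> om \<in> space M ==> f om \<in> Rn k"
 by (drule measurable_space) auto

lemma measurable_vec_add [measurable]:
 assumes [measurable]: "f \<in> M \<rightarrow>\<^sub>M leb k" "g \<in> M \<rightarrow>\<^sub>M leb k"
 shows "(%om. f om + g om) \<in> M \<rightarrow>\<^sub>M leb k"
proof (rule measurable_lborel_vecI)
 fix i assume i: "i < k"
 have [measurable]: "(%om. f om $ i) \<in> borel_measurable M" "(%om. g om $ i) \<in> borel_measurable M"
  by (rule assms(1,2)[THEN measurable_vec_index', OF i])+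
 have "(f om + g om) $ i = f om $ i + g om $ i" if "om \<in> space M" for om
  using i measurable_lborel_vecD[OF assms(2) that] by simp
 then show "(%om. (f om + g om) $ i) \<in> borel_measurable M"
  by (simp cong: measurable_cong)
qed (auto intro!: add_carrier_vec measurable_lborel_vecD[OF assms(1)] measurable_lborel_vecD[OF assms(2)])

lemma measurable_vec_smult [measurable]:
 assumes [measurable]: "f \<in> M \<rightarrow>\<^sub>M leb k" "c \<in> borel_measurable M"
 shows "(%om. c om \<cdot>\<^sub>v f om) \<in> M \<rightarrow>\<^sub>M leb k"
proof (rule measurable_lborel_vecI)
 fix i assume i: "i < k"
 have [measurable]: "(%om. f om $ i) \<in> borel_measurable M"
  by (rule measurable_vec_index'[OF assms(1) i])
 have "(c om \<cdot>\<^sub>v f om) $ i = c om * f om $ i" if "om \<in> space M" for om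
  using i measurable_lborel_vecD[OF assms(1) that] by simp
 then show "(%om. (c om \<cdot>\<^sub>v f om) $ i) \<in> borel_measurable M"
  by (simp cong: measurable_cong)
qed (auto intro: measurable_lborel_vecD[OF assms(1)])

lemma measurable_scalar_prod:
 assumes [measurable]: "f \<in> M \<rightarrow>\<^sub>M leb k" "g \<in> M \<rightarrow>\<^sub>M leb k"
 shows "(%om. f om \<bullet> g om) \<in> borel_measurable M"
proof -
 have [measurable]: "(%om. f om $ i) \<in> borel_measurable M" "(%om. g om $ i) \<in> borel_measurable M"
  if "i < k" for i
  by (rule assms(1,2)[THEN measurable_vec_index', OF that])+
 have "f om \<bullet> g om = (\<Sum>i\<in>{..<k}. f om $ i * g om $ i)" if "om \<in> space M" for om
  using measurable_lborel_vecD[OF assms(2) that] by (simp add: scalar_prod_def lessThan_atLeast0)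
 moreover have "(%om. \<Sum>i\<in>{..<k}. f om $ i * g om $ i) \<in> borel_measurable M"
  by (intro borel_measurable_sum) measurable
 ultimately show ?thesis
  by (simp cong: measurable_cong)
qed

lemma measurable_vec_const: "v \<in> Rn k ==> (%om. v) \<in> M \<rightarrow>\<^sub>M leb k"
 by simp

lemma measurable_mult_mat_vec:
 assumes "B \<in> Mat d k" and [measurable]: "f \<in> M \<rightarrow>\<^sub>M leb k"
 shows "(%om. B *\<^sub>v f om) \<in> M \<rightarrow>\<^sub>M leb d"
proof (rule measurable_lborel_vecI)
 fix i assume i: "i < d"
 have r: "row B i \<in> Rn k"
  using assms(1) i by auto
 have [measurable]: "(%om. row B i \<bullet> f om) \<in> borel_measurable M"
  using measurable_scalar_prod[OF measurable_vec_const[OF r] assms(2)] .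
 have "(B *\<^sub>v f om) $ i = row B i \<bullet> f om" for om
  using i assms(1) by simp
 then show "(%om. (B *\<^sub>v f om) $ i) \<in> borel_measurable M"
  by simp
qed (use assms in \<open>auto intro!: mult_mat_vec_carrier measurable_lborel_vecD[OF assms(2)]\<close>)

lemma measurable_append_vec [measurable]:
 assumes [measurable]: "f \<in> M \<rightarrow>\<^sub>M leb a" "g \<in> M \<rightarrow>\<^sub>M leb b"
 shows "(%om. f om @\<^sub>v g om) \<in> M \<rightarrow>\<^sub>M leb (a + b)"
proof (rule measurable_lborel_vecI)
 fix i assume i: "i < a + b"
 show "(%om. (f om @\<^sub>v g om) $ i) \<in> borel_measurable M"
 proof (cases "i < a")
  case True
  have [measurable]: "(%om. f om $ i) \<in> borel_measurable M"
   by (rule measurable_vec_index'[OF assms(1) True])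
  have "(f om @\<^sub>v g om) $ i = f om $ i" if "om \<in> space M" for om
   using True i measurable_lborel_vecD[OF assms(2) that] measurable_lborel_vecD[OF assms(1) that]
   by simp
  then show ?thesis by (simp cong: measurable_cong)
 next
  case False
  have [measurable]: "(%om. g om $ (i - a)) \<in> borel_measurable M"
   using False i by (intro measurable_compose[OF assms(2) measurable_vec_index]) auto
  have "(f om @\<^sub>v g om) $ i = g om $ (i - a)" if "om \<in> space M" for om
   using False i measurable_lborel_vecD[OF assms(2) that] measurable_lborel_vecD[OF assms(1) that]
   by simp
  then show ?thesis by (simp cong: measurable_cong)
 qed
qed (auto dest: measurable_lborel_vecD[OF assms(1)] measurable_lborel_vecD[OF assms(2)])

lemma sets_box_lborel_vec:
 assumes "!!i. i < k ==> A i \<in> sets borel"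
 shows "{v \<in> Rn k. \<forall>i<k. v $ i \<in> A i} \<in> sets (leb k)"
proof -
 have "{v \<in> space (leb k). v $ i \<in> A i} \<in> sets (leb k)" if "i < k" for i
  using measurable_sets[OF measurable_vec_index[OF that] assms[OF that]]
  by (simp add: vimage_def Int_def conj_commute)
 then have "{v \<in> space (leb k). \<forall>i\<in>{..<k}. v $ i \<in> A i} \<in> sets (leb k)"
  by (intro sets.sets_Collect_finite_All) simp_all
 then show ?thesis unfolding Ball_def lessThan_iff space_lborel_vec .
qed

lemma emeasure_lborel_vec_Pi:
 assumes "!!i. i < k ==> A i \<in> sets borel"
 shows "emeasure (leb k) {v \<in> Rn k. \<forall>i<k. v $ i \<in> A i}
  = (\<Prod>i<k. emeasure lborel (A i))"
proof -
 interpret product_sigma_finite "%_::nat. lborel :: real measure" ..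
 have "emeasure (leb k) {v \<in> Rn k. \<forall>i<k. v $ i \<in> A i}
  = emeasure (\<Pi>\<^sub>M i\<in>{..<k}. lborel)
    (vec k -` {v \<in> Rn k. \<forall>i<k. v $ i \<in> A i} \<inter> space (\<Pi>\<^sub>M i\<in>{..<k}. lborel))"
  by (subst lborel_vec_eq_distr, rule emeasure_distr[OF measurable_vec_PiM sets_box_lborel_vec[OF assms]])
 also have "vec k -` {v \<in> Rn k. \<forall>i<k. v $ i \<in> A i} \<inter> space (\<Pi>\<^sub>M i\<in>{..<k}. lborel)
  = PiE {..<k} A"
  by (auto simp: space_PiM PiE_iff)
 also have "emeasure (\<Pi>\<^sub>M i\<in>{..<k}. lborel) (PiE {..<k} A) = (\<Prod>i<k. emeasure lborel (A i))"
  using assms by (intro emeasure_PiM) auto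
 finally show ?thesis .
qed

text \<open>Reading off coordinates carries \<open>Q\<close> to a measure on functions over
  \<open>{..<k}\<close>, where agreement on boxes characterises the product measure. Translation,
  reflection and concatenation are all treated by checking boxes through this criterion.\<close>

lemma lborel_vec_eqI:
 assumes sets: "sets Q = sets (leb k)"
  and box: "!!A. (!!i. i < k ==> A i \<in> sets borel) ==>
   emeasure Q {v \<in> Rn k. \<forall>i<k. v $ i \<in> A i} = (\<Prod>i<k. emeasure lborel (A i))"
 shows "Q = leb k"
proof -
 interpret product_sigma_finite "%_::nat. lborel :: real measure" ..
 let ?P = "\<Pi>\<^sub>M i\<in>{..<k}. (lborel :: real measure)"
 let ?r = "%v. \<lambda>i\<in>{..<k}. v $ i"
 have sp: "space Q = Rn k"
  using sets_eq_imp_space_eq[OF sets] by simp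
 have m: "?r \<in> Q \<rightarrow>\<^sub>M ?P"
  using measurable_vec_index[of _ k] by (intro measurable_restrict) (simp add: measurable_cong_sets[OF sets refl])
 have "distr Q ?P ?r = ?P"
 proof (rule PiM_eqI)
  fix A :: "nat => real set" assume A: "!!i. i \<in> {..<k} ==> A i \<in> sets lborel"
  have "emeasure (distr Q ?P ?r) (PiE {..<k} A) = emeasure Q (?r -` PiE {..<k} A \<inter> space Q)"
   using A by (intro emeasure_distr m sets_PiM_I_finite) simp_all
  also have "?r -` PiE {..<k} A \<inter> space Q = {v \<in> Rn k. \<forall>i<k. v $ i \<in> A i}"
   unfolding sp vimage_def restrict_PiE_iff by blast
  finally show "emeasure (distr Q ?P ?r) (PiE {..<k} A) = (\<Prod>i<k. emeasure lborel (A i))"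
   using box[of A] A by (simp only: sets_lborel lessThan_iff)
 qed simp_all
 then have "leb k = distr (distr Q ?P ?r) (leb k) (vec k)"
  using lborel_vec_eq_distr[of k] by simp
 also have "... = distr Q (leb k) (%v. vec k (?r v))"
  using m by (subst distr_distr) (auto intro: measurable_vec_PiM simp: comp_def)
 also have "... = distr Q Q (%v. v)"
 proof (rule distr_cong)
  show "vec k (?r v) = v" if "v \<in> space Q" for v
   using that unfolding sp by (intro eq_vecI) auto
 qed (simp_all add: sets)
 also have "... = Q"
  by (rule distr_id)
 finally show ?thesis ..
qed

text \<open>The preimage of a box under a coordinatewise map is a box, so invariance on the line in
  each coordinate suffices. Translations and reflections are the two instances.\<close>

lemma distr_lborel_vec_coordinatewise:
 assumes T: "!!i. i < k ==> T i \<in> borel_measurable borel" "!!i. i < k ==> distr lborel borel (T i) = lborel"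
 shows "distr (leb k) (leb k) (%v. vec k (%i. T i (v $ i))) = leb k"
proof (rule lborel_vec_eqI)
 have m: "(%v. vec k (%i. T i (v $ i))) \<in> leb k \<rightarrow>\<^sub>M leb k"
  using T(1) by (intro measurable_lborel_vecI) (auto intro!: measurable_compose[OF measurable_vec_index])
 fix A :: "nat => real set" assume A: "!!i. i < k ==> A i \<in> sets borel"
 let ?B = "%A. {v \<in> Rn k. \<forall>i<k. v $ i \<in> A i}"
 have "(%v. vec k (%i. T i (v $ i))) -` ?B A \<inter> space (leb k) = ?B (%i. T i -` A i \<inter> space borel)"
  by (intro Set.set_eqI) (simp add: conj_commute)
 with emeasure_distr[OF m sets_box_lborel_vec[of k A]] A
 have "emeasure (distr (leb k) (leb k) (%v. vec k (%i. T i (v $ i)))) (?B A)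
  = emeasure (leb k) (?B (%i. T i -` A i \<inter> space borel))"
  by metis
 also have "... = (\<Prod>i<k. emeasure lborel (T i -` A i \<inter> space borel))"
  using A T(1) by (intro emeasure_lborel_vec_Pi measurable_sets)
 also have "... = (\<Prod>i<k. emeasure (distr lborel borel (T i)) (A i))"
  using A T(1) by (intro prod.cong refl) (subst emeasure_distr, auto)
 finally show "emeasure (distr (leb k) (leb k) (%v. vec k (%i. T i (v $ i)))) (?B A)
  = (\<Prod>i<k. emeasure lborel (A i))"
  using T(2) by simp
qed simp

lemma distr_lborel_vec_translation:
 assumes "a \<in> Rn k"
 shows "distr (leb k) (leb k) (%v. v + a) = leb k"
proof -
 have "distr (leb k) (leb k) (%v. v + a)
  = distr (leb k) (leb k) (%v. vec k (%i. a $ i + v $ i))"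
  using assms by (intro distr_cong refl eq_vecI) auto
 then show ?thesis
  using distr_lborel_vec_coordinatewise[of k "%i. (+) (a $ i)"] by (simp add: lborel_distr_plus)
qed

lemma distr_lborel_vec_uminus:
 "distr (leb k) (leb k) (%v. - v) = leb k"
proof -
 have "distr (leb k) (leb k) (%v. - v)
  = distr (leb k) (leb k) (%v. vec k (%i. - (v $ i)))"
  by (intro distr_cong refl eq_vecI) auto
 then show ?thesis
  using distr_lborel_vec_coordinatewise[of k "%_. uminus"] by (simp add: lborel_distr_uminus)
qed

section \<open>Product structure and Fubini's theorem\<close>

lemma sigma_finite_lborel_vec: "sigma_finite_measure (leb k)"
proof
 let ?B = "%n::nat. {v \<in> Rn k. \<forall>i<k. v $ i \<in> {- real n..real n}}"
 have 1: "range ?B \<subseteq> sets (leb k)"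
  by (rule image_subsetI, rule sets_box_lborel_vec) simp
 have 2: "(\<Union>n. ?B n) = space (leb k)"
 proof safe
  fix v :: "real vec" assume v: "v \<in> space (leb k)"
  obtain n :: nat where n: "(\<Sum>i<k. \<bar>v $ i\<bar>) \<le> real n"
   using real_arch_simple by blast
  have "\<bar>v $ i\<bar> \<le> (\<Sum>i<k. \<bar>v $ i\<bar>)" if "i < k" for i
   using that by (intro member_le_sum) auto
  then have "\<bar>v $ i\<bar> \<le> real n" if "i < k" for i
   using n that order_trans by blast
  then have "v $ i \<in> {- real n..real n}" if "i < k" for i
   using that by (simp add: abs_le_iff minus_le_iff)
  with v have "v \<in> ?B n" unfolding space_lborel_vec by blast
  then show "v \<in> (\<Union>n. ?B n)" by blast
 qed auto
 have 3: "emeasure (leb k) (?B n) \<noteq> \<infinity>" for n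
  by (subst emeasure_lborel_vec_box) simp_all
 show "\<exists>A. countable A \<and> A \<subseteq> sets (leb k) \<and> \<Union>A = space (leb k) \<and>
   (\<forall>a\<in>A. emeasure (leb k) a \<noteq> \<infinity>)"
  using 1 2 3 by (intro exI[of _ "range ?B"]) blast
qed

text \<open>Concatenation is the bridge between dimensions: through it, block matrices acting on a
  pair of variables are handled by iterated integrals.\<close>

lemma lborel_vec_append:
 "distr (leb a \<Otimes>\<^sub>M leb b) (leb (a + b)) (%(x, y). x @\<^sub>v y) = leb (a + b)"
proof (rule lborel_vec_eqI)
 interpret b: sigma_finite_measure "leb b" by (rule sigma_finite_lborel_vec)
 fix A :: "nat => real set" assume A: "!!i. i < a + b ==> A i \<in> sets borel"
 have A1: "A i \<in> sets borel" if "i < a" for i using A that by simp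
 have A2: "A (a + i) \<in> sets borel" if "i < b" for i using A that by simp
 let ?B = "%k A. {v \<in> Rn k. \<forall>i<k. v $ i \<in> A i}"
 have "emeasure (distr (leb a \<Otimes>\<^sub>M leb b) (leb (a + b)) (%(x, y). x @\<^sub>v y)) (?B (a + b) A)
  = emeasure (leb a \<Otimes>\<^sub>M leb b)
   ((%(x, y). x @\<^sub>v y) -` ?B (a + b) A \<inter> space (leb a \<Otimes>\<^sub>M leb b))"
  by (intro emeasure_distr sets_box_lborel_vec[OF A]) measurable
 also have "(%(x, y). x @\<^sub>v y) -` ?B (a + b) A \<inter> space (leb a \<Otimes>\<^sub>M leb b)
  = ?B a A \<times> ?B b (%i. A (a + i))" (is "?L = ?R")
 proof (intro Set.set_eqI iffI)
  fix z assume z: "z \<in> ?L"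
  obtain x y where xy: "z = (x, y)" by force
  have c: "x \<in> Rn a" "y \<in> Rn b" and h: "!!i. i < a + b ==> (x @\<^sub>v y) $ i \<in> A i"
   using z xy by (auto simp: space_pair_measure)
  have "x $ i \<in> A i" if "i < a" for i
   using h[of i] that c by simp
  moreover have "y $ i \<in> A (a + i)" if "i < b" for i
   using h[of "a + i"] that c by simp
  ultimately show "z \<in> ?R" using c xy by auto
 next
  fix z assume "z \<in> ?R"
  then obtain x y where xy: "z = (x, y)" and c: "x \<in> Rn a" "y \<in> Rn b"
   and h: "!!i. i < a ==> x $ i \<in> A i" "!!i. i < b ==> y $ i \<in> A (a + i)"
   by blast
  have "(x @\<^sub>v y) $ i \<in> A i" if "i < a + b" for i
   using that c h(1)[of i] h(2)[of "i - a"] by (cases "i < a") simp_all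
  moreover have "z \<in> space (leb a \<Otimes>\<^sub>M leb b)" "x @\<^sub>v y \<in> Rn (a + b)"
   using c by (simp_all add: xy space_pair_measure)
  ultimately show "z \<in> ?L" unfolding xy by simp
 qed
 also have "emeasure (leb a \<Otimes>\<^sub>M leb b) ...
  = (\<Prod>i<a. emeasure lborel (A i)) * (\<Prod>i<b. emeasure lborel (A (a + i)))"
  by (rule trans[OF b.emeasure_pair_measure_Times arg_cong2[where f = "(*)"]])
   (rule sets_box_lborel_vec emeasure_lborel_vec_Pi, erule A1 A2)+
 also have "... = (\<Prod>i<a + b. emeasure lborel (A i))"
  by (induction b) (simp_all add: mult.assoc[symmetric])
 finally show "emeasure (distr (leb a \<Otimes>\<^sub>M leb b) (leb (a + b)) (%(x, y). x @\<^sub>v y)) (?B (a + b) A)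
  = (\<Prod>i<a + b. emeasure lborel (A i))" .
qed simp

lemma nn_integral_lborel_vec_append:
 assumes [measurable]: "g \<in> borel_fun (a + b)"
 shows "(\<integral>\<^sup>+ z. g z \<partial>leb (a + b)) = (\<integral>\<^sup>+ x. \<integral>\<^sup>+ y. g (x @\<^sub>v y) \<partial>leb b \<partial>leb a)"
proof -
 interpret b: sigma_finite_measure "leb b" by (rule sigma_finite_lborel_vec)
 have "(\<integral>\<^sup>+ z. g z \<partial>leb (a + b)) = (\<integral>\<^sup>+ z. g (fst z @\<^sub>v snd z) \<partial>(leb a \<Otimes>\<^sub>M leb b))"
  by (subst lborel_vec_append[symmetric], subst nn_integral_distr) (measurable, simp add: case_prod_beta)
 also have "... = (\<integral>\<^sup>+ x. \<integral>\<^sup>+ y. g (x @\<^sub>v y) \<partial>leb b \<partial>leb a)"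
  by (subst b.nn_integral_fst[symmetric]) simp_all
 finally show ?thesis .
qed

lemma nn_integral_lborel_vec_Fubini:
 assumes [measurable]: "case_prod g \<in> borel_measurable (leb a \<Otimes>\<^sub>M leb b)"
 shows "(\<integral>\<^sup>+ x. \<integral>\<^sup>+ y. g x y \<partial>leb b \<partial>leb a) = (\<integral>\<^sup>+ y. \<integral>\<^sup>+ x. g x y \<partial>leb a \<partial>leb b)"
proof -
 interpret pair_sigma_finite "leb a" "leb b"
  using sigma_finite_lborel_vec by (simp add: pair_sigma_finite_def)
 show ?thesis
  using Fubini'[of g] by simp
qed

lemma nn_integral_lborel_vec_translation:
 assumes [measurable]: "g \<in> borel_fun k" and "a \<in> Rn k"
 shows "(\<integral>\<^sup>+ v. g (v + a) \<partial>leb k) = (\<integral>\<^sup>+ v. g v \<partial>leb k)"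
proof -
 have m: "(%v. v + a) \<in> leb k \<rightarrow>\<^sub>M leb k"
  using assms(2) by (intro measurable_vec_add measurable_vec_const) simp_all
 show ?thesis
  using nn_integral_distr[OF m, of g] by (simp add: distr_lborel_vec_translation[OF assms(2)])
qed

lemma nn_integral_lborel_vec_uminus:
 assumes [measurable]: "g \<in> borel_fun k"
 shows "(\<integral>\<^sup>+ v. g (- v) \<partial>leb k) = (\<integral>\<^sup>+ v. g v \<partial>leb k)"
proof -
 have "(%v::real vec. - v) \<in> leb k \<rightarrow>\<^sub>M leb k"
 proof (rule measurable_lborel_vecI)
  fix i assume i: "i < k"
  have "(%v. - (v $ i)) \<in> borel_fun k"
   using measurable_vec_index[OF i] by simp
  moreover have "(- v) $ i = - (v $ i)" if "v \<in> space (leb k)" for v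
   using that i by simp
  ultimately show "(%v. (- v) $ i) \<in> borel_fun k"
   using measurable_cong[of "leb k" "%v. (- v) $ i" "%v. - (v $ i)" borel] by blast
 qed simp
 from nn_integral_distr[OF this, of g] show ?thesis
  by (simp add: distr_lborel_vec_uminus)
qed

lemma nn_integral_lborel_vec_prod:
 assumes f: "!!i. i < k ==> f i \<in> borel_measurable borel"
 shows "(\<integral>\<^sup>+ v. (\<Prod>i<k. f i (v $ i)) \<partial>leb k) = (\<Prod>i<k. \<integral>\<^sup>+ t. f i t \<partial>lborel)"
proof -
 interpret product_sigma_finite "%_::nat. lborel :: real measure" ..
 have "(%v. (\<Prod>i<k. f i (v $ i))) \<in> borel_fun k"
  using f by (intro borel_measurable_prod_ennreal measurable_compose[OF measurable_vec_index]) auto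
 then have "(\<integral>\<^sup>+ v. (\<Prod>i<k. f i (v $ i)) \<partial>leb k)
  = (\<integral>\<^sup>+ x. (\<Prod>i<k. f i (vec k x $ i)) \<partial>(\<Pi>\<^sub>M i\<in>{..<k}. lborel))"
  by (subst lborel_vec_eq_distr, subst nn_integral_distr) (auto intro: measurable_vec_PiM)
 also have "... = (\<integral>\<^sup>+ x. (\<Prod>i<k. f i (x i)) \<partial>(\<Pi>\<^sub>M i\<in>{..<k}. lborel))"
  by (intro nn_integral_cong prod.cong) auto
 also have "... = (\<Prod>i<k. \<integral>\<^sup>+ t. f i t \<partial>lborel)"
  using f by (intro product_nn_integral_prod) auto
 finally show ?thesis .
qed

section \<open>Linear changes of variables\<close>

lemma measurable_uminus_vec: "(%v::real vec. - v) \<in> leb k \<rightarrow>\<^sub>M leb k"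
proof (rule measurable_lborel_vecI)
 fix i assume i: "i < k"
 have "(%v. - (v $ i)) \<in> borel_fun k"
  using measurable_vec_index[OF i] by simp
 moreover have "(- v) $ i = - (v $ i)" if "v \<in> space (leb k)" for v
  using that i by simp
 ultimately show "(%v. (- v) $ i) \<in> borel_fun k"
  using measurable_cong[of "leb k" "%v. (- v) $ i" "%v. - (v $ i)" borel] by blast
qed simp

lemma measurable_mat_lborel_vec:
 "B \<in> Mat d k ==> (%v. B *\<^sub>v v) \<in> leb k \<rightarrow>\<^sub>M leb d"
 by (rule measurable_mult_mat_vec[OF _ measurable_ident_sets[OF refl]])

lemma measurable_scalar_prod_self: "(%v. v \<bullet> v) \<in> borel_fun k"
 by (rule measurable_scalar_prod[OF measurable_ident_sets[OF refl] measurable_ident_sets[OF refl]])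

text \<open>For each fixed \<open>x\<close> the shear is a translation of the inner
  variable.\<close>

lemma nn_integral_lborel_vec_shear:
 assumes h: "case_prod h \<in> borel_measurable (leb a \<Otimes>\<^sub>M leb b)"
  and t: "!!x. x \<in> Rn a ==> t x \<in> Rn b"
 shows "(\<integral>\<^sup>+ x. \<integral>\<^sup>+ y. h x (y + t x) \<partial>leb b \<partial>leb a)
  = (\<integral>\<^sup>+ x. \<integral>\<^sup>+ y. h x y \<partial>leb b \<partial>leb a)"
 using h t by (intro nn_integral_cong nn_integral_lborel_vec_translation) simp_all

text \<open>Here the outer variable is sheared, so Fubini's theorem has to bring it inside first;
  this is where \<open>t\<close> must be measurable.\<close>

lemma nn_integral_lborel_vec_shear':
 assumes h: "case_prod h \<in> borel_measurable (leb a \<Otimes>\<^sub>M leb b)"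
  and t [measurable]: "t \<in> leb b \<rightarrow>\<^sub>M leb a"
 shows "(\<integral>\<^sup>+ x. \<integral>\<^sup>+ y. h (x + t y) y \<partial>leb b \<partial>leb a)
  = (\<integral>\<^sup>+ x. \<integral>\<^sup>+ y. h x y \<partial>leb b \<partial>leb a)"
proof -
 have [measurable]: "(%p. h (fst p) (snd p)) \<in> borel_measurable (leb a \<Otimes>\<^sub>M leb b)"
  using h by (simp add: case_prod_beta)
 have m: "(%p. (fst p + t (snd p), snd p)) \<in> leb a \<Otimes>\<^sub>M leb b \<rightarrow>\<^sub>M leb a \<Otimes>\<^sub>M leb b"
  by measurable
 have 1: "(%(x, y). h (x + t y) y) \<in> borel_measurable (leb a \<Otimes>\<^sub>M leb b)"
  using measurable_compose[OF m h] by (simp add: case_prod_beta)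
 have 2: "(%(y, x). h x y) \<in> borel_measurable (leb b \<Otimes>\<^sub>M leb a)"
  using measurable_pair_swap[OF h] by simp
 have tc: "t y \<in> Rn a" if "y \<in> Rn b" for y
  using measurable_space[OF t, of y] that by simp
 have "(\<integral>\<^sup>+ x. \<integral>\<^sup>+ y. h (x + t y) y \<partial>leb b \<partial>leb a)
   = (\<integral>\<^sup>+ y. \<integral>\<^sup>+ x. h (x + t y) y \<partial>leb a \<partial>leb b)"
  by (rule nn_integral_lborel_vec_Fubini[OF 1])
 also have "... = (\<integral>\<^sup>+ y. \<integral>\<^sup>+ x. h x y \<partial>leb a \<partial>leb b)"
  by (rule nn_integral_lborel_vec_shear[OF 2 tc])
 also have "... = (\<integral>\<^sup>+ x. \<integral>\<^sup>+ y. h x y \<partial>leb b \<partial>leb a)"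
  by (rule nn_integral_lborel_vec_Fubini[OF h, symmetric])
 finally show ?thesis .
qed

lemma mult_mat_vec_uminus: "M \<in> Mat d k ==> v \<in> Rn k ==> M *\<^sub>v (- v) = - (M *\<^sub>v (v :: real vec))"
 by (intro eq_vecI) (auto simp: scalar_prod_def sum_negf)

lemma zero_mult_mat_vec: "v \<in> Rn b ==> 0\<^sub>m a b *\<^sub>v v = (0\<^sub>v a :: real vec)"
 by (intro eq_vecI) auto

text \<open>The change of variables formula as a predicate on matrices, so that it can be passed
  through products and blocks. Positivity of the determinant is included: it lets
  \<open>ennreal (det M)\<close> stand for the absolute value, and it gives \<open>0 < det M\<close>
  for positive definite \<open>M\<close> as a by-product.\<close>

definition preserves_lborel_by_det :: "nat => real mat => bool" where
 "preserves_lborel_by_det k M \<longleftrightarrow> M \<in> Mat k k \<and> 0 < det M \<and>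
  (\<forall>g\<in>borel_fun k.
    ennreal (det M) * (\<integral>\<^sup>+ v. g (M *\<^sub>v v) \<partial>leb k) = (\<integral>\<^sup>+ v. g v \<partial>leb k))"

lemma preserves_lborel_by_detD:
 "preserves_lborel_by_det k M ==> g \<in> borel_fun k ==>
  ennreal (det M) * (\<integral>\<^sup>+ v. g (M *\<^sub>v v) \<partial>leb k) = (\<integral>\<^sup>+ v. g v \<partial>leb k)"
 unfolding preserves_lborel_by_det_def by blast

lemma preserves_lborel_by_det_mult:
 assumes P: "preserves_lborel_by_det k P" and Q: "preserves_lborel_by_det k Q"
 shows "preserves_lborel_by_det k (P * Q)"
 unfolding preserves_lborel_by_det_def
proof (intro conjI ballI)
 have c: "P \<in> Mat k k" "Q \<in> Mat k k"
  using P Q by (auto simp: preserves_lborel_by_det_def)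
 then show "P * Q \<in> Mat k k" by simp
 have d: "det (P * Q) = det P * det Q"
  using c by (rule det_mult)
 have pos: "0 < det P" "0 < det Q"
  using P Q by (auto simp: preserves_lborel_by_det_def)
 then show "0 < det (P * Q)" by (simp add: d)
 fix g :: "real vec => ennreal" assume g: "g \<in> borel_fun k"
 have gP: "(%v. g (P *\<^sub>v v)) \<in> borel_fun k"
  by (rule measurable_compose[OF measurable_mat_lborel_vec[OF c(1)] g])
 have "ennreal (det (P * Q)) * (\<integral>\<^sup>+ v. g (P * Q *\<^sub>v v) \<partial>leb k)
  = ennreal (det P) * (ennreal (det Q) * (\<integral>\<^sup>+ v. g (P *\<^sub>v (Q *\<^sub>v v)) \<partial>leb k))"
  using c pos by (auto simp: d ennreal_mult mult.assoc intro!: nn_integral_cong arg_cong2[of _ _ _ _ "(*)"] arg_cong[of _ _ g] assoc_mult_mat_vec)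
 also have "... = ennreal (det P) * (\<integral>\<^sup>+ v. g (P *\<^sub>v v) \<partial>leb k)"
  using preserves_lborel_by_detD[OF Q gP] by simp
 also have "... = (\<integral>\<^sup>+ v. g v \<partial>leb k)"
  by (rule preserves_lborel_by_detD[OF P g])
 finally show "ennreal (det (P * Q)) * (\<integral>\<^sup>+ v. g (P * Q *\<^sub>v v) \<partial>leb k) = (\<integral>\<^sup>+ v. g v \<partial>leb k)" .
qed

lemma measurable_mat_append:
 assumes [measurable]: "g \<in> borel_fun (a + b)"
 shows "case_prod (%x y. g (x @\<^sub>v y)) \<in> borel_measurable (leb a \<Otimes>\<^sub>M leb b)"
 unfolding case_prod_beta by measurable

text \<open>In block form the map adds a linear function of the first block to the second, so it is
  a shear.\<close>

lemma preserves_lborel_lower: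
 assumes C: "C \<in> Mat b a"
 shows "preserves_lborel_by_det (a + b) (four_block_mat (1\<^sub>m a) (0\<^sub>m a b) C (1\<^sub>m b))" (is "preserves_lborel_by_det _ ?M")
 unfolding preserves_lborel_by_det_def
proof (intro conjI ballI)
 show M: "?M \<in> Mat (a + b) (a + b)" using C by simp
 have d: "det ?M = 1"
  using C by (subst det_four_block_mat_upper_right_zero) auto
 then show "0 < det ?M" by simp
 fix g :: "real vec => ennreal" assume g: "g \<in> borel_fun (a + b)"
 have eq: "?M *\<^sub>v (x @\<^sub>v y) = x @\<^sub>v (y + C *\<^sub>v x)" if "x \<in> Rn a" "y \<in> Rn b" for x y
  using that C four_block_mat_mult_vec[of "1\<^sub>m a" a a "0\<^sub>m a b" b C b "1\<^sub>m b" x y]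
  by (simp add: zero_mult_mat_vec comm_add_vec[of y b])
 have "(\<integral>\<^sup>+ v. g (?M *\<^sub>v v) \<partial>leb (a + b))
  = (\<integral>\<^sup>+ x. \<integral>\<^sup>+ y. g (?M *\<^sub>v (x @\<^sub>v y)) \<partial>leb b \<partial>leb a)"
  by (rule nn_integral_lborel_vec_append, rule measurable_compose[OF measurable_mat_lborel_vec[OF M] g])
 also have "... = (\<integral>\<^sup>+ x. \<integral>\<^sup>+ y. g (x @\<^sub>v (y + C *\<^sub>v x)) \<partial>leb b \<partial>leb a)"
  by (intro nn_integral_cong) (simp add: eq)
 also have "... = (\<integral>\<^sup>+ x. \<integral>\<^sup>+ y. g (x @\<^sub>v y) \<partial>leb b \<partial>leb a)"
  using C by (intro nn_integral_lborel_vec_shear[OF measurable_mat_append[OF g]]) simp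
 also have "... = (\<integral>\<^sup>+ v. g v \<partial>leb (a + b))"
  by (rule nn_integral_lborel_vec_append[OF g, symmetric])
 finally show "ennreal (det ?M) * (\<integral>\<^sup>+ v. g (?M *\<^sub>v v) \<partial>leb (a + b)) = (\<integral>\<^sup>+ v. g v \<partial>leb (a + b))"
  by (simp add: d)
qed

lemma preserves_lborel_upper:
 assumes C: "C \<in> Mat a b"
 shows "preserves_lborel_by_det (a + b) (four_block_mat (1\<^sub>m a) C (0\<^sub>m b a) (1\<^sub>m b))" (is "preserves_lborel_by_det _ ?M")
 unfolding preserves_lborel_by_det_def
proof (intro conjI ballI)
 show M: "?M \<in> Mat (a + b) (a + b)" using C by simp
 have d: "det ?M = 1"
  using C by (subst det_four_block_mat_lower_left_zero) auto
 then show "0 < det ?M" by simp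
 fix g :: "real vec => ennreal" assume g: "g \<in> borel_fun (a + b)"
 have eq: "?M *\<^sub>v (x @\<^sub>v y) = (x + C *\<^sub>v y) @\<^sub>v y" if "x \<in> Rn a" "y \<in> Rn b" for x y
  using that C four_block_mat_mult_vec[of "1\<^sub>m a" a a C b "0\<^sub>m b a" b "1\<^sub>m b" x y]
  by (simp add: zero_mult_mat_vec)
 have "(\<integral>\<^sup>+ v. g (?M *\<^sub>v v) \<partial>leb (a + b))
  = (\<integral>\<^sup>+ x. \<integral>\<^sup>+ y. g (?M *\<^sub>v (x @\<^sub>v y)) \<partial>leb b \<partial>leb a)"
  by (rule nn_integral_lborel_vec_append, rule measurable_compose[OF measurable_mat_lborel_vec[OF M] g])
 also have "... = (\<integral>\<^sup>+ x. \<integral>\<^sup>+ y. g ((x + C *\<^sub>v y) @\<^sub>v y) \<partial>leb b \<partial>leb a)"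
  by (intro nn_integral_cong) (simp add: eq)
 also have "... = (\<integral>\<^sup>+ x. \<integral>\<^sup>+ y. g (x @\<^sub>v y) \<partial>leb b \<partial>leb a)"
  using C by (intro nn_integral_lborel_vec_shear'[OF measurable_mat_append[OF g]] measurable_mat_lborel_vec)
 also have "... = (\<integral>\<^sup>+ v. g v \<partial>leb (a + b))"
  by (rule nn_integral_lborel_vec_append[OF g, symmetric])
 finally show "ennreal (det ?M) * (\<integral>\<^sup>+ v. g (?M *\<^sub>v v) \<partial>leb (a + b)) = (\<integral>\<^sup>+ v. g v \<partial>leb (a + b))"
  by (simp add: d)
qed

lemma preserves_lborel_block_diag:
 assumes P: "preserves_lborel_by_det a P" and Q: "preserves_lborel_by_det b Q"
 shows "preserves_lborel_by_det (a + b) (four_block_mat P (0\<^sub>m a b) (0\<^sub>m b a) Q)" (is "preserves_lborel_by_det _ ?M")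
 unfolding preserves_lborel_by_det_def
proof (intro conjI ballI)
 have c: "P \<in> Mat a a" "Q \<in> Mat b b" and pos: "0 < det P" "0 < det Q"
  using P Q by (auto simp: preserves_lborel_by_det_def)
 show M: "?M \<in> Mat (a + b) (a + b)" using c by simp
 have d: "det ?M = det P * det Q"
  using c by (subst det_four_block_mat_upper_right_zero) auto
 then show "0 < det ?M" using pos by simp
 fix g :: "real vec => ennreal" assume g: "g \<in> borel_fun (a + b)"
 interpret b: sigma_finite_measure "leb b" by (rule sigma_finite_lborel_vec)
 have eq: "?M *\<^sub>v (x @\<^sub>v y) = (P *\<^sub>v x) @\<^sub>v (Q *\<^sub>v y)" if "x \<in> Rn a" "y \<in> Rn b" for x y
  using that c four_block_mat_mult_vec[of P a a "0\<^sub>m a b" b "0\<^sub>m b a" b Q x y]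
  by (simp add: zero_mult_mat_vec)
 have mg: "(%y. g (x @\<^sub>v y)) \<in> borel_fun b" if "x \<in> Rn a" for x
 proof -
  have "(%y. x @\<^sub>v y) \<in> leb b \<rightarrow>\<^sub>M leb (a + b)"
   using that by (intro measurable_append_vec measurable_vec_const) simp_all
  from measurable_compose[OF this g] show ?thesis .
 qed
 have mg2: "(%x. \<integral>\<^sup>+ y. g (x @\<^sub>v y) \<partial>leb b) \<in> borel_fun a"
  using b.borel_measurable_nn_integral[OF measurable_mat_append[OF g]] by simp
 have inner: "ennreal (det Q) * (\<integral>\<^sup>+ y. g (x @\<^sub>v (Q *\<^sub>v y)) \<partial>leb b) = (\<integral>\<^sup>+ y. g (x @\<^sub>v y) \<partial>leb b)"
  if "x \<in> Rn a" for x
  using preserves_lborel_by_detD[OF Q mg[OF that]] .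
 have "(\<integral>\<^sup>+ v. g (?M *\<^sub>v v) \<partial>leb (a + b))
  = (\<integral>\<^sup>+ x. \<integral>\<^sup>+ y. g (?M *\<^sub>v (x @\<^sub>v y)) \<partial>leb b \<partial>leb a)"
  by (rule nn_integral_lborel_vec_append, rule measurable_compose[OF measurable_mat_lborel_vec[OF M] g])
 also have "... = (\<integral>\<^sup>+ x. \<integral>\<^sup>+ y. g ((P *\<^sub>v x) @\<^sub>v (Q *\<^sub>v y)) \<partial>leb b \<partial>leb a)"
  by (intro nn_integral_cong) (simp add: eq)
 also have "ennreal (det Q) * ... = (\<integral>\<^sup>+ x. ennreal (det Q) * (\<integral>\<^sup>+ y. g ((P *\<^sub>v x) @\<^sub>v (Q *\<^sub>v y)) \<partial>leb b) \<partial>leb a)"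
 proof (rule nn_integral_cmult[symmetric])
  have "(%p. (P *\<^sub>v fst p) @\<^sub>v (Q *\<^sub>v snd p)) \<in> leb a \<Otimes>\<^sub>M leb b \<rightarrow>\<^sub>M leb (a + b)"
   by (rule measurable_append_vec[OF measurable_mult_mat_vec[OF c(1) measurable_fst] measurable_mult_mat_vec[OF c(2) measurable_snd]])
  from measurable_compose[OF this g]
  show "(%x. \<integral>\<^sup>+ y. g ((P *\<^sub>v x) @\<^sub>v (Q *\<^sub>v y)) \<partial>leb b) \<in> borel_fun a"
   by (intro b.borel_measurable_nn_integral) (simp add: case_prod_beta)
 qed
 also have "... = (\<integral>\<^sup>+ x. (\<integral>\<^sup>+ y. g ((P *\<^sub>v x) @\<^sub>v y) \<partial>leb b) \<partial>leb a)"
  using c by (intro nn_integral_cong inner) simp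
 also have "ennreal (det P) * ... = (\<integral>\<^sup>+ x. (\<integral>\<^sup>+ y. g (x @\<^sub>v y) \<partial>leb b) \<partial>leb a)"
  by (rule preserves_lborel_by_detD[OF P mg2])
 also have "... = (\<integral>\<^sup>+ v. g v \<partial>leb (a + b))"
  by (rule nn_integral_lborel_vec_append[OF g, symmetric])
 finally show "ennreal (det ?M) * (\<integral>\<^sup>+ v. g (?M *\<^sub>v v) \<partial>leb (a + b)) = (\<integral>\<^sup>+ v. g v \<partial>leb (a + b))"
  using pos by (simp add: d ennreal_mult mult.assoc)
qed

lemma lborel_vec_1: "leb 1 = distr lborel (leb 1) (%t. vec 1 (%_. t))"
proof (rule lborel_vec_eqI[symmetric])
 have m: "(%t::real. vec 1 (%_. t)) \<in> lborel \<rightarrow>\<^sub>M leb 1"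
  by (rule measurable_lborel_vecI) simp_all
 fix A :: "nat => real set" assume A: "!!i. i < 1 ==> A i \<in> sets borel"
 have "(%t. vec 1 (%_. t)) -` {v \<in> Rn 1. \<forall>i<1. v $ i \<in> A i} \<inter> space lborel = A 0"
  by (intro Set.set_eqI) simp
 with emeasure_distr[OF m sets_box_lborel_vec[of 1 A, OF A]]
 show "emeasure (distr lborel (leb 1) (%t. vec 1 (%_. t))) {v \<in> Rn 1. \<forall>i<1. v $ i \<in> A i}
  = (\<Prod>i<1. emeasure lborel (A i))"
  by simp
qed simp

lemma nn_integral_lborel_vec_1:
 assumes "g \<in> borel_fun 1"
 shows "(\<integral>\<^sup>+ v. g v \<partial>leb 1) = (\<integral>\<^sup>+ t. g (vec 1 (%_. t)) \<partial>lborel)"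
proof -
 have m: "(%t::real. vec 1 (%_. t)) \<in> lborel \<rightarrow>\<^sub>M leb 1"
  by (rule measurable_lborel_vecI) simp_all
 show ?thesis
  using nn_integral_distr[OF m, of g] assms unfolding lborel_vec_1[symmetric] by simp
qed

lemma preserves_lborel_1:
 assumes "0 < a"
 shows "preserves_lborel_by_det 1 (mat 1 1 (%_. a))" (is "preserves_lborel_by_det _ ?M")
 unfolding preserves_lborel_by_det_def
proof (intro conjI ballI)
 show M: "?M \<in> Mat 1 1" by simp
 have d: "det ?M = a"
  by (subst det_single) simp_all
 then show "0 < det ?M" using assms by simp
 fix g :: "real vec => ennreal" assume g: "g \<in> borel_fun 1"
 have m: "(%t::real. vec 1 (%_. t)) \<in> borel \<rightarrow>\<^sub>M leb 1"
  by (rule measurable_lborel_vecI) simp_all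
 have eq: "?M *\<^sub>v vec 1 (%_. t) = vec 1 (%_. 0 + a * t)" for t
  by (intro eq_vecI) (simp_all add: scalar_prod_def)
 have "(\<integral>\<^sup>+ v. g (?M *\<^sub>v v) \<partial>leb 1) = (\<integral>\<^sup>+ t. g (vec 1 (%_. 0 + a * t)) \<partial>lborel)"
  unfolding nn_integral_lborel_vec_1[OF measurable_compose[OF measurable_mat_lborel_vec[OF M] g]] eq ..
 moreover have "(\<integral>\<^sup>+ t. g (vec 1 (%_. t)) \<partial>lborel) = ennreal \<bar>a\<bar> * (\<integral>\<^sup>+ t. g (vec 1 (%_. 0 + a * t)) \<partial>lborel)"
  using assms by (intro nn_integral_real_affine measurable_compose[OF m g]) simp
 ultimately show "ennreal (det ?M) * (\<integral>\<^sup>+ v. g (?M *\<^sub>v v) \<partial>leb 1) = (\<integral>\<^sup>+ v. g v \<partial>leb 1)"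
  using assms unfolding d nn_integral_lborel_vec_1[OF g] by (simp only: abs_of_pos)
qed

text \<open>Symmetric Gauss elimination of the first coordinate: \<open>M\<close> is a lower shear
  times a block diagonal matrix times an upper shear. The diagonal blocks are the pivot and its
  Schur complement, which is again positive definite, so induction on the dimension applies.\<close>

lemma preserves_lborel_sym_pos_def:
 assumes "sym_pos_def k M"
 shows "preserves_lborel_by_det k M"
 using assms
proof (induction k arbitrary: M)
 case 0
 then have M: "M \<in> Mat 0 0" by (simp add: sym_pos_def_def)
 then have "det M = 1" by simp
 moreover have "M *\<^sub>v v = v" if "v \<in> Rn 0" for v
  using that M by (intro eq_vecI) auto
 ultimately show ?case
  using M by (auto simp: preserves_lborel_by_det_def intro!: nn_integral_cong)
next
 case (Suc k)
 note One_nat_def [simp del]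
 have [simp]: "(\<Sum>i = 0..<1. h i) = h 0" for h :: "nat => real"
  by (simp add: One_nat_def)
 have M: "M \<in> Mat (Suc k) (Suc k)" and MT: "M\<^sup>T = M"
  and pos: "!!v. v \<in> Rn (Suc k) ==> v \<noteq> 0\<^sub>v (Suc k) ==> 0 < v \<bullet> (M *\<^sub>v v)"
  using Suc.prems by (auto simp: sym_pos_def_def)
 have sym: "M $$ (i, j) = M $$ (j, i)" if "i < Suc k" "j < Suc k" for i j
  using that M arg_cong[OF MT, of "%X. X $$ (j, i)"] by simp
 define a where "a = M $$ (0, 0)"
 define b where "b = mat k 1 (%(i, j). M $$ (Suc i, 0))"
 define D where "D = mat k k (%(i, j). M $$ (Suc i, Suc j))"
 define a1 where "a1 = mat 1 1 (%_. a)"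
 define c where "c = (1 / a) \<cdot>\<^sub>m b"
 \<comment> \<open>The Schur complement of the pivot \<open>a\<close>.\<close>
 define D' where "D' = D - b * c\<^sup>T"
 have [simp]: "b \<in> Mat k 1" "D \<in> Mat k k" "a1 \<in> Mat 1 1" "c \<in> Mat k 1"
  "b\<^sup>T \<in> Mat 1 k" "c\<^sup>T \<in> Mat 1 k"
  by (simp_all add: b_def D_def a1_def c_def)
 have [simp]: "b * c\<^sup>T \<in> Mat k k"
  by (rule mult_carrier_mat[of _ _ 1]) simp_all
 then have [simp]: "D' \<in> Mat k k"
  unfolding D'_def by (rule minus_carrier_mat)
 have M_eq: "M = four_block_mat a1 (b\<^sup>T) b D"
 proof (rule eq_matI)
  fix i j assume "i < dim_row (four_block_mat a1 (b\<^sup>T) b D)" "j < dim_col (four_block_mat a1 (b\<^sup>T) b D)"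
  then have ij: "i < Suc k" "j < Suc k" by (simp_all add: a1_def D_def)
  then show "M $$ (i, j) = four_block_mat a1 (b\<^sup>T) b D $$ (i, j)"
   using sym[of 0 j] by (cases i; cases j) (simp_all add: a1_def D_def b_def a_def)
 qed (use M in \<open>simp_all add: a1_def D_def\<close>)
 have Mv: "M *\<^sub>v (x @\<^sub>v y) = (a1 *\<^sub>v x + b\<^sup>T *\<^sub>v y) @\<^sub>v (b *\<^sub>v x + D *\<^sub>v y)"
  if "x \<in> Rn 1" "y \<in> Rn k" for x y
  unfolding M_eq using that by (intro four_block_mat_mult_vec[of _ 1 1 _ k _ k]) simp_all
 have a: "0 < a"
 proof -
  have u: "unit_vec (Suc k) 0 \<noteq> (0\<^sub>v (Suc k) :: real vec)"
   by (metis index_unit_vec(1) index_zero_vec(1) zero_less_Suc zero_neq_one)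
  have "unit_vec (Suc k) 0 \<bullet> (M *\<^sub>v unit_vec (Suc k) 0) = a"
   using M by (simp add: a_def)
  with pos[OF _ u] show ?thesis by simp
 qed
 have D'T: "D'\<^sup>T = D'"
 proof (rule eq_matI)
  fix i j assume "i < dim_row D'" "j < dim_col D'"
  then have "i < k" "j < k" by (simp_all add: D'_def c_def b_def)
  then show "D'\<^sup>T $$ (i, j) = D' $$ (i, j)"
   using sym[of "Suc i" "Suc j"]
   by (simp add: D'_def D_def b_def c_def scalar_prod_def mult.commute)
 qed (simp_all add: D'_def c_def b_def)
 have e2: "a1 * c\<^sup>T = b\<^sup>T"
  using a by (intro eq_matI) (simp_all add: c_def b_def a1_def scalar_prod_def)
 have a1c: "a1 *\<^sub>v (c\<^sup>T *\<^sub>v x) = b\<^sup>T *\<^sub>v x" if "x \<in> Rn k" for x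
  using that assoc_mult_mat_vec[of a1 1 1 "c\<^sup>T" k x] by (simp add: e2)
 have D': "sym_pos_def k D'"
  unfolding sym_pos_def_def
 proof (intro conjI ballI impI)
  fix x :: "real vec" assume x: "x \<in> Rn k" "x \<noteq> 0\<^sub>v k"
  \<comment> \<open>This first coordinate makes the first block of
    \<open>M *\<^sub>v (t @\<^sub>v x)\<close> vanish, so the form of \<open>M\<close> at
    \<open>t @\<^sub>v x\<close> is the form of \<open>D'\<close> at \<open>x\<close>.\<close>
  define t where "t = - (c\<^sup>T *\<^sub>v x)"
  have ct: "c\<^sup>T *\<^sub>v x \<in> Rn 1" using x by (intro mult_mat_vec_carrier[of _ 1 k]) simp_all
  have t: "t \<in> Rn 1"
   using ct by (simp add: t_def)
  have z: "t @\<^sub>v x \<in> Rn (Suc k)" "t @\<^sub>v x \<noteq> 0\<^sub>v (Suc k)"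
  proof -
   show "t @\<^sub>v x \<in> Rn (Suc k)" using append_carrier_vec[OF t x(1)] unfolding plus_1_eq_Suc .
   obtain i where i: "i < k" "x $ i \<noteq> 0"
    using x by (metis carrier_vecD eq_vecI index_zero_vec)
   then have "(t @\<^sub>v x) $ Suc i \<noteq> 0" using t x by simp
   then show "t @\<^sub>v x \<noteq> 0\<^sub>v (Suc k)" using i by (metis Suc_less_eq index_zero_vec(1))
  qed
  have bx: "b\<^sup>T *\<^sub>v x \<in> Rn 1" using x by (intro mult_mat_vec_carrier[of _ 1 k]) simp_all
  have "a1 *\<^sub>v t = - (a1 *\<^sub>v (c\<^sup>T *\<^sub>v x))"
   unfolding t_def using ct by (intro mult_mat_vec_uminus[of _ 1 1]) simp_all
  then have 1: "a1 *\<^sub>v t + b\<^sup>T *\<^sub>v x = 0\<^sub>v 1"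
   using a1c[OF x(1)] bx by simp
  have "b *\<^sub>v t = - (b *\<^sub>v (c\<^sup>T *\<^sub>v x))"
   unfolding t_def using ct by (intro mult_mat_vec_uminus[of _ k 1]) simp_all
  also have "b *\<^sub>v (c\<^sup>T *\<^sub>v x) = (b * c\<^sup>T) *\<^sub>v x"
   using x by (intro assoc_mult_mat_vec[symmetric, of _ k 1 _ k]) simp_all
  finally have "b *\<^sub>v t + D *\<^sub>v x = D *\<^sub>v x - (b * c\<^sup>T) *\<^sub>v x"
   using x by (intro eq_vecI) (simp_all add: b_def c_def D_def)
  also have "... = D' *\<^sub>v x"
   unfolding D'_def using x by (intro minus_mult_distrib_mat_vec[symmetric, of _ k k]) simp_all
  finally have "M *\<^sub>v (t @\<^sub>v x) = 0\<^sub>v 1 @\<^sub>v (D' *\<^sub>v x)"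
   using Mv[OF t x(1)] 1 by simp
  then have "(t @\<^sub>v x) \<bullet> (M *\<^sub>v (t @\<^sub>v x)) = t \<bullet> 0\<^sub>v 1 + x \<bullet> (D' *\<^sub>v x)"
   using scalar_prod_append[OF t x(1) zero_carrier_vec mult_mat_vec_carrier[of D' k k x]] x by simp
  then show "0 < x \<bullet> (D' *\<^sub>v x)"
   using pos[OF z] t by simp
 qed (simp_all add: D'T)
 let ?L = "four_block_mat (1\<^sub>m 1) (0\<^sub>m 1 k) c (1\<^sub>m k)"
 let ?Dg = "four_block_mat a1 (0\<^sub>m 1 k) (0\<^sub>m k 1) D'"
 let ?R = "four_block_mat (1\<^sub>m 1) (c\<^sup>T) (0\<^sub>m k 1) (1\<^sub>m k)"
 have e1: "c * a1 = b"
  using a by (intro eq_matI) (simp_all add: c_def b_def a1_def scalar_prod_def)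
 have e3: "b * c\<^sup>T + D' = D"
  by (intro eq_matI) (simp_all add: D'_def c_def b_def D_def)
 note blk = left_mult_one_mat[of a1 1 1] left_mult_zero_mat[of D' k k] right_mult_zero_mat[of c k 1]
  left_mult_one_mat[of D' k k] right_mult_one_mat[of a1 1 1] right_mult_one_mat[of D' k k]
  right_mult_one_mat[of b k 1] right_mult_zero_mat[of D' k k] left_mult_zero_mat[of "1\<^sub>m k" k k]
  right_add_zero_mat[of a1 1 1] left_add_zero_mat[of D' k k] right_add_zero_mat[of b k 1]
  right_add_zero_mat[of "b\<^sup>T" 1 k]
 have "?L * ?Dg = four_block_mat a1 (0\<^sub>m 1 k) b D'"
  by (subst mult_four_block_mat[of _ 1 1 _ k _ k _ _ 1 _ k]) (simp_all add: e1 blk)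
 also have "... * ?R = M"
  unfolding M_eq by (subst mult_four_block_mat[of _ 1 1 _ k _ k _ _ 1 _ k]) (simp_all add: e2 e3 blk)
 finally have "M = ?L * ?Dg * ?R" ..
 moreover have "preserves_lborel_by_det (1 + k) ?L"
  by (rule preserves_lborel_lower) simp
 moreover have "preserves_lborel_by_det (1 + k) ?Dg"
  unfolding a1_def by (intro preserves_lborel_block_diag preserves_lborel_1 a Suc.IH D')
 moreover have "preserves_lborel_by_det (1 + k) ?R"
  by (rule preserves_lborel_upper) simp
 ultimately show ?case
  unfolding plus_1_eq_Suc by (simp only: preserves_lborel_by_det_mult)
qed

section \<open>The Gaussian measure\<close>

text \<open>This is sqrt pi, carried along as a positive symbol. Its powers on the two sides are
  matched in \<open>constant_identity\<close>.\<close>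

definition gauss_int :: real where
 "gauss_int = enn2real (\<integral>\<^sup>+ t. ennreal (exp (- (t * t))) \<partial>lborel)"

text \<open>The integrand is at most \<open>exp (1 - \<bar>t\<bar>)\<close>, which has an explicit
  antiderivative on each half-line.\<close>

lemma gauss_int_finite: "(\<integral>\<^sup>+ t. ennreal (exp (- (t * t))) \<partial>lborel) < \<infinity>"
proof -
 let ?h = "%t::real. ennreal (exp (1 - t)) * indicator {0..} t"
 have h: "(\<integral>\<^sup>+ t. ?h t \<partial>lborel) = ennreal (0 - (- exp (1 - 0)))"
 proof (rule nn_integral_FTC_atLeast)
  show "((%t::real. - exp (1 - t)) has_real_derivative exp (1 - t)) (at t)" for t
   by (auto intro!: derivative_eq_intros)
  show "((%t::real. - exp (1 - t)) \<longlongrightarrow> 0) at_top"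
  proof -
   have "((%t::real. - (exp 1 * exp (- t))) \<longlongrightarrow> - (exp 1 * 0)) at_top"
    by (intro tendsto_intros exp_at_bot[THEN filterlim_compose] filterlim_uminus_at_bot_at_top)
   then show ?thesis by (simp add: exp_diff exp_minus field_simps)
  qed
 qed auto
 have h': "(\<integral>\<^sup>+ t. ?h (0 + (-1) * t) \<partial>lborel) = (\<integral>\<^sup>+ t. ?h t \<partial>lborel)"
  using nn_integral_real_affine[of ?h "-1" 0] by simp
 \<comment> \<open>Completing the square at 1/2 gives
   \<open>\<bar>t\<bar> \<le> t * t + 1/4\<close>.\<close>
 have bnd: "exp (- (t * t)) \<le> exp (1 - \<bar>t\<bar>)" for t :: real
 proof -
  have "0 \<le> (\<bar>t\<bar> - 1 / 2)\<^sup>2" by simp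
  then have "\<bar>t\<bar> \<le> t * t + 1" by (simp add: power2_eq_square algebra_simps abs_mult[symmetric])
  then show ?thesis by simp
 qed
 have "ennreal (exp (- (t * t))) \<le> ?h t + ?h (0 + (-1) * t)" for t :: real
 proof (cases "0 \<le> t")
  case True
  then have "ennreal (exp (- (t * t))) \<le> ?h t" using bnd[of t] by (auto intro: ennreal_leI)
  then show ?thesis by (rule add_increasing2[rotated]) simp
 next
  case False
  then have "ennreal (exp (- (t * t))) \<le> ?h (0 + (-1) * t)" using bnd[of t] by (auto intro: ennreal_leI)
  then show ?thesis by (rule add_increasing[rotated]) simp
 qed
 then have "(\<integral>\<^sup>+ t. ennreal (exp (- (t * t))) \<partial>lborel) \<le> (\<integral>\<^sup>+ t. ?h t + ?h (0 + (-1) * t) \<partial>lborel)"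
  by (intro nn_integral_mono) simp
 also have "... = (\<integral>\<^sup>+ t. ?h t \<partial>lborel) + (\<integral>\<^sup>+ t. ?h (0 + (-1) * t) \<partial>lborel)"
  by (intro nn_integral_add) simp_all
 also have "... < \<infinity>"
  unfolding h' h by simp
 finally show ?thesis .
qed

lemma nn_integral_exp_lborel: "(\<integral>\<^sup>+ t. ennreal (exp (- (t * t))) \<partial>lborel) = ennreal gauss_int"
 using gauss_int_finite unfolding gauss_int_def by simp

lemma gauss_int_pos: "0 < gauss_int"
proof (rule ccontr)
 assume "\<not> 0 < gauss_int"
 then have "(\<integral>\<^sup>+ t. ennreal (exp (- (t * t))) \<partial>lborel) = 0"
  unfolding nn_integral_exp_lborel by (simp add: ennreal_neg)
 then have "AE t in lborel :: real measure. ennreal (exp (- (t * t))) = 0"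
  by (subst (asm) nn_integral_0_iff_AE) simp_all
 then have "AE t in lborel :: real measure. False"
  by simp
 then have "(UNIV :: real set) \<in> null_sets lborel"
  by (simp add: AE_iff_null)
 then have "emeasure lborel (UNIV :: real set) = 0"
  by (rule null_setsD1)
 then show False by (simp add: emeasure_lborel_UNIV)
qed

lemma scalar_prod_self_sum: "v \<in> Rn k ==> v \<bullet> v = (\<Sum>i<k. v $ i * v $ (i::nat) :: real)"
 by (simp add: scalar_prod_def lessThan_atLeast0)

lemma nn_integral_exp_lborel_vec:
 assumes "0 < a"
 shows "(\<integral>\<^sup>+ v. ennreal (exp (- a * (v \<bullet> v))) \<partial>leb k) = ennreal ((gauss_int / sqrt a) ^ k)"
proof -
 have "(\<integral>\<^sup>+ v. ennreal (exp (- a * (v \<bullet> v))) \<partial>leb k)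
  = (\<integral>\<^sup>+ v. (\<Prod>i<k. ennreal (exp (- a * (v $ i * v $ i)))) \<partial>leb k)"
  by (intro nn_integral_cong)
   (simp add: scalar_prod_self_sum sum_distrib_left exp_sum prod_ennreal sum_negf[symmetric])
 also have "... = (\<Prod>i<k. \<integral>\<^sup>+ t. ennreal (exp (- a * (t * t))) \<partial>lborel)"
  by (rule nn_integral_lborel_vec_prod) simp
 also have "(\<integral>\<^sup>+ t. ennreal (exp (- a * (t * t))) \<partial>lborel) = ennreal (gauss_int / sqrt a)"
 proof -
  have sq: "- ((0 + sqrt a * t) * (0 + sqrt a * t)) = - a * (t * t)" for t
  proof -
   have "(0 + sqrt a * t) * (0 + sqrt a * t) = (sqrt a * sqrt a) * (t * t)" by (simp only: add_0_left mult_ac)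
   then show ?thesis using assms by simp
  qed
  have "ennreal (sqrt a) * (\<integral>\<^sup>+ t. ennreal (exp (- a * (t * t))) \<partial>lborel) = ennreal gauss_int"
   using nn_integral_real_affine[of "%t. ennreal (exp (- (t * t)))" "sqrt a" 0] assms
   unfolding sq nn_integral_exp_lborel by simp
  then have "ennreal (1 / sqrt a) * (ennreal (sqrt a) * (\<integral>\<^sup>+ t. ennreal (exp (- a * (t * t))) \<partial>lborel))
   = ennreal (1 / sqrt a) * ennreal gauss_int"
   by simp
  then show ?thesis
   using assms gauss_int_pos by (simp add: ennreal_mult[symmetric] mult.assoc[symmetric])
 qed
 finally show ?thesis
  using assms gauss_int_pos by (simp add: ennreal_power)
qed

text \<open>The exponent is \<open>v \<bullet> v\<close> and not half of it, so each coordinate has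
  variance 1/2. With this choice the density is exactly the factor that \<open>phi\<close> splits
  off, and the functions of the equality case become constant.\<close>

definition gauss :: "nat => real vec measure" where
 "gauss k = density (leb k) (%v. ennreal (exp (- (v \<bullet> v)) / gauss_int ^ k))"

lemma sets_gauss_vec [simp, measurable_cong]: "sets (gauss k) = sets (leb k)"
 by (simp add: gauss_def)

lemma space_gauss_vec [simp]: "space (gauss k) = Rn k"
 by (simp add: gauss_def)

lemma measurable_gauss_density: "(%v. exp (- (v \<bullet> v)) / gauss_int ^ k) \<in> borel_fun k"
proof -
 have [measurable]: "(%v. v \<bullet> v) \<in> borel_fun k"
  by (rule measurable_scalar_prod_self)
 show ?thesis by measurable
qed

lemma nn_integral_gauss_vec:
 assumes "g \<in> borel_fun k"
 shows "(\<integral>\<^sup>+ v. g v \<partial>gauss k) = (\<integral>\<^sup>+ v. ennreal (exp (- (v \<bullet> v)) / gauss_int ^ k) * g v \<partial>leb k)"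
 unfolding gauss_def using assms measurable_gauss_density by (intro nn_integral_density) auto

lemma gauss_vec_lborel_vec:
 assumes [measurable]: "g \<in> borel_fun k"
 shows "(\<integral>\<^sup>+ v. ennreal (exp (- (v \<bullet> v))) * g v \<partial>leb k) = ennreal (gauss_int ^ k) * (\<integral>\<^sup>+ v. g v \<partial>gauss k)"
proof -
 have [measurable]: "(%v. exp (- (v \<bullet> v)) / gauss_int ^ k) \<in> borel_fun k"
  by (rule measurable_gauss_density)
 have e: "ennreal (exp (- (v \<bullet> v))) = ennreal (gauss_int ^ k) * ennreal (exp (- (v \<bullet> v)) / gauss_int ^ k)" for v :: "real vec"
  using gauss_int_pos by (simp add: ennreal_mult[symmetric])
 show ?thesis
  unfolding e by (simp add: nn_integral_gauss_vec mult.assoc nn_integral_cmult)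
qed

lemma emeasure_gauss_vec_space: "emeasure (gauss k) (Rn k) = 1"
proof -
 have "ennreal (gauss_int ^ k) * 1 = ennreal (gauss_int ^ k) * (\<integral>\<^sup>+ v. 1 \<partial>gauss k)"
  using gauss_vec_lborel_vec[of "%_. 1" k] nn_integral_exp_lborel_vec[of 1 k] by simp
 then have "(\<integral>\<^sup>+ v. 1 \<partial>gauss k) = 1"
  using gauss_int_pos by (subst (asm) ennreal_mult_cancel_left) auto
 then show ?thesis by simp
qed

lemma finite_measure_gauss_vec: "finite_measure (gauss k)"
 by (rule finite_measureI) (simp add: emeasure_gauss_vec_space)

lemma sigma_finite_gauss_vec: "sigma_finite_measure (gauss k)"
 using finite_measure_gauss_vec by (simp add: finite_measure_def)

lemma measure_gauss_vec_space [simp]: "measure (gauss k) (Rn k) = 1"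
 by (simp add: measure_def emeasure_gauss_vec_space)

lemma measurable_gauss_vec [simp]: "measurable (gauss k) M = measurable (leb k) M"
 by (rule measurable_cong_sets) simp_all

lemma nn_integral_gauss_vec_append:
 assumes g: "g \<in> borel_fun (a + b)"
 shows "(\<integral>\<^sup>+ z. g z \<partial>gauss (a + b)) = (\<integral>\<^sup>+ x. \<integral>\<^sup>+ y. g (x @\<^sub>v y) \<partial>gauss b \<partial>gauss a)"
proof -
 interpret b: sigma_finite_measure "gauss b" by (rule sigma_finite_gauss_vec)
 note [measurable] = g measurable_gauss_density
 have gx: "(%y. g (x @\<^sub>v y)) \<in> borel_fun b" if "x \<in> Rn a" for x
  using that by (intro measurable_compose[OF measurable_append_vec g] measurable_vec_const measurable_ident_sets refl)
 have m: "(%x. \<integral>\<^sup>+ y. g (x @\<^sub>v y) \<partial>gauss b) \<in> borel_fun a"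
  using measurable_mat_append[OF g]
  by (intro b.borel_measurable_nn_integral) (simp cong: measurable_cong_sets)
 have "(\<integral>\<^sup>+ z. g z \<partial>gauss (a + b))
  = (\<integral>\<^sup>+ x. \<integral>\<^sup>+ y. ennreal (exp (- ((x @\<^sub>v y) \<bullet> (x @\<^sub>v y))) / gauss_int ^ (a + b)) * g (x @\<^sub>v y) \<partial>leb b \<partial>leb a)"
  unfolding nn_integral_gauss_vec[OF g] by (rule nn_integral_lborel_vec_append) measurable
 also have "... = (\<integral>\<^sup>+ x. ennreal (exp (- (x \<bullet> x)) / gauss_int ^ a) * (\<integral>\<^sup>+ y. g (x @\<^sub>v y) \<partial>gauss b) \<partial>leb a)"
 proof (intro nn_integral_cong)
  fix x :: "real vec" assume "x \<in> space (leb a)"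
  then have x: "x \<in> Rn a" by simp
  have "(\<integral>\<^sup>+ y. ennreal (exp (- ((x @\<^sub>v y) \<bullet> (x @\<^sub>v y))) / gauss_int ^ (a + b)) * g (x @\<^sub>v y) \<partial>leb b)
   = (\<integral>\<^sup>+ y. ennreal (exp (- (x \<bullet> x)) / gauss_int ^ a) * (ennreal (exp (- (y \<bullet> y)) / gauss_int ^ b) * g (x @\<^sub>v y)) \<partial>leb b)"
   using x gauss_int_pos
   by (intro nn_integral_cong)
    (simp add: scalar_prod_append[of _ a _ b] exp_add[symmetric] power_add ennreal_mult[symmetric] mult.assoc[symmetric] flip: exp_minus)
  also have "... = ennreal (exp (- (x \<bullet> x)) / gauss_int ^ a) * (\<integral>\<^sup>+ y. g (x @\<^sub>v y) \<partial>gauss b)"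
   using gx[OF x] by (simp add: nn_integral_cmult nn_integral_gauss_vec)
  finally show "(\<integral>\<^sup>+ y. ennreal (exp (- ((x @\<^sub>v y) \<bullet> (x @\<^sub>v y))) / gauss_int ^ (a + b)) * g (x @\<^sub>v y) \<partial>leb b)
   = ennreal (exp (- (x \<bullet> x)) / gauss_int ^ a) * (\<integral>\<^sup>+ y. g (x @\<^sub>v y) \<partial>gauss b)" .
 qed
 also have "... = (\<integral>\<^sup>+ x. \<integral>\<^sup>+ y. g (x @\<^sub>v y) \<partial>gauss b \<partial>gauss a)"
  by (rule nn_integral_gauss_vec[OF m, symmetric])
 finally show ?thesis .
qed

lemma scalar_prod_transpose:
 "B \<in> Mat d k ==> x \<in> Rn k ==> y \<in> Rn d ==> x \<bullet> (B\<^sup>T *\<^sub>v y) = (B *\<^sub>v x) \<bullet> (y :: real vec)"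
 using transpose_vec_mult_scalar[of B d k x y]
 by (metis comm_scalar_prod mult_mat_vec_carrier transpose_carrier_mat)

text \<open>A linear map with orthonormal rows carries the Gaussian of dimension \<open>k\<close> to
  that of dimension \<open>d\<close>. Completing \<open>B\<close> to an orthogonal matrix is
  avoided: an independent variable \<open>p\<close> of dimension \<open>d\<close> is added and
  exchanged with \<open>B q\<close>. This exchange is a composition of shears and a reflection, all
  of which preserve Lebesgue measure, and it preserves the norm of the pair.\<close>

lemma nn_integral_gauss_vec_coisometry:
 assumes B: "B \<in> Mat d k" and BB: "B * B\<^sup>T = 1\<^sub>m d"
  and g: "g \<in> borel_fun d"
 shows "(\<integral>\<^sup>+ z. g (B *\<^sub>v z) \<partial>gauss k) = (\<integral>\<^sup>+ v. g v \<partial>gauss d)"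
proof -
 interpret k: sigma_finite_measure "leb k" by (rule sigma_finite_lborel_vec)
 let ?e = "%v. ennreal (exp (- (v \<bullet> v)))"
 let ?C = "B\<^sup>T"
 have C: "?C \<in> Mat k d" using B by simp
 have e: "?e \<in> borel_fun j" for j
  using measurable_scalar_prod_self[of j] by measurable
 have gB: "(%z. g (B *\<^sub>v z)) \<in> borel_fun k"
  by (rule measurable_compose[OF measurable_mat_lborel_vec[OF B] g])
 note [measurable] = g e gB
 \<comment> \<open>Over the pair \<open>(p, q)\<close> this integrates to the right-hand side times
   powers of \<open>gauss_int\<close>. The functions \<open>?Psi1\<close> to \<open>?Psi3\<close>
   apply the shears and the reflection one after the other.\<close>
 let ?Psi = "%p q. ?e p * g p * ?e q"
 have m0: "case_prod ?Psi \<in> borel_measurable (leb d \<Otimes>\<^sub>M leb k)"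
  unfolding case_prod_beta by measurable
 let ?Psi1 = "%p q. ?Psi p (q + - (?C *\<^sub>v p))"
 have t1: "(%p. - (?C *\<^sub>v p)) \<in> leb d \<rightarrow>\<^sub>M leb k"
  by (rule measurable_compose[OF measurable_mat_lborel_vec[OF C] measurable_uminus_vec])
 note [measurable] = t1 measurable_mat_lborel_vec[OF B] measurable_uminus_vec
 have m1: "case_prod ?Psi1 \<in> borel_measurable (leb d \<Otimes>\<^sub>M leb k)"
  unfolding case_prod_beta by measurable
 let ?Psi2 = "%p q. ?Psi1 (p + B *\<^sub>v q) q"
 have m2: "case_prod ?Psi2 \<in> borel_measurable (leb d \<Otimes>\<^sub>M leb k)"
 proof -
  have "(%z. (fst z + B *\<^sub>v snd z, snd z)) \<in> leb d \<Otimes>\<^sub>M leb k \<rightarrow>\<^sub>M leb d \<Otimes>\<^sub>M leb k"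
   by measurable
  from measurable_compose[OF this m1] show ?thesis unfolding case_prod_beta fst_conv snd_conv .
 qed
 let ?Psi3 = "%p q. ?Psi2 (- p) q"
 have m3: "case_prod ?Psi3 \<in> borel_measurable (leb d \<Otimes>\<^sub>M leb k)"
 proof -
  have "(%z. (- fst z, snd z)) \<in> leb d \<Otimes>\<^sub>M leb k \<rightarrow>\<^sub>M leb d \<Otimes>\<^sub>M leb k"
   by measurable
  from measurable_compose[OF this m2] show ?thesis unfolding case_prod_beta fst_conv snd_conv .
 qed
 \<comment> \<open>The composed map sends \<open>(p, q)\<close> to
   \<open>(s, q + B\<^sup>T t)\<close> with \<open>s = B q\<close> and \<open>t = p - s\<close>. In
   \<open>q\<close> the component \<open>B\<^sup>T B q\<close> has been replaced by
   \<open>B\<^sup>T p\<close>, so the sum of the two squared norms is unchanged; this is the fact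
   \<open>3\<close>.\<close>
 have pt: "?Psi3 p (q + ?C *\<^sub>v p) = ?e p * (?e q * g (B *\<^sub>v q))" if p: "p \<in> Rn d" and q: "q \<in> Rn k" for p q
 proof -
  define s where "s = B *\<^sub>v q"
  define t where "t = p - s"
  have s: "s \<in> Rn d" and t: "t \<in> Rn d" using p q B by (auto simp: s_def t_def)
  have BC: "B *\<^sub>v (?C *\<^sub>v v) = v" if "v \<in> Rn d" for v
   using assoc_mult_mat_vec[OF B C that] that by (simp add: BB)
  have Cc: "?C *\<^sub>v v \<in> Rn k" if "v \<in> Rn d" for v
   using C that by simp
  have "B *\<^sub>v (q + ?C *\<^sub>v p) = s + p"
   using mult_add_distrib_mat_vec[OF B q Cc[OF p]] BC[OF p] by (simp add: s_def)
  then have 1: "- p + B *\<^sub>v (q + ?C *\<^sub>v p) = s"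
   using s p by (intro eq_vecI) auto
  have 2: "q + ?C *\<^sub>v p + - (?C *\<^sub>v s) = q + ?C *\<^sub>v t"
   using mult_minus_distrib_mat_vec[OF C p s] Cc[OF p] Cc[OF s] q unfolding t_def by (intro eq_vecI) auto
  have ps: "p = s + t" using p s by (intro eq_vecI) (auto simp: t_def)
  have "(q + ?C *\<^sub>v t) \<bullet> (q + ?C *\<^sub>v t) = q \<bullet> q + 2 * (q \<bullet> (?C *\<^sub>v t)) + (?C *\<^sub>v t) \<bullet> (?C *\<^sub>v t)"
   using q Cc[OF t] comm_scalar_prod[OF q Cc[OF t]]
   by (simp add: scalar_prod_add_distrib[of _ k] add_scalar_prod_distrib[of _ k])
  also have "q \<bullet> (?C *\<^sub>v t) = s \<bullet> t"
   using scalar_prod_transpose[OF B q t] by (simp add: s_def)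
  also have "(?C *\<^sub>v t) \<bullet> (?C *\<^sub>v t) = t \<bullet> t"
   using scalar_prod_transpose[OF B Cc[OF t] t] by (simp add: BC[OF t])
  finally have 3: "s \<bullet> s + (q + ?C *\<^sub>v t) \<bullet> (q + ?C *\<^sub>v t) = p \<bullet> p + q \<bullet> q"
   unfolding ps using s t comm_scalar_prod[OF s t]
   by (simp add: scalar_prod_add_distrib[of _ d] add_scalar_prod_distrib[of _ d])
  have "?Psi3 p (q + ?C *\<^sub>v p) = g s * (?e s * ?e (q + ?C *\<^sub>v t))"
   unfolding 1 2 by (simp add: mult_ac)
  also have "?e s * ?e (q + ?C *\<^sub>v t) = ?e p * ?e q"
   using 3 by (simp add: ennreal_mult[symmetric] exp_add[symmetric])
  finally show ?thesis by (simp add: s_def mult_ac)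
 qed
 have ej: "(\<integral>\<^sup>+ v. ?e v \<partial>leb j) = ennreal (gauss_int ^ j)" for j
  using nn_integral_exp_lborel_vec[of 1 j] by simp
 have "(\<integral>\<^sup>+ q. ?Psi p q \<partial>leb k) = ?e p * g p * ennreal (gauss_int ^ k)" for p
  by (simp only: nn_integral_cmult[OF e] ej)
 then have "(\<integral>\<^sup>+ p. \<integral>\<^sup>+ q. ?Psi p q \<partial>leb k \<partial>leb d)
   = (\<integral>\<^sup>+ p. ?e p * g p * ennreal (gauss_int ^ k) \<partial>leb d)"
  by (simp only:)
 also have "... = (\<integral>\<^sup>+ p. ?e p * g p \<partial>leb d) * ennreal (gauss_int ^ k)"
  using borel_measurable_times_ennreal[OF e g] by (rule nn_integral_multc)
 also have "... = ennreal (gauss_int ^ d) * ennreal (gauss_int ^ k) * (\<integral>\<^sup>+ v. g v \<partial>gauss d)"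
  unfolding gauss_vec_lborel_vec[OF g] by (simp only: mult_ac)
 finally have "ennreal (gauss_int ^ d) * ennreal (gauss_int ^ k) * (\<integral>\<^sup>+ v. g v \<partial>gauss d)
   = (\<integral>\<^sup>+ p. \<integral>\<^sup>+ q. ?Psi p q \<partial>leb k \<partial>leb d)" ..
 also have "... = (\<integral>\<^sup>+ p. \<integral>\<^sup>+ q. ?Psi1 p q \<partial>leb k \<partial>leb d)"
  using C by (intro nn_integral_lborel_vec_shear[OF m0, symmetric]) simp
 also have "... = (\<integral>\<^sup>+ p. \<integral>\<^sup>+ q. ?Psi2 p q \<partial>leb k \<partial>leb d)"
  by (intro nn_integral_lborel_vec_shear'[OF m1, symmetric]) measurable
 also have "... = (\<integral>\<^sup>+ p. \<integral>\<^sup>+ q. ?Psi3 p q \<partial>leb k \<partial>leb d)"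
  using k.borel_measurable_nn_integral[OF m2] by (intro nn_integral_lborel_vec_uminus[symmetric])
 also have "... = (\<integral>\<^sup>+ p. \<integral>\<^sup>+ q. ?Psi3 p (q + ?C *\<^sub>v p) \<partial>leb k \<partial>leb d)"
  using C by (intro nn_integral_lborel_vec_shear[OF m3, symmetric]) simp
 also have "... = (\<integral>\<^sup>+ p. \<integral>\<^sup>+ q. ?e p * (?e q * g (B *\<^sub>v q)) \<partial>leb k \<partial>leb d)"
  by (intro nn_integral_cong pt) simp_all
 also have "... = ennreal (gauss_int ^ d) * (ennreal (gauss_int ^ k) * (\<integral>\<^sup>+ z. g (B *\<^sub>v z) \<partial>gauss k))"
  by (subst nn_integral_cmult) (measurable, simp only: gauss_vec_lborel_vec[OF gB] nn_integral_multc[OF e] ej)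
 finally show ?thesis
  unfolding mult.assoc[symmetric] using gauss_int_pos
  by (subst (asm) ennreal_mult_cancel_left) (auto simp: ennreal_mult[symmetric])
qed

lemma distr_gauss_vec_coisometry:
 assumes B: "B \<in> Mat d k" and BB: "B * B\<^sup>T = 1\<^sub>m d"
 shows "distr (gauss k) (leb d) (%z. B *\<^sub>v z) = gauss d"
proof (rule measure_eqI)
 fix X assume "X \<in> sets (distr (gauss k) (leb d) (%z. B *\<^sub>v z))"
 then have X: "X \<in> sets (leb d)" by simp
 have m: "(%z. B *\<^sub>v z) \<in> gauss k \<rightarrow>\<^sub>M leb d"
  using measurable_mat_lborel_vec[OF B] by simp
 have "emeasure (distr (gauss k) (leb d) (%z. B *\<^sub>v z)) X
  = (\<integral>\<^sup>+ v. indicator X v \<partial>distr (gauss k) (leb d) (%z. B *\<^sub>v z))"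
  using X by simp
 also have "... = (\<integral>\<^sup>+ z. indicator X (B *\<^sub>v z) \<partial>gauss k)"
  using X by (intro nn_integral_distr m) simp
 also have "... = (\<integral>\<^sup>+ v. indicator X v \<partial>gauss d)"
  using X by (intro nn_integral_gauss_vec_coisometry[OF B BB]) simp
 finally show "emeasure (distr (gauss k) (leb d) (%z. B *\<^sub>v z)) X = emeasure (gauss d) X"
  using X by simp
qed simp

lemma integral_gauss_vec_coisometry:
 fixes g :: "real vec => real"
 assumes B: "B \<in> Mat d k" and BB: "B * B\<^sup>T = 1\<^sub>m d" and g: "g \<in> borel_fun d"
 shows "(\<integral> z. g (B *\<^sub>v z) \<partial>gauss k) = (\<integral> v. g v \<partial>gauss d)"
 using integral_distr[of "%z. B *\<^sub>v z" "gauss k" "leb d" g] measurable_mat_lborel_vec[OF B] g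
 by (simp add: distr_gauss_vec_coisometry[OF B BB])

section \<open>One step of the heat flow\<close>

lemma scalar_prod_Cauchy_Schwarz:
 assumes "x \<in> Rn k" "y \<in> Rn k"
 shows "(x \<bullet> y)\<^sup>2 \<le> (x \<bullet> x) * (y \<bullet> y :: real)"
proof -
 have e: "u \<bullet> v = (\<Sum>i<k. u $ i * v $ i)" if "v \<in> Rn k" for u v :: "real vec"
  using that by (simp add: scalar_prod_def lessThan_atLeast0)
 have "(\<Sum>i<k. x $ i * y $ i)\<^sup>2 \<le> (\<Sum>i<k. (x $ i)\<^sup>2) * (\<Sum>i<k. (y $ i)\<^sup>2)"
  by (rule Cauchy_Schwarz_ineq_sum)
 then show ?thesis
  unfolding e[OF assms(1)] e[OF assms(2)] by (simp add: power2_eq_square)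
qed

lemma smult_mult_mat_vec:
 "A \<in> Mat d k ==> v \<in> Rn k ==> (c \<cdot>\<^sub>m A) *\<^sub>v v = c \<cdot>\<^sub>v (A *\<^sub>v (v :: real vec))"
 by (intro eq_vecI) (auto simp: scalar_prod_def sum_distrib_left mult.assoc)

lemma scalar_prod_self_nonneg: "0 \<le> v \<bullet> (v :: real vec)"
 by (simp add: scalar_prod_def sum_nonneg)

lemma scalar_prod_self_eq_0:
 assumes "v \<in> Rn k" "v \<bullet> v = (0 :: real)"
 shows "v = 0\<^sub>v k"
proof (rule eq_vecI)
 fix i assume i: "i < dim_vec (0\<^sub>v k :: real vec)"
 have "(\<Sum>i<k. v $ i * v $ i) = 0"
  using assms by (simp add: scalar_prod_self_sum)
 then have "v $ i * v $ i = 0"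
  using i by (subst (asm) sum_nonneg_eq_0_iff) auto
 then show "v $ i = 0\<^sub>v k $ i" using i by simp
qed (use assms in simp)

text \<open>The Cauchy-Schwarz inequality row by row; the constant is the squared Frobenius
  norm.\<close>

lemma mat_vec_bounded:
 assumes L: "L \<in> Mat d k"
 shows "\<exists>l\<ge>0. \<forall>x\<in>Rn k. (L *\<^sub>v x) \<bullet> (L *\<^sub>v x) \<le> l * (x \<bullet> (x :: real vec))"
proof (intro exI conjI ballI)
 let ?l = "\<Sum>i<d. row L i \<bullet> row L i"
 show "0 \<le> ?l" by (intro sum_nonneg scalar_prod_self_nonneg)
 fix x :: "real vec" assume x: "x \<in> Rn k"
 have "L *\<^sub>v x \<in> Rn d" by (rule mult_mat_vec_carrier[OF L x])
 then have "(L *\<^sub>v x) \<bullet> (L *\<^sub>v x) = (\<Sum>i<d. (L *\<^sub>v x) $ i * (L *\<^sub>v x) $ i)"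
  by (rule scalar_prod_self_sum)
 also have "... = (\<Sum>i<d. (row L i \<bullet> x)\<^sup>2)"
  using L by (intro sum.cong) (simp_all add: power2_eq_square)
 also have "... \<le> (\<Sum>i<d. (row L i \<bullet> row L i) * (x \<bullet> x))"
  using L x by (intro sum_mono scalar_prod_Cauchy_Schwarz[of _ k]) auto
 finally show "(L *\<^sub>v x) \<bullet> (L *\<^sub>v x) \<le> ?l * (x \<bullet> x)"
  by (simp add: sum_distrib_right)
qed

section \<open>Matrices placed side by side\<close>

definition hcat :: "real mat => real mat => real mat" where
 "hcat V W = mat (dim_row V) (dim_col V + dim_col W)
  (%(i, j). if j < dim_col V then V $$ (i, j) else W $$ (i, j - dim_col V))"

lemma hcat_carrier: "V \<in> Mat d a ==> W \<in> Mat d b ==> hcat V W \<in> Mat d (a + b)"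
 by (simp add: hcat_def)

lemma row_hcat:
 "V \<in> Mat d a ==> W \<in> Mat d b ==> i < d ==> row (hcat V W) i = row V i @\<^sub>v row W i"
 by (intro eq_vecI) (auto simp: hcat_def)

lemma hcat_mult_vec:
 assumes "V \<in> Mat d a" "W \<in> Mat d b" "x \<in> Rn a" "y \<in> Rn b"
 shows "hcat V W *\<^sub>v (x @\<^sub>v y) = V *\<^sub>v x + W *\<^sub>v y"
proof (rule eq_vecI)
 fix i assume "i < dim_vec (V *\<^sub>v x + W *\<^sub>v y)"
 then have i: "i < d" using assms by simp
 have "row V i \<in> Rn a" "row W i \<in> Rn b" using assms i by auto
 then show "(hcat V W *\<^sub>v (x @\<^sub>v y)) $ i = (V *\<^sub>v x + W *\<^sub>v y) $ i"
  using assms i hcat_carrier[OF assms(1,2)] row_hcat[OF assms(1,2) i]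
   scalar_prod_append[of "row V i" a "row W i" b x y] by simp
qed (use assms hcat_carrier[OF assms(1,2)] in simp)

lemma hcat_mult_transpose:
 assumes "V \<in> Mat d a" "W \<in> Mat d b" "V' \<in> Mat d' a" "W' \<in> Mat d' b"
 shows "hcat V W * (hcat V' W')\<^sup>T = V * V'\<^sup>T + W * W'\<^sup>T"
proof (rule eq_matI)
 fix i j assume "i < dim_row (V * V'\<^sup>T + W * W'\<^sup>T)" "j < dim_col (V * V'\<^sup>T + W * W'\<^sup>T)"
 then have ij: "i < d" "j < d'" using assms by auto
 have "row V i \<in> Rn a" "row W i \<in> Rn b" "row V' j \<in> Rn a" "row W' j \<in> Rn b"
  using assms ij by auto
 then show "(hcat V W * (hcat V' W')\<^sup>T) $$ (i, j) = (V * V'\<^sup>T + W * W'\<^sup>T) $$ (i, j)"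
  using assms ij hcat_carrier[OF assms(1,2)] hcat_carrier[OF assms(3,4)]
   row_hcat[OF assms(1,2) ij(1)] row_hcat[OF assms(3,4) ij(2)]
   scalar_prod_append[of "row V i" a "row W i" b "row V' j" "row W' j"] by simp
qed (use assms hcat_carrier[OF assms(1,2)] hcat_carrier[OF assms(3,4)] in simp_all)

section \<open>Moments of the Gaussian measure\<close>

definition gauss_var :: real where
 "gauss_var = (\<integral> v. (v $ 0)\<^sup>2 \<partial>gauss 1)"

text \<open>In this normalisation \<open>gauss_var\<close> is 1/2. It multiplies the quadratic form
  in the heat step, so its sign is what decides the direction there.\<close>

lemma gauss_var_nonneg: "0 \<le> gauss_var"
 unfolding gauss_var_def by (rule integral_nonneg_AE) simp

text \<open>The row \<open>w\<close> divided by its length is a coisometry onto dimension 1, where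
  the second moment is \<open>gauss_var\<close> by definition.\<close>

lemma integral_gauss_linear_square:
 assumes w: "w \<in> Rn k"
 shows "(\<integral> xi. (w \<bullet> xi)\<^sup>2 \<partial>gauss k) = gauss_var * (w \<bullet> w)"
proof (cases "w \<bullet> w = 0")
 case True
 then have w0: "w = 0\<^sub>v k" using scalar_prod_self_eq_0[OF w] by simp
 have "(\<integral> xi. (w \<bullet> xi)\<^sup>2 \<partial>gauss k) = (\<integral> xi. 0 \<partial>gauss k)"
  by (intro Bochner_Integration.integral_cong) (simp_all add: w0)
 then show ?thesis using True by simp
next
 case False
 define s where "s = sqrt (w \<bullet> w)"
 have s: "s * s = w \<bullet> w" "s > 0"
  using False scalar_prod_self_nonneg[of w] by (simp_all add: s_def less_le)
 define B where "B = mat 1 k (%(_, j). w $ j / s)"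
 have B: "B \<in> Mat 1 k" by (simp add: B_def)
 have "(\<Sum>j = 0..<k. w $ j / s * (w $ j / s)) = (w \<bullet> w) / (s * s)"
  using w by (simp add: scalar_prod_def sum_divide_distrib)
 then have BB: "B * B\<^sup>T = 1\<^sub>m 1"
  using s False by (intro eq_matI) (simp_all add: B_def scalar_prod_def)
 have Bx: "(B *\<^sub>v xi) $ 0 = (w \<bullet> xi) / s" if "xi \<in> Rn k" for xi
  using that by (simp add: B_def scalar_prod_def sum_divide_distrib)
 have m: "(%v. (v $ 0)\<^sup>2) \<in> borel_fun 1"
  by (intro borel_measurable_power measurable_vec_index) simp
 have "gauss_var = (\<integral> xi. ((B *\<^sub>v xi) $ 0)\<^sup>2 \<partial>gauss k)"
  unfolding gauss_var_def by (rule integral_gauss_vec_coisometry[OF B BB m, symmetric])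
 also have "... = (\<integral> xi. (w \<bullet> xi)\<^sup>2 / (s * s) \<partial>gauss k)"
  by (intro Bochner_Integration.integral_cong) (simp_all add: Bx power2_eq_square)
 also have "... = (\<integral> xi. (w \<bullet> xi)\<^sup>2 \<partial>gauss k) / (s * s)"
  by simp
 finally show ?thesis
  unfolding s(1)[symmetric] using s(2) by (simp add: field_simps)
qed

lemma measurable_linear_gauss: "w \<in> Rn k ==> (%xi. w \<bullet> xi) \<in> borel_fun k"
 by (intro measurable_scalar_prod[OF measurable_vec_const measurable_ident_sets]) simp_all

text \<open>The reflection \<open>- 1\<^sub>m k\<close> is an isometry and changes the sign of the
  integrand.\<close>

lemma integral_gauss_linear:
 assumes w: "w \<in> Rn k"
 shows "(\<integral> xi. w \<bullet> xi \<partial>gauss k) = 0"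
proof -
 let ?B = "- (1\<^sub>m k) :: real mat"
 have B: "?B \<in> Mat k k" by simp
 have BB: "?B * ?B\<^sup>T = 1\<^sub>m k"
  by (simp add: transpose_uminus)
 have Bx: "w \<bullet> - xi = - (w \<bullet> xi)" if "xi \<in> Rn k" for xi
  using that w by (simp add: scalar_prod_def sum_negf)
 have "(\<integral> xi. w \<bullet> xi \<partial>gauss k) = (\<integral> xi. w \<bullet> (?B *\<^sub>v xi) \<partial>gauss k)"
  by (rule integral_gauss_vec_coisometry[OF B BB measurable_linear_gauss[OF w], symmetric])
 also have "... = (\<integral> xi. - (w \<bullet> xi) \<partial>gauss k)"
  by (intro Bochner_Integration.integral_cong) (simp_all add: Bx)
 finally show ?thesis by simp
qed

text \<open>This weight dominates all error terms of the heat step: the fluctuations are bounded by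
  multiples of \<open>1 + xi \<bullet> xi\<close>, and the Taylor remainder is cubic in
  them.\<close>

lemma integrable_gauss_weight: "integrable (gauss k) (%xi. (1 + xi \<bullet> xi) ^ 3)"
proof (rule integrableI_bounded)
 have m [measurable]: "(%xi. xi \<bullet> xi) \<in> borel_fun k"
  by (rule measurable_scalar_prod_self)
 show "(%xi. (1 + xi \<bullet> xi) ^ 3) \<in> borel_measurable (gauss k)"
  by simp
 have cube: "x ^ 3 \<le> 27 * exp x" if "0 \<le> x" for x :: real
 proof -
  have "(x / 3) ^ 3 \<le> exp (x / 3) ^ 3"
  proof (rule power_mono)
   show "x / 3 \<le> exp (x / 3)" using exp_ge_add_one_self[of "x / 3"] by linarith
  qed (use that in simp)
  also have "exp (x / 3) ^ 3 = exp x"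
   by (simp flip: exp_of_nat_mult)
  finally show ?thesis by (simp add: power_divide)
 qed
 \<comment> \<open>Applying \<open>cube\<close> at \<open>(1 + s) / 2\<close> spends only half of
   the Gaussian exponent, so a Gaussian remains to be integrated; 216 is 8 times 27.\<close>
 have b: "(1 + s) ^ 3 \<le> 216 * exp (1 / 2) * exp (s / 2)" if "0 \<le> s" for s :: real
 proof -
  have "((1 + s) / 2) ^ 3 = (1 + s) ^ 3 / 8" by (simp add: power_divide)
  moreover have "exp ((1 + s) / 2) = exp (1 / 2) * exp (s / 2)"
   by (simp add: exp_add[symmetric] add_divide_distrib)
  ultimately show ?thesis using cube[of "(1 + s) / 2"] that by simp
 qed
 have "(\<integral>\<^sup>+ xi. ennreal (norm ((1 + xi \<bullet> xi) ^ 3)) \<partial>gauss k)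
  \<le> (\<integral>\<^sup>+ xi. ennreal (216 * exp (1 / 2) * exp ((xi \<bullet> xi) / 2)) \<partial>gauss k)"
  using b scalar_prod_self_nonneg by (intro nn_integral_mono ennreal_leI) simp
 also have "... = (\<integral>\<^sup>+ xi. ennreal (exp (- (xi \<bullet> xi)) / gauss_int ^ k) * ennreal (216 * exp (1 / 2) * exp ((xi \<bullet> xi) / 2)) \<partial>leb k)"
  by (rule nn_integral_gauss_vec) measurable
 also have "... = (\<integral>\<^sup>+ xi. ennreal (216 * exp (1 / 2) / gauss_int ^ k) * ennreal (exp (- (1 / 2) * (xi \<bullet> xi))) \<partial>leb k)"
 proof (intro nn_integral_cong)
  fix xi :: "real vec"
  have "exp (- (xi \<bullet> xi)) * exp ((xi \<bullet> xi) / 2) = exp (- (1 / 2) * (xi \<bullet> xi))"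
   by (simp add: exp_add[symmetric])
  then show "ennreal (exp (- (xi \<bullet> xi)) / gauss_int ^ k) * ennreal (216 * exp (1 / 2) * exp ((xi \<bullet> xi) / 2))
   = ennreal (216 * exp (1 / 2) / gauss_int ^ k) * ennreal (exp (- (1 / 2) * (xi \<bullet> xi)))"
   using gauss_int_pos by (subst (1 2) ennreal_mult[symmetric]) (simp_all add: field_simps)
 qed
 also have "... = ennreal (216 * exp (1 / 2) / gauss_int ^ k) * (\<integral>\<^sup>+ xi. ennreal (exp (- (1 / 2) * (xi \<bullet> xi))) \<partial>leb k)"
  by (rule nn_integral_cmult) measurable
 also have "... < \<infinity>"
  using nn_integral_exp_lborel_vec[of "1 / 2" k] by (simp add: ennreal_mult_less_top)
 finally show "(\<integral>\<^sup>+ xi. ennreal (norm ((1 + xi \<bullet> xi) ^ 3)) \<partial>gauss k) < \<infinity>" .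
qed

lemma integrable_gauss_bound:
 fixes f :: "real vec => real"
 assumes f: "f \<in> borel_fun k"
  and b: "!!xi. xi \<in> Rn k ==> \<bar>f xi\<bar> \<le> c * (1 + xi \<bullet> xi) ^ 3"
 shows "integrable (gauss k) f"
proof (rule Bochner_Integration.integrable_bound)
 show "integrable (gauss k) (%xi. c * (1 + xi \<bullet> xi) ^ 3)"
  by (intro integrable_mult_right integrable_gauss_weight)
 show "f \<in> borel_measurable (gauss k)" using f by simp
 show "AE xi in gauss k. norm (f xi) \<le> norm (c * (1 + xi \<bullet> xi) ^ 3)"
  using b by (intro AE_I2) (force intro: order_trans[OF _ abs_ge_self])
qed

lemma gauss_weight_ge_1: "1 \<le> 1 + xi \<bullet> (xi :: real vec)"
 using scalar_prod_self_nonneg[of xi] by simp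

lemma linear_le_gauss_weight:
 assumes "w \<in> Rn k" "xi \<in> Rn k"
 shows "\<bar>w \<bullet> xi\<bar> \<le> (1 + w \<bullet> w) * (1 + xi \<bullet> (xi :: real vec))"
proof -
 have *: "\<bar>x\<bar> \<le> 1 + x\<^sup>2" for x :: real
  using zero_le_power2[of "\<bar>x\<bar> - 1 / 2"] by (simp add: power2_eq_square algebra_simps)
 have "\<bar>w \<bullet> xi\<bar> \<le> 1 + (w \<bullet> w) * (xi \<bullet> xi)"
  using *[of "w \<bullet> xi"] scalar_prod_Cauchy_Schwarz[OF assms] by simp
 also have "... \<le> (1 + w \<bullet> w) * (1 + xi \<bullet> xi)"
  using scalar_prod_self_nonneg[of w] scalar_prod_self_nonneg[of xi] by (simp add: algebra_simps)
 finally show ?thesis .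
qed

lemma gauss_weight_power_mono: "m \<le> n ==> (1 + xi \<bullet> xi) ^ m \<le> (1 + xi \<bullet> (xi :: real vec)) ^ n"
 by (intro power_increasing gauss_weight_ge_1)

lemma integrable_gauss_linear:
 assumes "w \<in> Rn k"
 shows "integrable (gauss k) (%xi. w \<bullet> xi)"
proof (rule integrable_gauss_bound[OF measurable_linear_gauss[OF assms]])
 fix xi :: "real vec" assume xi: "xi \<in> Rn k"
 have "(1 + w \<bullet> w) * (1 + xi \<bullet> xi) ^ 1 \<le> (1 + w \<bullet> w) * (1 + xi \<bullet> xi) ^ 3"
  using scalar_prod_self_nonneg[of w] by (intro mult_left_mono gauss_weight_power_mono) auto
 with linear_le_gauss_weight[OF assms xi]
 show "\<bar>w \<bullet> xi\<bar> \<le> (1 + w \<bullet> w) * (1 + xi \<bullet> xi) ^ 3" by simp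
qed

lemma integrable_gauss_linear_mult:
 assumes "w \<in> Rn k" "w' \<in> Rn k"
 shows "integrable (gauss k) (%xi. (w \<bullet> xi) * (w' \<bullet> xi))"
proof (rule integrable_gauss_bound)
 show "(%xi. (w \<bullet> xi) * (w' \<bullet> xi)) \<in> borel_fun k"
  by (intro borel_measurable_times measurable_linear_gauss assms)
 fix xi :: "real vec" assume xi: "xi \<in> Rn k"
 have "\<bar>(w \<bullet> xi) * (w' \<bullet> xi)\<bar> \<le> ((1 + w \<bullet> w) * (1 + xi \<bullet> xi)) * ((1 + w' \<bullet> w') * (1 + xi \<bullet> xi))"
  unfolding abs_mult using scalar_prod_self_nonneg[of w] scalar_prod_self_nonneg[of xi]
  by (intro mult_mono linear_le_gauss_weight[OF assms(1) xi] linear_le_gauss_weight[OF assms(2) xi]) auto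
 also have "... = ((1 + w \<bullet> w) * (1 + w' \<bullet> w')) * (1 + xi \<bullet> xi) ^ 2"
  by (simp only: power2_eq_square mult_ac)
 also have "... \<le> ((1 + w \<bullet> w) * (1 + w' \<bullet> w')) * (1 + xi \<bullet> xi) ^ 3"
  using scalar_prod_self_nonneg[of w] scalar_prod_self_nonneg[of w'] by (intro mult_left_mono gauss_weight_power_mono) auto
 finally show "\<bar>(w \<bullet> xi) * (w' \<bullet> xi)\<bar> \<le> ((1 + w \<bullet> w) * (1 + w' \<bullet> w')) * (1 + xi \<bullet> xi) ^ 3" .
qed

text \<open>Polarisation of \<open>integral_gauss_linear_square\<close>.\<close>

lemma integral_gauss_linear_mult:
 assumes w: "w \<in> Rn k" and w': "w' \<in> Rn k"
 shows "(\<integral> xi. (w \<bullet> xi) * (w' \<bullet> xi) \<partial>gauss k) = gauss_var * (w \<bullet> w')"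
proof -
 have ww: "w + w' \<in> Rn k" using w w' by simp
 have e: "((w + w') \<bullet> xi)\<^sup>2 = (w \<bullet> xi) * (w \<bullet> xi) + (w' \<bullet> xi) * (w' \<bullet> xi) + 2 * ((w \<bullet> xi) * (w' \<bullet> xi))"
  if "xi \<in> Rn k" for xi
  unfolding add_scalar_prod_distrib[OF w w' that] by (simp add: power2_eq_square algebra_simps)
 have sq: "(\<integral> xi. (v \<bullet> xi) * (v \<bullet> xi) \<partial>gauss k) = gauss_var * (v \<bullet> v)" if "v \<in> Rn k" for v
  using integral_gauss_linear_square[OF that] by (simp only: power2_eq_square)
 have "gauss_var * ((w + w') \<bullet> (w + w')) = (\<integral> xi. ((w + w') \<bullet> xi)\<^sup>2 \<partial>gauss k)"
  by (rule integral_gauss_linear_square[OF ww, symmetric])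
 also have "... = (\<integral> xi. (w \<bullet> xi) * (w \<bullet> xi) + (w' \<bullet> xi) * (w' \<bullet> xi) + 2 * ((w \<bullet> xi) * (w' \<bullet> xi)) \<partial>gauss k)"
  by (intro Bochner_Integration.integral_cong) (simp_all add: e)
 also have "... = gauss_var * (w \<bullet> w) + gauss_var * (w' \<bullet> w') + 2 * (\<integral> xi. (w \<bullet> xi) * (w' \<bullet> xi) \<partial>gauss k)"
  using integrable_gauss_linear_mult[OF w w] integrable_gauss_linear_mult[OF w' w'] integrable_gauss_linear_mult[OF w w']
  by (simp add: sq[OF w] sq[OF w'])
 also have "(w + w') \<bullet> (w + w') = w \<bullet> w + w' \<bullet> w' + 2 * (w \<bullet> w')"
  using w w' comm_scalar_prod[OF w w']
  by (simp add: scalar_prod_add_distrib[of _ k] add_scalar_prod_distrib[of _ k])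
 finally show ?thesis by (simp add: algebra_simps)
qed

text \<open>The block row formed by \<open>s / r\<close> and \<open>t / r\<close> times the identity
  has orthonormal rows precisely because \<open>s\<^sup>2 + t\<^sup>2 = r\<^sup>2\<close>. The
  convolution identity is thus an instance of invariance under coisometries.\<close>

lemma nn_integral_gauss_vec_semigroup:
 assumes g: "g \<in> borel_fun k" and st: "s\<^sup>2 + t\<^sup>2 = r\<^sup>2" and r: "0 < r"
 shows "(\<integral>\<^sup>+ x. \<integral>\<^sup>+ y. g (s \<cdot>\<^sub>v x + t \<cdot>\<^sub>v y) \<partial>gauss k \<partial>gauss k) = (\<integral>\<^sup>+ x. g (r \<cdot>\<^sub>v x) \<partial>gauss k)"
proof -
 define V where "V = (s / r) \<cdot>\<^sub>m (1\<^sub>m k :: real mat)"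
 define W where "W = (t / r) \<cdot>\<^sub>m (1\<^sub>m k :: real mat)"
 have c: "V \<in> Mat k k" "W \<in> Mat k k" by (simp_all add: V_def W_def)
 let ?B = "hcat V W"
 have B: "?B \<in> Mat k (k + k)" by (rule hcat_carrier[OF c])
 have one: "s / r * (s / r) + t / r * (t / r) = 1"
  using st r by (simp add: power2_eq_square add_divide_distrib[symmetric])
 have VV: "V * V\<^sup>T + W * W\<^sup>T = 1\<^sub>m k"
 proof (rule eq_matI)
  fix i j assume "i < dim_row (1\<^sub>m k :: real mat)" "j < dim_col (1\<^sub>m k :: real mat)"
  then have ij: "i < k" "j < k" by simp_all
  have sm: "(x \<cdot>\<^sub>m 1\<^sub>m k) * (x \<cdot>\<^sub>m 1\<^sub>m k)\<^sup>T = (x * x) \<cdot>\<^sub>m (1\<^sub>m k :: real mat)" for x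
  proof -
   have "(x \<cdot>\<^sub>m 1\<^sub>m k)\<^sup>T = x \<cdot>\<^sub>m (1\<^sub>m k :: real mat)"
    by (intro eq_matI) auto
   then show ?thesis
    by (intro eq_matI) (auto simp: mult_smult_assoc_mat[of _ k k _ k] mult_smult_distrib[of _ k k _ k])
  qed
  note 1 = sm[of "s / r", folded V_def] sm[of "t / r", folded W_def]
  show "(V * V\<^sup>T + W * W\<^sup>T) $$ (i, j) = 1\<^sub>m k $$ (i, j)"
   unfolding 1 using ij one by simp
 qed (simp_all add: c[THEN carrier_matD(1)] c[THEN carrier_matD(2)])
 then have BB: "?B * ?B\<^sup>T = 1\<^sub>m k"
  using hcat_mult_transpose[OF c c] by simp
 have mg: "(%v. g (r \<cdot>\<^sub>v v)) \<in> borel_fun k"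
  by (rule measurable_compose[OF measurable_vec_smult[OF measurable_ident_sets[OF refl] borel_measurable_const] g])
 have Bx: "r \<cdot>\<^sub>v (?B *\<^sub>v (x @\<^sub>v y)) = s \<cdot>\<^sub>v x + t \<cdot>\<^sub>v y"
  if "x \<in> Rn k" "y \<in> Rn k" for x y
  using that r hcat_mult_vec[OF c that]
  by (intro eq_vecI) (auto simp: V_def W_def smult_mult_mat_vec[of _ k k] algebra_simps)
 have "(\<integral>\<^sup>+ x. g (r \<cdot>\<^sub>v x) \<partial>gauss k) = (\<integral>\<^sup>+ z. g (r \<cdot>\<^sub>v (?B *\<^sub>v z)) \<partial>gauss (k + k))"
  by (rule nn_integral_gauss_vec_coisometry[OF B BB mg, symmetric])
 also have "... = (\<integral>\<^sup>+ x. \<integral>\<^sup>+ y. g (r \<cdot>\<^sub>v (?B *\<^sub>v (x @\<^sub>v y))) \<partial>gauss k \<partial>gauss k)"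
  by (rule nn_integral_gauss_vec_append, rule measurable_compose[OF measurable_mat_lborel_vec[OF B] mg])
 also have "... = (\<integral>\<^sup>+ x. \<integral>\<^sup>+ y. g (s \<cdot>\<^sub>v x + t \<cdot>\<^sub>v y) \<partial>gauss k \<partial>gauss k)"
  by (intro nn_integral_cong) (simp add: Bx)
 finally show ?thesis ..
qed

text \<open>Taylor's formula along the segment from 1 to \<open>1 + r i\<close>, taken in all
  factors at once. The exponents have arbitrary signs, so the factors must stay away from 0 and from
  infinity; the remainder constant depends on \<open>dl\<close>, \<open>R\<close> and the exponents,
  but not on \<open>r\<close>.\<close>

lemma prod_powr_taylor:
 fixes al :: "'i => real"
 assumes I: "finite I" and dl: "0 < dl" "dl \<le> 1" and R: "0 \<le> R"
 shows "\<exists>D\<ge>0. \<forall>r. (\<forall>i\<in>I. dl \<le> 1 + r i \<and> r i \<le> R) \<longrightarrow>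
  \<bar>(\<Prod>i\<in>I. (1 + r i) powr al i) - (1 + (\<Sum>i\<in>I. al i * r i) + ((\<Sum>i\<in>I. al i * r i)\<^sup>2 - (\<Sum>i\<in>I. al i * (r i)\<^sup>2)) / 2)\<bar>
   \<le> D * (\<Sum>i\<in>I. \<bar>r i\<bar>) ^ 3"
proof -
 define A where "A = (\<Sum>i\<in>I. \<bar>al i\<bar>)"
 \<comment> \<open>On the segment \<open>\<bar>ln (1 + t * r i)\<bar> \<le> R - ln dl\<close>, so
   \<open>E\<close> bounds the product along it. In \<open>D\<close> the 6 is the factorial of 3,
   and \<open>dl ^ 3\<close> comes from bounding the quotients \<open>q i t\<close>.\<close>
 define E where "E = exp (A * (R - ln dl))"
 define D where "D = E * (A ^ 3 + 3 * A * A + 2 * A) / (6 * dl ^ 3)"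
 have A: "0 \<le> A" by (simp add: A_def sum_nonneg)
 have E: "0 < E" by (simp add: E_def)
 have D: "0 \<le> D" using A E dl by (simp add: D_def)
 have "\<bar>(\<Prod>i\<in>I. (1 + r i) powr al i) - (1 + (\<Sum>i\<in>I. al i * r i) + ((\<Sum>i\<in>I. al i * r i)\<^sup>2 - (\<Sum>i\<in>I. al i * (r i)\<^sup>2)) / 2)\<bar>
   \<le> D * (\<Sum>i\<in>I. \<bar>r i\<bar>) ^ 3" if r: "\<forall>i\<in>I. dl \<le> 1 + r i \<and> r i \<le> R" for r
 proof -
  define T where "T = (\<Sum>i\<in>I. \<bar>r i\<bar>)"
  define q where "q = (%i t. r i / (1 + t * r i))"
  \<comment> \<open>The quotients satisfy \<open>q' = - q\<^sup>2\<close>, hence the power sums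
    differentiate into each other: the derivative of \<open>S1\<close> is \<open>- S2\<close> and
    that of \<open>S2\<close> is \<open>- 2 * S3\<close>. Together with the logarithmic derivative
    \<open>S1\<close> of \<open>phi\<close> this produces the polynomials in
    \<open>diff\<close>.\<close>
  define S1 where "S1 = (%t. \<Sum>i\<in>I. al i * q i t)"
  define S2 where "S2 = (%t. \<Sum>i\<in>I. al i * q i t ^ 2)"
  define S3 where "S3 = (%t. \<Sum>i\<in>I. al i * q i t ^ 3)"
  define phi where "phi = (%t. exp (\<Sum>i\<in>I. al i * ln (1 + t * r i)))"
  define diff where "diff = (%m::nat. if m = 0 then phi else if m = 1 then (%t. phi t * S1 t)
   else if m = 2 then (%t. phi t * (S1 t ^ 2 - S2 t)) else (%t. phi t * (S1 t ^ 3 - 3 * S1 t * S2 t + 2 * S3 t)))"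
  have T: "0 \<le> T" by (simp add: T_def sum_nonneg)
  \<comment> \<open>\<open>1 + t * r i\<close> is a convex combination of 1 and
    \<open>1 + r i\<close>, both at least \<open>dl\<close> because
    \<open>dl \<le> 1\<close>.\<close>
  have pos: "dl \<le> 1 + t * r i" if "0 \<le> t" "t \<le> 1" "i \<in> I" for t i
  proof -
   have "dl \<le> 1 + r i" using r that by blast
   then have "(1 - t) * dl + t * dl \<le> (1 - t) * 1 + t * (1 + r i)"
    using that dl by (intro add_mono mult_left_mono) auto
   then show ?thesis by (simp add: algebra_simps)
  qed
  have dq: "(q i has_real_derivative - (q i t ^ 2)) (at t)" if "0 \<le> t" "t \<le> 1" "i \<in> I" for t i
   unfolding q_def using pos[OF that] dl
   by (auto intro!: derivative_eq_intros simp: power2_eq_square divide_simps)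
  have dphi: "(phi has_real_derivative phi t * S1 t) (at t)" if t: "0 \<le> t" "t \<le> 1" for t
   unfolding phi_def
  proof (rule derivative_eq_intros)
   show "((%t. \<Sum>i\<in>I. al i * ln (1 + t * r i)) has_real_derivative S1 t) (at t)"
    unfolding S1_def
   proof (rule DERIV_sum)
    fix i assume i: "i \<in> I"
    then show "((%t. al i * ln (1 + t * r i)) has_real_derivative al i * q i t) (at t)"
     using pos[OF t i] dl by (auto intro!: derivative_eq_intros simp: q_def)
   qed
  qed simp
  have dS1: "(S1 has_real_derivative - S2 t) (at t)" if t: "0 \<le> t" "t \<le> 1" for t
   unfolding S1_def S2_def sum_negf[symmetric]
   by (intro DERIV_sum) (auto intro!: derivative_eq_intros dq t)
  have dS2: "(S2 has_real_derivative - 2 * S3 t) (at t)" if t: "0 \<le> t" "t \<le> 1" for t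
   unfolding S2_def S3_def sum_distrib_left
   by (intro DERIV_sum) (auto intro!: derivative_eq_intros dq t simp: power2_eq_square power3_eq_cube)
  have deriv: "\<forall>m t. m < 3 \<and> 0 \<le> t \<and> t \<le> 1 \<longrightarrow> DERIV (diff m) t :> diff (Suc m) t"
  proof (intro allI impI, elim conjE)
   fix m :: nat and t :: real assume m: "m < 3" and t: "0 \<le> t" "t \<le> 1"
   from m consider "m = 0" | "m = 1" | "m = 2" by linarith
   then show "DERIV (diff m) t :> diff (Suc m) t"
   proof cases
    case 1 then show ?thesis using dphi[OF t] by (simp add: diff_def)
   next
    case 2 then show ?thesis
     by (auto simp: diff_def power2_eq_square algebra_simps intro!: derivative_eq_intros dphi dS1 t)
   next
    case 3 then show ?thesis
     by (auto simp: diff_def power2_eq_square power3_eq_cube algebra_simps intro!: derivative_eq_intros dphi dS1 dS2 t)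
   qed
  qed
  obtain t where t: "0 < t" "t < 1" and eq: "phi 1 = (\<Sum>m<3. diff m 0 / fact m * 1 ^ m) + diff 3 t / fact 3 * 1 ^ 3"
   using Maclaurin[of 1 3 diff phi, OF _ _ _ deriv] by (auto simp: diff_def)
  have phi1: "phi 1 = (\<Prod>i\<in>I. (1 + r i) powr al i)"
   unfolding phi_def exp_sum[OF I]
  proof (rule prod.cong)
   fix i assume "i \<in> I"
   then have "0 < 1 + r i" using pos[of 1 i] dl by simp
   then show "exp (al i * ln (1 + 1 * r i)) = (1 + r i) powr al i" by (simp add: powr_def)
  qed simp
  have z: "phi 0 = 1" "S1 0 = (\<Sum>i\<in>I. al i * r i)" "S2 0 = (\<Sum>i\<in>I. al i * (r i)\<^sup>2)"
   by (simp_all add: phi_def S1_def S2_def q_def)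
  have h: "phi 1 - (1 + S1 0 + (S1 0 ^ 2 - S2 0) / 2) = diff 3 t / 6"
   unfolding eq by (simp add: diff_def z(1) numeral_3_eq_3 fact_numeral)
  have main: "\<bar>(\<Prod>i\<in>I. (1 + r i) powr al i) - (1 + (\<Sum>i\<in>I. al i * r i) + ((\<Sum>i\<in>I. al i * r i)\<^sup>2 - (\<Sum>i\<in>I. al i * (r i)\<^sup>2)) / 2)\<bar> = \<bar>diff 3 t\<bar> / 6"
   by (simp only: h[unfolded phi1 z] abs_divide abs_numeral)
  have qb: "\<bar>q i t\<bar> \<le> T / dl" if i: "i \<in> I" for i
  proof -
   have "\<bar>r i\<bar> \<le> T" unfolding T_def using i I by (intro member_le_sum) auto
   moreover have "dl \<le> \<bar>1 + t * r i\<bar>" using pos[of t i] t i by simp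
   ultimately show ?thesis unfolding q_def abs_divide using dl T by (intro frac_le) auto
  qed
  have Sb: "\<bar>\<Sum>i\<in>I. al i * q i t ^ n\<bar> \<le> A * (T / dl) ^ n" for n
  proof -
   have "\<bar>\<Sum>i\<in>I. al i * q i t ^ n\<bar> \<le> (\<Sum>i\<in>I. \<bar>al i * q i t ^ n\<bar>)" by (rule sum_abs)
   also have "... \<le> (\<Sum>i\<in>I. \<bar>al i\<bar> * (T / dl) ^ n)"
    unfolding abs_mult power_abs by (intro sum_mono mult_left_mono power_mono qb) auto
   finally show ?thesis by (simp add: A_def sum_distrib_right)
  qed
  have phib: "phi t \<le> E"
  proof -
   have "(\<Sum>i\<in>I. al i * ln (1 + t * r i)) \<le> (\<Sum>i\<in>I. \<bar>al i\<bar> * (R - ln dl))"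
   proof (rule sum_mono)
    fix i assume i: "i \<in> I"
    have p: "dl \<le> 1 + t * r i" using pos[of t i] t i by simp
    have tr: "t * r i \<le> R"
    proof (cases "0 \<le> r i")
     case True
     then have "t * r i \<le> 1 * r i" using t by (intro mult_right_mono) auto
     then show ?thesis using r i by (auto intro: order_trans)
    next
     case False
     then have "t * r i \<le> 0" using t by (simp add: mult_nonneg_nonpos)
     then show ?thesis using R by simp
    qed
    have "ln (1 + t * r i) \<le> t * r i" using p dl by (intro ln_add_one_self_le_self2) auto
    moreover have "ln dl \<le> ln (1 + t * r i)" using p dl by simp
    moreover have "ln dl \<le> 0" using dl by simp
    ultimately have "\<bar>ln (1 + t * r i)\<bar> \<le> R - ln dl" using tr R by (simp add: abs_le_iff)
    then have "\<bar>al i\<bar> * \<bar>ln (1 + t * r i)\<bar> \<le> \<bar>al i\<bar> * (R - ln dl)" by (intro mult_left_mono) auto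
    then show "al i * ln (1 + t * r i) \<le> \<bar>al i\<bar> * (R - ln dl)"
     by (metis abs_ge_self abs_mult order_trans)
   qed
   then show ?thesis by (simp add: phi_def E_def A_def sum_distrib_right)
  qed
  define B where "B = T / dl"
  have B: "0 \<le> B" using T dl by (simp add: B_def)
  have S1b: "\<bar>S1 t\<bar> \<le> A * B" using Sb[of 1] by (simp add: S1_def B_def)
  have S2b: "\<bar>S2 t\<bar> \<le> A * B ^ 2" using Sb[of 2] by (simp add: S2_def B_def)
  have S3b: "\<bar>S3 t\<bar> \<le> A * B ^ 3" using Sb[of 3] by (simp add: S3_def B_def)
  have "\<bar>S1 t ^ 3\<bar> \<le> (A * B) ^ 3" unfolding power_abs by (intro power_mono S1b) simp
  moreover have "\<bar>S1 t * S2 t\<bar> \<le> (A * B) * (A * B ^ 2)"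
   unfolding abs_mult using A B by (intro mult_mono S1b S2b) auto
  ultimately have "\<bar>S1 t ^ 3 - 3 * S1 t * S2 t + 2 * S3 t\<bar> \<le> (A * B) ^ 3 + 3 * ((A * B) * (A * B ^ 2)) + 2 * (A * B ^ 3)"
   using S3b by linarith
  also have "... = (A ^ 3 + 3 * A * A + 2 * A) * B ^ 3"
   by (simp add: power_mult_distrib algebra_simps power2_eq_square power3_eq_cube)
  finally have "\<bar>diff 3 t\<bar> \<le> E * ((A ^ 3 + 3 * A * A + 2 * A) * B ^ 3)"
   unfolding diff_def using phib E by (auto simp: abs_mult phi_def intro!: mult_mono)
  also have "... = 6 * (D * T ^ 3)"
   using dl by (simp add: D_def B_def power_divide)
  finally show ?thesis unfolding main T_def by simp
 qed
 with D show ?thesis by blast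
qed

text \<open>The class of functions with Lipschitz gradient, described by a first-order expansion
  with quadratic remainder instead of by derivatives; \<open>g\<close> is the gradient. In this form
  the conditions pass under an integral. A single constant serves for the squared gradient and for
  the remainder.\<close>

definition C11 :: "nat => real => real => real => (real vec => real) => bool" where
 "C11 d a b C h \<longleftrightarrow> h \<in> borel_fun d \<and> (\<forall>u\<in>Rn d. a \<le> h u \<and> h u \<le> b) \<and>
  (\<exists>g. g \<in> leb d \<rightarrow>\<^sub>M leb d \<and> (\<forall>u\<in>Rn d. g u \<bullet> g u \<le> C) \<and>
   (\<forall>u\<in>Rn d. \<forall>v\<in>Rn d. \<bar>h (u + v) - h u - g u \<bullet> v\<bar> \<le> C * (v \<bullet> v)))"

text \<open>The heat semigroup with diffusion matrix \<open>L * L\<^sup>T\<close>, run for a time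
  proportional to \<open>eps\<^sup>2\<close>: \<open>eps\<close> is a standard deviation, so steps
  compose by adding squares.\<close>

definition gauss_avg :: "nat => real mat => real => (real vec => real) => real vec => real" where
 "gauss_avg N L eps h u = (\<integral> xi. h (u + eps \<cdot>\<^sub>v (L *\<^sub>v xi)) \<partial>gauss N)"

lemma measurable_gauss_vec_target: "measurable M (gauss N) = measurable M (leb N)"
 by (rule measurable_cong_sets) simp_all

lemma measurable_shift:
 assumes "L \<in> Mat d N" "u \<in> Rn d"
 shows "(%xi. u + eps \<cdot>\<^sub>v (L *\<^sub>v xi)) \<in> leb N \<rightarrow>\<^sub>M leb d"
 by (rule measurable_vec_add[OF measurable_vec_const[OF assms(2)]
  measurable_vec_smult[OF measurable_mat_lborel_vec[OF assms(1)] borel_measurable_const]])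

lemma measurable_shift_pair:
 assumes "L \<in> Mat d N"
 shows "(%z. fst z + eps \<cdot>\<^sub>v (L *\<^sub>v snd z)) \<in> leb d \<Otimes>\<^sub>M gauss N \<rightarrow>\<^sub>M leb d"
proof -
 have "snd \<in> leb d \<Otimes>\<^sub>M gauss N \<rightarrow>\<^sub>M leb N"
  using measurable_snd[of "leb d" "gauss N"] by (simp add: measurable_gauss_vec_target)
 from measurable_vec_add[OF measurable_fst measurable_vec_smult[OF measurable_mult_mat_vec[OF assms this] borel_measurable_const]]
 show ?thesis .
qed

lemma integrable_gauss_bounded:
 fixes f :: "real vec => real"
 assumes "f \<in> borel_fun k" "!!xi. xi \<in> Rn k ==> \<bar>f xi\<bar> \<le> B"
 shows "integrable (gauss k) f"
 using assms by (intro finite_measure.integrable_const_bound[OF finite_measure_gauss_vec, of _ B] AE_I2) simp_all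

lemma integral_gauss_le:
 fixes f g :: "real vec => real"
 assumes "integrable (gauss k) f" "integrable (gauss k) g" "!!xi. xi \<in> Rn k ==> f xi \<le> g xi"
 shows "(\<integral> xi. f xi \<partial>gauss k) \<le> (\<integral> xi. g xi \<partial>gauss k)"
 using assms by (intro integral_mono) auto

lemma integral_gauss_const [simp]: "(\<integral> xi. c \<partial>gauss k) = (c :: real)"
 by simp

lemma integrable_gauss_const [simp]: "integrable (gauss k) (%xi. c :: real)"
 by (rule integrable_gauss_bounded[of _ _ "\<bar>c\<bar>"]) simp_all

lemma abs_coordinate_le:
 assumes "v \<in> Rn d" "j < d" "v \<bullet> v \<le> C"
 shows "\<bar>v $ j\<bar> \<le> 1 + (C :: real)"
proof -
 have "v $ j * v $ j \<le> (\<Sum>i<d. v $ i * v $ i)"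
  using assms(2) by (intro member_le_sum) auto
 then have "(v $ j)\<^sup>2 \<le> C"
  using assms(1,3) by (simp add: scalar_prod_self_sum power2_eq_square)
 moreover have "\<bar>x\<bar> \<le> 1 + x\<^sup>2" for x :: real
  using zero_le_power2[of "\<bar>x\<bar> - 1 / 2"] by (simp add: power2_eq_square algebra_simps)
 ultimately show ?thesis by (meson add_left_mono order_trans)
qed

text \<open>The mean of a bounded vector field is taken coordinatewise, and pairing with a fixed
  vector commutes with it. This is how the gradient of an average is represented.\<close>

lemma integral_gauss_vec_scalar_prod:
 assumes G: "G \<in> leb N \<rightarrow>\<^sub>M leb d" and C: "!!xi. xi \<in> Rn N ==> G xi \<bullet> G xi \<le> C"
  and w: "w \<in> Rn d"
 shows "vec d (%j. \<integral> xi. G xi $ j \<partial>gauss N) \<bullet> w = (\<integral> xi. G xi \<bullet> w \<partial>gauss N)"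
  and "integrable (gauss N) (%xi. G xi \<bullet> w)"
proof -
 have Gc: "G xi \<in> Rn d" if "xi \<in> Rn N" for xi
  using measurable_space[OF G] that by simp
 have int: "integrable (gauss N) (%xi. G xi $ j)" if "j < d" for j
  using Gc C that by (intro integrable_gauss_bounded[of _ _ "1 + C"] measurable_vec_index'[OF G] abs_coordinate_le[of _ d]) auto
 have e: "x \<bullet> w = (\<Sum>j<d. x $ j * w $ j)" for x
  using w by (simp add: scalar_prod_def lessThan_atLeast0)
 show "integrable (gauss N) (%xi. G xi \<bullet> w)"
  unfolding e using int by (intro Bochner_Integration.integrable_sum integrable_mult_left) simp
 show "vec d (%j. \<integral> xi. G xi $ j \<partial>gauss N) \<bullet> w = (\<integral> xi. G xi \<bullet> w \<partial>gauss N)"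
  unfolding e using int by (subst Bochner_Integration.integral_sum) (auto intro!: sum.cong)
qed

lemma two_scalar_prod_le:
 assumes "x \<in> Rn d" "y \<in> Rn d"
 shows "2 * (x \<bullet> y) \<le> x \<bullet> x + y \<bullet> (y :: real vec)"
proof -
 have "0 \<le> (x - y) \<bullet> (x - y)" by (rule scalar_prod_self_nonneg)
 also have "... = x \<bullet> x + y \<bullet> y - 2 * (x \<bullet> y)"
  using assms comm_scalar_prod[OF assms]
  by (simp add: minus_scalar_prod_distrib[of _ d] scalar_prod_minus_distrib[of _ d])
 finally show ?thesis by simp
qed

lemma gauss_avg_bounds:
 assumes "h \<in> borel_fun d" "\<forall>u\<in>Rn d. a \<le> h u \<and> h u \<le> b"
  and "L \<in> Mat d N" "u \<in> Rn d"
 shows "a \<le> gauss_avg N L eps h u" "gauss_avg N L eps h u \<le> b"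
  "integrable (gauss N) (%xi. h (u + eps \<cdot>\<^sub>v (L *\<^sub>v xi)))"
proof -
 have c: "u + eps \<cdot>\<^sub>v (L *\<^sub>v xi) \<in> Rn d" if "xi \<in> Rn N" for xi
  using assms(3,4) that by simp
 have ab: "a \<le> h (u + eps \<cdot>\<^sub>v (L *\<^sub>v xi))" "h (u + eps \<cdot>\<^sub>v (L *\<^sub>v xi)) \<le> b" if "xi \<in> Rn N" for xi
  using assms(2) c[OF that] by auto
 show int: "integrable (gauss N) (%xi. h (u + eps \<cdot>\<^sub>v (L *\<^sub>v xi)))"
 proof (rule integrable_gauss_bounded)
  show "(%xi. h (u + eps \<cdot>\<^sub>v (L *\<^sub>v xi))) \<in> borel_fun N"
   by (rule measurable_compose[OF measurable_shift[OF assms(3,4)] assms(1)])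
  show "\<bar>h (u + eps \<cdot>\<^sub>v (L *\<^sub>v xi))\<bar> \<le> \<bar>a\<bar> + \<bar>b\<bar>" if "xi \<in> Rn N" for xi
   using ab[OF that] by linarith
 qed
 show "a \<le> gauss_avg N L eps h u"
  using integral_gauss_le[OF integrable_gauss_const int ab(1)] by (simp add: gauss_avg_def)
 show "gauss_avg N L eps h u \<le> b"
  using integral_gauss_le[OF int integrable_gauss_const ab(2)] by (simp add: gauss_avg_def)
qed

text \<open>Averaging the first-order expansions gives an expansion of the average, with the
  averaged gradient. The constants \<open>a\<close>, \<open>b\<close> and \<open>C\<close> do not
  deteriorate, which is what lets one error constant serve for arbitrarily many steps.\<close>

lemma C11_gauss_avg:
 assumes h: "C11 d a b C h" and L: "L \<in> Mat d N"
 shows "C11 d a b C (gauss_avg N L eps h)"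
proof -
 interpret gauss: sigma_finite_measure "gauss N" by (rule sigma_finite_gauss_vec)
 obtain g where hm: "h \<in> borel_fun d" and hab: "\<forall>u\<in>Rn d. a \<le> h u \<and> h u \<le> b"
  and gm: "g \<in> leb d \<rightarrow>\<^sub>M leb d" and gC: "!!u. u \<in> Rn d ==> g u \<bullet> g u \<le> C"
  and gh: "!!u v. u \<in> Rn d ==> v \<in> Rn d ==> \<bar>h (u + v) - h u - g u \<bullet> v\<bar> \<le> C * (v \<bullet> v)"
  using h unfolding C11_def by blast
 let ?s = "%u xi. u + eps \<cdot>\<^sub>v (L *\<^sub>v xi)"
 have sc: "?s u xi \<in> Rn d" if "u \<in> Rn d" "xi \<in> Rn N" for u xi
  using L that by simp
 have gc: "g u \<in> Rn d" if "u \<in> Rn d" for u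
  using measurable_space[OF gm] that by simp
 define g' where "g' = (%u. vec d (%j. \<integral> xi. g (?s u xi) $ j \<partial>gauss N))"
 have gs: "(%xi. g (?s u xi)) \<in> leb N \<rightarrow>\<^sub>M leb d" if "u \<in> Rn d" for u
  by (rule measurable_compose[OF measurable_shift[OF L that] gm])
 have g'w: "g' u \<bullet> w = (\<integral> xi. g (?s u xi) \<bullet> w \<partial>gauss N)" "integrable (gauss N) (%xi. g (?s u xi) \<bullet> w)"
  if "u \<in> Rn d" "w \<in> Rn d" for u w
  unfolding g'_def using integral_gauss_vec_scalar_prod[OF gs[OF that(1)] gC[OF sc[OF that(1)]] that(2)] by auto
 show ?thesis
  unfolding C11_def
 proof (intro conjI exI[of _ g'] ballI)
  show "gauss_avg N L eps h \<in> borel_fun d"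
   unfolding gauss_avg_def[abs_def]
   using measurable_compose[OF measurable_shift_pair[OF L] hm]
   by (intro gauss.borel_measurable_lebesgue_integral) (simp add: case_prod_beta)
  show "g' \<in> leb d \<rightarrow>\<^sub>M leb d"
  proof (rule measurable_lborel_vecI)
   fix j assume j: "j < d"
   have "(%u. \<integral> xi. g (?s u xi) $ j \<partial>gauss N) \<in> borel_fun d"
    using measurable_vec_index'[OF measurable_compose[OF measurable_shift_pair[OF L] gm] j]
    by (intro gauss.borel_measurable_lebesgue_integral) (simp add: case_prod_beta)
   then show "(%u. g' u $ j) \<in> borel_fun d"
    using j by (simp add: g'_def)
  qed (simp add: g'_def)
  fix u :: "real vec" assume u: "u \<in> Rn d"
  show "a \<le> gauss_avg N L eps h u" "gauss_avg N L eps h u \<le> b"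
   using gauss_avg_bounds[OF hm hab L u] by auto
  have g'c: "g' u \<in> Rn d" by (simp add: g'_def)
  \<comment> \<open>The mean gradient is paired with itself;
    \<open>2 * (x \<bullet> y) \<le> x \<bullet> x + y \<bullet> y\<close> under the integral then
    yields \<open>2 * G \<le> C + G\<close> for its squared length \<open>G\<close>.\<close>
  have "2 * (g' u \<bullet> g' u) = (\<integral> xi. 2 * (g (?s u xi) \<bullet> g' u) \<partial>gauss N)"
   using g'w[OF u g'c] by simp
  also have "... \<le> (\<integral> xi. C + g' u \<bullet> g' u \<partial>gauss N)"
  proof (rule integral_gauss_le)
   show "integrable (gauss N) (%xi. 2 * (g (?s u xi) \<bullet> g' u))"
    using g'w(2)[OF u g'c] by simp
   fix xi :: "real vec" assume "xi \<in> Rn N"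
   then have c: "?s u xi \<in> Rn d" by (rule sc[OF u])
   show "2 * (g (?s u xi) \<bullet> g' u) \<le> C + g' u \<bullet> g' u"
    using two_scalar_prod_le[OF gc[OF c] g'c] gC[OF c] by linarith
  qed simp
  finally show "g' u \<bullet> g' u \<le> C" by simp
  fix v :: "real vec" assume v: "v \<in> Rn d"
  have uv: "u + v \<in> Rn d" using u v by simp
  have 1: "integrable (gauss N) (%xi. h (?s (u + v) xi))" "integrable (gauss N) (%xi. h (?s u xi))"
   using gauss_avg_bounds(3)[OF hm hab L] u uv by auto
  have eq: "gauss_avg N L eps h (u + v) - gauss_avg N L eps h u - g' u \<bullet> v
   = (\<integral> xi. h (?s (u + v) xi) - h (?s u xi) - g (?s u xi) \<bullet> v \<partial>gauss N)"
   unfolding gauss_avg_def g'w(1)[OF u v]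
   by (simp only: Bochner_Integration.integral_diff[OF 1] Bochner_Integration.integral_diff[OF Bochner_Integration.integrable_diff[OF 1] g'w(2)[OF u v]])
  have "\<bar>gauss_avg N L eps h (u + v) - gauss_avg N L eps h u - g' u \<bullet> v\<bar> \<le> (\<integral> xi. \<bar>h (?s (u + v) xi) - h (?s u xi) - g (?s u xi) \<bullet> v\<bar> \<partial>gauss N)"
   unfolding eq by (rule integral_abs_bound)
  also have "... \<le> (\<integral> xi. C * (v \<bullet> v) \<partial>gauss N)"
  proof (rule integral_gauss_le)
   show "integrable (gauss N) (%xi. \<bar>h (?s (u + v) xi) - h (?s u xi) - g (?s u xi) \<bullet> v\<bar>)"
    by (intro integrable_abs Bochner_Integration.integrable_diff 1 g'w(2)[OF u v])
   fix xi :: "real vec" assume x: "xi \<in> Rn N"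
   have "(u + v) + e = (u + e) + v" if "e \<in> Rn d" for e
    using u v that by (intro eq_vecI) simp_all
   from this[of "eps \<cdot>\<^sub>v (L *\<^sub>v xi)"] have "?s (u + v) xi = ?s u xi + v"
    using x L by simp
   then show "\<bar>h (?s (u + v) xi) - h (?s u xi) - g (?s u xi) \<bullet> v\<bar> \<le> C * (v \<bullet> v)"
    using gh[OF sc[OF u x] v] by simp
  qed simp
  finally show "\<bar>gauss_avg N L eps h (u + v) - gauss_avg N L eps h u - g' u \<bullet> v\<bar> \<le> C * (v \<bullet> v)"
   by simp
 qed
qed

definition gauss_form :: "nat set => (nat => real) => (nat => real mat) => (nat => real vec) => real" where
 "gauss_form I al L v =
  (\<Sum>i\<in>I. \<Sum>j\<in>I. al i * al j * (((L i)\<^sup>T *\<^sub>v v i) \<bullet> ((L j)\<^sup>T *\<^sub>v v j)))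
   - (\<Sum>i\<in>I. al i * (((L i)\<^sup>T *\<^sub>v v i) \<bullet> ((L i)\<^sup>T *\<^sub>v v i)))"

lemma half_diff_bound:
 fixes x y :: real
 assumes "\<bar>x - y\<bar> \<le> 2 * p" "\<bar>x2 - y2\<bar> \<le> 2 * q"
 shows "\<bar>(c + (y - y2) / 2) - (c + (x - x2) / 2)\<bar> \<le> p + q"
proof -
 have eq: "(c + (y - y2) / 2) - (c + (x - x2) / 2) = ((x2 - y2) - (x - y)) / 2"
  by (simp add: field_simps)
 have "\<bar>(x2 - y2) - (x - y)\<bar> \<le> 2 * p + 2 * q"
  using assms by linarith
 then show ?thesis
  unfolding eq abs_divide abs_numeral by (subst pos_divide_le_eq) simp_all
qed

text \<open>One step of the heat flow. Since the fluctuations of \<open>h\<^sub>i\<close> around its average have mean zero,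
 only the second-order term of \<open>\<Prod> (1 + r\<^sub>i)\<^sup>al\<close> survives, and its leading part is the quadratic form
 of the gradients.\<close>

lemma heat_step:
 fixes d :: "nat => nat"
 assumes I: "finite I" and L: "!!i. i \<in> I ==> L i \<in> Mat (d i) N"
  and ab: "0 < a" "a \<le> b" and sgm: "sgm = 1 \<or> sgm = (- 1 :: real)" and C: "0 \<le> C"
  and Q: "!!v. (!!i. i \<in> I ==> v i \<in> Rn (d i)) ==> sgm * gauss_form I al L v \<le> 0"
 shows "\<exists>D\<ge>0. \<forall>h u eps. (\<forall>i\<in>I. C11 (d i) a b C (h i)) \<longrightarrow> (\<forall>i\<in>I. u i \<in> Rn (d i)) \<longrightarrow> 0 \<le> eps \<longrightarrow> eps \<le> 1 \<longrightarrow>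
  sgm * (\<integral> xi. (\<Prod>i\<in>I. h i (u i + eps \<cdot>\<^sub>v (L i *\<^sub>v xi)) powr al i) \<partial>gauss N)
   \<le> sgm * (\<Prod>i\<in>I. gauss_avg N (L i) eps (h i) (u i) powr al i) + D * eps ^ 3"
proof -
 define s where "s = (%xi::real vec. 1 + xi \<bullet> xi)"
 have s1: "1 \<le> s xi" for xi by (simp add: s_def scalar_prod_self_nonneg)
 have s0: "0 \<le> s xi" for xi using s1[of xi] by simp
 have s3: "s xi ^ m \<le> s xi ^ 3" if "m \<le> 3" for xi m using that s1 by (rule power_increasing)
 have smeas: "s \<in> borel_fun N"
  unfolding s_def using measurable_scalar_prod_self[of N] by simp
 have ints3: "integrable (gauss N) (%xi. s xi ^ 3)"
  unfolding s_def by (rule integrable_gauss_weight)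
 have ints: "integrable (gauss N) s"
 proof (rule integrable_gauss_bound[OF smeas])
  show "\<bar>s xi\<bar> \<le> 1 * (1 + xi \<bullet> xi) ^ 3" for xi
   using s3[of 1 xi] s0[of xi] unfolding s_def by simp
 qed
 define m1 where "m1 = (\<integral> xi. s xi \<partial>gauss N)"
 define m3 where "m3 = (\<integral> xi. s xi ^ 3 \<partial>gauss N)"
 have m0: "0 \<le> m1" "0 \<le> m3"
  unfolding m1_def m3_def using s0 by (auto intro!: integral_nonneg_AE)
 have "\<exists>l\<ge>0. \<forall>i\<in>I. \<forall>x\<in>Rn N. (L i *\<^sub>v x) \<bullet> (L i *\<^sub>v x) \<le> l * (x \<bullet> x)"
 proof -
  have "\<forall>i\<in>I. \<exists>l\<ge>0. \<forall>x\<in>Rn N. (L i *\<^sub>v x) \<bullet> (L i *\<^sub>v x) \<le> l * (x \<bullet> x)"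
   using mat_vec_bounded[OF L] by blast
  then obtain l where l: "!!i. i \<in> I ==> 0 \<le> l i"
   "!!i x. i \<in> I ==> x \<in> Rn N ==> (L i *\<^sub>v x) \<bullet> (L i *\<^sub>v x) \<le> l i * (x \<bullet> x)"
   by metis
  have "(L i *\<^sub>v x) \<bullet> (L i *\<^sub>v x) \<le> sum l I * (x \<bullet> x)" if "i \<in> I" "x \<in> Rn N" for i x
   using l(2)[OF that] member_le_sum[of i I l] l(1) I that scalar_prod_self_nonneg[of x]
   by (meson mult_right_mono order_trans DiffD1)
  then show ?thesis using l(1) by (intro exI[of _ "sum l I"]) (auto intro: sum_nonneg)
 qed
 then obtain l where l0: "0 \<le> l"
  and l: "!!i x. i \<in> I ==> x \<in> Rn N ==> (L i *\<^sub>v x) \<bullet> (L i *\<^sub>v x) \<le> l * (x \<bullet> x)"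
  by blast
 \<comment> \<open>A function value and its average both lie in \<open>[a, b]\<close>, so their
   quotient \<open>1 + r i\<close> lies between \<open>a / b\<close> and
   \<open>b / a\<close>.\<close>
 obtain D0 where D0: "0 \<le> D0" and taylor: "!!r. (\<forall>i\<in>I. a / b \<le> 1 + r i \<and> r i \<le> b / a) ==>
  \<bar>(\<Prod>i\<in>I. (1 + r i) powr al i) - (1 + (\<Sum>i\<in>I. al i * r i) + ((\<Sum>i\<in>I. al i * r i)\<^sup>2 - (\<Sum>i\<in>I. al i * (r i)\<^sup>2)) / 2)\<bar>
   \<le> D0 * (\<Sum>i\<in>I. \<bar>r i\<bar>) ^ 3"
  using prod_powr_taylor[OF I, of "a / b" "b / a" al] ab by auto
 define A where "A = (\<Sum>i\<in>I. \<bar>al i\<bar>)"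
 \<comment> \<open>\<open>K1\<close> controls the deviation of the relative fluctuation from its
   linear part, at order \<open>eps\<^sup>2\<close>; \<open>K2\<close> controls the linear
   functional itself; \<open>K3\<close> covers both quantities at order \<open>eps\<close>.
   \<open>D1\<close> is the resulting constant at order \<open>eps ^ 3\<close>.\<close>
 define K1 where "K1 = C * l * (1 + m1) / a"
 define K2 where "K2 = (1 + C * l) / a"
 define K3 where "K3 = K1 + K2"
 define D1 where "D1 = D0 * (card I * K3) ^ 3 + K1 * K3 * (A * A + A)"
 \<comment> \<open>The sign of \<open>al i\<close> is open, so the bound for a power adds the values
   at both ends of \<open>[a, b]\<close>.\<close>
 define E where "E = (\<Prod>i\<in>I. a powr al i + b powr al i)"
 have nn: "0 \<le> A" "0 \<le> K1" "0 \<le> K2" "0 \<le> K3" "K2 \<le> K3"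
  using C l0 m0 ab by (auto simp: A_def K1_def K2_def K3_def sum_nonneg)
 have D1: "0 \<le> D1" using D0 nn by (simp add: D1_def)
 have E: "0 \<le> E" by (simp add: E_def prod_nonneg)
 have "sgm * (\<integral> xi. (\<Prod>i\<in>I. h i (u i + eps \<cdot>\<^sub>v (L i *\<^sub>v xi)) powr al i) \<partial>gauss N)
   \<le> sgm * (\<Prod>i\<in>I. gauss_avg N (L i) eps (h i) (u i) powr al i) + (E * (D1 * m3)) * eps ^ 3"
  if h: "\<forall>i\<in>I. C11 (d i) a b C (h i)" and u': "\<forall>i\<in>I. u i \<in> Rn (d i)" and eps: "0 \<le> eps" "eps \<le> 1" for h u eps
 proof -
  have u: "u i \<in> Rn (d i)" if "i \<in> I" for i using u' that by blast
  have hm: "h i \<in> borel_fun (d i)" and hab: "\<forall>u\<in>Rn (d i). a \<le> h i u \<and> h i u \<le> b"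
   if "i \<in> I" for i
   using h that unfolding C11_def by blast+
  have "\<forall>i\<in>I. \<exists>g. (\<forall>u\<in>Rn (d i). g u \<in> Rn (d i) \<and> g u \<bullet> g u \<le> C) \<and>
   (\<forall>u\<in>Rn (d i). \<forall>v\<in>Rn (d i). \<bar>h i (u + v) - h i u - g u \<bullet> v\<bar> \<le> C * (v \<bullet> v))"
  proof
   fix i assume "i \<in> I"
   then obtain g where g: "g \<in> leb (d i) \<rightarrow>\<^sub>M leb (d i)" "\<forall>u\<in>Rn (d i). g u \<bullet> g u \<le> C"
    "\<forall>u\<in>Rn (d i). \<forall>v\<in>Rn (d i). \<bar>h i (u + v) - h i u - g u \<bullet> v\<bar> \<le> C * (v \<bullet> v)"
    using h unfolding C11_def by blast
   have "g u \<in> Rn (d i)" if "u \<in> Rn (d i)" for u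
    using measurable_space[OF g(1)] that by simp
   then show "\<exists>g. (\<forall>u\<in>Rn (d i). g u \<in> Rn (d i) \<and> g u \<bullet> g u \<le> C) \<and>
    (\<forall>u\<in>Rn (d i). \<forall>v\<in>Rn (d i). \<bar>h i (u + v) - h i u - g u \<bullet> v\<bar> \<le> C * (v \<bullet> v))"
    using g(2,3) by blast
  qed
  then obtain G where G: "\<forall>i\<in>I. (\<forall>u\<in>Rn (d i). G i u \<in> Rn (d i) \<and> G i u \<bullet> G i u \<le> C) \<and>
   (\<forall>u\<in>Rn (d i). \<forall>v\<in>Rn (d i). \<bar>h i (u + v) - h i u - G i u \<bullet> v\<bar> \<le> C * (v \<bullet> v))"
   by (metis (no_types))
  define g where "g = (%i. G i (u i))"
  have gc: "g i \<in> Rn (d i)" and gC: "g i \<bullet> g i \<le> C"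
   and gh: "!!v. v \<in> Rn (d i) ==> \<bar>h i (u i + v) - h i (u i) - g i \<bullet> v\<bar> \<le> C * (v \<bullet> v)"
   if "i \<in> I" for i
   using G u[OF that] that unfolding g_def by blast+
  define H where "H = (%i xi. h i (u i + eps \<cdot>\<^sub>v (L i *\<^sub>v xi)))"
  define M where "M = (%i. gauss_avg N (L i) eps (h i) (u i))"
  \<comment> \<open>The fluctuation is measured from the average \<open>M i\<close> and not from the
    value at the centre. Its mean is then exactly 0, and the first-order term of the expansion
    disappears without an error.\<close>
  define R where "R = (%i xi. (H i xi - M i) / M i)"
  define v where "v = (%i. (1 / M i) \<cdot>\<^sub>v g i)"
  define w where "w = (%i. (L i)\<^sup>T *\<^sub>v v i)"
  have Lx: "L i *\<^sub>v xi \<in> Rn (d i)" if "i \<in> I" "xi \<in> Rn N" for i xi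
   by (rule mult_mat_vec_carrier[OF L[OF that(1)] that(2)])
  have Mab: "a \<le> M i" "M i \<le> b" and Hint: "integrable (gauss N) (H i)" if "i \<in> I" for i
   using gauss_avg_bounds[OF hm[OF that] hab[OF that] L[OF that] u[OF that]] by (simp_all add: M_def H_def[abs_def])
  have M0: "0 < M i" if "i \<in> I" for i using Mab[OF that] ab by simp
  have Mint: "M i = (\<integral> xi. H i xi \<partial>gauss N)" for i by (simp add: M_def H_def gauss_avg_def)
  have Hm: "H i \<in> borel_fun N" if "i \<in> I" for i
   unfolding H_def by (rule measurable_compose[OF measurable_shift[OF L[OF that] u[OF that]] hm[OF that]])
  have Hab: "a \<le> H i xi" "H i xi \<le> b" if "i \<in> I" "xi \<in> Rn N" for i xi
   using hab[OF that(1)] u[OF that(1)] Lx[OF that] unfolding H_def by (simp_all add: add_carrier_vec smult_carrier_vec)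
  have vc: "v i \<in> Rn (d i)" if "i \<in> I" for i using gc[OF that] by (simp add: v_def)
  have wc: "w i \<in> Rn N" if "i \<in> I" for i
   unfolding w_def using L[OF that] vc[OF that] by (intro mult_mat_vec_carrier[of _ N "d i"]) simp_all
  have wx: "w i \<bullet> xi = (g i \<bullet> (L i *\<^sub>v xi)) / M i" if "i \<in> I" "xi \<in> Rn N" for i xi
  proof -
   have "w i \<bullet> xi = xi \<bullet> w i" by (rule comm_scalar_prod[OF wc[OF that(1)] that(2)])
   also have "... = (L i *\<^sub>v xi) \<bullet> v i"
    unfolding w_def by (rule scalar_prod_transpose[OF L[OF that(1)] that(2) vc[OF that(1)]])
   also have "... = v i \<bullet> (L i *\<^sub>v xi)" by (rule comm_scalar_prod[OF Lx[OF that] vc[OF that(1)]])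
   also have "... = (g i \<bullet> (L i *\<^sub>v xi)) / M i"
    unfolding v_def using gc[OF that(1)] Lx[OF that] by simp
   finally show ?thesis .
  qed
  have B1: "\<bar>H i xi - h i (u i) - eps * (M i * (w i \<bullet> xi))\<bar> \<le> C * l * eps\<^sup>2 * s xi" if i: "i \<in> I" and x: "xi \<in> Rn N" for i xi
  proof -
   let ?y = "L i *\<^sub>v xi"
   have "(eps \<cdot>\<^sub>v ?y) \<bullet> (eps \<cdot>\<^sub>v ?y) = eps\<^sup>2 * (?y \<bullet> ?y)"
    using Lx[OF i x] by (simp add: power2_eq_square)
   also have "... \<le> eps\<^sup>2 * (l * s xi)"
    using l[OF i x] l0 by (intro mult_left_mono) (auto simp: s_def algebra_simps)
   finally have "C * ((eps \<cdot>\<^sub>v ?y) \<bullet> (eps \<cdot>\<^sub>v ?y)) \<le> C * (eps\<^sup>2 * (l * s xi))"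
    using C by (rule mult_left_mono)
   moreover have "g i \<bullet> (eps \<cdot>\<^sub>v ?y) = eps * (M i * (w i \<bullet> xi))"
    unfolding wx[OF i x] using gc[OF i] Lx[OF i x] M0[OF i] by simp
   ultimately show ?thesis
    using gh[OF i, of "eps \<cdot>\<^sub>v ?y"] Lx[OF i x] by (simp add: H_def mult_ac)
  qed
  have wint: "integrable (gauss N) (%xi. w i \<bullet> xi)" if "i \<in> I" for i
   by (rule integrable_gauss_linear[OF wc[OF that]])
  have w0: "(\<integral> xi. w i \<bullet> xi \<partial>gauss N) = 0" if "i \<in> I" for i
   by (rule integral_gauss_linear[OF wc[OF that]])
  \<comment> \<open>The linear part of the fluctuation has mean zero, so average and central value
    differ only at second order.\<close>
  have B2: "\<bar>M i - h i (u i)\<bar> \<le> C * l * eps\<^sup>2 * m1" if i: "i \<in> I" for i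
  proof -
   have eq: "M i - h i (u i) = (\<integral> xi. H i xi - h i (u i) - eps * (M i * (w i \<bullet> xi)) \<partial>gauss N)"
    using Hint[OF i] wint[OF i] w0[OF i] by (simp add: Mint[symmetric])
   have "\<bar>M i - h i (u i)\<bar> \<le> (\<integral> xi. \<bar>H i xi - h i (u i) - eps * (M i * (w i \<bullet> xi))\<bar> \<partial>gauss N)"
    unfolding eq by (rule integral_abs_bound)
   also have "... \<le> (\<integral> xi. C * l * eps\<^sup>2 * s xi \<partial>gauss N)"
    by (intro integral_gauss_le B1 i integrable_abs Bochner_Integration.integrable_diff integrable_mult_right
     Hint[OF i] wint[OF i] ints integrable_gauss_const)
   finally show ?thesis by (simp add: m1_def)
  qed
  have B3: "\<bar>R i xi - eps * (w i \<bullet> xi)\<bar> \<le> K1 * (eps\<^sup>2 * s xi)" if i: "i \<in> I" and x: "xi \<in> Rn N" for i xi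
  proof -
   have "C * l * eps\<^sup>2 * m1 \<le> C * l * eps\<^sup>2 * m1 * s xi"
    using mult_left_mono[OF s1[of xi], of "C * l * eps\<^sup>2 * m1"] C l0 m0 by simp
   then have "\<bar>H i xi - M i - eps * (M i * (w i \<bullet> xi))\<bar> \<le> C * l * (1 + m1) * (eps\<^sup>2 * s xi)"
    using B1[OF i x] B2[OF i] by (simp add: algebra_simps)
   then have "\<bar>H i xi - M i - eps * (M i * (w i \<bullet> xi))\<bar> / M i \<le> C * l * (1 + m1) * (eps\<^sup>2 * s xi) / a"
    using C l0 m0 s0[of xi] ab Mab[OF i] by (intro frac_le) auto
   moreover have "R i xi - eps * (w i \<bullet> xi) = (H i xi - M i - eps * (M i * (w i \<bullet> xi))) / M i"
    using M0[OF i] by (simp add: R_def field_simps)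
   ultimately show ?thesis
    using M0[OF i] by (simp add: K1_def)
  qed
  have B4: "\<bar>w i \<bullet> xi\<bar> \<le> K2 * s xi" if i: "i \<in> I" and x: "xi \<in> Rn N" for i xi
  proof -
   have "(g i \<bullet> (L i *\<^sub>v xi))\<^sup>2 \<le> (g i \<bullet> g i) * ((L i *\<^sub>v xi) \<bullet> (L i *\<^sub>v xi))"
    by (rule scalar_prod_Cauchy_Schwarz[OF gc[OF i] Lx[OF i x]])
   also have "... \<le> C * (l * (xi \<bullet> xi))"
    using gC[OF i] l[OF i x] C by (intro mult_mono scalar_prod_self_nonneg)
   finally have *: "(g i \<bullet> (L i *\<^sub>v xi))\<^sup>2 \<le> C * l * (xi \<bullet> xi)" by (simp add: mult.assoc)
   have "\<bar>y\<bar> \<le> 1 + y\<^sup>2" for y :: real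
    using zero_le_power2[of "\<bar>y\<bar> - 1 / 2"] by (simp add: power2_eq_square algebra_simps)
   from this[of "g i \<bullet> (L i *\<^sub>v xi)"] * have "\<bar>g i \<bullet> (L i *\<^sub>v xi)\<bar> \<le> 1 + C * l * (xi \<bullet> xi)"
    by linarith
   also have "... \<le> 1 + C * l * (xi \<bullet> xi) + (xi \<bullet> xi + C * l)"
    using C l0 scalar_prod_self_nonneg[of xi] by simp
   also have "... = (1 + C * l) * s xi"
    by (simp add: s_def algebra_simps)
   finally have "\<bar>g i \<bullet> (L i *\<^sub>v xi)\<bar> / M i \<le> (1 + C * l) * s xi / a"
    using C l0 s0[of xi] ab Mab[OF i] by (intro frac_le) auto
   then show ?thesis unfolding wx[OF i x] using M0[OF i] by (simp add: K2_def)
  qed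
  have B5: "\<bar>R i xi\<bar> \<le> K3 * (eps * s xi)" "\<bar>eps * (w i \<bullet> xi)\<bar> \<le> K3 * (eps * s xi)" if i: "i \<in> I" and x: "xi \<in> Rn N" for i xi
  proof -
   have e2: "eps\<^sup>2 * s xi \<le> eps * s xi"
    using eps s0[of xi] by (intro mult_right_mono) (auto simp: power2_eq_square mult_left_le)
   have 1: "\<bar>eps * (w i \<bullet> xi)\<bar> \<le> K2 * (eps * s xi)"
    using mult_left_mono[OF B4[OF i x] eps(1)] eps by (simp add: abs_mult mult_ac)
   have 2: "\<bar>R i xi - eps * (w i \<bullet> xi)\<bar> \<le> K1 * (eps * s xi)"
    using B3[OF i x] mult_left_mono[OF e2 nn(2)] by linarith
   show "\<bar>R i xi\<bar> \<le> K3 * (eps * s xi)"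
    using 1 2 by (simp add: K3_def distrib_right)
   have "0 \<le> K1 * (eps * s xi)" using nn eps s0 by simp
   then show "\<bar>eps * (w i \<bullet> xi)\<bar> \<le> K3 * (eps * s xi)"
    using 1 by (simp add: K3_def distrib_right)
  qed
  define P where "P = (%xi. \<Prod>i\<in>I. (1 + R i xi) powr al i)"
  define q where "q = (%xi. (\<Sum>i\<in>I. \<Sum>j\<in>I. al i * al j * ((w i \<bullet> xi) * (w j \<bullet> xi))) - (\<Sum>i\<in>I. al i * ((w i \<bullet> xi) * (w i \<bullet> xi))))"
  \<comment> \<open>The fluctuation is replaced by its linearisation in the quadratic terms only. In
    the linear term it is kept, because there an error of order \<open>eps\<^sup>2\<close> would be
    too large, while its mean vanishes exactly.\<close>
  define lin where "lin = (%xi. 1 + (\<Sum>i\<in>I. al i * R i xi) + eps\<^sup>2 / 2 * q xi)"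
  have HR: "H i xi = M i * (1 + R i xi)" if "i \<in> I" for i xi
   using M0[OF that] by (simp add: R_def field_simps)
  have Rrange: "a / b \<le> 1 + R i xi" "R i xi \<le> b / a" if i: "i \<in> I" and x: "xi \<in> Rn N" for i xi
  proof -
   have e: "1 + R i xi = H i xi / M i" using M0[OF i] by (simp add: R_def field_simps)
   show "a / b \<le> 1 + R i xi"
    unfolding e using Hab[OF i x] Mab[OF i] ab by (intro frac_le) auto
   have "H i xi / M i \<le> b / a"
    using Hab[OF i x] Mab[OF i] ab by (intro frac_le) auto
   then show "R i xi \<le> b / a" using e by simp
  qed
  have err: "\<bar>P xi - lin xi\<bar> \<le> (D1 * eps ^ 3) * s xi ^ 3" if x: "xi \<in> Rn N" for xi
  proof -
   let ?X = "\<Sum>i\<in>I. al i * R i xi" and ?Y = "\<Sum>i\<in>I. al i * (eps * (w i \<bullet> xi))"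
   let ?X2 = "\<Sum>i\<in>I. al i * (R i xi)\<^sup>2" and ?Y2 = "\<Sum>i\<in>I. al i * (eps * (w i \<bullet> xi))\<^sup>2"
   define k where "k = K3 * (eps * s xi)"
   define e where "e = K1 * (eps\<^sup>2 * s xi)"
   have ke: "0 \<le> k" "0 \<le> e" using nn eps s0[of xi] by (simp_all add: k_def e_def)
   have sb: "\<bar>\<Sum>i\<in>I. al i * z i\<bar> \<le> A * c" if "!!i. i \<in> I ==> \<bar>z i\<bar> \<le> c" for z c
   proof -
    have "\<bar>\<Sum>i\<in>I. al i * z i\<bar> \<le> (\<Sum>i\<in>I. \<bar>al i * z i\<bar>)" by (rule sum_abs)
    also have "... \<le> (\<Sum>i\<in>I. \<bar>al i\<bar> * c)"
     unfolding abs_mult using that by (intro sum_mono mult_left_mono) auto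
    finally show ?thesis by (simp add: A_def sum_distrib_right)
   qed
   have d: "\<bar>R i xi - eps * (w i \<bullet> xi)\<bar> \<le> e" "\<bar>R i xi + eps * (w i \<bullet> xi)\<bar> \<le> 2 * k" if "i \<in> I" for i
    using B3[OF that x] B5[OF that x] by (simp_all add: k_def e_def)
   have X1: "\<bar>?X - ?Y\<bar> \<le> A * e"
    using sb[OF d(1)] by (simp add: right_diff_distrib sum_subtractf)
   have X2: "\<bar>?X + ?Y\<bar> \<le> A * (2 * k)"
    using sb[OF d(2)] by (simp add: distrib_left sum.distrib)
   \<comment> \<open>The difference is of second order and the sum of first order in
     \<open>eps\<close>, so replacing \<open>R\<close> in a square costs only third order.\<close>
   have "\<bar>?X\<^sup>2 - ?Y\<^sup>2\<bar> = \<bar>?X - ?Y\<bar> * \<bar>?X + ?Y\<bar>"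
    unfolding abs_mult[symmetric] by (simp add: power2_eq_square algebra_simps)
   also have "... \<le> (A * e) * (A * (2 * k))"
    using nn ke by (intro mult_mono X1 X2) auto
   finally have Z1: "\<bar>?X\<^sup>2 - ?Y\<^sup>2\<bar> \<le> 2 * (A * A) * (e * k)" by (simp add: mult_ac)
   have "\<bar>(R i xi)\<^sup>2 - (eps * (w i \<bullet> xi))\<^sup>2\<bar> \<le> e * (2 * k)" if i: "i \<in> I" for i
   proof -
    have "\<bar>(R i xi)\<^sup>2 - (eps * (w i \<bullet> xi))\<^sup>2\<bar> = \<bar>R i xi - eps * (w i \<bullet> xi)\<bar> * \<bar>R i xi + eps * (w i \<bullet> xi)\<bar>"
     unfolding abs_mult[symmetric] by (simp add: power2_eq_square algebra_simps)
    then show ?thesis using d[OF i] ke by (auto intro!: mult_mono)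
   qed
   from sb[OF this] have Z2: "\<bar>?X2 - ?Y2\<bar> \<le> 2 * A * (e * k)"
    by (simp add: right_diff_distrib sum_subtractf mult_ac)
   have "?Y = eps * (\<Sum>i\<in>I. al i * (w i \<bullet> xi))"
    unfolding sum_distrib_left by (intro sum.cong refl) simp
   moreover have "(\<Sum>i\<in>I. al i * (w i \<bullet> xi)) * (\<Sum>i\<in>I. al i * (w i \<bullet> xi))
    = (\<Sum>i\<in>I. \<Sum>j\<in>I. al i * al j * ((w i \<bullet> xi) * (w j \<bullet> xi)))"
    unfolding sum_product by (intro sum.cong refl) (simp only: mult_ac)
   ultimately have "?Y\<^sup>2 = eps\<^sup>2 * (\<Sum>i\<in>I. \<Sum>j\<in>I. al i * al j * ((w i \<bullet> xi) * (w j \<bullet> xi)))"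
    by (simp only: power_mult_distrib) (simp only: power2_eq_square)
   moreover have "?Y2 = eps\<^sup>2 * (\<Sum>i\<in>I. al i * ((w i \<bullet> xi) * (w i \<bullet> xi)))"
    unfolding power2_eq_square sum_distrib_left by (intro sum.cong refl) (simp only: mult_ac)
   ultimately have lin': "lin xi = 1 + ?X + (?Y\<^sup>2 - ?Y2) / 2"
    by (simp add: lin_def q_def right_diff_distrib)
   have T: "\<bar>P xi - (1 + ?X + (?X\<^sup>2 - ?X2) / 2)\<bar> \<le> D0 * (\<Sum>i\<in>I. \<bar>R i xi\<bar>) ^ 3"
    unfolding P_def using Rrange x by (intro taylor) blast
   have "(\<Sum>i\<in>I. \<bar>R i xi\<bar>) \<le> card I * k"
    using B5(1)[OF _ x] by (intro sum_bounded_above) (simp add: k_def)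
   then have "D0 * (\<Sum>i\<in>I. \<bar>R i xi\<bar>) ^ 3 \<le> D0 * (card I * k) ^ 3"
    by (intro mult_left_mono power_mono D0 sum_nonneg) auto
   moreover have "\<bar>lin xi - (1 + ?X + (?X\<^sup>2 - ?X2) / 2)\<bar> \<le> (A * A + A) * (e * k)"
   proof -
    have "2 * (A * A) * (e * k) = 2 * (A * A * (e * k))" "2 * A * (e * k) = 2 * (A * (e * k))"
     by (simp_all only: mult.assoc)
    with half_diff_bound[of "?X\<^sup>2" "?Y\<^sup>2" "A * A * (e * k)" ?X2 ?Y2 "A * (e * k)" "1 + ?X"] Z1 Z2
    show ?thesis unfolding lin' distrib_right by metis
   qed
   ultimately have "\<bar>P xi - lin xi\<bar> \<le> D0 * (card I * k) ^ 3 + (A * A + A) * (e * k)"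
    using T by linarith
   also have "(card I * k) ^ 3 = (card I * K3) ^ 3 * (eps ^ 3 * s xi ^ 3)"
    by (simp add: k_def power_mult_distrib mult_ac)
   also have "e * k = K1 * K3 * (eps ^ 3 * s xi ^ 2)"
    by (simp add: k_def e_def power2_eq_square power3_eq_cube mult_ac)
   also have "D0 * ((card I * K3) ^ 3 * (eps ^ 3 * s xi ^ 3)) + (A * A + A) * (K1 * K3 * (eps ^ 3 * s xi ^ 2))
    \<le> D0 * ((card I * K3) ^ 3 * (eps ^ 3 * s xi ^ 3)) + (A * A + A) * (K1 * K3 * (eps ^ 3 * s xi ^ 3))"
    using nn eps by (intro add_left_mono mult_left_mono s3) auto
   also have "... = (D1 * eps ^ 3) * s xi ^ 3"
    by (simp add: D1_def algebra_simps)
   finally show ?thesis .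
  qed
  have Rint: "integrable (gauss N) (R i)" "(\<integral> xi. R i xi \<partial>gauss N) = 0" if "i \<in> I" for i
   unfolding R_def using Hint[OF that] by (auto simp: Mint[symmetric])
  have ww: "integrable (gauss N) (%xi. (w i \<bullet> xi) * (w j \<bullet> xi))"
   "(\<integral> xi. (w i \<bullet> xi) * (w j \<bullet> xi) \<partial>gauss N) = gauss_var * (w i \<bullet> w j)" if "i \<in> I" "j \<in> I" for i j
   using integrable_gauss_linear_mult[OF wc[OF that(1)] wc[OF that(2)]] integral_gauss_linear_mult[OF wc[OF that(1)] wc[OF that(2)]] by auto
  have qint: "integrable (gauss N) q"
   unfolding q_def using ww by (intro Bochner_Integration.integrable_diff Bochner_Integration.integrable_sum integrable_mult_right) auto
  have qval: "(\<integral> xi. q xi \<partial>gauss N) = gauss_var * gauss_form I al L v"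
  proof -
   have "(\<integral> xi. q xi \<partial>gauss N) = (\<Sum>i\<in>I. \<Sum>j\<in>I. al i * al j * (gauss_var * (w i \<bullet> w j))) - (\<Sum>i\<in>I. al i * (gauss_var * (w i \<bullet> w i)))"
    unfolding q_def using ww
    by (subst Bochner_Integration.integral_diff)
     (auto simp: Bochner_Integration.integral_sum intro!: Bochner_Integration.integrable_sum sum.cong arg_cong2[where f = "(-)"])
   then show ?thesis
    by (simp add: gauss_form_def w_def sum_distrib_left right_diff_distrib mult_ac)
  qed
  have linint: "integrable (gauss N) lin"
   unfolding lin_def using Rint qint by (intro Bochner_Integration.integrable_add Bochner_Integration.integrable_sum integrable_mult_right) auto
  have linval: "(\<integral> xi. lin xi \<partial>gauss N) = 1 + eps\<^sup>2 / 2 * (gauss_var * gauss_form I al L v)"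
  proof -
   have "(\<integral> xi. lin xi \<partial>gauss N) = 1 + (\<Sum>i\<in>I. al i * (\<integral> xi. R i xi \<partial>gauss N)) + eps\<^sup>2 / 2 * (\<integral> xi. q xi \<partial>gauss N)"
    unfolding lin_def using Rint(1) qint
    by (simp add: Bochner_Integration.integral_sum Bochner_Integration.integrable_sum)
   then show ?thesis using Rint(2) by (simp add: qval)
  qed
  have Pm: "P \<in> borel_fun N"
   unfolding P_def R_def using Hm by (intro borel_measurable_prod) simp
  have Pint: "integrable (gauss N) P"
  proof -
   have "integrable (gauss N) (%xi. P xi - lin xi)"
   proof (rule integrable_gauss_bound)
    show "(%xi. P xi - lin xi) \<in> borel_fun N"
     using Pm borel_measurable_integrable[OF linint] by simp
    show "\<bar>P xi - lin xi\<bar> \<le> (D1 * eps ^ 3) * (1 + xi \<bullet> xi) ^ 3" if "xi \<in> Rn N" for xi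
     using err[OF that] by (simp add: s_def)
   qed
   from Bochner_Integration.integrable_add[OF this linint] show ?thesis by simp
  qed
  have "\<bar>(\<integral> xi. P xi \<partial>gauss N) - (\<integral> xi. lin xi \<partial>gauss N)\<bar> = \<bar>\<integral> xi. P xi - lin xi \<partial>gauss N\<bar>"
   by (simp only: Bochner_Integration.integral_diff[OF Pint linint])
  also have "... \<le> (\<integral> xi. \<bar>P xi - lin xi\<bar> \<partial>gauss N)" by (rule integral_abs_bound)
  also have "... \<le> (\<integral> xi. (D1 * eps ^ 3) * s xi ^ 3 \<partial>gauss N)"
   by (intro integral_gauss_le err integrable_abs Bochner_Integration.integrable_diff integrable_mult_right Pint linint ints3)
  also have "... = D1 * eps ^ 3 * m3" by (simp add: m3_def)
  finally have P1: "\<bar>(\<integral> xi. P xi \<partial>gauss N) - (\<integral> xi. lin xi \<partial>gauss N)\<bar> \<le> D1 * eps ^ 3 * m3" .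
  \<comment> \<open>The sign hypothesis is used at \<open>v i\<close>, the gradient of
    \<open>h i\<close> divided by the average. A one-sided bound is all that results, and
    \<open>sgm\<close> records which side.\<close>
  have "eps\<^sup>2 / 2 * gauss_var * (sgm * gauss_form I al L v) \<le> 0"
   by (rule mult_nonneg_nonpos[OF _ Q[OF vc]]) (simp_all add: gauss_var_nonneg)
  then have P2: "sgm * (\<integral> xi. lin xi \<partial>gauss N) \<le> sgm"
   unfolding linval by (simp add: algebra_simps)
  have P3: "sgm * (\<integral> xi. P xi \<partial>gauss N) \<le> sgm + D1 * eps ^ 3 * m3"
   using P1 P2 sgm by (auto simp: abs_le_iff)
  define Z where "Z = (\<Prod>i\<in>I. M i powr al i)"
  have Z0: "0 \<le> Z" by (simp add: Z_def prod_nonneg)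
  have ZE: "Z \<le> E"
   unfolding Z_def E_def
  proof (rule prod_mono)
   fix i assume i: "i \<in> I"
   show "0 \<le> M i powr al i \<and> M i powr al i \<le> a powr al i + b powr al i"
   proof (cases "0 \<le> al i")
    case True
    then have "M i powr al i \<le> b powr al i" using Mab[OF i] ab by (intro powr_mono2) auto
    then show ?thesis using powr_ge_zero[of a "al i"] by (auto simp: add_increasing)
   next
    case False
    then have "M i powr al i \<le> a powr al i" using Mab[OF i] ab by (intro powr_mono2') auto
    then show ?thesis using powr_ge_zero[of b "al i"] by (auto simp: add_increasing2)
   qed
  qed
  have "(\<integral> xi. (\<Prod>i\<in>I. H i xi powr al i) \<partial>gauss N) = (\<integral> xi. Z * P xi \<partial>gauss N)"
  proof (intro Bochner_Integration.integral_cong refl)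
   fix xi assume "xi \<in> space (gauss N)"
   then have x: "xi \<in> Rn N" by simp
   have "0 \<le> 1 + R i xi" if "i \<in> I" for i
    using Rrange(1)[OF that x] ab by (meson divide_nonneg_pos less_le_trans order_trans less_imp_le)
   then show "(\<Prod>i\<in>I. H i xi powr al i) = Z * P xi"
    unfolding Z_def P_def prod.distrib[symmetric] using M0 by (intro prod.cong refl) (simp add: HR powr_mult less_imp_le)
  qed
  also have "... = Z * (\<integral> xi. P xi \<partial>gauss N)" by simp
  finally have "sgm * (\<integral> xi. (\<Prod>i\<in>I. H i xi powr al i) \<partial>gauss N) = Z * (sgm * (\<integral> xi. P xi \<partial>gauss N))"
   by simp
  also have "... \<le> Z * (sgm + D1 * eps ^ 3 * m3)"
   by (rule mult_left_mono[OF P3 Z0])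
  also have "... = sgm * Z + Z * (D1 * eps ^ 3 * m3)" by (simp add: algebra_simps)
  also have "Z * (D1 * eps ^ 3 * m3) \<le> E * (D1 * eps ^ 3 * m3)"
   using D1 eps m0 by (intro mult_right_mono[OF ZE]) simp
  finally show ?thesis
   by (simp add: H_def Z_def M_def mult_ac)
 qed
 then show ?thesis using E D1 m0 by (intro exI[of _ "E * (D1 * m3)"]) auto
qed

section \<open>The Gaussian inequality\<close>

lemma powr_le_endpoint_sum:
 assumes "0 < a" "a \<le> x" "x \<le> (b :: real)"
 shows "x powr al \<le> a powr al + b powr al"
proof (cases "0 \<le> al")
 case True
 then have "x powr al \<le> b powr al" using assms by (intro powr_mono2) auto
 then show ?thesis by (simp add: add_increasing)
next
 case False
 then have "x powr al \<le> a powr al" using assms by (intro powr_mono2') auto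
 then show ?thesis by (simp add: add_increasing2)
qed

lemma prod_powr_bounded:
 assumes "0 < a" "!!i. i \<in> I ==> a \<le> x i \<and> x i \<le> (b :: real)"
 shows "0 \<le> (\<Prod>i\<in>I. x i powr al i)" "(\<Prod>i\<in>I. x i powr al i) \<le> (\<Prod>i\<in>I. a powr al i + b powr al i)"
 using assms by (auto intro!: prod_nonneg prod_mono powr_le_endpoint_sum)

section \<open>Composition of Gaussian steps\<close>

lemma integral_gauss_semigroup:
 fixes g :: "real vec => real"
 assumes g: "g \<in> borel_fun k" and b: "!!u. u \<in> Rn k ==> 0 \<le> g u \<and> g u \<le> B"
  and st: "s\<^sup>2 + t\<^sup>2 = r\<^sup>2" and r: "0 < r"
 shows "(\<integral> x. \<integral> y. g (s \<cdot>\<^sub>v x + t \<cdot>\<^sub>v y) \<partial>gauss k \<partial>gauss k) = (\<integral> x. g (r \<cdot>\<^sub>v x) \<partial>gauss k)"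
  and "integrable (gauss k) (%x. \<integral> y. g (s \<cdot>\<^sub>v x + t \<cdot>\<^sub>v y) \<partial>gauss k)"
proof -
 interpret gauss: sigma_finite_measure "gauss k" by (rule sigma_finite_gauss_vec)
 have sndm: "snd \<in> leb k \<Otimes>\<^sub>M gauss k \<rightarrow>\<^sub>M leb k"
  using measurable_snd[of "leb k" "gauss k"] by (simp add: measurable_gauss_vec_target)
 have mpair: "(%z. s \<cdot>\<^sub>v fst z + t \<cdot>\<^sub>v snd z) \<in> leb k \<Otimes>\<^sub>M gauss k \<rightarrow>\<^sub>M leb k"
  by (rule measurable_vec_add[OF measurable_vec_smult[OF measurable_fst borel_measurable_const] measurable_vec_smult[OF sndm borel_measurable_const]])
 have m1: "(%y. s \<cdot>\<^sub>v x + t \<cdot>\<^sub>v y) \<in> leb k \<rightarrow>\<^sub>M leb k" if "x \<in> Rn k" for x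
  using that by (intro measurable_vec_add measurable_vec_smult measurable_vec_const measurable_ident_sets borel_measurable_const) simp_all
 have mr: "(%x. g (r \<cdot>\<^sub>v x)) \<in> borel_fun k"
  by (rule measurable_compose[OF measurable_vec_smult[OF measurable_ident_sets[OF refl] borel_measurable_const] g])
 let ?h = "%x. \<integral> y. g (s \<cdot>\<^sub>v x + t \<cdot>\<^sub>v y) \<partial>gauss k"
 have int1: "integrable (gauss k) (%y. g (s \<cdot>\<^sub>v x + t \<cdot>\<^sub>v y))" if x: "x \<in> Rn k" for x
 proof (rule integrable_gauss_bounded)
  show "(%y. g (s \<cdot>\<^sub>v x + t \<cdot>\<^sub>v y)) \<in> borel_fun k"
   by (rule measurable_compose[OF m1[OF x] g])
  show "\<bar>g (s \<cdot>\<^sub>v x + t \<cdot>\<^sub>v y)\<bar> \<le> B" if "y \<in> Rn k" for y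
   using b[of "s \<cdot>\<^sub>v x + t \<cdot>\<^sub>v y"] x that by simp
 qed
 have nn: "0 \<le> g (s \<cdot>\<^sub>v x + t \<cdot>\<^sub>v y)" "g (s \<cdot>\<^sub>v x + t \<cdot>\<^sub>v y) \<le> B" if "x \<in> Rn k" "y \<in> Rn k" for x y
  using b[of "s \<cdot>\<^sub>v x + t \<cdot>\<^sub>v y"] that by simp_all
 have hb: "0 \<le> ?h x" "?h x \<le> B" if x: "x \<in> Rn k" for x
 proof -
  show "0 \<le> ?h x" using nn[OF x] by (intro integral_nonneg_AE AE_I2) simp
  show "?h x \<le> B"
   using integral_gauss_le[OF int1[OF x] integrable_gauss_const[of k B] nn(2)[OF x]] by simp
 qed
 have hm: "?h \<in> borel_fun k"
  using measurable_compose[OF mpair g] by (intro gauss.borel_measurable_lebesgue_integral) (simp add: case_prod_beta)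
 show int2: "integrable (gauss k) ?h"
 proof (rule integrable_gauss_bounded[OF hm])
  show "\<bar>?h x\<bar> \<le> B" if "x \<in> Rn k" for x
   unfolding abs_of_nonneg[OF hb(1)[OF that]] by (rule hb(2)[OF that])
 qed
 have int3: "integrable (gauss k) (%x. g (r \<cdot>\<^sub>v x))"
  using b by (intro integrable_gauss_bounded[OF mr, of B]) (simp add: smult_carrier_vec)
 have gm: "(%u. ennreal (g u)) \<in> borel_fun k" using g by simp
 have "ennreal (\<integral> x. ?h x \<partial>gauss k) = (\<integral>\<^sup>+ x. ennreal (?h x) \<partial>gauss k)"
  by (rule nn_integral_eq_integral[symmetric, OF int2], rule AE_I2, rule hb(1)) simp
 also have "... = (\<integral>\<^sup>+ x. \<integral>\<^sup>+ y. ennreal (g (s \<cdot>\<^sub>v x + t \<cdot>\<^sub>v y)) \<partial>gauss k \<partial>gauss k)"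
  using nn(1) by (intro nn_integral_cong nn_integral_eq_integral[symmetric] int1 AE_I2) simp_all
 also have "... = (\<integral>\<^sup>+ x. ennreal (g (r \<cdot>\<^sub>v x)) \<partial>gauss k)"
  by (rule nn_integral_gauss_vec_semigroup[OF gm st r])
 also have "... = ennreal (\<integral> x. g (r \<cdot>\<^sub>v x) \<partial>gauss k)"
  using b by (intro nn_integral_eq_integral int3 AE_I2) simp
 finally show "(\<integral> x. ?h x \<partial>gauss k) = (\<integral> x. g (r \<cdot>\<^sub>v x) \<partial>gauss k)"
 proof (subst (asm) ennreal_inj)
  show "0 \<le> (\<integral> x. ?h x \<partial>gauss k)"
   by (rule integral_nonneg_AE, rule AE_I2, rule hb(1)) simp
  show "0 \<le> (\<integral> x. g (r \<cdot>\<^sub>v x) \<partial>gauss k)" using b by (intro integral_nonneg_AE AE_I2) simp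
 qed
qed

lemma shift_compose:
 assumes "L \<in> Mat d N" "u \<in> Rn d" "x \<in> Rn N" "y \<in> Rn N"
 shows "u + L *\<^sub>v (s \<cdot>\<^sub>v x + t \<cdot>\<^sub>v y) = (u + s \<cdot>\<^sub>v (L *\<^sub>v x)) + t \<cdot>\<^sub>v (L *\<^sub>v (y :: real vec))"
proof -
 have "L *\<^sub>v (s \<cdot>\<^sub>v x + t \<cdot>\<^sub>v y) = s \<cdot>\<^sub>v (L *\<^sub>v x) + t \<cdot>\<^sub>v (L *\<^sub>v y)"
  using assms by (simp add: mult_add_distrib_mat_vec[of L d N] mult_mat_vec[of L d N])
 then show ?thesis
  using assms assoc_add_vec[of u d "s \<cdot>\<^sub>v (L *\<^sub>v x)" "t \<cdot>\<^sub>v (L *\<^sub>v y)"] by simp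
qed

text \<open>All factors are driven by the same \<open>xi\<close>. The semigroup property is
  therefore applied to the whole product as one function of \<open>xi\<close>, and afterwards the
  outer step is absorbed into the base points.\<close>

lemma prod_gauss_semigroup:
 assumes I: "finite I" and L: "!!i. i \<in> I ==> L i \<in> Mat (d i) N" and u: "!!i. i \<in> I ==> u i \<in> Rn (d i)"
  and hm: "!!i. i \<in> I ==> h i \<in> borel_fun (d i)"
  and hab: "!!i v. i \<in> I ==> v \<in> Rn (d i) ==> a \<le> h i v \<and> h i v \<le> b" and a: "0 < (a :: real)"
  and st: "s\<^sup>2 + t\<^sup>2 = r\<^sup>2" and r: "0 < r"
 shows "(\<integral> x. \<integral> y. (\<Prod>i\<in>I. h i ((u i + s \<cdot>\<^sub>v (L i *\<^sub>v x)) + t \<cdot>\<^sub>v (L i *\<^sub>v y)) powr al i) \<partial>gauss N \<partial>gauss N)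
   = (\<integral> x. (\<Prod>i\<in>I. h i (u i + r \<cdot>\<^sub>v (L i *\<^sub>v x)) powr al i) \<partial>gauss N)"
  and "integrable (gauss N) (%x. \<integral> y. (\<Prod>i\<in>I. h i ((u i + s \<cdot>\<^sub>v (L i *\<^sub>v x)) + t \<cdot>\<^sub>v (L i *\<^sub>v y)) powr al i) \<partial>gauss N)"
proof -
 let ?g = "%z. \<Prod>i\<in>I. h i (u i + L i *\<^sub>v z) powr al i"
 have m: "?g \<in> borel_fun N"
 proof (intro borel_measurable_prod)
  fix i assume i: "i \<in> I"
  have "(%z. u i + L i *\<^sub>v z) \<in> leb N \<rightarrow>\<^sub>M leb (d i)"
   by (rule measurable_vec_add[OF measurable_vec_const[OF u[OF i]] measurable_mat_lborel_vec[OF L[OF i]]])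
  from measurable_compose[OF this hm[OF i]]
  show "(%z. h i (u i + L i *\<^sub>v z) powr al i) \<in> borel_fun N" by simp
 qed
 have b: "0 \<le> ?g z \<and> ?g z \<le> (\<Prod>i\<in>I. a powr al i + b powr al i)" if z: "z \<in> Rn N" for z
 proof -
  have *: "a \<le> h i (u i + L i *\<^sub>v z) \<and> h i (u i + L i *\<^sub>v z) \<le> b" if "i \<in> I" for i
   using u[OF that] mult_mat_vec_carrier[OF L[OF that] z] by (intro hab[OF that]) simp
  show ?thesis using prod_powr_bounded[where I = I and al = al and x = "%i. h i (u i + L i *\<^sub>v z)", OF a *] by blast
 qed
 have e1: "?g (s \<cdot>\<^sub>v x + t \<cdot>\<^sub>v y) = (\<Prod>i\<in>I. h i ((u i + s \<cdot>\<^sub>v (L i *\<^sub>v x)) + t \<cdot>\<^sub>v (L i *\<^sub>v y)) powr al i)"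
  if "x \<in> Rn N" "y \<in> Rn N" for x y
  using shift_compose[OF L u that] by (intro prod.cong refl) simp
 have e2: "?g (r \<cdot>\<^sub>v x) = (\<Prod>i\<in>I. h i (u i + r \<cdot>\<^sub>v (L i *\<^sub>v x)) powr al i)" if "x \<in> Rn N" for x
  using mult_mat_vec[OF L that] by (intro prod.cong refl) simp
 have e3: "(\<integral> y. ?g (s \<cdot>\<^sub>v x + t \<cdot>\<^sub>v y) \<partial>gauss N)
  = (\<integral> y. (\<Prod>i\<in>I. h i ((u i + s \<cdot>\<^sub>v (L i *\<^sub>v x)) + t \<cdot>\<^sub>v (L i *\<^sub>v y)) powr al i) \<partial>gauss N)"
  if "x \<in> Rn N" for x
  by (intro Bochner_Integration.integral_cong refl e1[OF that]) simp
 show "(\<integral> x. \<integral> y. (\<Prod>i\<in>I. h i ((u i + s \<cdot>\<^sub>v (L i *\<^sub>v x)) + t \<cdot>\<^sub>v (L i *\<^sub>v y)) powr al i) \<partial>gauss N \<partial>gauss N)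
   = (\<integral> x. (\<Prod>i\<in>I. h i (u i + r \<cdot>\<^sub>v (L i *\<^sub>v x)) powr al i) \<partial>gauss N)"
 proof -
  have "(\<integral> x. \<integral> y. ?g (s \<cdot>\<^sub>v x + t \<cdot>\<^sub>v y) \<partial>gauss N \<partial>gauss N) = (\<integral> x. ?g (r \<cdot>\<^sub>v x) \<partial>gauss N)"
   by (rule integral_gauss_semigroup(1)[OF m b st r])
  moreover have "(\<integral> x. \<integral> y. ?g (s \<cdot>\<^sub>v x + t \<cdot>\<^sub>v y) \<partial>gauss N \<partial>gauss N)
   = (\<integral> x. \<integral> y. (\<Prod>i\<in>I. h i ((u i + s \<cdot>\<^sub>v (L i *\<^sub>v x)) + t \<cdot>\<^sub>v (L i *\<^sub>v y)) powr al i) \<partial>gauss N \<partial>gauss N)"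
   by (intro Bochner_Integration.integral_cong refl e3) simp
  moreover have "(\<integral> x. ?g (r \<cdot>\<^sub>v x) \<partial>gauss N) = (\<integral> x. (\<Prod>i\<in>I. h i (u i + r \<cdot>\<^sub>v (L i *\<^sub>v x)) powr al i) \<partial>gauss N)"
   by (intro Bochner_Integration.integral_cong refl e2) simp
  ultimately show ?thesis by simp
 qed
 have "integrable (gauss N) (%x. \<integral> y. ?g (s \<cdot>\<^sub>v x + t \<cdot>\<^sub>v y) \<partial>gauss N)"
  by (rule integral_gauss_semigroup(2)[OF m b st r])
 moreover have "integrable (gauss N) (%x. \<integral> y. ?g (s \<cdot>\<^sub>v x + t \<cdot>\<^sub>v y) \<partial>gauss N)
  \<longleftrightarrow> integrable (gauss N) (%x. \<integral> y. (\<Prod>i\<in>I. h i ((u i + s \<cdot>\<^sub>v (L i *\<^sub>v x)) + t \<cdot>\<^sub>v (L i *\<^sub>v y)) powr al i) \<partial>gauss N)"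
  by (intro Bochner_Integration.integrable_cong refl e3) simp
 ultimately show "integrable (gauss N) (%x. \<integral> y. (\<Prod>i\<in>I. h i ((u i + s \<cdot>\<^sub>v (L i *\<^sub>v x)) + t \<cdot>\<^sub>v (L i *\<^sub>v y)) powr al i) \<partial>gauss N)"
  by blast
qed

text \<open>The case of a single factor with exponent 1; positivity of \<open>h\<close> makes
  \<open>powr 1\<close> the identity on its values.\<close>

lemma gauss_avg_semigroup:
 assumes L: "L \<in> Mat d N" and u: "u \<in> Rn d" and hm: "h \<in> borel_fun d"
  and hab: "!!v. v \<in> Rn d ==> a \<le> h v \<and> h v \<le> b" and a: "0 < (a :: real)"
  and st: "s\<^sup>2 + t\<^sup>2 = r\<^sup>2" and r: "0 < r"
 shows "gauss_avg N L s (gauss_avg N L t h) u = gauss_avg N L r h u"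
proof -
 have pos: "\<bar>h v\<bar> = h v" if "v \<in> Rn d" for v using hab[OF that] a by simp
 have c: "u + x \<cdot>\<^sub>v (L *\<^sub>v y) \<in> Rn d" "(u + x \<cdot>\<^sub>v (L *\<^sub>v y)) + x' \<cdot>\<^sub>v (L *\<^sub>v y') \<in> Rn d"
  if "y \<in> Rn N" "y' \<in> Rn N" for x y x' y'
  using u mult_mat_vec_carrier[OF L that(1)] mult_mat_vec_carrier[OF L that(2)] by simp_all
 have "(\<integral> x. \<integral> y. (\<Prod>i\<in>{0::nat}. h ((u + s \<cdot>\<^sub>v (L *\<^sub>v x)) + t \<cdot>\<^sub>v (L *\<^sub>v y)) powr 1) \<partial>gauss N \<partial>gauss N)
   = (\<integral> x. (\<Prod>i\<in>{0::nat}. h (u + r \<cdot>\<^sub>v (L *\<^sub>v x)) powr 1) \<partial>gauss N)"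
  by (rule prod_gauss_semigroup(1)[of "{0}" "%_. L" "%_. d" N "%_. u" "%_. h" a b s t r "%_. 1"]) (use assms in auto)
 moreover have "gauss_avg N L s (gauss_avg N L t h) u
  = (\<integral> x. \<integral> y. (\<Prod>i\<in>{0::nat}. h ((u + s \<cdot>\<^sub>v (L *\<^sub>v x)) + t \<cdot>\<^sub>v (L *\<^sub>v y)) powr 1) \<partial>gauss N \<partial>gauss N)"
  unfolding gauss_avg_def by (intro Bochner_Integration.integral_cong refl) (simp add: pos c)
 moreover have "gauss_avg N L r h u = (\<integral> x. (\<Prod>i\<in>{0::nat}. h (u + r \<cdot>\<^sub>v (L *\<^sub>v x)) powr 1) \<partial>gauss N)"
  unfolding gauss_avg_def by (intro Bochner_Integration.integral_cong refl) (simp add: pos c)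
 ultimately show ?thesis by simp
qed

text \<open>Induction with the base points \<open>u\<close> free. The new step of size
  \<open>eps\<close> is the outer integral: under it the induction hypothesis is used at the moved
  base points, and the outer step itself is then paid for by \<open>step\<close>, applied to the
  averaged functions, which belong to the same class. \<open>K\<close> counts the steps after the
  first, so the total size stays positive.\<close>

lemma heat_iterate:
 fixes d :: "nat => nat"
 assumes I: "finite I" and L: "!!i. i \<in> I ==> L i \<in> Mat (d i) N"
  and ab: "0 < a" "a \<le> b" and sgm: "sgm = 1 \<or> sgm = (- 1 :: real)"
  and step: "!!h u eps. (\<forall>i\<in>I. C11 (d i) a b C (h i)) ==> (\<forall>i\<in>I. u i \<in> Rn (d i)) ==> 0 \<le> eps ==> eps \<le> 1 ==>
  sgm * (\<integral> xi. (\<Prod>i\<in>I. h i (u i + eps \<cdot>\<^sub>v (L i *\<^sub>v xi)) powr al i) \<partial>gauss N)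
   \<le> sgm * (\<Prod>i\<in>I. gauss_avg N (L i) eps (h i) (u i) powr al i) + D * eps ^ 3"
  and h: "!!i. i \<in> I ==> C11 (d i) a b C (h i)" and u: "!!i. i \<in> I ==> u i \<in> Rn (d i)"
  and eps: "0 < eps" "eps \<le> 1"
 shows "sgm * (\<integral> xi. (\<Prod>i\<in>I. h i (u i + (sqrt (real (Suc K)) * eps) \<cdot>\<^sub>v (L i *\<^sub>v xi)) powr al i) \<partial>gauss N)
   \<le> sgm * (\<Prod>i\<in>I. gauss_avg N (L i) (sqrt (real (Suc K)) * eps) (h i) (u i) powr al i) + real (Suc K) * (D * eps ^ 3)"
 using u
proof (induction K arbitrary: u)
 case 0
 then show ?case using step[of h u eps] h eps by simp
next
 case (Suc K)
 \<comment> \<open>\<open>t\<close> is the combined size of the inner steps and \<open>r\<close>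
   that of all steps.\<close>
 define t where "t = sqrt (real (Suc K)) * eps"
 define r where "r = sqrt (real (Suc (Suc K))) * eps"
 have st: "eps\<^sup>2 + t\<^sup>2 = r\<^sup>2" by (simp add: t_def r_def power_mult_distrib algebra_simps)
 have r: "0 < r" using eps by (simp add: r_def)
 have hm: "h i \<in> borel_fun (d i)" and hab: "!!v. v \<in> Rn (d i) ==> a \<le> h i v \<and> h i v \<le> b"
  if "i \<in> I" for i using h[OF that] unfolding C11_def by blast+
 define h' where "h' = (%i. gauss_avg N (L i) t (h i))"
 have h': "C11 (d i) a b C (h' i)" if "i \<in> I" for i
  unfolding h'_def by (rule C11_gauss_avg[OF h[OF that] L[OF that]])
 have h'm: "h' i \<in> borel_fun (d i)" and h'ab: "!!v. v \<in> Rn (d i) ==> a \<le> h' i v \<and> h' i v \<le> b"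
  if "i \<in> I" for i using h'[OF that] unfolding C11_def by blast+
 let ?S = "%x. \<integral> y. (\<Prod>i\<in>I. h i ((u i + eps \<cdot>\<^sub>v (L i *\<^sub>v x)) + t \<cdot>\<^sub>v (L i *\<^sub>v y)) powr al i) \<partial>gauss N"
 let ?T = "%x. \<Prod>i\<in>I. h' i (u i + eps \<cdot>\<^sub>v (L i *\<^sub>v x)) powr al i"
 note sg = prod_gauss_semigroup[where al = al, OF I L Suc.prems hm hab ab(1) st r]
 have uc: "u i + eps \<cdot>\<^sub>v (L i *\<^sub>v x) \<in> Rn (d i)" if "i \<in> I" "x \<in> Rn N" for i x
  using Suc.prems[OF that(1)] mult_mat_vec_carrier[OF L[OF that(1)] that(2)] by simp
 have Tint: "integrable (gauss N) ?T"
 proof (rule integrable_gauss_bounded)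
  show "?T \<in> borel_fun N"
  proof (intro borel_measurable_prod)
   fix i assume i: "i \<in> I"
   from measurable_compose[OF measurable_shift[OF L[OF i] Suc.prems[OF i]] h'm[OF i]]
   show "(%x. h' i (u i + eps \<cdot>\<^sub>v (L i *\<^sub>v x)) powr al i) \<in> borel_fun N" by simp
  qed
  fix x :: "real vec" assume x: "x \<in> Rn N"
  have *: "a \<le> h' i (u i + eps \<cdot>\<^sub>v (L i *\<^sub>v x)) \<and> h' i (u i + eps \<cdot>\<^sub>v (L i *\<^sub>v x)) \<le> b" if "i \<in> I" for i
   by (rule h'ab[OF that uc[OF that x]])
  show "\<bar>?T x\<bar> \<le> (\<Prod>i\<in>I. a powr al i + b powr al i)"
   using prod_powr_bounded[where I = I and al = al and x = "%i. h' i (u i + eps \<cdot>\<^sub>v (L i *\<^sub>v x))", OF ab(1) *] by (simp only: abs_of_nonneg)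
 qed
 have "sgm * (\<integral> x. (\<Prod>i\<in>I. h i (u i + r \<cdot>\<^sub>v (L i *\<^sub>v x)) powr al i) \<partial>gauss N) = (\<integral> x. sgm * ?S x \<partial>gauss N)"
  using sg(1) by simp
 also have "... \<le> (\<integral> x. sgm * ?T x + real (Suc K) * (D * eps ^ 3) \<partial>gauss N)"
 proof (rule integral_gauss_le)
  show "integrable (gauss N) (%x. sgm * ?S x)" by (rule integrable_mult_right[OF sg(2)])
  show "integrable (gauss N) (%x. sgm * ?T x + real (Suc K) * (D * eps ^ 3))"
   by (intro Bochner_Integration.integrable_add integrable_mult_right[OF Tint] integrable_gauss_const)
  fix x :: "real vec" assume x: "x \<in> Rn N"
  show "sgm * ?S x \<le> sgm * ?T x + real (Suc K) * (D * eps ^ 3)"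
   unfolding h'_def t_def by (rule Suc.IH[OF uc[OF _ x]])
 qed
 also have "... = sgm * (\<integral> x. ?T x \<partial>gauss N) + real (Suc K) * (D * eps ^ 3)"
  using Tint by simp
 also have "sgm * (\<integral> x. ?T x \<partial>gauss N) \<le> sgm * (\<Prod>i\<in>I. gauss_avg N (L i) eps (h' i) (u i) powr al i) + D * eps ^ 3"
  using h' Suc.prems eps by (intro step) auto
 also have "(\<Prod>i\<in>I. gauss_avg N (L i) eps (h' i) (u i) powr al i) = (\<Prod>i\<in>I. gauss_avg N (L i) r (h i) (u i) powr al i)"
  unfolding h'_def
  by (intro prod.cong refl arg_cong2[where f = "(powr)"] gauss_avg_semigroup[OF L Suc.prems hm hab ab(1) st r])
 finally show ?case
  by (simp add: r_def algebra_simps)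
qed

text \<open>Starting from the origin, \<open>Suc K\<close> steps of size
  \<open>1 / sqrt (Suc K)\<close> make up one step of size 1. The constant \<open>D\<close> is
  chosen before \<open>K\<close>, so the total error \<open>D / sqrt (Suc K)\<close> tends to
  0.\<close>

lemma gauss_inequality_C11:
 fixes d :: "nat => nat"
 assumes I: "finite I" and L: "!!i. i \<in> I ==> L i \<in> Mat (d i) N"
  and ab: "0 < a" "a \<le> b" and sgm: "sgm = 1 \<or> sgm = (- 1 :: real)" and C: "0 \<le> C"
  and Q: "!!v. (!!i. i \<in> I ==> v i \<in> Rn (d i)) ==> sgm * gauss_form I al L v \<le> 0"
  and h: "!!i. i \<in> I ==> C11 (d i) a b C (h i)"
 shows "sgm * (\<integral> xi. (\<Prod>i\<in>I. h i (L i *\<^sub>v xi) powr al i) \<partial>gauss N)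
   \<le> sgm * (\<Prod>i\<in>I. (\<integral> xi. h i (L i *\<^sub>v xi) \<partial>gauss N) powr al i)" (is "?l \<le> ?r")
proof -
 from heat_step[OF I L ab sgm C Q] obtain D where D: "D \<ge> 0" and
  step: "!!h u eps. (\<forall>i\<in>I. C11 (d i) a b C (h i)) ==> (\<forall>i\<in>I. u i \<in> Rn (d i)) ==> 0 \<le> eps ==> eps \<le> 1 ==>
  sgm * (\<integral> xi. (\<Prod>i\<in>I. h i (u i + eps \<cdot>\<^sub>v (L i *\<^sub>v xi)) powr al i) \<partial>gauss N)
   \<le> sgm * (\<Prod>i\<in>I. gauss_avg N (L i) eps (h i) (u i) powr al i) + D * eps ^ 3"
  by blast
 have e: "0\<^sub>v (d i) + L i *\<^sub>v xi = L i *\<^sub>v xi" if "i \<in> I" "xi \<in> Rn N" for i xi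
  using mult_mat_vec_carrier[OF L[OF that(1)] that(2)] by simp
 have avg: "gauss_avg N (L i) 1 (h i) (0\<^sub>v (d i)) = (\<integral> xi. h i (L i *\<^sub>v xi) \<partial>gauss N)" if "i \<in> I" for i
  unfolding gauss_avg_def by (intro Bochner_Integration.integral_cong refl) (simp add: e[OF that])
 have ll: "(\<integral> xi. (\<Prod>i\<in>I. h i (0\<^sub>v (d i) + 1 \<cdot>\<^sub>v (L i *\<^sub>v xi)) powr al i) \<partial>gauss N) = (\<integral> xi. (\<Prod>i\<in>I. h i (L i *\<^sub>v xi) powr al i) \<partial>gauss N)"
  by (intro Bochner_Integration.integral_cong prod.cong refl) (simp add: e)
 have bound: "?l \<le> ?r + D * (1 / sqrt (real (Suc K)))" for K
 proof -
  define eps where "eps = 1 / sqrt (real (Suc K))"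
  have eps: "0 < eps" "eps \<le> 1" by (simp_all add: eps_def)
  have one: "sqrt (real (Suc K)) * eps = 1" by (simp add: eps_def)
  have "real (Suc K) = sqrt (real (Suc K)) * sqrt (real (Suc K))" by simp
  then have "real (Suc K) * (D * eps ^ 3) = D * ((sqrt (real (Suc K)) * eps) * (sqrt (real (Suc K)) * eps) * eps)"
   unfolding power3_eq_cube by (metis mult.assoc mult.left_commute)
  also have "... = D * eps" by (simp only: one mult_1_left)
  finally have D': "real (Suc K) * (D * eps ^ 3) = D * eps" .
  have "sgm * (\<integral> xi. (\<Prod>i\<in>I. h i (0\<^sub>v (d i) + (sqrt (real (Suc K)) * eps) \<cdot>\<^sub>v (L i *\<^sub>v xi)) powr al i) \<partial>gauss N)
   \<le> sgm * (\<Prod>i\<in>I. gauss_avg N (L i) (sqrt (real (Suc K)) * eps) (h i) (0\<^sub>v (d i)) powr al i) + real (Suc K) * (D * eps ^ 3)"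
   by (rule heat_iterate[OF I L ab sgm step h _ eps, where u = "%i. 0\<^sub>v (d i)"]) simp_all
  then have "sgm * (\<integral> xi. (\<Prod>i\<in>I. h i (L i *\<^sub>v xi) powr al i) \<partial>gauss N)
   \<le> sgm * (\<Prod>i\<in>I. gauss_avg N (L i) 1 (h i) (0\<^sub>v (d i)) powr al i) + D * eps"
   unfolding one D' ll .
  then show ?thesis using avg by (simp add: eps_def)
 qed
 have "(%K. ?r + D * (1 / sqrt (real (Suc K)))) \<longlonglongrightarrow> ?r + D * 0"
 proof (intro tendsto_intros)
  have "filterlim (%K. sqrt (real (Suc K))) at_top sequentially"
   by (rule filterlim_compose[OF sqrt_at_top filterlim_compose[OF filterlim_real_sequentially filterlim_Suc]])
  then show "(%K. 1 / sqrt (real (Suc K))) \<longlonglongrightarrow> 0"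
   by (intro tendsto_divide_0[OF tendsto_const] filterlim_at_top_imp_at_infinity)
 qed
 then show ?thesis
  using bound by (intro LIMSEQ_le_const[where X = "%K. ?r + D * (1 / sqrt (real (Suc K)))"]) auto
qed

section \<open>Operations on functions with Lipschitz gradient\<close>

lemma C11_mono:
 assumes "C11 d a b C h" "C \<le> C'"
 shows "C11 d a b C' h"
proof -
 have "C * (v \<bullet> v) \<le> C' * (v \<bullet> v)" for v :: "real vec"
  using assms(2) scalar_prod_self_nonneg[of v] by (rule mult_right_mono)
 then show ?thesis
  using assms unfolding C11_def by (meson order_trans)
qed

text \<open>The remainder scales by \<open>s\<close> and the squared gradient by
  \<open>s * s\<close>; the constant adds the two so as to cover both.\<close>

lemma C11_affine:
 assumes h: "C11 d 0 1 C h" and C: "0 \<le> C" and s: "0 \<le> s"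
 shows "C11 d a (a + s) ((s * s + s) * C) (%u. a + s * h u)"
proof -
 obtain g where hm: "h \<in> borel_fun d" and hab: "\<forall>u\<in>Rn d. 0 \<le> h u \<and> h u \<le> 1"
  and gm: "g \<in> leb d \<rightarrow>\<^sub>M leb d" and gC: "!!u. u \<in> Rn d ==> g u \<bullet> g u \<le> C"
  and gh: "!!u v. u \<in> Rn d ==> v \<in> Rn d ==> \<bar>h (u + v) - h u - g u \<bullet> v\<bar> \<le> C * (v \<bullet> v)"
  using h unfolding C11_def by blast
 have gc: "g u \<in> Rn d" if "u \<in> Rn d" for u
  using measurable_space[OF gm] that by simp
 have sC: "0 \<le> s * C" "0 \<le> s * s * C" using s C by simp_all
 show ?thesis
  unfolding C11_def
 proof (intro conjI exI[of _ "%u. s \<cdot>\<^sub>v g u"] ballI)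
  show "(%u. a + s * h u) \<in> borel_fun d" using hm by simp
  show "(%u. s \<cdot>\<^sub>v g u) \<in> leb d \<rightarrow>\<^sub>M leb d"
   by (rule measurable_vec_smult[OF gm borel_measurable_const])
  fix u :: "real vec" assume u: "u \<in> Rn d"
  show "a \<le> a + s * h u" "a + s * h u \<le> a + s"
   using hab u s by (simp_all add: mult_left_le)
  have "(s \<cdot>\<^sub>v g u) \<bullet> (s \<cdot>\<^sub>v g u) = s * s * (g u \<bullet> g u)"
   using gc[OF u] by simp
  also have "... \<le> s * s * C"
   using gC[OF u] by (intro mult_left_mono) auto
  also have "... \<le> (s * s + s) * C" using sC by (simp add: distrib_right)
  finally show "(s \<cdot>\<^sub>v g u) \<bullet> (s \<cdot>\<^sub>v g u) \<le> (s * s + s) * C" .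
  fix v :: "real vec" assume v: "v \<in> Rn d"
  have "(a + s * h (u + v)) - (a + s * h u) - (s \<cdot>\<^sub>v g u) \<bullet> v = s * (h (u + v) - h u - g u \<bullet> v)"
   using gc[OF u] v by (simp add: right_diff_distrib)
  then have "\<bar>(a + s * h (u + v)) - (a + s * h u) - (s \<cdot>\<^sub>v g u) \<bullet> v\<bar> = s * \<bar>h (u + v) - h u - g u \<bullet> v\<bar>"
   using s by (simp only: abs_mult abs_of_nonneg)
  also have "... \<le> s * (C * (v \<bullet> v))" by (rule mult_left_mono[OF gh[OF u v] s])
  also have "... \<le> (s * s + s) * C * (v \<bullet> v)"
   using mult_right_mono[OF sC(2) scalar_prod_self_nonneg[of v]] by (simp add: algebra_simps)
  finally show "\<bar>(a + s * h (u + v)) - (a + s * h u) - (s \<cdot>\<^sub>v g u) \<bullet> v\<bar> \<le> (s * s + s) * C * (v \<bullet> v)" .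
 qed
qed

lemma scalar_prod_add_self_le:
 assumes "x \<in> Rn d" "y \<in> Rn d"
 shows "(x + y) \<bullet> (x + y) \<le> 2 * (x \<bullet> x) + 2 * (y \<bullet> (y :: real vec))"
proof -
 have "(x + y) \<bullet> (x + y) = x \<bullet> x + y \<bullet> y + 2 * (x \<bullet> y)"
  using assms comm_scalar_prod[OF assms]
  by (simp add: scalar_prod_add_distrib[of _ d] add_scalar_prod_distrib[of _ d])
 then show ?thesis using two_scalar_prod_le[OF assms] by simp
qed

lemma abs_mult_le:
 fixes z :: real
 assumes "\<bar>z\<bar> \<le> B" "0 \<le> c" "c \<le> 1"
 shows "\<bar>c * z\<bar> \<le> B"
 using assms mult_right_mono[of c 1 "\<bar>z\<bar>"] by (simp add: abs_mult)

text \<open>In the product rule the remainder contains, besides the two remainders, the product of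
  the two increments. This is quadratic in \<open>v\<close> because each squared increment is, as
  shown in \<open>sq\<close>.\<close>

lemma C11_combination:
 assumes h1: "C11 d 0 1 C1 h1" and h2: "C11 d 0 1 C2 h2" and C: "0 \<le> C1" "0 \<le> C2"
 shows "C11 d 0 1 (3 * (C1 + C2)) (%u. h1 u * h2 u)"
  and "0 \<le> t ==> t \<le> 1 ==> C11 d 0 1 (3 * (C1 + C2)) (%u. t * h1 u + (1 - t) * h2 u)"
proof -
 obtain g1 where hm1: "h1 \<in> borel_fun d" and hab1: "\<forall>u\<in>Rn d. 0 \<le> h1 u \<and> h1 u \<le> 1"
  and gm1: "g1 \<in> leb d \<rightarrow>\<^sub>M leb d" and gC1: "!!u. u \<in> Rn d ==> g1 u \<bullet> g1 u \<le> C1"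
  and gh1: "!!u v. u \<in> Rn d ==> v \<in> Rn d ==> \<bar>h1 (u + v) - h1 u - g1 u \<bullet> v\<bar> \<le> C1 * (v \<bullet> v)"
  using h1 unfolding C11_def by blast
 obtain g2 where hm2: "h2 \<in> borel_fun d" and hab2: "\<forall>u\<in>Rn d. 0 \<le> h2 u \<and> h2 u \<le> 1"
  and gm2: "g2 \<in> leb d \<rightarrow>\<^sub>M leb d" and gC2: "!!u. u \<in> Rn d ==> g2 u \<bullet> g2 u \<le> C2"
  and gh2: "!!u v. u \<in> Rn d ==> v \<in> Rn d ==> \<bar>h2 (u + v) - h2 u - g2 u \<bullet> v\<bar> \<le> C2 * (v \<bullet> v)"
  using h2 unfolding C11_def by blast
 have gc: "g1 u \<in> Rn d" "g2 u \<in> Rn d" if "u \<in> Rn d" for u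
  using measurable_space[OF gm1] measurable_space[OF gm2] that by simp_all
 have small: "(s \<cdot>\<^sub>v g) \<bullet> (s \<cdot>\<^sub>v g) \<le> C" if "g \<in> Rn d" "g \<bullet> g \<le> C" "0 \<le> s" "s \<le> 1" for s g and C :: real
 proof -
  have "s * s \<le> 1" using that by (simp add: mult_le_one)
  then have "s * s * (g \<bullet> g) \<le> 1 * (g \<bullet> g)"
   by (rule mult_right_mono[OF _ scalar_prod_self_nonneg])
  then show ?thesis using that by (simp add: mult.assoc)
 qed
 have grad: "(s \<cdot>\<^sub>v g2 u + r \<cdot>\<^sub>v g1 u) \<bullet> (s \<cdot>\<^sub>v g2 u + r \<cdot>\<^sub>v g1 u) \<le> 3 * (C1 + C2)"
  if "u \<in> Rn d" "0 \<le> s" "s \<le> 1" "0 \<le> r" "r \<le> 1" for s r u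
 proof -
  have "(s \<cdot>\<^sub>v g2 u + r \<cdot>\<^sub>v g1 u) \<bullet> (s \<cdot>\<^sub>v g2 u + r \<cdot>\<^sub>v g1 u)
   \<le> 2 * ((s \<cdot>\<^sub>v g2 u) \<bullet> (s \<cdot>\<^sub>v g2 u)) + 2 * ((r \<cdot>\<^sub>v g1 u) \<bullet> (r \<cdot>\<^sub>v g1 u))"
   using gc[OF that(1)] by (intro scalar_prod_add_self_le[of _ d]) auto
  then show ?thesis
   using small[OF gc(2)[OF that(1)] gC2[OF that(1)] that(2,3)] small[OF gc(1)[OF that(1)] gC1[OF that(1)] that(4,5)] C
   by argo
 qed
 have lin: "(s \<cdot>\<^sub>v g2 u + r \<cdot>\<^sub>v g1 u) \<bullet> v = s * (g2 u \<bullet> v) + r * (g1 u \<bullet> v)" if "u \<in> Rn d" "v \<in> Rn d" for s r u v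
  using gc[OF that(1)] that by (simp add: add_scalar_prod_distrib[of _ d])
 \<comment> \<open>For small \<open>v\<close> the increment is gradient plus remainder, and the
   squared remainder is dominated by the remainder bound itself. For large \<open>v\<close> the
   range \<open>[0, 1]\<close> bounds the increment by 1.\<close>
 have sq: "(h (u + v) - h u)\<^sup>2 \<le> 4 * (C * (v \<bullet> v))"
  if "u \<in> Rn d" "v \<in> Rn d" "\<forall>u\<in>Rn d. 0 \<le> h u \<and> h u \<le> 1" "g \<in> Rn d" "g \<bullet> g \<le> C"
   "\<bar>h (u + v) - h u - g \<bullet> v\<bar> \<le> C * (v \<bullet> v)" for h u v g and C :: real
 proof (cases "C * (v \<bullet> v) \<le> 1")
  case True
  define e where "e = h (u + v) - h u - g \<bullet> v"
  have C0: "0 \<le> C" using that(5) scalar_prod_self_nonneg[of g] by linarith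
  have q: "0 \<le> C * (v \<bullet> v)" using C0 scalar_prod_self_nonneg[of v] by simp
  have "e\<^sup>2 \<le> (C * (v \<bullet> v))\<^sup>2"
   using that(6) by (simp add: e_def abs_le_square_iff[symmetric] abs_of_nonneg[OF q])
  also have "... \<le> C * (v \<bullet> v)"
   using True q by (simp add: power2_eq_square mult_left_le)
  finally have e: "e\<^sup>2 \<le> C * (v \<bullet> v)" .
  have "(g \<bullet> v)\<^sup>2 \<le> (g \<bullet> g) * (v \<bullet> v)" by (rule scalar_prod_Cauchy_Schwarz[OF that(4,2)])
  also have "... \<le> C * (v \<bullet> v)" by (rule mult_right_mono[OF that(5) scalar_prod_self_nonneg])
  finally have "(g \<bullet> v)\<^sup>2 \<le> C * (v \<bullet> v)" .
  moreover have "(g \<bullet> v + e)\<^sup>2 \<le> 2 * (g \<bullet> v)\<^sup>2 + 2 * e\<^sup>2"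
   using zero_le_power2[of "g \<bullet> v - e"] by (simp add: power2_eq_square algebra_simps)
  moreover have "h (u + v) - h u = g \<bullet> v + e" by (simp add: e_def)
  ultimately show ?thesis using e by simp
 next
  case False
  have "u + v \<in> Rn d" using that by simp
  then have "\<bar>h (u + v) - h u\<bar> \<le> \<bar>1 :: real\<bar>" using that(1,3) by (smt (verit))
  then have "(h (u + v) - h u)\<^sup>2 \<le> 1" by (simp only: abs_le_square_iff power_one)
  then show ?thesis using False by linarith
 qed
 have mg: "(%u. s u \<cdot>\<^sub>v g2 u + r u \<cdot>\<^sub>v g1 u) \<in> leb d \<rightarrow>\<^sub>M leb d"
  if "s \<in> borel_fun d" "r \<in> borel_fun d" for s r
  by (rule measurable_vec_add[OF measurable_vec_smult[OF gm2 that(1)] measurable_vec_smult[OF gm1 that(2)]])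
 show "C11 d 0 1 (3 * (C1 + C2)) (%u. h1 u * h2 u)"
  unfolding C11_def
 proof (intro conjI exI[of _ "%u. h1 u \<cdot>\<^sub>v g2 u + h2 u \<cdot>\<^sub>v g1 u"] ballI)
  show "(%u. h1 u * h2 u) \<in> borel_fun d" using hm1 hm2 by simp
  show "(%u. h1 u \<cdot>\<^sub>v g2 u + h2 u \<cdot>\<^sub>v g1 u) \<in> leb d \<rightarrow>\<^sub>M leb d" by (rule mg[OF hm1 hm2])
  fix u :: "real vec" assume u: "u \<in> Rn d"
  have b: "0 \<le> h1 u" "h1 u \<le> 1" "0 \<le> h2 u" "h2 u \<le> 1" using hab1 hab2 u by auto
  show "0 \<le> h1 u * h2 u" "h1 u * h2 u \<le> 1" using b by (simp_all add: mult_le_one)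
  show "(h1 u \<cdot>\<^sub>v g2 u + h2 u \<cdot>\<^sub>v g1 u) \<bullet> (h1 u \<cdot>\<^sub>v g2 u + h2 u \<cdot>\<^sub>v g1 u) \<le> 3 * (C1 + C2)"
   by (rule grad[OF u b])
  fix v :: "real vec" assume v: "v \<in> Rn d"
  define e1 where "e1 = h1 (u + v) - h1 u - g1 u \<bullet> v"
  define e2 where "e2 = h2 (u + v) - h2 u - g2 u \<bullet> v"
  define D1 where "D1 = h1 (u + v) - h1 u"
  define D2 where "D2 = h2 (u + v) - h2 u"
  have "D1\<^sup>2 \<le> 4 * (C1 * (v \<bullet> v))" unfolding D1_def by (rule sq[OF u v hab1 gc(1)[OF u] gC1[OF u] gh1[OF u v]])
  moreover have "D2\<^sup>2 \<le> 4 * (C2 * (v \<bullet> v))" unfolding D2_def by (rule sq[OF u v hab2 gc(2)[OF u] gC2[OF u] gh2[OF u v]])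
  moreover have "2 * \<bar>D1 * D2\<bar> \<le> D1\<^sup>2 + D2\<^sup>2"
   using zero_le_power2[of "\<bar>D1\<bar> - \<bar>D2\<bar>"] by (simp add: power2_diff abs_mult)
  ultimately have DD: "\<bar>D1 * D2\<bar> \<le> 2 * (C1 * (v \<bullet> v)) + 2 * (C2 * (v \<bullet> v))" by linarith
  have ee: "\<bar>h1 u * e2\<bar> \<le> C2 * (v \<bullet> v)" "\<bar>h2 u * e1\<bar> \<le> C1 * (v \<bullet> v)"
   unfolding e1_def e2_def by (rule abs_mult_le[OF gh2[OF u v] b(1,2)] abs_mult_le[OF gh1[OF u v] b(3,4)])+
  have "h1 (u + v) * h2 (u + v) - h1 u * h2 u - (h1 u \<cdot>\<^sub>v g2 u + h2 u \<cdot>\<^sub>v g1 u) \<bullet> v = D1 * D2 + h1 u * e2 + h2 u * e1"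
   unfolding lin[OF u v] by (simp add: D1_def D2_def e1_def e2_def algebra_simps)
  then have "\<bar>h1 (u + v) * h2 (u + v) - h1 u * h2 u - (h1 u \<cdot>\<^sub>v g2 u + h2 u \<cdot>\<^sub>v g1 u) \<bullet> v\<bar>
   \<le> 2 * (C1 * (v \<bullet> v)) + 2 * (C2 * (v \<bullet> v)) + C2 * (v \<bullet> v) + C1 * (v \<bullet> v)"
   using DD ee by linarith
  then show "\<bar>h1 (u + v) * h2 (u + v) - h1 u * h2 u - (h1 u \<cdot>\<^sub>v g2 u + h2 u \<cdot>\<^sub>v g1 u) \<bullet> v\<bar> \<le> 3 * (C1 + C2) * (v \<bullet> v)"
   by (simp add: algebra_simps)
 qed
 assume t: "0 \<le> t" "t \<le> 1"
 show "C11 d 0 1 (3 * (C1 + C2)) (%u. t * h1 u + (1 - t) * h2 u)"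
  unfolding C11_def
 proof (intro conjI exI[of _ "%u. (1 - t) \<cdot>\<^sub>v g2 u + t \<cdot>\<^sub>v g1 u"] ballI)
  show "(%u. t * h1 u + (1 - t) * h2 u) \<in> borel_fun d" using hm1 hm2 by simp
  show "(%u. (1 - t) \<cdot>\<^sub>v g2 u + t \<cdot>\<^sub>v g1 u) \<in> leb d \<rightarrow>\<^sub>M leb d" by (rule mg) simp_all
  fix u :: "real vec" assume u: "u \<in> Rn d"
  have b: "0 \<le> h1 u" "h1 u \<le> 1" "0 \<le> h2 u" "h2 u \<le> 1" using hab1 hab2 u by auto
  show "0 \<le> t * h1 u + (1 - t) * h2 u" using b t by simp
  show "t * h1 u + (1 - t) * h2 u \<le> 1" using b t by (intro convex_bound_le) auto
  show "((1 - t) \<cdot>\<^sub>v g2 u + t \<cdot>\<^sub>v g1 u) \<bullet> ((1 - t) \<cdot>\<^sub>v g2 u + t \<cdot>\<^sub>v g1 u) \<le> 3 * (C1 + C2)"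
   using t by (intro grad u) auto
  fix v :: "real vec" assume v: "v \<in> Rn d"
  have "t * h1 (u + v) + (1 - t) * h2 (u + v) - (t * h1 u + (1 - t) * h2 u) - ((1 - t) \<cdot>\<^sub>v g2 u + t \<cdot>\<^sub>v g1 u) \<bullet> v
   = t * (h1 (u + v) - h1 u - g1 u \<bullet> v) + (1 - t) * (h2 (u + v) - h2 u - g2 u \<bullet> v)"
   unfolding lin[OF u v] by (simp add: algebra_simps)
  moreover have "\<bar>t * (h1 (u + v) - h1 u - g1 u \<bullet> v)\<bar> \<le> C1 * (v \<bullet> v)" "\<bar>(1 - t) * (h2 (u + v) - h2 u - g2 u \<bullet> v)\<bar> \<le> C2 * (v \<bullet> v)"
   using t by (auto intro!: abs_mult_le gh1[OF u v] gh2[OF u v])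
  ultimately have "\<bar>t * h1 (u + v) + (1 - t) * h2 (u + v) - (t * h1 u + (1 - t) * h2 u) - ((1 - t) \<cdot>\<^sub>v g2 u + t \<cdot>\<^sub>v g1 u) \<bullet> v\<bar>
   \<le> C1 * (v \<bullet> v) + C2 * (v \<bullet> v)"
   by linarith
  moreover have "0 \<le> C1 * (v \<bullet> v)" "0 \<le> C2 * (v \<bullet> v)" using C scalar_prod_self_nonneg[of v] by simp_all
  ultimately show "\<bar>t * h1 (u + v) + (1 - t) * h2 (u + v) - (t * h1 u + (1 - t) * h2 u) - ((1 - t) \<cdot>\<^sub>v g2 u + t \<cdot>\<^sub>v g1 u) \<bullet> v\<bar>
   \<le> 3 * (C1 + C2) * (v \<bullet> v)"
   unfolding distrib_right distrib_left by linarith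
 qed
qed

lemma C11_const: "0 \<le> c ==> c \<le> 1 ==> C11 d 0 1 0 (%_. c)"
 unfolding C11_def by (intro conjI exI[of _ "%_. 0\<^sub>v d"]) auto

lemma C11_compl:
 assumes "C11 d 0 1 C h" "0 \<le> C"
 shows "C11 d 0 1 C (%u. 1 - h u)"
proof -
 obtain g where hm: "h \<in> borel_fun d" and hab: "\<forall>u\<in>Rn d. 0 \<le> h u \<and> h u \<le> 1"
  and gm: "g \<in> leb d \<rightarrow>\<^sub>M leb d" and gC: "!!u. u \<in> Rn d ==> g u \<bullet> g u \<le> C"
  and gh: "!!u v. u \<in> Rn d ==> v \<in> Rn d ==> \<bar>h (u + v) - h u - g u \<bullet> v\<bar> \<le> C * (v \<bullet> v)"
  using assms unfolding C11_def by blast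
 have gc: "g u \<in> Rn d" if "u \<in> Rn d" for u
  using measurable_space[OF gm] that by simp
 show ?thesis
  unfolding C11_def
 proof (intro conjI exI[of _ "%u. (- 1) \<cdot>\<^sub>v g u"] ballI)
  show "(%u. 1 - h u) \<in> borel_fun d" using hm by simp
  show "(%u. (- 1) \<cdot>\<^sub>v g u) \<in> leb d \<rightarrow>\<^sub>M leb d"
   by (rule measurable_vec_smult[OF gm borel_measurable_const])
  fix u :: "real vec" assume u: "u \<in> Rn d"
  show "0 \<le> 1 - h u" "1 - h u \<le> 1" using hab u by auto
  have s1: "((- 1) \<cdot>\<^sub>v g u) \<bullet> w = - (g u \<bullet> w)" if "w \<in> Rn d" for w
   using smult_scalar_prod_distrib[OF gc[OF u] that, of "- 1"] by simp
  have "g u \<bullet> ((- 1) \<cdot>\<^sub>v g u) = - (g u \<bullet> g u)"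
   using scalar_prod_smult_distrib[OF gc[OF u] gc[OF u], of "- 1"] by simp
  then show "((- 1) \<cdot>\<^sub>v g u) \<bullet> ((- 1) \<cdot>\<^sub>v g u) \<le> C"
   using s1[of "(- 1) \<cdot>\<^sub>v g u"] gc[OF u] gC[OF u] by (simp only: smult_carrier_vec minus_minus)
  fix v :: "real vec" assume v: "v \<in> Rn d"
  show "\<bar>1 - h (u + v) - (1 - h u) - ((- 1) \<cdot>\<^sub>v g u) \<bullet> v\<bar> \<le> C * (v \<bullet> v)"
   using gh[OF u v] unfolding s1[OF v] by linarith
 qed
qed

text \<open>The mean value theorem produces the derivative at an intermediate point
  \<open>z\<close>. The difference of \<open>1 / (1 + z\<^sup>2)\<close> and
  \<open>1 / (1 + y\<^sup>2)\<close> contains the factor \<open>y - z\<close>, of size at most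
  \<open>\<bar>k\<bar>\<close>, and the remaining quotient is at most 1.\<close>

lemma arctan_C11: "\<bar>arctan (y + k) - arctan y - k / (1 + y\<^sup>2)\<bar> \<le> k\<^sup>2"
proof -
 have "\<exists>z. \<bar>z - y\<bar> \<le> \<bar>k\<bar> \<and> arctan (y + k) - arctan y = k * inverse (1 + z\<^sup>2)"
 proof -
  consider "k = 0" | "0 < k" | "k < 0" by linarith
  then show ?thesis
  proof cases
   case 2
   obtain z where "y < z" "z < y + k" "arctan (y + k) - arctan y = (y + k - y) * inverse (1 + z\<^sup>2)"
    using MVT2[of y "y + k" arctan "%z. inverse (1 + z\<^sup>2)"] 2 DERIV_arctan by auto
   then show ?thesis using 2 by (intro exI[of _ z]) auto
  next
   case 3
   obtain z where "y + k < z" "z < y" "arctan y - arctan (y + k) = (y - (y + k)) * inverse (1 + z\<^sup>2)"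
    using MVT2[of "y + k" y arctan "%z. inverse (1 + z\<^sup>2)"] 3 DERIV_arctan by auto
   then show ?thesis using 3 by (intro exI[of _ z]) auto
  qed auto
 qed
 then obtain z where z: "\<bar>z - y\<bar> \<le> \<bar>k\<bar>" and eq: "arctan (y + k) - arctan y = k * inverse (1 + z\<^sup>2)" by blast
 have p: "0 < 1 + z\<^sup>2" "0 < 1 + y\<^sup>2" by (auto intro: add_pos_nonneg)
 have "k * inverse (1 + z\<^sup>2) - k / (1 + y\<^sup>2) = k * ((y - z) * (y + z) / ((1 + z\<^sup>2) * (1 + y\<^sup>2)))"
  using p by (simp add: field_simps power2_eq_square)
 then have "\<bar>arctan (y + k) - arctan y - k / (1 + y\<^sup>2)\<bar> = \<bar>k\<bar> * (\<bar>y - z\<bar> * (\<bar>y + z\<bar> / ((1 + z\<^sup>2) * (1 + y\<^sup>2))))"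
  unfolding eq using p by (simp add: abs_mult)
 also have "... \<le> \<bar>k\<bar> * (\<bar>k\<bar> * 1)"
 proof (intro mult_left_mono mult_mono)
  have b: "\<bar>x\<bar> \<le> 1 + x\<^sup>2" for x :: real
   using zero_le_power2[of "\<bar>x\<bar> - 1 / 2"] by (simp add: power2_eq_square algebra_simps)
  have h: "2 * \<bar>x\<bar> \<le> 1 + x\<^sup>2" for x :: real
   using zero_le_power2[of "\<bar>x\<bar> - 1"] by (simp add: power2_eq_square algebra_simps)
  have zy: "0 \<le> z\<^sup>2 * y\<^sup>2" by simp
  have ex: "(1 + z\<^sup>2) * (1 + y\<^sup>2) = 1 + z\<^sup>2 + y\<^sup>2 + z\<^sup>2 * y\<^sup>2"
   by (simp add: algebra_simps)
  have "\<bar>y + z\<bar> \<le> (1 + z\<^sup>2) * (1 + y\<^sup>2)"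
   unfolding ex using h[of y] h[of z] zy zero_le_power2[of y] zero_le_power2[of z] abs_triangle_ineq[of y z]
   by argo
  then show "\<bar>y + z\<bar> / ((1 + z\<^sup>2) * (1 + y\<^sup>2)) \<le> 1" using p by (subst divide_le_eq_1_pos) auto
 qed (use z p in \<open>auto simp: abs_minus_commute\<close>)
 also have "... = k\<^sup>2" by (simp add: power2_eq_square)
 finally show ?thesis .
qed

text \<open>A smooth substitute for the indicator of the half-space
  \<open>c * u $ i \<le> e\<close>, steeper for larger \<open>c\<close>; it starts the Baire class
  on measurable sets.\<close>

lemma C11_soft_indicator:
 assumes i: "i < d"
 shows "C11 d 0 1 (c * c) (%u. 1 / 2 - arctan (c * u $ i - e) / pi)"
proof -
 define q where "q = (%u::real vec. - (c / (1 + (c * u $ i - e)\<^sup>2)) / pi)"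
 have um: "unit_vec d i \<in> Rn d" by simp
 have lin: "(q u \<cdot>\<^sub>v unit_vec d i) \<bullet> v = q u * v $ i" if "v \<in> Rn d" for u v
  using i that by simp
 have pi1: "1 \<le> pi" using pi_gt3 by simp
 have cm [measurable]: "(%u. u $ i) \<in> borel_fun d"
  by (rule measurable_vec_index[OF i])
 have qm: "q \<in> borel_fun d"
  unfolding q_def by measurable
 show ?thesis
  unfolding C11_def
 proof (intro conjI exI[of _ "%u. q u \<cdot>\<^sub>v unit_vec d i"] ballI)
  show "(%u. 1 / 2 - arctan (c * u $ i - e) / pi) \<in> borel_fun d"
   by measurable
  show "(%u. q u \<cdot>\<^sub>v unit_vec d i) \<in> leb d \<rightarrow>\<^sub>M leb d"
   by (rule measurable_vec_smult[OF measurable_vec_const[OF um] qm])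
  fix u :: "real vec" assume u: "u \<in> Rn d"
  have "- (pi / 2) < arctan (c * u $ i - e)" "arctan (c * u $ i - e) < pi / 2"
   by (rule arctan_lbound arctan_ubound)+
  then have "- (pi / 2) / pi \<le> arctan (c * u $ i - e) / pi" "arctan (c * u $ i - e) / pi \<le> (pi / 2) / pi"
   by (intro divide_right_mono; simp)+
  then show "0 \<le> 1 / 2 - arctan (c * u $ i - e) / pi" "1 / 2 - arctan (c * u $ i - e) / pi \<le> 1"
   by simp_all
  have p: "1 \<le> 1 + (c * u $ i - e)\<^sup>2" by simp
  have "\<bar>q u\<bar> = \<bar>c\<bar> / ((1 + (c * u $ i - e)\<^sup>2) * pi)"
   using p pi1 by (simp add: q_def abs_divide)
  also have "... \<le> \<bar>c\<bar> / 1"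
  proof (rule divide_left_mono)
   have "1 * 1 \<le> (1 + (c * u $ i - e)\<^sup>2) * pi" using p pi1 by (intro mult_mono) auto
   then show "1 \<le> (1 + (c * u $ i - e)\<^sup>2) * pi" by simp
  qed (use p pi1 in \<open>auto intro!: mult_pos_pos add_pos_nonneg\<close>)
  finally have "(q u)\<^sup>2 \<le> c\<^sup>2" by (simp add: abs_le_square_iff)
  then show "(q u \<cdot>\<^sub>v unit_vec d i) \<bullet> (q u \<cdot>\<^sub>v unit_vec d i) \<le> c * c"
   using i by (simp add: power2_eq_square)
  fix v :: "real vec" assume v: "v \<in> Rn d"
  let ?y = "c * u $ i - e" and ?k = "c * v $ i"
  have "1 / 2 - arctan (c * (u + v) $ i - e) / pi - (1 / 2 - arctan ?y / pi) - q u * v $ i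
   = - ((arctan (?y + ?k) - arctan ?y - ?k / (1 + ?y\<^sup>2)) / pi)"
   using u v i by (simp add: q_def algebra_simps diff_divide_distrib add_divide_distrib)
  then have "\<bar>1 / 2 - arctan (c * (u + v) $ i - e) / pi - (1 / 2 - arctan ?y / pi) - q u * v $ i\<bar>
   = \<bar>arctan (?y + ?k) - arctan ?y - ?k / (1 + ?y\<^sup>2)\<bar> / pi"
   by (simp only: abs_minus_cancel abs_divide abs_of_pos[OF pi_gt_zero])
  also have "... \<le> ?k\<^sup>2 / 1"
   using pi1 by (intro frac_le arctan_C11) auto
  also have "... = c * c * (v $ i * v $ i)" by (simp add: power2_eq_square)
  also have "... \<le> c * c * (v \<bullet> v)"
   unfolding scalar_prod_self_sum[OF v] using i by (intro mult_left_mono member_le_sum) auto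
  finally show "\<bar>1 / 2 - arctan (c * (u + v) $ i - e) / pi - (1 / 2 - arctan ?y / pi) - (q u \<cdot>\<^sub>v unit_vec d i) \<bullet> v\<bar> \<le> c * c * (v \<bullet> v)"
   unfolding lin[OF v] .
 qed
qed

text \<open>A Baire class: it contains every measurable function with values in \<open>[0, 1]\<close>, so inequalities stable under pointwise
 limits need only be proved for the \<open>C\<^sup>1\<^sup>,\<^sup>1\<close> ones.\<close>

inductive baire :: "nat => (real vec => real) => bool" for d where
 base: "C11 d 0 1 C h ==> 0 \<le> C ==> baire d h"
| lim: "(!!n::nat. baire d (h n)) ==> (!!u. u \<in> Rn d ==> (%n. h n u) \<longlonglongrightarrow> h' u) ==> baire d h'"

section \<open>Closure properties of the Baire class\<close>

lemma baire_measurable: "baire d h ==> h \<in> borel_fun d"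
proof (induction rule: baire.induct)
 case (lim h h')
 show ?case
  by (rule borel_measurable_LIMSEQ_real[OF _ lim.IH]) (use lim.hyps in simp)
qed (auto simp: C11_def)

lemma baire_bounds: "baire d h ==> u \<in> Rn d ==> 0 \<le> h u \<and> h u \<le> 1"
proof (induction rule: baire.induct)
 case (lim h h')
 then show ?case
  using LIMSEQ_le_const[of "%n. h n u" "h' u" 0] LIMSEQ_le_const2[of "%n. h n u" "h' u" 1] by blast
qed (auto simp: C11_def)

lemma baire_cong:
 assumes "baire d h" "!!u. u \<in> Rn d ==> h u = h' u"
 shows "baire d h'"
 by (rule baire.lim[of d "%_. h"]) (use assms in auto)

lemma baire_const: "0 \<le> c ==> c \<le> 1 ==> baire d (%_. c)"
 by (rule baire.base[OF C11_const]) simp_all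

lemma baire_compl: "baire d h ==> baire d (%u. 1 - h u)"
proof (induction rule: baire.induct)
 case (base C h)
 then show ?case by (intro baire.base[OF C11_compl])
next
 case (lim h h')
 show ?case
  by (rule baire.lim, rule lim.IH, rule tendsto_diff[OF tendsto_const lim.hyps(2)])
qed

text \<open>Two nested inductions: limits are first taken in the second argument with a smooth first
  one, and then in the first argument. Continuity of \<open>T\<close> carries each limit through,
  and the range \<open>[0, 1]\<close> makes the constant in \<open>T\<close> depend on
  \<open>C1\<close> and \<open>C2\<close> only.\<close>

lemma baire_combine:
 assumes T: "!!C1 C2 h k. C11 d 0 1 C1 h ==> C11 d 0 1 C2 k ==> 0 \<le> C1 ==> 0 \<le> C2 ==>
   C11 d 0 1 (3 * (C1 + C2)) (%u. T (h u) (k u))"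
  and cont: "!!x y a b. x \<longlonglongrightarrow> a ==> y \<longlonglongrightarrow> b ==> (%n::nat. T (x n) (y n)) \<longlonglongrightarrow> T a b"
  and h: "baire d h" and k: "baire d k"
 shows "baire d (%u. T (h u) (k u) :: real)"
 using h
proof (induction rule: baire.induct)
 case (base C h)
 note b = base
 show ?case
  using k
 proof (induction rule: baire.induct)
  case (base C' k)
  show ?case by (rule baire.base[OF T[OF b(1) base(1) b(2) base(2)]]) (use b base in simp)
 next
  case (lim k k')
  show ?case by (rule baire.lim, rule lim.IH, rule cont[OF tendsto_const lim.hyps(2)])
 qed
next
 case (lim h h')
 show ?case by (rule baire.lim, rule lim.IH, rule cont[OF lim.hyps(2) tendsto_const])
qed

lemma baire_mult: "baire d h ==> baire d k ==> baire d (%u. h u * k u)"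
 by (rule baire_combine[where T = "%x y. x * y", OF C11_combination(1) tendsto_mult])

lemma baire_convex: "0 \<le> t ==> t \<le> 1 ==> baire d h ==> baire d k ==> baire d (%u. t * h u + (1 - t) * k u)"
 by (rule baire_combine[where T = "%x y. t * x + (1 - t) * y", OF C11_combination(2)
  tendsto_add[OF tendsto_mult[OF tendsto_const] tendsto_mult[OF tendsto_const]]])

text \<open>Finite unions are expressed by complements and products, which stay in
  \<open>[0, 1]\<close>, whereas sums of indicators would not. At each point the sequence is
  eventually constant.\<close>

lemma baire_Union:
 assumes B: "!!j::nat. baire d (%u. indicator (B j) (phi u))"
 shows "baire d (%u. indicator (\<Union>j. B j) (phi u))"
proof (rule baire.lim)
 let ?p = "%n u. 1 - (\<Prod>j<n. 1 - indicator (B j) (phi u)) :: real"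
 have "baire d (%u. \<Prod>j<n. 1 - indicator (B j) (phi u))" for n
  by (induction n) (auto intro!: baire_const baire_mult baire_compl B)
 then show "baire d (?p n)" for n by (rule baire_compl)
 show "(%n. ?p n u) \<longlonglongrightarrow> indicator (\<Union>j. B j) (phi u)" for u
 proof (cases "phi u \<in> (\<Union>j. B j)")
  case True
  then obtain j where j: "phi u \<in> B j" by blast
  have "?p n u = 1" if "Suc j \<le> n" for n
   using that j by (subst prod_zero) (auto intro!: bexI[of _ j])
  then show ?thesis using True by (intro tendsto_eventually eventually_sequentiallyI[of "Suc j"]) simp
 qed (auto simp: indicator_def)
qed

text \<open>The sets with this property form a sigma-algebra, and the half-lines generating the
  Borel sets belong to it.\<close>

lemma baire_coordinate:
 assumes i: "i < d" and X: "X \<in> sets borel"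
 shows "baire d (%u. indicator X (u $ i))"
proof -
 have "X \<in> sigma_sets UNIV (range (%a::real. {..a}))"
  using X unfolding borel_eq_atMost by simp
 then show ?thesis
 proof (induction rule: sigma_sets.induct)
  case (Basic a)
  then obtain t where a: "a = {..t}" by blast
  show ?case
  proof (rule baire.lim)
   fix n :: nat
   \<comment> \<open>The shift by \<open>sqrt (real n)\<close> decides the endpoint: at
     \<open>u $ i = t\<close> the argument is \<open>- sqrt (real n)\<close>, so the limit is 1
     there, as a closed half-line demands. For \<open>u $ i > t\<close> the term linear in
     \<open>n\<close> outweighs the shift.\<close>
   show "baire d (%u. 1 / 2 - arctan (real n * u $ i - (real n * t + sqrt (real n))) / pi)"
    by (rule baire.base[OF C11_soft_indicator[OF i]]) simp
   fix u :: "real vec"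
   have fl: "filterlim (%n. sqrt (real n)) at_top sequentially"
    by (rule filterlim_compose[OF sqrt_at_top filterlim_real_sequentially])
   have e: "real n * u $ i - (real n * t + sqrt (real n)) = sqrt (real n) * (sqrt (real n) * (u $ i - t) - 1)" for n
    by (simp add: algebra_simps)
   show "(%n. 1 / 2 - arctan (real n * u $ i - (real n * t + sqrt (real n))) / pi) \<longlonglongrightarrow> indicator a (u $ i)"
   proof (cases "u $ i \<le> t")
    case True
    have "filterlim (%n. real n * u $ i - (real n * t + sqrt (real n))) at_bot sequentially"
    proof (rule filterlim_at_bot_mono)
     show "filterlim (%n. - sqrt (real n)) at_bot sequentially"
      by (rule filterlim_compose[OF filterlim_uminus_at_bot_at_top fl])
     show "\<forall>\<^sub>F n in sequentially. real n * u $ i - (real n * t + sqrt (real n)) \<le> - sqrt (real n)"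
      using True by (intro always_eventually allI) (simp add: mult_left_mono)
    qed
    then have "(%n. 1 / 2 - arctan (real n * u $ i - (real n * t + sqrt (real n))) / pi) \<longlonglongrightarrow> 1 / 2 - (- (pi / 2)) / pi"
     by (intro tendsto_intros filterlim_compose[OF tendsto_arctan_at_bot]) auto
    then show ?thesis using True by (simp add: a)
   next
    case False
    then have s: "0 < u $ i - t" by simp
    have "filterlim (%n. sqrt (real n) * (u $ i - t)) at_top sequentially"
     using s fl by (subst mult.commute) (rule filterlim_tendsto_pos_mult_at_top[OF tendsto_const])
    then have "filterlim (%n. - 1 + sqrt (real n) * (u $ i - t)) at_top sequentially"
     by (rule filterlim_tendsto_add_at_top[OF tendsto_const])
    then have "filterlim (%n. sqrt (real n) * (- 1 + sqrt (real n) * (u $ i - t))) at_top sequentially"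
     by (rule filterlim_at_top_mult_at_top[OF fl])
    then have "filterlim (%n. real n * u $ i - (real n * t + sqrt (real n))) at_top sequentially"
     unfolding e by (simp add: algebra_simps)
    then have "(%n. 1 / 2 - arctan (real n * u $ i - (real n * t + sqrt (real n))) / pi) \<longlonglongrightarrow> 1 / 2 - (pi / 2) / pi"
     by (intro tendsto_intros filterlim_compose[OF tendsto_arctan_at_top]) auto
    then show ?thesis using False by (simp add: a)
   qed
  qed
 next
  case Empty
  show ?case using baire_const[of 0 d] by simp
 next
  case (Compl a)
  have "baire d (%u. 1 - indicator a (u $ i))" by (rule baire_compl[OF Compl.IH])
  then show ?case by (rule baire_cong) (simp add: indicator_def)
 next
  case (Union a)
  show ?case by (rule baire_Union[OF Union.IH])
 qed
qed

lemma indicator_complement: "(x \<in> B) = (x \<notin> A) ==> 1 - indicator A x = (indicator B x :: real)"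
 by (simp add: indicator_def)

text \<open>The same sigma-algebra argument, carried out on the product space, where the algebra is
  generated by conditions on one coordinate; \<open>?r\<close> transfers the result to
  vectors.\<close>

lemma baire_indicator:
 assumes A: "A \<in> sets (leb d)"
 shows "baire d (indicator A)"
proof -
 let ?P = "\<Pi>\<^sub>M i\<in>{..<d}. (lborel :: real measure)"
 let ?r = "%v::real vec. \<lambda>i\<in>{..<d}. v $ i"
 have rs: "?r v \<in> space ?P" for v by (simp add: space_PiM)
 obtain B where B: "B \<in> sets ?P" and AB: "A = vec d ` B"
  using A unfolding lborel_vec_def sets_embed_measure'[OF inj_on_vec] by blast
 have "B \<in> sigma_sets (\<Pi>\<^sub>E i\<in>{..<d}. space (lborel :: real measure))
   {{f \<in> (\<Pi>\<^sub>E i\<in>{..<d}. space (lborel :: real measure)). f i \<in> X} | i X. i \<in> {..<d} \<and> X \<in> sets (lborel :: real measure)}"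
  using B unfolding sets_PiM_single .
 then have "baire d (%v. indicator B (?r v))"
 proof (induction rule: sigma_sets.induct)
  case (Basic a)
  then obtain i X where a: "a = {f \<in> (\<Pi>\<^sub>E i\<in>{..<d}. space (lborel :: real measure)). f i \<in> X}" "i < d" "X \<in> sets borel"
   by auto
  show ?case
  proof (rule baire_cong[OF baire_coordinate[OF a(2,3)]])
   fix u :: "real vec"
   have m: "?r u \<in> (\<Pi>\<^sub>E i\<in>{..<d}. space (lborel :: real measure))"
    by (simp add: restrict_PiE_iff)
   have "?r u i = u $ i" using a(2) by simp
   then have "?r u \<in> a \<longleftrightarrow> u $ i \<in> X"
    unfolding a(1) mem_Collect_eq using m by metis
   then show "indicator X (u $ i) = (indicator a (?r u) :: real)" by (simp only: indicator_def)
  qed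
 next
  case Empty
  show ?case using baire_const[of 0 d] by simp
 next
  case (Compl a)
  have "baire d (%v. 1 - indicator a (?r v))" by (rule baire_compl[OF Compl.IH])
  then show ?case
  proof (rule baire_cong)
   fix u :: "real vec"
   have "?r u \<in> (\<Pi>\<^sub>E i\<in>{..<d}. space (lborel :: real measure))"
    by (simp add: restrict_PiE_iff)
   then have "(?r u \<in> (\<Pi>\<^sub>E i\<in>{..<d}. space (lborel :: real measure)) - a) = (?r u \<notin> a)"
    by blast
   then show "1 - indicator a (?r u) = (indicator ((\<Pi>\<^sub>E i\<in>{..<d}. space (lborel :: real measure)) - a) (?r u) :: real)"
    by (rule indicator_complement)
  qed
 next
  case (Union a)
  show ?case by (rule baire_Union[OF Union.IH])
 qed
 then show ?thesis
 proof (rule baire_cong)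
  fix u :: "real vec" assume u: "u \<in> Rn d"
  have "u = vec d (?r u)" using u by (intro eq_vecI) auto
  moreover have "B \<subseteq> space ?P" using B by (rule sets.sets_into_space)
  ultimately have eq: "u = vec d (?r u)" and sub: "B \<subseteq> space ?P" by blast+
  have "?r u \<in> B \<longleftrightarrow> u \<in> vec d ` B"
  proof
   assume "?r u \<in> B"
   then have "vec d (?r u) \<in> vec d ` B" by (rule imageI)
   then show "u \<in> vec d ` B" by (simp only: eq[symmetric])
  next
   assume "u \<in> vec d ` B"
   then obtain w where w: "w \<in> B" "u = vec d w" by blast
   have "vec d (?r u) = vec d w" using eq w(2) by argo
   from inj_onD[OF inj_on_vec this rs] w(1) sub have "?r u = w" by blast
   with w(1) show "?r u \<in> B" by (simp only:)
  qed
  then show "indicator B (?r u) = indicator A u" by (simp add: AB indicator_def)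
 qed
qed

text \<open>Averages in place of sums, again to stay in \<open>[0, 1]\<close>. The new term enters
  as a convex combination with the old average.\<close>

lemma baire_average:
 assumes "!!j::nat. baire d (p j)"
 shows "baire d (%u. (\<Sum>j<Suc m. p j u) / real (Suc m))"
proof (induction m)
 case 0
 then show ?case using assms[of 0] by simp
next
 case (Suc m)
 let ?t = "real (Suc m) / real (Suc (Suc m))"
 have t: "1 - ?t = 1 / real (Suc (Suc m))" by (simp add: field_simps)
 have "baire d (%u. ?t * ((\<Sum>j<Suc m. p j u) / real (Suc m)) + (1 - ?t) * p (Suc m) u)"
  by (rule baire_convex[OF _ _ Suc.IH assms]) simp_all
 then show ?case
 proof (rule baire_cong)
  fix u
  have q: "?t * (s / real (Suc m)) = s / real (Suc (Suc m))" for s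
   by (simp del: of_nat_Suc)
  show "?t * ((\<Sum>j<Suc m. p j u) / real (Suc m)) + (1 - ?t) * p (Suc m) u = (\<Sum>j<Suc (Suc m). p j u) / real (Suc (Suc m))"
   unfolding t q sum.lessThan_Suc[of _ "Suc m"] add_divide_distrib
   by (simp del: sum.lessThan_Suc of_nat_Suc)
 qed
qed

text \<open>The average of the indicators of the superlevel sets is \<open>k u\<close> rounded down
  to a multiple of \<open>1 / (m + 1)\<close>, so the convergence is uniform. Level \<open>j\<close>
  is \<open>(j + 1) / (m + 1)\<close>, so the number of levels reached is the floor itself.\<close>

lemma baire_of_measurable:
 assumes k: "k \<in> borel_fun d" and b: "!!u. u \<in> Rn d ==> 0 \<le> k u \<and> k u \<le> 1"
 shows "baire d k"
proof (rule baire.lim)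
 fix m :: nat
 let ?A = "%m j. {u \<in> space (leb d). real (Suc j) \<le> real (Suc m) * k u}"
 have "?A m j \<in> sets (leb d)" for m j
  using k by (intro borel_measurable_le) simp_all
 then show "baire d (%u. (\<Sum>j<Suc m. indicator (?A m j) u) / real (Suc m))"
  by (intro baire_average baire_indicator)
 fix u :: "real vec" assume u: "u \<in> Rn d"
 have bound: "norm ((\<Sum>j<Suc m. indicator (?A m j) u) / real (Suc m) - k u) \<le> inverse (real (Suc m))" for m
 proof -
  define y where "y = real (Suc m) * k u"
  have y: "0 \<le> y" "y \<le> real (Suc m)"
   using b[OF u] by (simp_all add: y_def mult_left_le del: of_nat_Suc)
  have fl: "nat \<lfloor>y\<rfloor> \<le> Suc m" using y by linarith
  have "(\<Sum>j<Suc m. indicator (?A m j) u) = (\<Sum>j<Suc m. if j < nat \<lfloor>y\<rfloor> then 1 else 0 :: real)"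
  proof (rule sum.cong)
   fix j
   have "real (Suc j) \<le> y \<longleftrightarrow> j < nat \<lfloor>y\<rfloor>" using y by linarith
   then show "indicator (?A m j) u = (if j < nat \<lfloor>y\<rfloor> then 1 else 0 :: real)"
    using u by (simp add: y_def indicator_def del: of_nat_Suc)
  qed simp
  also have "... = real (card ({..<Suc m} \<inter> {j. j < nat \<lfloor>y\<rfloor>}))"
   by (subst sum.If_cases) (simp_all del: sum.lessThan_Suc)
  also have "{..<Suc m} \<inter> {j. j < nat \<lfloor>y\<rfloor>} = {..<nat \<lfloor>y\<rfloor>}" using fl by auto
  finally have s: "(\<Sum>j<Suc m. indicator (?A m j) u) = real (nat \<lfloor>y\<rfloor>)" by simp
  have "\<bar>real (nat \<lfloor>y\<rfloor>) - y\<bar> \<le> 1" using y by linarith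
  moreover have "real (nat \<lfloor>y\<rfloor>) / real (Suc m) - k u = (real (nat \<lfloor>y\<rfloor>) - y) / real (Suc m)"
   by (simp add: y_def diff_divide_distrib del: of_nat_Suc)
  ultimately have "\<bar>real (nat \<lfloor>y\<rfloor>) / real (Suc m) - k u\<bar> \<le> 1 / real (Suc m)"
   by (simp only: abs_divide abs_of_nat) (rule divide_right_mono, simp_all)
  then show ?thesis unfolding s by (simp add: inverse_eq_divide)
 qed
 have "(%m. (\<Sum>j<Suc m. indicator (?A m j) u) / real (Suc m) - k u) \<longlonglongrightarrow> 0"
  using bound by (intro Lim_null_comparison[OF _ LIMSEQ_inverse_real_of_nat] always_eventually) blast
 then show "(%m. (\<Sum>j<Suc m. indicator (?A m j) u) / real (Suc m)) \<longlonglongrightarrow> k u"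
  by (rule LIM_zero_cancel)
qed

text \<open>The smooth functions are exchanged for measurable ones one index at a time.
  \<open>J\<close> is the set of indices already freed; freeing another is an induction over the
  Baire class at that index, with all other functions fixed. The affine form
  \<open>a + s * k\<close> keeps every limit between positive bounds, so negative powers remain
  continuous and dominated convergence applies.\<close>

lemma gauss_inequality:
 fixes d :: "nat => nat"
 assumes I: "finite I" and L: "!!i. i \<in> I ==> L i \<in> Mat (d i) N"
  and a: "0 < a" and sgm: "sgm = 1 \<or> sgm = (- 1 :: real)"
  and Q: "!!v. (!!i. i \<in> I ==> v i \<in> Rn (d i)) ==> sgm * gauss_form I al L v \<le> 0"
  and hm: "!!i. i \<in> I ==> h i \<in> borel_fun (d i)"
  and hab: "!!i u. i \<in> I ==> u \<in> Rn (d i) ==> a \<le> h i u \<and> h i u \<le> b"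
 shows "sgm * (\<integral> xi. (\<Prod>i\<in>I. h i (L i *\<^sub>v xi) powr al i) \<partial>gauss N)
   \<le> sgm * (\<Prod>i\<in>I. (\<integral> xi. h i (L i *\<^sub>v xi) \<partial>gauss N) powr al i)"
proof -
 \<comment> \<open>The extra 1 makes \<open>s\<close> positive also when \<open>a = b\<close>, so
   that \<open>h\<close> can be normalised to \<open>[0, 1]\<close>.\<close>
 define b' where "b' = max a b + 1"
 define s where "s = b' - a"
 have s: "0 < s" by (simp add: s_def b'_def)
 let ?h = "%k i u. a + s * (k i u :: real)"
 define P where "P = (%k. sgm * (\<integral> xi. (\<Prod>i\<in>I. ?h k i (L i *\<^sub>v xi) powr al i) \<partial>gauss N)
   \<le> sgm * (\<Prod>i\<in>I. (\<integral> xi. ?h k i (L i *\<^sub>v xi) \<partial>gauss N) powr al i))"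
 have Lx: "L i *\<^sub>v xi \<in> Rn (d i)" if "i \<in> I" "xi \<in> Rn N" for i xi
  by (rule mult_mat_vec_carrier[OF L[OF that(1)] that(2)])
 have range: "a \<le> a + s * q (L i *\<^sub>v xi)" "a + s * q (L i *\<^sub>v xi) \<le> a + s"
  if "i \<in> I" "baire (d i) q" "xi \<in> Rn N" for q i xi
  using baire_bounds[OF that(2) Lx[OF that(1,3)]] s by (simp_all add: mult_left_le)
 have meas: "(%xi. a + s * q (L i *\<^sub>v xi)) \<in> borel_fun N" if "i \<in> I" "baire (d i) q" for q i
  using measurable_compose[OF measurable_mat_lborel_vec[OF L[OF that(1)]] baire_measurable[OF that(2)]] by simp
 have limit: "P (k(j := k'))"
  if j: "j \<in> I" and k: "!!i. i \<in> I ==> baire (d i) (k i)" and kn: "!!n::nat. baire (d j) (kn n)"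
   and conv: "!!u. u \<in> Rn (d j) ==> (%n. kn n u) \<longlonglongrightarrow> k' u"
   and Pn: "!!n. P (k(j := kn n))" for j k k' kn
 proof -
  have k': "baire (d j) k'" by (rule baire.lim[OF kn conv])
  define H where "H = (%n i u. a + s * (k(j := kn n)) i u)"
  define H' where "H' = (%i u. a + s * (k(j := k')) i u)"
  have bk: "baire (d i) ((k(j := kn n)) i)" "baire (d i) ((k(j := k')) i)" if "i \<in> I" for i n
   using k[OF that] kn k' by auto
  have Hm: "(%xi. H n i (L i *\<^sub>v xi)) \<in> borel_fun N" if "i \<in> I" for n i
   unfolding H_def by (rule meas[OF that bk(1)[OF that]])
  have H'm: "(%xi. H' i (L i *\<^sub>v xi)) \<in> borel_fun N" if "i \<in> I" for i
   unfolding H'_def by (rule meas[OF that bk(2)[OF that]])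
  have Hb: "a \<le> H n i (L i *\<^sub>v xi)" "H n i (L i *\<^sub>v xi) \<le> a + s" if "i \<in> I" "xi \<in> Rn N" for n i xi
   unfolding H_def by (rule range[OF that(1) bk(1)[OF that(1)] that(2)])+
  have H'b: "a \<le> H' i (L i *\<^sub>v xi)" "H' i (L i *\<^sub>v xi) \<le> a + s" if "i \<in> I" "xi \<in> Rn N" for i xi
   unfolding H'_def by (rule range[OF that(1) bk(2)[OF that(1)] that(2)])+
  have pt: "(%n. H n i (L i *\<^sub>v xi)) \<longlonglongrightarrow> H' i (L i *\<^sub>v xi)" if "i \<in> I" "xi \<in> Rn N" for i xi
  proof (cases "i = j")
   case True
   show ?thesis unfolding H_def H'_def True fun_upd_same
    by (intro tendsto_intros conv) (use Lx[OF that] True in blast)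
  next
   case False
   show ?thesis unfolding H_def H'_def fun_upd_other[OF False] by (rule tendsto_const)
  qed
  have dom: "(%n. \<integral> xi. f n xi \<partial>gauss N) \<longlonglongrightarrow> (\<integral> xi. f' xi \<partial>gauss N)"
   if "!!n. f n \<in> borel_fun N" "f' \<in> borel_fun N"
    "!!xi. xi \<in> Rn N ==> (%n. f n xi) \<longlonglongrightarrow> f' xi"
    "!!n xi. xi \<in> Rn N ==> \<bar>f n xi\<bar> \<le> B" for f :: "nat => real vec => real" and f' and B :: real
   by (rule integral_dominated_convergence[where w = "%_. B"]) (use that in auto)
  define F where "F = (%n xi. \<Prod>i\<in>I. H n i (L i *\<^sub>v xi) powr al i)"
  define F' where "F' = (%xi. \<Prod>i\<in>I. H' i (L i *\<^sub>v xi) powr al i)"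
  have F1: "F n \<in> borel_fun N" for n
   unfolding F_def by (intro borel_measurable_prod powr_real_measurable Hm borel_measurable_const)
  have F2: "F' \<in> borel_fun N"
   unfolding F'_def by (intro borel_measurable_prod powr_real_measurable H'm borel_measurable_const)
  have F3: "(%n. F n xi) \<longlonglongrightarrow> F' xi" if x: "xi \<in> Rn N" for xi
   unfolding F_def F'_def
  proof (rule tendsto_prod)
   fix i assume i: "i \<in> I"
   have "H' i (L i *\<^sub>v xi) \<noteq> 0" using H'b(1)[OF i x] a by linarith
   then show "(%n. H n i (L i *\<^sub>v xi) powr al i) \<longlonglongrightarrow> H' i (L i *\<^sub>v xi) powr al i"
    by (rule tendsto_powr[OF pt[OF i x] tendsto_const])
  qed
  have F4: "\<bar>F n xi\<bar> \<le> (\<Prod>i\<in>I. a powr al i + (a + s) powr al i)" if x: "xi \<in> Rn N" for n xi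
  proof -
   have *: "a \<le> H n i (L i *\<^sub>v xi) \<and> H n i (L i *\<^sub>v xi) \<le> a + s" if "i \<in> I" for i
    using Hb[OF that x] by blast
   show ?thesis unfolding F_def
    using prod_powr_bounded[where I = I and al = al and x = "%i. H n i (L i *\<^sub>v xi)", OF a *] by (simp only: abs_of_nonneg)
  qed
  have 1: "(%n. \<integral> xi. F n xi \<partial>gauss N) \<longlonglongrightarrow> (\<integral> xi. F' xi \<partial>gauss N)"
   by (rule dom[OF F1 F2 F3 F4])
  define E where "E = (%n i. \<integral> xi. H n i (L i *\<^sub>v xi) \<partial>gauss N)"
  define E' where "E' = (%i. \<integral> xi. H' i (L i *\<^sub>v xi) \<partial>gauss N)"
  have 2: "(%n. E n i) \<longlonglongrightarrow> E' i" if i: "i \<in> I" for i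
   unfolding E_def E'_def
  proof -
   have bnd: "\<bar>H n i (L i *\<^sub>v xi)\<bar> \<le> a + s" if "xi \<in> Rn N" for n xi
    using Hb[OF i that, of n] a by linarith
   show "(%n. \<integral> xi. H n i (L i *\<^sub>v xi) \<partial>gauss N) \<longlonglongrightarrow> (\<integral> xi. H' i (L i *\<^sub>v xi) \<partial>gauss N)"
    by (rule dom[OF Hm[OF i] H'm[OF i] pt[OF i] bnd])
  qed
  have 3: "0 < E' i" if i: "i \<in> I" for i
  proof -
   have "integrable (gauss N) (%xi. H' i (L i *\<^sub>v xi))"
   proof (rule integrable_gauss_bounded[OF H'm[OF i]])
    show "\<bar>H' i (L i *\<^sub>v xi)\<bar> \<le> a + s" if "xi \<in> Rn N" for xi
     using H'b[OF i that] a by linarith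
   qed
   from integral_gauss_le[OF integrable_gauss_const this H'b(1)[OF i]] show ?thesis
    using a unfolding E'_def by simp
  qed
  have 4: "(%n. \<Prod>i\<in>I. E n i powr al i) \<longlonglongrightarrow> (\<Prod>i\<in>I. E' i powr al i)"
  proof (rule tendsto_prod)
   fix i assume i: "i \<in> I"
   have "E' i \<noteq> 0" using 3[OF i] by simp
   then show "(%n. E n i powr al i) \<longlonglongrightarrow> E' i powr al i"
    by (rule tendsto_powr[OF 2[OF i] tendsto_const])
  qed
  have 5: "sgm * (\<integral> xi. F n xi \<partial>gauss N) \<le> sgm * (\<Prod>i\<in>I. E n i powr al i)" for n
   using Pn[of n] unfolding P_def F_def E_def H_def .
  have "sgm * (\<integral> xi. F' xi \<partial>gauss N) \<le> sgm * (\<Prod>i\<in>I. E' i powr al i)"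
   by (rule LIMSEQ_le[OF tendsto_mult[OF tendsto_const 1] tendsto_mult[OF tendsto_const 4]]) (use 5 in blast)
  then show ?thesis unfolding P_def F'_def E'_def H'_def .
 qed
 have main: "(\<forall>i\<in>I. baire (d i) (k i)) \<longrightarrow> (\<forall>i\<in>I - J. \<exists>C\<ge>0. C11 (d i) 0 1 C (k i)) \<longrightarrow> P k" if "finite J" "J \<subseteq> I" for J k
  using that
 proof (induction J arbitrary: k rule: finite_induct)
  case empty
  show ?case
  proof (intro impI)
   assume "\<forall>i\<in>I - {}. \<exists>C\<ge>0. C11 (d i) 0 1 C (k i)"
   then obtain C where C: "!!i. i \<in> I ==> 0 \<le> C i \<and> C11 (d i) 0 1 (C i) (k i)" by (metis Diff_empty)
   define C' where "C' = sum C I"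
   have C'0: "0 \<le> C'" unfolding C'_def using C by (intro sum_nonneg) blast
   have "C11 (d i) a (a + s) ((s * s + s) * C') (%u. a + s * k i u)" if i: "i \<in> I" for i
   proof (rule C11_affine)
    have "C i \<le> C'" unfolding C'_def using C I i by (intro member_le_sum) auto
    then show "C11 (d i) 0 1 C' (k i)" using C[OF i] by (blast intro: C11_mono)
   qed (use C'0 s in simp_all)
   from gauss_inequality_C11[OF I L a _ sgm _ Q this] show "P k"
    unfolding P_def using s C'0 by simp
  qed
 next
  case (insert j J)
  then have j: "j \<in> I" and J: "J \<subseteq> I" by auto
  show ?case
  proof (intro impI)
   assume k: "\<forall>i\<in>I. baire (d i) (k i)" and kC: "\<forall>i\<in>I - insert j J. \<exists>C\<ge>0. C11 (d i) 0 1 C (k i)"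
   have "baire (d j) (k j)" using k j by blast
   moreover have "P (k(j := k'))" if "baire (d j) k'" for k'
    using that
   proof (induction rule: baire.induct)
    case (base C h)
    have "\<forall>i\<in>I. baire (d i) ((k(j := h)) i)" using k baire.base[OF base] by auto
    moreover have "\<forall>i\<in>I - J. \<exists>C\<ge>0. C11 (d i) 0 1 C ((k(j := h)) i)" using kC base by auto
    ultimately show ?case using insert.IH[OF J, of "k(j := h)"] by blast
   next
    case (lim h h')
    show ?case
     by (rule limit[OF j _ lim.hyps(1) lim.hyps(2) lim.IH]) (use k in auto)
   qed
   ultimately have "P (k(j := k j))" by blast
   then show "P k" by simp
  qed
 qed
 define k where "k = (%i u. (h i u - a) / s)"
 have kb: "baire (d i) (k i)" if i: "i \<in> I" for i
 proof (rule baire_of_measurable)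
  show "k i \<in> borel_fun (d i)" unfolding k_def using hm[OF i] by simp
  show "0 \<le> k i u \<and> k i u \<le> 1" if "u \<in> Rn (d i)" for u
   using hab[OF i that] s by (auto simp: k_def s_def b'_def)
 qed
 have "P k" using main[OF I order_refl] kb by blast
 moreover have "?h k i u = h i u" for i u using s by (simp add: k_def)
 ultimately show ?thesis unfolding P_def by simp
qed

section \<open>Nested integrals\<close>

lemma ennreal_powr_ennreal: "0 \<le> x ==> ennreal_powr (ennreal x) p = ennreal (x powr p)"
 by (simp add: ennreal_powr_def)

lemma ennreal_powr_top [simp]: "ennreal_powr top_class.top p = top_class.top"
 by (simp add: ennreal_powr_def)

lemma ennreal_powr_cases:
 obtains (top) "x = \<infinity>" | (real) r where "0 \<le> r" "x = ennreal r"
 by (cases x) auto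

lemma ennreal_powr_mono:
 assumes "x \<le> y" "0 < p"
 shows "ennreal_powr x p \<le> ennreal_powr y p"
proof (cases y rule: ennreal_powr_cases)
 case (real r)
 then have "x < \<infinity>" using assms(1) le_less_trans ennreal_less_top unfolding infinity_ennreal_def by blast
 then obtain q where "0 \<le> q" "x = ennreal q" by (cases x rule: ennreal_powr_cases) auto
 then show ?thesis using real assms by (auto simp: ennreal_powr_ennreal intro!: ennreal_leI powr_mono2)
qed simp

lemma ennreal_powr_powr: "ennreal_powr (ennreal_powr x p) q = ennreal_powr x (p * q)"
 by (cases x rule: ennreal_powr_cases) (simp_all add: ennreal_powr_ennreal powr_powr)

lemma ennreal_powr_one: "ennreal_powr x 1 = x"
 by (cases x rule: ennreal_powr_cases) (simp_all add: ennreal_powr_ennreal)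

lemma ennreal_powr_cmult:
 assumes "0 < K"
 shows "ennreal_powr (ennreal K * x) p = ennreal (K powr p) * ennreal_powr x p"
proof (cases x rule: ennreal_powr_cases)
 case top
 then show ?thesis using assms by (simp add: ennreal_mult_top ennreal_powr_def)
next
 case (real r)
 then show ?thesis using assms
  by (simp add: ennreal_mult[symmetric] ennreal_powr_ennreal powr_mult)
qed

lemma measurable_ennreal_powr [measurable]:
 assumes [measurable]: "f \<in> borel_measurable M"
 shows "(%x. ennreal_powr (f x) p) \<in> borel_measurable M"
 unfolding ennreal_powr_def by measurable

lemma tendsto_ennreal_powr:
 assumes lim: "x \<longlonglongrightarrow> l" and p: "0 < p"
 shows "(%n::nat. ennreal_powr (x n) p) \<longlonglongrightarrow> ennreal_powr l p"
proof (cases l rule: ennreal_powr_cases)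
 case top
 have "\<forall>\<^sub>F n in sequentially. ennreal K < ennreal_powr (x n) p" if K: "0 < K" for K :: real
 proof -
  have "\<forall>\<^sub>F n in sequentially. ennreal ((K + 1) powr (1 / p)) < x n"
   using lim unfolding top by (rule order_tendstoD(1)) simp
  then show ?thesis
  proof eventually_elim
   case (elim n)
   have "ennreal K < ennreal (K + 1)" using K by (simp add: ennreal_lessI)
   also have "ennreal (K + 1) = ennreal_powr (ennreal ((K + 1) powr (1 / p))) p"
    using K p by (simp add: ennreal_powr_ennreal powr_powr)
   also have "... \<le> ennreal_powr (x n) p" using elim p by (intro ennreal_powr_mono) auto
   finally show ?case .
  qed
 qed
 then have "(%n. ennreal_powr (x n) p) \<longlonglongrightarrow> \<infinity>"
  unfolding infinity_ennreal_def tendsto_top_iff_ennreal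
 proof (intro allI impI)
  fix K :: real assume *: "!!K. 0 < K ==> \<forall>\<^sub>F n in sequentially. ennreal K < ennreal_powr (x n) p" and "0 \<le> K"
  then have "\<forall>\<^sub>F n in sequentially. ennreal (K + 1) < ennreal_powr (x n) p" by (intro *) simp
  moreover have "ennreal K \<le> ennreal (K + 1)" by (rule ennreal_leI) simp
  ultimately show "\<forall>\<^sub>F n in sequentially. ennreal K < ennreal_powr (x n) p"
   by (auto elim!: eventually_mono intro: le_less_trans)
 qed
 then show ?thesis by (simp add: top)
next
 case (real r)
 have fin: "\<forall>\<^sub>F n in sequentially. x n < \<infinity>"
  using order_tendstoD(2)[OF lim] real by simp
 have "(%n. enn2real (x n)) \<longlonglongrightarrow> r"
  by (rule tendsto_enn2real[OF lim[unfolded real(2)] real(1)])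
 then have "(%n. enn2real (x n) powr p) \<longlonglongrightarrow> r powr p"
  using p real by (intro tendsto_powr2) auto
 then have "(%n. ennreal (enn2real (x n) powr p)) \<longlonglongrightarrow> ennreal (r powr p)"
  by (rule tendsto_ennrealI)
 moreover have "\<forall>\<^sub>F n in sequentially. ennreal (enn2real (x n) powr p) = ennreal_powr (x n) p"
  using fin by eventually_elim (simp add: ennreal_powr_def)
 ultimately show ?thesis
  using real by (simp add: ennreal_powr_ennreal tendsto_cong)
qed

text \<open>Multiplication is discontinuous at the pair 0 and \<infinity>. If both sequences stay
  below their limits, a factor with limit 0 is constantly 0, and the convention for the product
  agrees with the limit. If both limits are finite, the pair does not occur. These are the two kinds
  of approximation used later.\<close>

lemma tendsto_mult_ennreal_mode:
 fixes x y :: "nat => ennreal"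
 assumes "x \<longlonglongrightarrow> a" "y \<longlonglongrightarrow> b"
  and "(\<forall>n. x n \<le> a) \<and> (\<forall>n. y n \<le> b) \<or> a < \<infinity> \<and> b < \<infinity>"
 shows "(%n. x n * y n) \<longlonglongrightarrow> a * b"
proof (cases "a = 0 \<and> b = \<infinity> \<or> a = \<infinity> \<and> b = 0")
 case True
 then have "x n * y n = 0" for n using assms(3) by auto
 then have "(%n. x n * y n) = (%_. 0)" by (rule ext)
 moreover have "a * b = 0" using True by auto
 ultimately show ?thesis by (simp only: tendsto_const)
next
 case False
 then show ?thesis using assms by (intro tendsto_mult_ennreal) auto
qed

lemma tendsto_prod_ennreal_mode:
 fixes x :: "nat => nat => ennreal"
 assumes lim: "!!i. i < m ==> (%n. x n i) \<longlonglongrightarrow> a i"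
  and mode: "(\<forall>n. \<forall>i<m. x n i \<le> a i) \<or> (\<forall>i<m. a i < \<infinity>)"
 shows "(%n. \<Prod>i<m. x n i) \<longlonglongrightarrow> (\<Prod>i<m. a i)"
 using assms
proof (induction m)
 case (Suc m)
 have IH: "(%n. \<Prod>i<m. x n i) \<longlonglongrightarrow> (\<Prod>i<m. a i)"
  using Suc.prems by (intro Suc.IH) auto
 have "(\<forall>n. (\<Prod>i<m. x n i) \<le> (\<Prod>i<m. a i)) \<and> (\<forall>n. x n m \<le> a m) \<or> (\<Prod>i<m. a i) < \<infinity> \<and> a m < \<infinity>"
  using Suc.prems(2)
 proof
  assume "\<forall>n. \<forall>i<Suc m. x n i \<le> a i"
  then have le: "x n i \<le> a i" if "i < Suc m" for n i using that by blast
  have "(\<Prod>i<l. x n i) \<le> (\<Prod>i<l. a i)" if "l \<le> Suc m" for l n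
   using that
  proof (induction l)
   case (Suc l)
   then show ?case using le[of l n] by (auto intro!: mult_mono)
  qed simp
  from this[of m] show ?thesis using le[of m] by auto
 next
  assume "\<forall>i<Suc m. a i < \<infinity>"
  then have "(\<Prod>i<m. a i) < \<infinity>" by (induction m) (auto simp: ennreal_mult_less_top)
  then show ?thesis using \<open>\<forall>i<Suc m. a i < \<infinity>\<close> by auto
 qed
 from tendsto_mult_ennreal_mode[OF IH Suc.prems(1) this] show ?case by simp
qed simp

text \<open>Dominated convergence by a constant, which is integrable for a probability measure, or
  monotone convergence.\<close>

lemma nn_integral_gauss_tendsto:
 fixes f :: "nat => real vec => ennreal"
 assumes m: "!!n. f n \<in> borel_fun k" "g \<in> borel_fun k"
  and lim: "!!v. v \<in> Rn k ==> (%n. f n v) \<longlonglongrightarrow> g v"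
  and mode: "(\<exists>B<\<infinity>. \<forall>n. \<forall>v\<in>Rn k. f n v \<le> B) \<or> (\<forall>n. \<forall>v\<in>Rn k. f n v \<le> f (Suc n) v)"
 shows "(%n. \<integral>\<^sup>+ v. f n v \<partial>gauss k) \<longlonglongrightarrow> (\<integral>\<^sup>+ v. g v \<partial>gauss k)"
 using mode
proof
 assume "\<exists>B<\<infinity>. \<forall>n. \<forall>v\<in>Rn k. f n v \<le> B"
 then obtain B where B: "B < \<infinity>" "!!n v. v \<in> Rn k ==> f n v \<le> B" by blast
 show ?thesis
 proof (rule nn_integral_dominated_convergence[where w = "%_. B"])
  show "(\<integral>\<^sup>+ v. B \<partial>gauss k) < \<infinity>"
   using B(1) by (simp add: emeasure_gauss_vec_space)
 qed (use m lim B in auto)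
next
 assume inc: "\<forall>n. \<forall>v\<in>Rn k. f n v \<le> f (Suc n) v"
 \<comment> \<open>Monotonicity is known only for vectors of dimension \<open>k\<close>; the value 0
   elsewhere makes the sequence increasing as a sequence of functions.\<close>
 define f' where "f' = (%n v. if v \<in> Rn k then f n v else 0)"
 define g' where "g' = (%v. if v \<in> Rn k then g v else 0)"
 have "incseq f'"
  using inc by (intro incseq_SucI) (auto simp: f'_def le_fun_def)
 moreover have "f' n \<in> borel_measurable (gauss k)" for n
 proof -
  have "f n \<in> borel_measurable (gauss k)" using m(1) by simp
  then show ?thesis by (rule measurable_cong[THEN iffD1, rotated]) (simp add: f'_def)
 qed
 moreover have "(%n. f' n v) \<longlonglongrightarrow> g' v" for v
  using lim by (auto simp: f'_def g'_def)
 ultimately have "(%n. \<integral>\<^sup>+ v. f' n v \<partial>gauss k) \<longlonglongrightarrow> (\<integral>\<^sup>+ v. g' v \<partial>gauss k)"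
  by (rule nn_integral_LIMSEQ)
 moreover have "(\<integral>\<^sup>+ v. f' n v \<partial>gauss k) = (\<integral>\<^sup>+ v. f n v \<partial>gauss k)" for n
  by (intro nn_integral_cong) (simp add: f'_def)
 moreover have "(\<integral>\<^sup>+ v. g' v \<partial>gauss k) = (\<integral>\<^sup>+ v. g v \<partial>gauss k)"
  by (intro nn_integral_cong) (simp add: g'_def)
 ultimately show ?thesis by simp
qed

section \<open>A nested integral against a product of norms\<close>

lemma transpose_hcat_mult_vec:
 assumes "P \<in> Mat d n" "R \<in> Mat d k" "v \<in> Rn d"
 shows "(hcat P R)\<^sup>T *\<^sub>v v = (P\<^sup>T *\<^sub>v v) @\<^sub>v (R\<^sup>T *\<^sub>v v)"
proof (rule eq_vecI)
 fix i assume "i < dim_vec ((P\<^sup>T *\<^sub>v v) @\<^sub>v (R\<^sup>T *\<^sub>v v))"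
 then have i: "i < n + k" using assms by simp
 have "col (hcat P R) i = (if i < n then col P i else col R (i - n))"
  using assms i by (intro eq_vecI) (auto simp: hcat_def)
 then show "((hcat P R)\<^sup>T *\<^sub>v v) $ i = ((P\<^sup>T *\<^sub>v v) @\<^sub>v (R\<^sup>T *\<^sub>v v)) $ i"
  using assms i hcat_carrier[OF assms(1,2)] by auto
qed (use assms hcat_carrier[OF assms(1,2)] in simp)

definition nested_integral :: "nat => nat => nat => (nat => real mat) => (nat => real mat) => real => (nat => real vec => real) => ennreal" where
 "nested_integral m n k P R r psi =
  (\<integral>\<^sup>+ x. ennreal_powr (\<integral>\<^sup>+ y. ennreal (\<Prod>i<m. psi i (P i *\<^sub>v x + R i *\<^sub>v y)) \<partial>gauss k) r \<partial>gauss n)"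

text \<open>The scaling reproduces the law of \<open>P i x + R i y\<close> under the covariance
  condition of \<open>nested\<close>. The factors are thus the norms with exponent
  \<open>1 / s i\<close> of the marginals of the product in \<open>nested_integral\<close>.\<close>

definition norm_product :: "nat => (nat => nat) => real => (nat => real) => (nat => real vec => real) => ennreal" where
 "norm_product m d kap s psi =
  (\<Prod>i<m. ennreal_powr (\<integral>\<^sup>+ u. ennreal (psi i (sqrt (kap * s i) \<cdot>\<^sub>v u) powr (1 / s i)) \<partial>gauss (d i)) (s i))"

text \<open>The common form of both comparisons. Inner and outer variable change roles between the
  two instances, \<open>nested_outer\<close> and \<open>nested_inner\<close>, so the blocks are
  named neutrally and the powers of \<rho> are absorbed into \<open>r\<close>, \<open>kap\<close>
  and \<open>s\<close>. The condition \<open>orth\<close> is orthogonality with the outer variable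
  weighted by \<open>r\<close>; \<open>cov\<close> says that the marginals are isotropic.\<close>

locale nested =
 fixes m n k :: nat and d :: "nat => nat" and P R :: "nat => real mat" and r kap :: real and s :: "nat => real"
 assumes P: "!!i. i < m ==> P i \<in> Mat (d i) n"
  and R: "!!i. i < m ==> R i \<in> Mat (d i) k"
  and r: "0 < r" and kap: "0 < kap" and s: "!!i. i < m ==> 0 < s i"
  and orth: "!!i j u v. i < m ==> j < m ==> u \<in> Rn (d i) ==> v \<in> Rn (d j) ==>
   r * (((P i)\<^sup>T *\<^sub>v u) \<bullet> ((P j)\<^sup>T *\<^sub>v v)) + ((R i)\<^sup>T *\<^sub>v u) \<bullet> ((R j)\<^sup>T *\<^sub>v v) = (if i = j then kap * (u \<bullet> v) else 0)"
  and cov: "!!i. i < m ==> P i * (P i)\<^sup>T + R i * (R i)\<^sup>T = (kap * s i) \<cdot>\<^sub>m 1\<^sub>m (d i)"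
begin

text \<open>Index \<open>m\<close> is the additional function, depending on the outer variable
  alone, hence the projection. Its exponent \<open>1 - 1 / r\<close> is the one for which duality
  closes, and it is negative exactly for \<open>r < 1\<close>.\<close>

definition L :: "nat => real mat" where
 "L i = (if i < m then hcat (P i) (R i) else hcat (1\<^sub>m n) (0\<^sub>m n k))"

definition dd :: "nat => nat" where "dd i = (if i < m then d i else n)"

definition al :: "nat => real" where "al i = (if i < m then s i else 1 - 1 / r)"

lemma L: "L i \<in> Mat (dd i) (n + k)"
 using hcat_carrier[OF P R] hcat_carrier[of "1\<^sub>m n" n n "0\<^sub>m n k" k] by (simp add: L_def dd_def)

lemma L_append:
 assumes "x \<in> Rn n" "y \<in> Rn k"
 shows "i < m ==> L i *\<^sub>v (x @\<^sub>v y) = P i *\<^sub>v x + R i *\<^sub>v y" and "L m *\<^sub>v (x @\<^sub>v y) = x"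
 using hcat_mult_vec[OF P R assms] hcat_mult_vec[of "1\<^sub>m n" n n "0\<^sub>m n k" k x y] assms
 by (simp_all add: L_def zero_mult_mat_vec)

lemma scalar_prod_cov:
 assumes "i < m" "u \<in> Rn (d i)"
 shows "((P i)\<^sup>T *\<^sub>v u) \<bullet> ((P i)\<^sup>T *\<^sub>v u) + ((R i)\<^sup>T *\<^sub>v u) \<bullet> ((R i)\<^sup>T *\<^sub>v u) = kap * s i * (u \<bullet> u)"
proof -
 note Pi = P[OF assms(1)] and Ri = R[OF assms(1)]
 have c: "(P i)\<^sup>T *\<^sub>v u \<in> Rn n" "(R i)\<^sup>T *\<^sub>v u \<in> Rn k"
  by (rule mult_mat_vec_carrier[OF transpose_carrier_mat[THEN iffD2, OF Pi] assms(2)] mult_mat_vec_carrier[OF transpose_carrier_mat[THEN iffD2, OF Ri] assms(2)])+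
 have PP: "P i * (P i)\<^sup>T \<in> Mat (d i) (d i)" "R i * (R i)\<^sup>T \<in> Mat (d i) (d i)"
  using Pi Ri by auto
 have e: "(P i * (P i)\<^sup>T) *\<^sub>v u = P i *\<^sub>v ((P i)\<^sup>T *\<^sub>v u)" "(R i * (R i)\<^sup>T) *\<^sub>v u = R i *\<^sub>v ((R i)\<^sup>T *\<^sub>v u)"
  by (rule assoc_mult_mat_vec[OF Pi transpose_carrier_mat[THEN iffD2, OF Pi] assms(2)] assoc_mult_mat_vec[OF Ri transpose_carrier_mat[THEN iffD2, OF Ri] assms(2)])+
 have "((P i)\<^sup>T *\<^sub>v u) \<bullet> ((P i)\<^sup>T *\<^sub>v u) + ((R i)\<^sup>T *\<^sub>v u) \<bullet> ((R i)\<^sup>T *\<^sub>v u)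
  = (P i *\<^sub>v ((P i)\<^sup>T *\<^sub>v u)) \<bullet> u + (R i *\<^sub>v ((R i)\<^sup>T *\<^sub>v u)) \<bullet> u"
  using scalar_prod_transpose[OF Pi c(1) assms(2)] scalar_prod_transpose[OF Ri c(2) assms(2)] by simp
 also have "... = ((P i * (P i)\<^sup>T + R i * (R i)\<^sup>T) *\<^sub>v u) \<bullet> u"
  unfolding add_mult_distrib_mat_vec[OF PP assms(2)] e
  by (rule add_scalar_prod_distrib[symmetric, of _ "d i"]) (use assms Pi Ri c in auto)
 also have "... = kap * s i * (u \<bullet> u)"
  unfolding cov[OF assms(1)] using assms(2) by (simp add: smult_mult_mat_vec[of _ "d i" "d i"])
 finally show ?thesis .
qed

text \<open>By \<open>orth\<close> and \<open>cov\<close> the diagonal sum equals the double sum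
  with the outer part weighted by \<open>r\<close>. The inner contributions \<open>H\<close>
  therefore cancel, and completing the square in the variable \<open>w\<close> of the additional
  function leaves \<open>1 - r\<close> as the only factor of indefinite sign.\<close>

lemma gauss_form_nested:
 assumes v: "!!i. i \<le> m ==> v i \<in> Rn (dd i)"
 shows "\<exists>q\<ge>0. gauss_form {..<Suc m} al L v = (1 - r) * q"
proof -
 define xi where "xi = (%i. (P i)\<^sup>T *\<^sub>v v i)"
 define eta where "eta = (%i. (R i)\<^sup>T *\<^sub>v v i)"
 define w where "w = v m"
 have vi: "v i \<in> Rn (d i)" if "i < m" for i using v[of i] that by (simp add: dd_def)
 have w: "w \<in> Rn n" using v[of m] by (simp add: dd_def w_def)
 have xi: "xi i \<in> Rn n" and eta: "eta i \<in> Rn k" if "i < m" for i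
  unfolding xi_def eta_def
  by (rule mult_mat_vec_carrier[OF transpose_carrier_mat[THEN iffD2, OF P[OF that]] vi[OF that]]
   mult_mat_vec_carrier[OF transpose_carrier_mat[THEN iffD2, OF R[OF that]] vi[OF that]])+
 have Li: "(L i)\<^sup>T *\<^sub>v v i = xi i @\<^sub>v eta i" if "i < m" for i
  using transpose_hcat_mult_vec[OF P[OF that] R[OF that] vi[OF that]] that by (simp add: L_def xi_def eta_def)
 have Lm: "(L m)\<^sup>T *\<^sub>v v m = w @\<^sub>v 0\<^sub>v k"
  using transpose_hcat_mult_vec[of "1\<^sub>m n" n n "0\<^sub>m n k" k w] w by (simp add: L_def w_def[symmetric] zero_mult_mat_vec)
 have ip: "(xi i @\<^sub>v eta i) \<bullet> (xi j @\<^sub>v eta j) = xi i \<bullet> xi j + eta i \<bullet> eta j" if "i < m" "j < m" for i j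
  by (rule scalar_prod_append[OF xi[OF that(1)] eta[OF that(1)] xi[OF that(2)] eta[OF that(2)]])
 have ipm: "(xi i @\<^sub>v eta i) \<bullet> (w @\<^sub>v 0\<^sub>v k) = xi i \<bullet> w" "(w @\<^sub>v 0\<^sub>v k) \<bullet> (xi i @\<^sub>v eta i) = xi i \<bullet> w" if "i < m" for i
  using scalar_prod_append[OF xi[OF that] eta[OF that] w zero_carrier_vec]
   scalar_prod_append[OF w zero_carrier_vec xi[OF that] eta[OF that]] eta[OF that] comm_scalar_prod[OF w xi[OF that]] by simp_all
 have ipw: "(w @\<^sub>v 0\<^sub>v k) \<bullet> (w @\<^sub>v 0\<^sub>v k) = w \<bullet> w"
  using scalar_prod_append[OF w zero_carrier_vec w zero_carrier_vec] by simp
 define S where "S = (\<Sum>i<m. \<Sum>j<m. s i * s j * (xi i \<bullet> xi j))"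
 define T where "T = (\<Sum>i<m. s i * (xi i \<bullet> w))"
 define H where "H = (\<Sum>i<m. \<Sum>j<m. s i * s j * (eta i \<bullet> eta j))"
 have o: "r * (xi i \<bullet> xi j) + eta i \<bullet> eta j = (if i = j then kap * (v i \<bullet> v i) else 0)" if "i < m" "j < m" for i j
  using orth[OF that vi[OF that(1)] vi[OF that(2)]] by (auto simp: xi_def eta_def)
 have "r * S + H = (\<Sum>i<m. \<Sum>j<m. s i * s j * (r * (xi i \<bullet> xi j) + eta i \<bullet> eta j))"
  unfolding S_def H_def by (simp add: sum_distrib_left sum.distrib algebra_simps)
 also have "... = (\<Sum>i<m. \<Sum>j<m. if i = j then s i * s j * (kap * (v i \<bullet> v i)) else 0)"
  by (intro sum.cong refl) (simp add: o)
 also have "... = (\<Sum>i<m. s i * (kap * s i * (v i \<bullet> v i)))"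
  by (intro sum.cong refl) (simp add: mult_ac)
 also have "... = (\<Sum>i<m. s i * (xi i \<bullet> xi i + eta i \<bullet> eta i))"
  using scalar_prod_cov[OF _ vi] by (intro sum.cong refl) (simp add: xi_def eta_def)
 finally have diag: "(\<Sum>i<m. s i * (xi i \<bullet> xi i + eta i \<bullet> eta i)) = r * S + H" ..
 define b where "b = 1 - 1 / r"
 \<comment> \<open>From here on \<open>b\<close> is the exponent of the additional function;
   \<open>b * (1 - b) = b / r\<close> supplies the coefficient of
   \<open>w \<bullet> w\<close>.\<close>
 have a_i: "al i = s i" if "i < m" for i using that by (simp add: al_def)
 have am: "al m = b" by (simp add: al_def b_def)
 have "gauss_form {..<Suc m} al L v = (S + H + b * T + (b * T + b * b * (w \<bullet> w))) - ((r * S + H) + b * (w \<bullet> w))"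
 proof -
  have 1: "(\<Sum>j<Suc m. al i * al j * (((L i)\<^sup>T *\<^sub>v v i) \<bullet> ((L j)\<^sup>T *\<^sub>v v j)))
   = (\<Sum>j<m. s i * s j * (xi i \<bullet> xi j)) + (\<Sum>j<m. s i * s j * (eta i \<bullet> eta j)) + b * (s i * (xi i \<bullet> w))" if "i < m" for i
  proof -
   have a: "al i * al j * (((L i)\<^sup>T *\<^sub>v v i) \<bullet> ((L j)\<^sup>T *\<^sub>v v j)) = s i * s j * (xi i \<bullet> xi j) + s i * s j * (eta i \<bullet> eta j)" if "j < m" for j
    unfolding a_i[OF \<open>i < m\<close>] a_i[OF that] Li[OF \<open>i < m\<close>] Li[OF that] ip[OF \<open>i < m\<close> that] by (rule distrib_left)
   have b: "al i * al m * (((L i)\<^sup>T *\<^sub>v v i) \<bullet> ((L m)\<^sup>T *\<^sub>v v m)) = b * (s i * (xi i \<bullet> w))"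
    unfolding a_i[OF \<open>i < m\<close>] am Li[OF \<open>i < m\<close>] Lm ipm[OF \<open>i < m\<close>] by (simp only: mult_ac)
   show ?thesis unfolding sum.lessThan_Suc b using a by (simp add: sum.distrib)
  qed
  have 2: "(\<Sum>j<Suc m. al m * al j * (((L m)\<^sup>T *\<^sub>v v m) \<bullet> ((L j)\<^sup>T *\<^sub>v v j))) = b * T + b * b * (w \<bullet> w)"
   by (simp add: a_i am Li Lm ipm ipw T_def sum_distrib_left mult.assoc)
  have 3: "(\<Sum>i<Suc m. al i * (((L i)\<^sup>T *\<^sub>v v i) \<bullet> ((L i)\<^sup>T *\<^sub>v v i))) = (\<Sum>i<m. s i * (xi i \<bullet> xi i + eta i \<bullet> eta i)) + b * (w \<bullet> w)"
   by (simp add: a_i am Li Lm ip ipw)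
  have "(\<Sum>i<Suc m. \<Sum>j<Suc m. al i * al j * (((L i)\<^sup>T *\<^sub>v v i) \<bullet> ((L j)\<^sup>T *\<^sub>v v j)))
   = (\<Sum>i<m. (\<Sum>j<m. s i * s j * (xi i \<bullet> xi j)) + (\<Sum>j<m. s i * s j * (eta i \<bullet> eta j)) + b * (s i * (xi i \<bullet> w))) + (b * T + b * b * (w \<bullet> w))"
   unfolding sum.lessThan_Suc[of _ m] 2[unfolded sum.lessThan_Suc]
   using 1[unfolded sum.lessThan_Suc] by simp
  also have "... = S + H + b * T + (b * T + b * b * (w \<bullet> w))"
   by (simp add: sum.distrib S_def H_def T_def sum_distrib_left)
  finally show ?thesis unfolding gauss_form_def 3 diag by simp
 qed
 also have "... = (1 - r) * S + 2 * b * T - b / r * (w \<bullet> w)"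
  using r by (simp add: b_def field_simps)
 finally have gf: "gauss_form {..<Suc m} al L v = (1 - r) * S + 2 * b * T - b / r * (w \<bullet> w)" .
 \<comment> \<open>The square is that of \<open>Xi - w / r\<close>, where \<open>Xi\<close> is the
   weighted sum of the outer components; \<open>S\<close> is its squared length and \<open>T\<close>
   its product with \<open>w\<close>.\<close>
 define Xi where "Xi = vec n (%l. \<Sum>i<m. s i * xi i $ l)"
 have Xic: "Xi \<in> Rn n" by (simp add: Xi_def)
 have Xiu: "Xi \<bullet> u = (\<Sum>i<m. s i * (xi i \<bullet> u))" if "u \<in> Rn n" for u
 proof -
  have "Xi \<bullet> u = (\<Sum>l = 0..<n. \<Sum>i<m. s i * (xi i $ l * u $ l))"
   using that by (simp add: Xi_def scalar_prod_def sum_distrib_right mult.assoc)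
  also have "... = (\<Sum>i<m. \<Sum>l = 0..<n. s i * (xi i $ l * u $ l))" by (rule sum.swap)
  also have "... = (\<Sum>i<m. s i * (xi i \<bullet> u))"
   using that by (simp add: scalar_prod_def sum_distrib_left)
  finally show ?thesis .
 qed
 have XT: "Xi \<bullet> w = T" unfolding Xiu[OF w] T_def ..
 have "Xi \<bullet> Xi = (\<Sum>i<m. s i * (Xi \<bullet> xi i))"
  unfolding Xiu[OF Xic] using xi comm_scalar_prod[OF Xic] by (intro sum.cong refl) simp
 also have "... = S"
  unfolding S_def
 proof (intro sum.cong refl)
  fix i assume i: "i \<in> {..<m}"
  show "s i * (Xi \<bullet> xi i) = (\<Sum>j<m. s i * s j * (xi i \<bullet> xi j))"
   using i comm_scalar_prod[OF xi xi, of i] by (simp add: Xiu[OF xi] sum_distrib_left mult.assoc)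
 qed
 finally have XS: "Xi \<bullet> Xi = S" .
 define q where "q = S - 2 / r * T + (w \<bullet> w) / (r * r)"
 have "(Xi - (1 / r) \<cdot>\<^sub>v w) \<bullet> (Xi - (1 / r) \<cdot>\<^sub>v w) = q"
 proof -
  have c: "(1 / r) \<cdot>\<^sub>v w \<in> Rn n" using w by simp
  have "(Xi - (1 / r) \<cdot>\<^sub>v w) \<bullet> (Xi - (1 / r) \<cdot>\<^sub>v w) = Xi \<bullet> Xi - Xi \<bullet> ((1 / r) \<cdot>\<^sub>v w) - (((1 / r) \<cdot>\<^sub>v w) \<bullet> Xi - ((1 / r) \<cdot>\<^sub>v w) \<bullet> ((1 / r) \<cdot>\<^sub>v w))"
   unfolding minus_scalar_prod_distrib[OF Xic c minus_carrier_vec[OF Xic c]]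
    scalar_prod_minus_distrib[OF Xic Xic c] scalar_prod_minus_distrib[OF c Xic c] ..
  moreover have "Xi \<bullet> ((1 / r) \<cdot>\<^sub>v w) = T / r" "((1 / r) \<cdot>\<^sub>v w) \<bullet> Xi = T / r" "((1 / r) \<cdot>\<^sub>v w) \<bullet> ((1 / r) \<cdot>\<^sub>v w) = (w \<bullet> w) / (r * r)"
   using Xic w comm_scalar_prod[OF w Xic] by (simp_all add: XT)
  moreover have "2 / r * T = T / r + T / r" by simp
  ultimately show ?thesis unfolding XS q_def by linarith
 qed
 then have "0 \<le> q" using scalar_prod_self_nonneg by metis
 moreover have "(1 - r) * S + 2 * b * T - b / r * (w \<bullet> w) = (1 - r) * q"
 proof -
  have b: "b = - ((1 - r) / r)" using r by (simp add: b_def field_simps)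
  show ?thesis unfolding b q_def using r by (simp add: field_simps)
 qed
 ultimately show ?thesis using gf by auto
qed

lemma integral_gauss_vec_append:
 fixes g :: "real vec => real"
 assumes g: "g \<in> borel_fun (n + k)" and b: "!!z. z \<in> Rn (n + k) ==> 0 \<le> g z \<and> g z \<le> B"
 shows "(\<integral> z. g z \<partial>gauss (n + k)) = (\<integral> x. \<integral> y. g (x @\<^sub>v y) \<partial>gauss k \<partial>gauss n)"
  and "integrable (gauss n) (%x. \<integral> y. g (x @\<^sub>v y) \<partial>gauss k)"
  and "!!x. x \<in> Rn n ==> integrable (gauss k) (%y. g (x @\<^sub>v y))"
proof -
 interpret gauss: sigma_finite_measure "gauss k" by (rule sigma_finite_gauss_vec)
 have sndm: "snd \<in> leb n \<Otimes>\<^sub>M gauss k \<rightarrow>\<^sub>M leb k"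
  using measurable_snd[of "leb n" "gauss k"] by (simp add: measurable_gauss_vec_target)
 have mp: "(%z. g (fst z @\<^sub>v snd z)) \<in> borel_measurable (leb n \<Otimes>\<^sub>M gauss k)"
  by (rule measurable_compose[OF measurable_append_vec[OF measurable_fst sndm] g])
 let ?h = "%x. \<integral> y. g (x @\<^sub>v y) \<partial>gauss k"
 have gb: "0 \<le> g (x @\<^sub>v y)" "g (x @\<^sub>v y) \<le> B" if "x \<in> Rn n" "y \<in> Rn k" for x y
  using b[OF append_carrier_vec[OF that]] by auto
 show int1: "integrable (gauss k) (%y. g (x @\<^sub>v y))" if x: "x \<in> Rn n" for x
 proof (rule integrable_gauss_bounded)
  show "(%y. g (x @\<^sub>v y)) \<in> borel_fun k"
   by (rule measurable_compose[OF measurable_append_vec[OF measurable_vec_const[OF x] measurable_ident_sets[OF refl]] g])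
  show "\<bar>g (x @\<^sub>v y)\<bar> \<le> B" if "y \<in> Rn k" for y
   using gb[OF x that] by linarith
 qed
 have h0: "0 \<le> ?h x" if "x \<in> Rn n" for x
  by (rule integral_nonneg_AE, rule AE_I2, rule gb(1)[OF that]) simp
 have hB: "?h x \<le> B" if "x \<in> Rn n" for x
  using integral_gauss_le[OF int1[OF that] integrable_gauss_const[of k B] gb(2)[OF that]] by simp
 have hm: "?h \<in> borel_fun n"
  using mp by (intro gauss.borel_measurable_lebesgue_integral) (simp add: case_prod_beta)
 show int2: "integrable (gauss n) ?h"
 proof (rule integrable_gauss_bounded[OF hm])
  show "\<bar>?h x\<bar> \<le> B" if "x \<in> Rn n" for x
   unfolding abs_of_nonneg[OF h0[OF that]] by (rule hB[OF that])
 qed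
 have int3: "integrable (gauss (n + k)) g"
  using b by (intro integrable_gauss_bounded[OF g, of B]) simp
 have gm: "(%z. ennreal (g z)) \<in> borel_fun (n + k)" using g by simp
 have "ennreal (\<integral> z. g z \<partial>gauss (n + k)) = (\<integral>\<^sup>+ z. ennreal (g z) \<partial>gauss (n + k))"
  using b by (intro nn_integral_eq_integral[symmetric] int3 AE_I2) simp
 also have "... = (\<integral>\<^sup>+ x. \<integral>\<^sup>+ y. ennreal (g (x @\<^sub>v y)) \<partial>gauss k \<partial>gauss n)"
  by (rule nn_integral_gauss_vec_append[OF gm])
 also have "... = (\<integral>\<^sup>+ x. ennreal (?h x) \<partial>gauss n)"
  using gb(1) by (intro nn_integral_cong nn_integral_eq_integral int1 AE_I2) simp_all
 also have "... = ennreal (\<integral> x. ?h x \<partial>gauss n)"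
  by (rule nn_integral_eq_integral[OF int2], rule AE_I2, rule h0) simp
 finally show "(\<integral> z. g z \<partial>gauss (n + k)) = (\<integral> x. ?h x \<partial>gauss n)"
 proof (subst (asm) ennreal_inj)
  show "0 \<le> (\<integral> z. g z \<partial>gauss (n + k))" using b by (intro integral_nonneg_AE AE_I2) simp
  show "0 \<le> (\<integral> x. ?h x \<partial>gauss n)"
   by (rule integral_nonneg_AE, rule AE_I2, rule h0) simp
 qed
qed

text \<open>By \<open>cov\<close>, \<open>L i\<close> divided by \<open>sqrt (kap * s i)\<close> has
  orthonormal rows.\<close>

lemma integral_L:
 fixes g :: "real vec => real"
 assumes i: "i < m" and g: "g \<in> borel_fun (d i)"
 shows "(\<integral> z. g (L i *\<^sub>v z) \<partial>gauss (n + k)) = (\<integral> u. g (sqrt (kap * s i) \<cdot>\<^sub>v u) \<partial>gauss (d i))"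
proof -
 define t where "t = sqrt (kap * s i)"
 have t: "0 < t" "t * t = kap * s i" using kap s[OF i] by (simp_all add: t_def)
 define B where "B = (1 / t) \<cdot>\<^sub>m L i"
 have Li: "L i \<in> Mat (d i) (n + k)" using L[of i] i by (simp add: dd_def)
 have B: "B \<in> Mat (d i) (n + k)" using Li by (simp add: B_def)
 have LL: "L i * (L i)\<^sup>T = (kap * s i) \<cdot>\<^sub>m 1\<^sub>m (d i)"
  using hcat_mult_transpose[OF P[OF i] R[OF i] P[OF i] R[OF i]] i by (simp add: L_def cov[OF i])
 have BT: "B\<^sup>T = (1 / t) \<cdot>\<^sub>m (L i)\<^sup>T" using Li by (intro eq_matI) (auto simp: B_def)
 have "B * B\<^sup>T = (1 / t) \<cdot>\<^sub>m ((1 / t) \<cdot>\<^sub>m (L i * (L i)\<^sup>T))"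
  unfolding BT using Li unfolding B_def
  by (simp add: mult_smult_assoc_mat[of _ "d i" "n + k" _ "d i"] mult_smult_distrib[of _ "d i" "n + k" _ "d i"])
 also have "... = 1\<^sub>m (d i)"
  unfolding LL t(2)[symmetric] using t(1) by (intro eq_matI) auto
 finally have BB: "B * B\<^sup>T = 1\<^sub>m (d i)" .
 have gt: "(%u. g (t \<cdot>\<^sub>v u)) \<in> borel_fun (d i)"
  by (rule measurable_compose[OF measurable_vec_smult[OF measurable_ident_sets[OF refl] borel_measurable_const] g])
 have "(\<integral> u. g (t \<cdot>\<^sub>v u) \<partial>gauss (d i)) = (\<integral> z. g (t \<cdot>\<^sub>v (B *\<^sub>v z)) \<partial>gauss (n + k))"
  by (rule integral_gauss_vec_coisometry[OF B BB gt, symmetric])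
 also have "... = (\<integral> z. g (L i *\<^sub>v z) \<partial>gauss (n + k))"
 proof (intro Bochner_Integration.integral_cong refl arg_cong[of _ _ g])
  fix z :: "real vec" assume "z \<in> space (gauss (n + k))"
  then have z: "z \<in> Rn (n + k)" by simp
  show "t \<cdot>\<^sub>v (B *\<^sub>v z) = L i *\<^sub>v z"
   unfolding B_def smult_mult_mat_vec[OF Li z] using t(1) by (simp add: smult_smult_assoc)
 qed
 finally show ?thesis by (simp add: t_def)
qed

text \<open>The duality argument. Let \<open>Psi\<close> be the inner integral of the product
  \<open>Z\<close>. With \<open>Psi powr r\<close> as additional function, the left side of the
  Gaussian inequality is the integral of \<open>Z * Psi powr (r - 1)\<close>; integrating over the
  inner variable first turns it into \<open>J\<close>, the integral of \<open>Psi powr r\<close>.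
  The right side is \<open>M * J powr (1 - 1 / r)\<close>, and dividing by the positive power of
  \<open>J\<close> leaves \<open>J powr (1 / r)\<close> against \<open>M\<close>.\<close>

lemma nested_inequality_bounded:
 assumes a: "0 < a" and psim: "!!i. i < m ==> psi i \<in> borel_fun (d i)"
  and psib: "!!i u. i < m ==> u \<in> Rn (d i) ==> a \<le> psi i u \<and> psi i u \<le> b"
 shows "(1 \<le> r \<longrightarrow> ennreal_powr (nested_integral m n k P R r psi) (1 / r) \<le> norm_product m d kap s psi)
  \<and> (r \<le> 1 \<longrightarrow> norm_product m d kap s psi \<le> ennreal_powr (nested_integral m n k P R r psi) (1 / r))"
proof -
 define Z where "Z = (%z. \<Prod>i<m. psi i (L i *\<^sub>v z))"
 define Bz where "Bz = max 1 b ^ m"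
 define az where "az = min 1 a ^ m"
 have Li: "L i \<in> Mat (d i) (n + k)" if "i < m" for i using L[of i] that by (simp add: dd_def)
 have Lc: "L i *\<^sub>v z \<in> Rn (d i)" if "i < m" "z \<in> Rn (n + k)" for i z
  by (rule mult_mat_vec_carrier[OF Li[OF that(1)] that(2)])
 have Zm: "Z \<in> borel_fun (n + k)"
  unfolding Z_def using psim
  by (intro borel_measurable_prod) (auto intro: measurable_compose[OF measurable_mat_lborel_vec[OF Li]])
 have az: "0 < az" using a by (simp add: az_def)
 have psipos: "0 < psi i u" if "i < m" "u \<in> Rn (d i)" for i u using psib[OF that] a by linarith
 have Zb: "az \<le> Z z" "Z z \<le> Bz" if z: "z \<in> Rn (n + k)" for z
 proof -
  have "(\<Prod>i<m. min 1 a) \<le> Z z"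
   unfolding Z_def using psib[OF _ Lc[OF _ z]] a by (intro prod_mono) (auto simp: min_le_iff_disj)
  then show "az \<le> Z z" by (simp add: az_def)
  have "Z z \<le> (\<Prod>i<m. max 1 b)"
   unfolding Z_def
  proof (rule prod_mono)
   fix i assume "i \<in> {..<m}"
   then have i: "i < m" by simp
   show "0 \<le> psi i (L i *\<^sub>v z) \<and> psi i (L i *\<^sub>v z) \<le> max 1 b"
    using psib[OF i Lc[OF i z]] a by (auto simp: le_max_iff_disj)
  qed
  then show "Z z \<le> Bz" by (simp add: Bz_def)
 qed
 have Zb': "0 \<le> Z z \<and> Z z \<le> Bz" if "z \<in> Rn (n + k)" for z using Zb[OF that] az by simp
 have app2: "integrable (gauss n) (%x. \<integral> y. Z (x @\<^sub>v y) \<partial>gauss k)"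
  by (rule integral_gauss_vec_append(2)[OF Zm Zb'])
 have app3: "integrable (gauss k) (%y. Z (x @\<^sub>v y))" if "x \<in> Rn n" for x
  by (rule integral_gauss_vec_append(3)[OF Zm Zb' that])
 define Psi where "Psi = (%x. \<integral> y. Z (x @\<^sub>v y) \<partial>gauss k)"
 have Psib: "az \<le> Psi x" "Psi x \<le> Bz" if x: "x \<in> Rn n" for x
 proof -
  have "az \<le> Z (x @\<^sub>v y)" "Z (x @\<^sub>v y) \<le> Bz" if "y \<in> Rn k" for y
   using Zb[OF append_carrier_vec[OF x that]] by auto
  with integral_gauss_le[OF integrable_gauss_const[of k az] app3[OF x]] integral_gauss_le[OF app3[OF x] integrable_gauss_const[of k Bz]]
  show "az \<le> Psi x" "Psi x \<le> Bz" unfolding Psi_def by simp_all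
 qed
 have Psipos: "0 < Psi x" if "x \<in> Rn n" for x using Psib(1)[OF that] az by simp
 have Psim: "Psi \<in> borel_fun n"
  using borel_measurable_integrable[OF app2] by (simp add: Psi_def[abs_def])
 \<comment> \<open>Raised to \<open>al i\<close>, these give back \<open>psi i\<close> for
   \<open>i < m\<close> and \<open>Psi powr (r - 1)\<close> at index \<open>m\<close>.\<close>
 define h where "h = (%i u. if i < m then psi i u powr (1 / s i) else Psi u powr r)"
 define J where "J = (\<integral> x. Psi x powr r \<partial>gauss n)"
 define M where "M = (\<Prod>i<m. (\<integral> u. psi i (sqrt (kap * s i) \<cdot>\<^sub>v u) powr (1 / s i) \<partial>gauss (d i)) powr s i)"
 define lo where "lo = Min (insert (az powr r) ((%i. a powr (1 / s i)) ` {..<m}))"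
 define hi where "hi = Max (insert (Bz powr r) ((%i. b powr (1 / s i)) ` {..<m}))"
 have lo0: "0 < lo"
  unfolding lo_def using a az by (subst Min_gr_iff) auto
 have hm: "h i \<in> borel_fun (dd i)" if "i \<in> {..<Suc m}" for i
  using that psim[of i] Psim by (cases "i < m") (auto simp: h_def[abs_def] dd_def)
 have hb: "lo \<le> h i u \<and> h i u \<le> hi" if i: "i \<in> {..<Suc m}" and u: "u \<in> Rn (dd i)" for i u
 proof (cases "i < m")
  case True
  then have u': "u \<in> Rn (d i)" using u by (simp add: dd_def)
  have "a powr (1 / s i) \<le> psi i u powr (1 / s i)" "psi i u powr (1 / s i) \<le> b powr (1 / s i)"
   using psib[OF True u'] a s[OF True] by (auto intro!: powr_mono2)
  moreover have "lo \<le> a powr (1 / s i)" "b powr (1 / s i) \<le> hi"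
   unfolding lo_def hi_def using True by (auto intro!: Min_le Max_ge)
  ultimately show ?thesis using True by (simp add: h_def)
 next
  case False
  then have u': "u \<in> Rn n" using u by (simp add: dd_def)
  have "az powr r \<le> Psi u powr r" "Psi u powr r \<le> Bz powr r"
   using Psib[OF u'] az r by (auto intro!: powr_mono2)
  moreover have "lo \<le> az powr r" "Bz powr r \<le> hi"
   unfolding lo_def hi_def by (auto intro!: Min_le Max_ge)
  ultimately show ?thesis using False by (simp add: h_def)
 qed
 have Lz: "L m *\<^sub>v z \<in> Rn n" if "z \<in> Rn (n + k)" for z
  using mult_mat_vec_carrier[OF L that, of m] by (simp add: dd_def)
 have prod: "(\<Prod>i\<in>{..<Suc m}. h i (L i *\<^sub>v z) powr al i) = Z z * Psi (L m *\<^sub>v z) powr (r - 1)" if z: "z \<in> Rn (n + k)" for z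
 proof -
  have "(\<Prod>i<m. h i (L i *\<^sub>v z) powr al i) = Z z"
   unfolding Z_def
  proof (rule prod.cong)
   fix i assume "i \<in> {..<m}"
   then have i: "i < m" by simp
   show "h i (L i *\<^sub>v z) powr al i = psi i (L i *\<^sub>v z)"
    using i s[OF i] psipos[OF i Lc[OF i z]] by (simp add: h_def al_def powr_powr)
  qed simp
  moreover have "h m (L m *\<^sub>v z) powr al m = Psi (L m *\<^sub>v z) powr (r - 1)"
   using r by (simp add: h_def al_def powr_powr right_diff_distrib)
  ultimately show ?thesis by simp
 qed
 let ?Y = "%z. Z z * Psi (L m *\<^sub>v z) powr (r - 1)"
 have Lm: "L m \<in> Mat n (n + k)" using L[of m] by (simp add: dd_def)
 have Ym: "?Y \<in> borel_fun (n + k)"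
  using Zm measurable_compose[OF measurable_mat_lborel_vec[OF Lm] Psim] by simp
 have Yb: "0 \<le> ?Y z \<and> ?Y z \<le> Bz * (az powr (r - 1) + Bz powr (r - 1))" if z: "z \<in> Rn (n + k)" for z
 proof -
  have "Psi (L m *\<^sub>v z) powr (r - 1) \<le> az powr (r - 1) + Bz powr (r - 1)"
   by (rule powr_le_endpoint_sum[OF az Psib[OF Lz[OF z]]])
  then show ?thesis using Zb'[OF z] by (auto intro!: mult_mono)
 qed
 have J_eq: "(\<integral> z. (\<Prod>i\<in>{..<Suc m}. h i (L i *\<^sub>v z) powr al i) \<partial>gauss (n + k)) = J"
 proof -
  have "(\<integral> z. (\<Prod>i\<in>{..<Suc m}. h i (L i *\<^sub>v z) powr al i) \<partial>gauss (n + k)) = (\<integral> z. ?Y z \<partial>gauss (n + k))"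
   by (intro Bochner_Integration.integral_cong refl prod) simp
  also have "... = (\<integral> x. \<integral> y. ?Y (x @\<^sub>v y) \<partial>gauss k \<partial>gauss n)"
   by (rule integral_gauss_vec_append(1)[OF Ym Yb])
  also have "... = J"
   unfolding J_def
  proof (intro Bochner_Integration.integral_cong refl)
   fix x assume "x \<in> space (gauss n)"
   then have x: "x \<in> Rn n" by simp
   have "(\<integral> y. ?Y (x @\<^sub>v y) \<partial>gauss k) = (\<integral> y. Z (x @\<^sub>v y) * Psi x powr (r - 1) \<partial>gauss k)"
    by (intro Bochner_Integration.integral_cong refl) (simp add: L_append(2)[OF x])
   also have "... = Psi x * Psi x powr (r - 1)" by (simp add: Psi_def)
   also have "... = Psi x powr 1 * Psi x powr (r - 1)" using Psipos[OF x] by simp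
   also have "... = Psi x powr r" unfolding powr_add[symmetric] by simp
   finally show "(\<integral> y. ?Y (x @\<^sub>v y) \<partial>gauss k) = Psi x powr r" .
  qed
  finally show ?thesis .
 qed
 have Psirb: "az powr r \<le> Psi x powr r" "Psi x powr r \<le> Bz powr r" if "x \<in> Rn n" for x
  using Psib[OF that] az r by (auto intro!: powr_mono2)
 have Psiint: "integrable (gauss n) (%x. Psi x powr r)"
  using Psim Psirb by (intro integrable_gauss_bounded[of _ _ "Bz powr r"]) auto
 have Jpos: "0 < J"
 proof -
  have "az powr r \<le> J"
   using integral_gauss_le[OF integrable_gauss_const[of n "az powr r"] Psiint Psirb(1)] by (simp add: J_def)
  moreover have "0 < az powr r" using az by simp
  ultimately show ?thesis by linarith
 qed
 have hm_int: "(\<integral> z. h m (L m *\<^sub>v z) \<partial>gauss (n + k)) = J"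
 proof -
  have m1: "(%z. Psi (L m *\<^sub>v z) powr r) \<in> borel_fun (n + k)"
   using measurable_compose[OF measurable_mat_lborel_vec[OF Lm] Psim] by simp
  have b1: "0 \<le> Psi (L m *\<^sub>v z) powr r \<and> Psi (L m *\<^sub>v z) powr r \<le> Bz powr r" if "z \<in> Rn (n + k)" for z
   using Psirb[OF Lz[OF that]] by simp
  have "(\<integral> z. h m (L m *\<^sub>v z) \<partial>gauss (n + k)) = (\<integral> z. Psi (L m *\<^sub>v z) powr r \<partial>gauss (n + k))"
   by (simp add: h_def)
  also have "... = (\<integral> x. \<integral> y. Psi (L m *\<^sub>v (x @\<^sub>v y)) powr r \<partial>gauss k \<partial>gauss n)"
   by (rule integral_gauss_vec_append(1)[OF m1 b1])
  also have "... = (\<integral> x. \<integral> y. Psi x powr r \<partial>gauss k \<partial>gauss n)"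
   by (intro Bochner_Integration.integral_cong refl) (simp add: L_append(2))
  also have "... = J" by (simp add: J_def)
  finally show ?thesis .
 qed
 have hi_int: "(\<integral> z. h i (L i *\<^sub>v z) \<partial>gauss (n + k)) = (\<integral> u. psi i (sqrt (kap * s i) \<cdot>\<^sub>v u) powr (1 / s i) \<partial>gauss (d i))" if i: "i < m" for i
  using integral_L[OF i, of "%u. psi i u powr (1 / s i)"] psim[OF i] i by (simp add: h_def)
 have rhs: "(\<Prod>i\<in>{..<Suc m}. (\<integral> z. h i (L i *\<^sub>v z) \<partial>gauss (n + k)) powr al i) = M * J powr (1 - 1 / r)"
  by (simp add: hm_int hi_int M_def al_def)
 \<comment> \<open>Since the form is \<open>(1 - r)\<close> times a nonnegative number,
   \<open>sgm = 1\<close> is admissible for \<open>1 \<le> r\<close> and \<open>sgm = - 1\<close>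
   for \<open>r \<le> 1\<close>.\<close>
 have ineq: "sgm * J \<le> sgm * (M * J powr (1 - 1 / r))" if sgm: "sgm = 1 \<or> sgm = - 1" "0 \<le> sgm * (r - 1)" for sgm :: real
 proof -
  have Q: "sgm * gauss_form {..<Suc m} al L v \<le> 0" if "!!i. i \<in> {..<Suc m} ==> v i \<in> Rn (dd i)" for v
  proof -
   have "\<exists>q\<ge>0. gauss_form {..<Suc m} al L v = (1 - r) * q"
    by (rule gauss_form_nested) (use that in simp)
   then obtain q where q: "0 \<le> q" "gauss_form {..<Suc m} al L v = (1 - r) * q" by blast
   have "sgm * gauss_form {..<Suc m} al L v = - ((sgm * (r - 1)) * q)" unfolding q(2) by (simp add: algebra_simps)
   moreover have "0 \<le> (sgm * (r - 1)) * q" using q(1) sgm(2) by (rule mult_nonneg_nonneg[rotated])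
   ultimately show ?thesis by linarith
  qed
  show ?thesis
   using gauss_inequality[where I = "{..<Suc m}" and L = L and d = dd and N = "n + k" and h = h and al = al,
     OF _ L lo0 sgm(1) Q hm hb]
   unfolding J_eq rhs by simp
 qed
 have M0: "0 \<le> M" by (simp add: M_def prod_nonneg)
 have Jsplit: "J = J powr (1 / r) * J powr (1 - 1 / r)"
  using Jpos by (simp add: powr_add[symmetric])
 have Jp: "0 < J powr (1 - 1 / r)" using Jpos by simp
 have le: "J powr (1 / r) \<le> M" if "1 \<le> r"
 proof -
  have "J powr (1 / r) * J powr (1 - 1 / r) \<le> M * J powr (1 - 1 / r)"
   using ineq[of 1] that Jsplit by simp
  then show ?thesis using Jp by (simp only: mult_le_cancel_right_pos)
 qed
 have ge: "M \<le> J powr (1 / r)" if "r \<le> 1"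
 proof -
  have "M * J powr (1 - 1 / r) \<le> J powr (1 / r) * J powr (1 - 1 / r)"
   using ineq[of "- 1"] that Jsplit by simp
  then show ?thesis using Jp by (simp only: mult_le_cancel_right_pos)
 qed
 have "nested_integral m n k P R r psi = (\<integral>\<^sup>+ x. ennreal (Psi x powr r) \<partial>gauss n)"
  unfolding nested_integral_def
 proof (intro nn_integral_cong)
  fix x assume "x \<in> space (gauss n)"
  then have x: "x \<in> Rn n" by simp
  have "(\<integral>\<^sup>+ y. ennreal (\<Prod>i<m. psi i (P i *\<^sub>v x + R i *\<^sub>v y)) \<partial>gauss k) = (\<integral>\<^sup>+ y. ennreal (Z (x @\<^sub>v y)) \<partial>gauss k)"
   by (intro nn_integral_cong) (simp add: Z_def L_append(1)[OF x])
  also have "... = ennreal (Psi x)"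
   unfolding Psi_def using Zb'[OF append_carrier_vec[OF x]]
   by (intro nn_integral_eq_integral app3[OF x] AE_I2) simp
  finally show "ennreal_powr (\<integral>\<^sup>+ y. ennreal (\<Prod>i<m. psi i (P i *\<^sub>v x + R i *\<^sub>v y)) \<partial>gauss k) r = ennreal (Psi x powr r)"
   using Psipos[OF x] by (simp add: ennreal_powr_ennreal)
 qed
 also have "... = ennreal J"
  unfolding J_def by (intro nn_integral_eq_integral Psiint AE_I2) simp
 finally have 1: "ennreal_powr (nested_integral m n k P R r psi) (1 / r) = ennreal (J powr (1 / r))"
  using Jpos by (simp add: ennreal_powr_ennreal)
 have "norm_product m d kap s psi = (\<Prod>i<m. ennreal ((\<integral> u. psi i (sqrt (kap * s i) \<cdot>\<^sub>v u) powr (1 / s i) \<partial>gauss (d i)) powr s i))"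
  unfolding norm_product_def
 proof (rule prod.cong)
  fix i assume "i \<in> {..<m}"
  then have i: "i < m" by simp
  have g: "(%u. psi i (sqrt (kap * s i) \<cdot>\<^sub>v u) powr (1 / s i)) \<in> borel_fun (d i)"
   using measurable_compose[OF measurable_vec_smult[OF measurable_ident_sets[OF refl] borel_measurable_const] psim[OF i]] by simp
  have "integrable (gauss (d i)) (%u. psi i (sqrt (kap * s i) \<cdot>\<^sub>v u) powr (1 / s i))"
  proof (rule integrable_gauss_bounded[OF g])
   show "\<bar>psi i (sqrt (kap * s i) \<cdot>\<^sub>v u) powr (1 / s i)\<bar> \<le> b powr (1 / s i)" if "u \<in> Rn (d i)" for u
    using psib[OF i, of "sqrt (kap * s i) \<cdot>\<^sub>v u"] that a s[OF i] by (auto intro!: powr_mono2)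
  qed
  then have "(\<integral>\<^sup>+ u. ennreal (psi i (sqrt (kap * s i) \<cdot>\<^sub>v u) powr (1 / s i)) \<partial>gauss (d i))
   = ennreal (\<integral> u. psi i (sqrt (kap * s i) \<cdot>\<^sub>v u) powr (1 / s i) \<partial>gauss (d i))"
   by (intro nn_integral_eq_integral AE_I2) simp_all
  then show "ennreal_powr (\<integral>\<^sup>+ u. ennreal (psi i (sqrt (kap * s i) \<cdot>\<^sub>v u) powr (1 / s i)) \<partial>gauss (d i)) (s i)
   = ennreal ((\<integral> u. psi i (sqrt (kap * s i) \<cdot>\<^sub>v u) powr (1 / s i) \<partial>gauss (d i)) powr s i)"
   by (simp add: ennreal_powr_ennreal integral_nonneg_AE)
 qed simp
 also have "... = ennreal M" unfolding M_def by (rule prod_ennreal) simp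
 finally have 2: "norm_product m d kap s psi = ennreal M" .
 show ?thesis
  unfolding 1 2 using le ge by (auto intro!: ennreal_leI)
qed

text \<open>Both sides are continuous along uniformly bounded and along increasing sequences. The
  first mode removes the positive lower bound on the functions, the second the upper bound.\<close>

lemma nested_tendsto:
 assumes mpsi: "!!l i. i < m ==> psil l i \<in> borel_fun (d i)"
  and nn: "!!l i u. i < m ==> u \<in> Rn (d i) ==> 0 \<le> psil l i u"
  and lim: "!!i u. i < m ==> u \<in> Rn (d i) ==> (%l::nat. psil l i u) \<longlonglongrightarrow> psi i u"
  and mode: "(\<exists>B. \<forall>l. \<forall>i<m. \<forall>u\<in>Rn (d i). psil l i u \<le> B) \<or> (\<forall>l. \<forall>i<m. \<forall>u\<in>Rn (d i). psil l i u \<le> psil (Suc l) i u)"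
 shows "(%l. nested_integral m n k P R r (psil l)) \<longlonglongrightarrow> nested_integral m n k P R r psi"
  and "(%l. norm_product m d kap s (psil l)) \<longlonglongrightarrow> norm_product m d kap s psi"
proof -
 interpret gauss: sigma_finite_measure "gauss k" by (rule sigma_finite_gauss_vec)
 have mpsi': "psi i \<in> borel_fun (d i)" if "i < m" for i
  by (rule borel_measurable_LIMSEQ_real[OF _ mpsi[OF that]]) (use lim[OF that] in simp)
 have nn': "0 \<le> psi i u" if "i < m" "u \<in> Rn (d i)" for i u
  by (rule LIMSEQ_le_const[OF lim[OF that]]) (use nn[OF that] in auto)
 have cc: "P i *\<^sub>v x + R i *\<^sub>v y \<in> Rn (d i)" if "i < m" "x \<in> Rn n" "y \<in> Rn k" for i x y
  using mult_mat_vec_carrier[OF P[OF that(1)] that(2)] mult_mat_vec_carrier[OF R[OF that(1)] that(3)] by simp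
 let ?F = "%phi x y. ennreal (\<Prod>i<m. phi i (P i *\<^sub>v x + R i *\<^sub>v y))"
 have sndm: "snd \<in> leb n \<Otimes>\<^sub>M gauss k \<rightarrow>\<^sub>M leb k"
  using measurable_snd[of "leb n" "gauss k"] by (simp add: measurable_gauss_vec_target)
 have Fm2: "(%z. ?F phi (fst z) (snd z)) \<in> borel_measurable (leb n \<Otimes>\<^sub>M gauss k)"
  if "!!i. i < m ==> phi i \<in> borel_fun (d i)" for phi
 proof -
  have "(%z. \<Prod>i<m. phi i (P i *\<^sub>v fst z + R i *\<^sub>v snd z)) \<in> borel_measurable (leb n \<Otimes>\<^sub>M gauss k)"
  proof (rule borel_measurable_prod)
   fix i assume "i \<in> {..<m}"
   then have i: "i < m" by simp
   show "(%z. phi i (P i *\<^sub>v fst z + R i *\<^sub>v snd z)) \<in> borel_measurable (leb n \<Otimes>\<^sub>M gauss k)"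
    by (rule measurable_compose[OF measurable_vec_add[OF measurable_mult_mat_vec[OF P[OF i] measurable_fst] measurable_mult_mat_vec[OF R[OF i] sndm]] that[OF i]])
  qed
  then show ?thesis by simp
 qed
 have Fm1: "?F phi x \<in> borel_fun k"
  if "!!i. i < m ==> phi i \<in> borel_fun (d i)" and x: "x \<in> Rn n" for phi x
 proof -
  have "(%y. (x, y)) \<in> gauss k \<rightarrow>\<^sub>M leb n \<Otimes>\<^sub>M gauss k"
   using x by (intro measurable_Pair1') simp
  from measurable_compose[OF this Fm2[OF that(1)]] show ?thesis by simp
 qed
 let ?G = "%phi x. \<integral>\<^sup>+ y. ?F phi x y \<partial>gauss k"
 have Gm: "?G phi \<in> borel_fun n"
  if "!!i. i < m ==> phi i \<in> borel_fun (d i)" for phi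
  using Fm2[OF that] by (intro gauss.borel_measurable_nn_integral) (simp add: case_prod_beta)
 have Flim: "(%l. ?F (psil l) x y) \<longlonglongrightarrow> ?F psi x y" if "x \<in> Rn n" "y \<in> Rn k" for x y
  by (intro tendsto_ennrealI tendsto_prod lim cc that) simp_all
 have Fmode: "(\<exists>B<\<infinity>. \<forall>l. \<forall>x\<in>Rn n. \<forall>y\<in>Rn k. ?F (psil l) x y \<le> B)
  \<or> (\<forall>l. \<forall>x\<in>Rn n. \<forall>y\<in>Rn k. ?F (psil l) x y \<le> ?F (psil (Suc l)) x y)"
  using mode
 proof
  assume "\<exists>B. \<forall>l. \<forall>i<m. \<forall>u\<in>Rn (d i). psil l i u \<le> B"
  then obtain B where B: "!!l i u. i < m ==> u \<in> Rn (d i) ==> psil l i u \<le> B" by blast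
  have "?F (psil l) x y \<le> ennreal (B ^ m)" if "x \<in> Rn n" "y \<in> Rn k" for l x y
  proof (rule ennreal_leI)
   have "(\<Prod>i<m. psil l i (P i *\<^sub>v x + R i *\<^sub>v y)) \<le> (\<Prod>i<m. B)"
    using B[OF _ cc[OF _ that]] nn[OF _ cc[OF _ that]] by (intro prod_mono) simp
   then show "(\<Prod>i<m. psil l i (P i *\<^sub>v x + R i *\<^sub>v y)) \<le> B ^ m" by simp
  qed
  then show ?thesis by (intro disjI1 exI[of _ "ennreal (B ^ m)"]) auto
 next
  assume inc: "\<forall>l. \<forall>i<m. \<forall>u\<in>Rn (d i). psil l i u \<le> psil (Suc l) i u"
  have "?F (psil l) x y \<le> ?F (psil (Suc l)) x y" if "x \<in> Rn n" "y \<in> Rn k" for l x y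
  proof (rule ennreal_leI, rule prod_mono)
   fix i assume "i \<in> {..<m}"
   then have i: "i < m" by simp
   show "0 \<le> psil l i (P i *\<^sub>v x + R i *\<^sub>v y) \<and> psil l i (P i *\<^sub>v x + R i *\<^sub>v y) \<le> psil (Suc l) i (P i *\<^sub>v x + R i *\<^sub>v y)"
    using inc i nn[OF i cc[OF i that]] cc[OF i that] by blast
  qed
  then show ?thesis by blast
 qed
 have Glim: "(%l. ?G (psil l) x) \<longlonglongrightarrow> ?G psi x" if x: "x \<in> Rn n" for x
 proof (rule nn_integral_gauss_tendsto)
  show "?F (psil l) x \<in> borel_fun k" for l by (rule Fm1[OF mpsi x])
  show "?F psi x \<in> borel_fun k" by (rule Fm1[OF mpsi' x])
  show "(%l. ?F (psil l) x v) \<longlonglongrightarrow> ?F psi x v" if "v \<in> Rn k" for v by (rule Flim[OF x that])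
  show "(\<exists>B<\<infinity>. \<forall>l. \<forall>v\<in>Rn k. ?F (psil l) x v \<le> B) \<or> (\<forall>l. \<forall>v\<in>Rn k. ?F (psil l) x v \<le> ?F (psil (Suc l)) x v)"
   using Fmode x by meson
 qed
 have Gmode: "(\<exists>B<\<infinity>. \<forall>l. \<forall>x\<in>Rn n. ennreal_powr (?G (psil l) x) r \<le> B)
  \<or> (\<forall>l. \<forall>x\<in>Rn n. ennreal_powr (?G (psil l) x) r \<le> ennreal_powr (?G (psil (Suc l)) x) r)"
  using Fmode
 proof
  assume "\<exists>B<\<infinity>. \<forall>l. \<forall>x\<in>Rn n. \<forall>y\<in>Rn k. ?F (psil l) x y \<le> B"
  then obtain B where B: "B < \<infinity>" "!!l x y. x \<in> Rn n ==> y \<in> Rn k ==> ?F (psil l) x y \<le> B" by blast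
  have "ennreal_powr (?G (psil l) x) r \<le> ennreal_powr B r" if x: "x \<in> Rn n" for l x
  proof (rule ennreal_powr_mono[OF _ r])
   have "?G (psil l) x \<le> (\<integral>\<^sup>+ y. B \<partial>gauss k)" by (intro nn_integral_mono B(2) x) simp
   then show "?G (psil l) x \<le> B" by (simp add: emeasure_gauss_vec_space)
  qed
  moreover have "ennreal_powr B r < \<infinity>" using B(1) by (auto simp: ennreal_powr_def)
  ultimately show ?thesis by blast
 next
  assume inc: "\<forall>l. \<forall>x\<in>Rn n. \<forall>y\<in>Rn k. ?F (psil l) x y \<le> ?F (psil (Suc l)) x y"
  have "ennreal_powr (?G (psil l) x) r \<le> ennreal_powr (?G (psil (Suc l)) x) r" if x: "x \<in> Rn n" for l x
   by (intro ennreal_powr_mono[OF _ r] nn_integral_mono) (use inc x in simp)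
  then show ?thesis by blast
 qed
 show "(%l. nested_integral m n k P R r (psil l)) \<longlonglongrightarrow> nested_integral m n k P R r psi"
  unfolding nested_integral_def
 proof (rule nn_integral_gauss_tendsto)
  show "(%x. ennreal_powr (?G (psil l) x) r) \<in> borel_fun n" for l
   by (intro measurable_ennreal_powr Gm mpsi)
  show "(%x. ennreal_powr (?G psi x) r) \<in> borel_fun n"
   by (intro measurable_ennreal_powr Gm mpsi')
 qed (use Gmode in \<open>auto intro!: tendsto_ennreal_powr Glim r\<close>)
 let ?H = "%phi i. \<integral>\<^sup>+ u. ennreal (phi (sqrt (kap * s i) \<cdot>\<^sub>v u) powr (1 / s i)) \<partial>gauss (d i)"
 have Hlim: "(%l. ?H (psil l i) i) \<longlonglongrightarrow> ?H (psi i) i" if i: "i < m" for i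
 proof (rule nn_integral_gauss_tendsto)
  have msc: "(%u. sqrt (kap * s i) \<cdot>\<^sub>v u) \<in> leb (d i) \<rightarrow>\<^sub>M leb (d i)"
   by (rule measurable_vec_smult[OF measurable_ident_sets[OF refl] borel_measurable_const])
  show "(%u. ennreal (psil l i (sqrt (kap * s i) \<cdot>\<^sub>v u) powr (1 / s i))) \<in> borel_fun (d i)" for l
   using measurable_compose[OF msc mpsi[OF i]] by simp
  show "(%u. ennreal (psi i (sqrt (kap * s i) \<cdot>\<^sub>v u) powr (1 / s i))) \<in> borel_fun (d i)"
   using measurable_compose[OF msc mpsi'[OF i]] by simp
  have sc: "sqrt (kap * s i) \<cdot>\<^sub>v u \<in> Rn (d i)" if "u \<in> Rn (d i)" for u using that by simp
  have pw: "x powr (1 / s i) \<le> y powr (1 / s i)" if "0 \<le> x" "x \<le> y" for x y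
   using that s[OF i] by (intro powr_mono2) auto
  show "(%l. ennreal (psil l i (sqrt (kap * s i) \<cdot>\<^sub>v u) powr (1 / s i))) \<longlonglongrightarrow> ennreal (psi i (sqrt (kap * s i) \<cdot>\<^sub>v u) powr (1 / s i))"
   if "u \<in> Rn (d i)" for u
  proof (intro tendsto_ennrealI tendsto_powr2 lim i sc that tendsto_const)
   show "\<forall>\<^sub>F l in sequentially. 0 \<le> psil l i (sqrt (kap * s i) \<cdot>\<^sub>v u)"
    by (intro always_eventually allI nn i sc that)
   show "0 < 1 / s i" using s[OF i] by simp
  qed
  show "(\<exists>B<\<infinity>. \<forall>l. \<forall>v\<in>Rn (d i). ennreal (psil l i (sqrt (kap * s i) \<cdot>\<^sub>v v) powr (1 / s i)) \<le> B)
   \<or> (\<forall>l. \<forall>v\<in>Rn (d i). ennreal (psil l i (sqrt (kap * s i) \<cdot>\<^sub>v v) powr (1 / s i)) \<le> ennreal (psil (Suc l) i (sqrt (kap * s i) \<cdot>\<^sub>v v) powr (1 / s i)))"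
   using mode
  proof
   assume "\<exists>B. \<forall>l. \<forall>i<m. \<forall>u\<in>Rn (d i). psil l i u \<le> B"
   then obtain B where B: "!!l u. u \<in> Rn (d i) ==> psil l i u \<le> B" using i by blast
   have "ennreal (psil l i (sqrt (kap * s i) \<cdot>\<^sub>v v) powr (1 / s i)) \<le> ennreal (B powr (1 / s i))" if "v \<in> Rn (d i)" for l v
    by (intro ennreal_leI pw nn i B sc that)
   then show ?thesis by (intro disjI1 exI[of _ "ennreal (B powr (1 / s i))"]) auto
  next
   assume inc: "\<forall>l. \<forall>i<m. \<forall>u\<in>Rn (d i). psil l i u \<le> psil (Suc l) i u"
   have "ennreal (psil l i (sqrt (kap * s i) \<cdot>\<^sub>v v) powr (1 / s i)) \<le> ennreal (psil (Suc l) i (sqrt (kap * s i) \<cdot>\<^sub>v v) powr (1 / s i))"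
    if "v \<in> Rn (d i)" for l v
    by (intro ennreal_leI pw nn i sc that) (use inc i sc[OF that] in blast)
   then show ?thesis by blast
  qed
 qed
 \<comment> \<open>The product of the norms is the one place where 0 and \<infinity> may meet. In
   the bounded mode the limits are finite; in the increasing mode every factor stays below its
   limit.\<close>
 have bnd: "(\<forall>l. \<forall>i<m. ennreal_powr (?H (psil l i) i) (s i) \<le> ennreal_powr (?H (psi i) i) (s i)) \<or> (\<forall>i<m. ennreal_powr (?H (psi i) i) (s i) < \<infinity>)"
  using mode
 proof
  assume "\<exists>B. \<forall>l. \<forall>i<m. \<forall>u\<in>Rn (d i). psil l i u \<le> B"
  then obtain B where B: "!!l i u. i < m ==> u \<in> Rn (d i) ==> psil l i u \<le> B" by blast
  have "?H (psi i) i < \<infinity>" if i: "i < m" for i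
  proof -
   have "psi i u \<le> B" if "u \<in> Rn (d i)" for u
    by (rule LIMSEQ_le_const2[OF lim[OF i that]]) (use B[OF i that] in auto)
   then have "?H (psi i) i \<le> (\<integral>\<^sup>+ u. ennreal (B powr (1 / s i)) \<partial>gauss (d i))"
    using s[OF i] by (intro nn_integral_mono ennreal_leI powr_mono2 nn' i) auto
   also have "... < \<infinity>" by (simp add: emeasure_gauss_vec_space)
   finally show ?thesis .
  qed
  then have "ennreal_powr (?H (psi i) i) (s i) < \<infinity>" if "i < m" for i
   using that by (auto simp: ennreal_powr_def less_top[symmetric])
  then show ?thesis by blast
 next
  assume inc: "\<forall>l. \<forall>i<m. \<forall>u\<in>Rn (d i). psil l i u \<le> psil (Suc l) i u"
  have "ennreal_powr (?H (psil l i) i) (s i) \<le> ennreal_powr (?H (psi i) i) (s i)" if i: "i < m" for l i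
  proof (intro ennreal_powr_mono nn_integral_mono ennreal_leI powr_mono2 nn i s)
   fix u assume "u \<in> space (gauss (d i))"
   then have u: "sqrt (kap * s i) \<cdot>\<^sub>v u \<in> Rn (d i)" by simp
   then show "sqrt (kap * s i) \<cdot>\<^sub>v u \<in> Rn (d i)" .
   have "incseq (%l. psil l i (sqrt (kap * s i) \<cdot>\<^sub>v u))" using inc i u by (intro incseq_SucI) blast
   then show "psil l i (sqrt (kap * s i) \<cdot>\<^sub>v u) \<le> psi i (sqrt (kap * s i) \<cdot>\<^sub>v u)" by (rule incseq_le[OF _ lim[OF i u]])
   show "0 \<le> 1 / s i" using s[OF i] by simp
  qed
  then show ?thesis by blast
 qed
 show "(%l. norm_product m d kap s (psil l)) \<longlonglongrightarrow> norm_product m d kap s psi"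
  unfolding norm_product_def by (rule tendsto_prod_ennreal_mode[OF tendsto_ennreal_powr[OF Hlim s] bnd])
qed

theorem nested_inequality:
 assumes psim: "!!i. i < m ==> psi i \<in> borel_fun (d i)"
  and psi0: "!!i u. i < m ==> u \<in> Rn (d i) ==> 0 \<le> psi i u"
 shows "1 \<le> r ==> ennreal_powr (nested_integral m n k P R r psi) (1 / r) \<le> norm_product m d kap s psi"
  and "r \<le> 1 ==> norm_product m d kap s psi \<le> ennreal_powr (nested_integral m n k P R r psi) (1 / r)"
proof -
 let ?J = "%psi. ennreal_powr (nested_integral m n k P R r psi) (1 / r)" and ?M = "norm_product m d kap s"
 have r': "0 < 1 / r" using r by simp
 \<comment> \<open>Truncation at height \<open>b\<close>; \<open>psil\<close> lifts it above
   \<open>1 / (l + 1)\<close>. First \<open>l\<close> tends to infinity at fixed \<open>b\<close>,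
   under the common bound \<open>b + 1\<close>, and then \<open>b\<close>, monotonically.\<close>
 define psit where "psit = (%b i u. min (psi i u) (real b))"
 define psil where "psil = (%b l i u. psit b i u + inverse (real (Suc l)))"
 have tm: "psit b i \<in> borel_fun (d i)" "psil b l i \<in> borel_fun (d i)" if "i < m" for b l i
  using psim[OF that] by (simp_all add: psit_def psil_def)
 have t0: "0 \<le> psit b i u" "0 \<le> psil b l i u" "psil b l i u \<le> real b + 1" "inverse (real (Suc l)) \<le> psil b l i u"
  if "i < m" "u \<in> Rn (d i)" for b l i u
 proof -
  show 1: "0 \<le> psit b i u" using psi0[OF that] by (simp add: psit_def)
  show "0 \<le> psil b l i u" using 1 by (simp add: psil_def)
  have "psit b i u \<le> real b" by (simp add: psit_def)
  moreover have "inverse (real (Suc l)) \<le> 1" by (simp add: inverse_le_1_iff)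
  ultimately show "psil b l i u \<le> real b + 1" unfolding psil_def by linarith
  show "inverse (real (Suc l)) \<le> psil b l i u" using 1 by (simp add: psil_def)
 qed
 have bounded: "(1 \<le> r \<longrightarrow> ?J (psil b l) \<le> ?M (psil b l)) \<and> (r \<le> 1 \<longrightarrow> ?M (psil b l) \<le> ?J (psil b l))" for b l
  by (rule nested_inequality_bounded[of "inverse (real (Suc l))" _ "real b + 1"]) (use tm t0 in auto)
 have l1: "(%l. ?J (psil b l)) \<longlonglongrightarrow> ?J (psit b)" "(%l. ?M (psil b l)) \<longlonglongrightarrow> ?M (psit b)" for b
 proof -
  have lim: "(%l. psil b l i u) \<longlonglongrightarrow> psit b i u" for i u
   using tendsto_add[OF tendsto_const LIMSEQ_inverse_real_of_nat, of "psit b i u"] by (simp add: psil_def)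
  have mode: "(\<exists>B. \<forall>l. \<forall>i<m. \<forall>u\<in>Rn (d i). psil b l i u \<le> B) \<or> (\<forall>l. \<forall>i<m. \<forall>u\<in>Rn (d i). psil b l i u \<le> psil b (Suc l) i u)"
   using t0(3) by blast
  note nt = nested_tendsto[where psil = "psil b" and psi = "psit b", OF tm(2) t0(2) lim mode]
  show "(%l. ?J (psil b l)) \<longlonglongrightarrow> ?J (psit b)" by (rule tendsto_ennreal_powr[OF nt(1) r'])
  show "(%l. ?M (psil b l)) \<longlonglongrightarrow> ?M (psit b)" by (rule nt(2))
 qed
 have l2: "(%b. ?J (psit b)) \<longlonglongrightarrow> ?J psi" "(%b. ?M (psit b)) \<longlonglongrightarrow> ?M psi"
 proof -
  have lim: "(%b. psit b i u) \<longlonglongrightarrow> psi i u" for i u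
  proof -
   obtain b0 :: nat where b0: "psi i u \<le> real b0" using real_arch_simple by blast
   then have "psit b i u = psi i u" if "b0 \<le> b" for b
    using that by (simp add: psit_def min_def)
   then show ?thesis by (intro tendsto_eventually eventually_sequentiallyI[of b0])
  qed
  have mode: "(\<exists>B. \<forall>b. \<forall>i<m. \<forall>u\<in>Rn (d i). psit b i u \<le> B) \<or> (\<forall>b. \<forall>i<m. \<forall>u\<in>Rn (d i). psit b i u \<le> psit (Suc b) i u)"
   by (auto simp: psit_def)
  note nt = nested_tendsto[where psil = psit and psi = psi, OF tm(1) t0(1) lim mode]
  show "(%b. ?J (psit b)) \<longlonglongrightarrow> ?J psi" by (rule tendsto_ennreal_powr[OF nt(1) r'])
  show "(%b. ?M (psit b)) \<longlonglongrightarrow> ?M psi" by (rule nt(2))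
 qed
 show "?J psi \<le> ?M psi" if "1 \<le> r"
  using LIMSEQ_le[OF l2] LIMSEQ_le[OF l1] bounded that by blast
 show "?M psi \<le> ?J psi" if "r \<le> 1"
  using LIMSEQ_le[OF l2(2,1)] LIMSEQ_le[OF l1(2,1)] bounded that by blast
qed

end

section \<open>Square roots of matrices\<close>

lemma mult_mat_zero_vec: "M \<in> Mat d k ==> M *\<^sub>v 0\<^sub>v k = (0\<^sub>v d :: real vec)"
 by (intro eq_vecI) auto

lemma mat_vec_scalar_prod_sym:
 assumes "M \<in> Mat n n" "M\<^sup>T = M" "x \<in> Rn n" "y \<in> Rn n"
 shows "x \<bullet> (M *\<^sub>v y) = (M *\<^sub>v x) \<bullet> (y :: real vec)"
 using scalar_prod_transpose[OF assms(1,3,4)] assms(2) by simp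

lemma scalar_prod_diff_smult:
 fixes a :: real
 assumes "x \<in> Rn n" "y \<in> Rn n"
 shows "(x - a \<cdot>\<^sub>v y) \<bullet> (x - a \<cdot>\<^sub>v y) = x \<bullet> x - 2 * a * (x \<bullet> y) + a * a * (y \<bullet> y)"
 using assms comm_scalar_prod[OF assms(2,1)]
 by (simp add: minus_scalar_prod_distrib[of _ n] scalar_prod_minus_distrib[of _ n] algebra_simps)

text \<open>The Cauchy-Schwarz inequality for the form of \<open>M\<close>, applied to \<open>x\<close> and \<open>M x\<close>.\<close>

lemma psd_form_bound:
 assumes M: "sym_pos_semidef n M"
 shows "\<exists>Lam>0. \<forall>x\<in>Rn n. (M *\<^sub>v x) \<bullet> (M *\<^sub>v x) \<le> Lam * (x \<bullet> (M *\<^sub>v x))"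
proof -
 have Mc: "M \<in> Mat n n" and Ms: "M\<^sup>T = M" and M0: "!!v. v \<in> Rn n ==> 0 \<le> v \<bullet> (M *\<^sub>v v)"
  using M by (auto simp: sym_pos_semidef_def)
 obtain l where l: "0 \<le> l" "!!x. x \<in> Rn n ==> (M *\<^sub>v x) \<bullet> (M *\<^sub>v x) \<le> l * (x \<bullet> x)"
  using mat_vec_bounded[OF Mc] by blast
 have Mx: "M *\<^sub>v x \<in> Rn n" if "x \<in> Rn n" for x by (rule mult_mat_vec_carrier[OF Mc that])
 define Lam where "Lam = 1 + l"
 have Lam: "0 < Lam" using l(1) by (simp add: Lam_def)
 have form: "x \<bullet> (M *\<^sub>v x) \<le> Lam * (x \<bullet> x)" if x: "x \<in> Rn n" for x
 proof -
  have "0 \<le> (x - 1 \<cdot>\<^sub>v (M *\<^sub>v x)) \<bullet> (x - 1 \<cdot>\<^sub>v (M *\<^sub>v x))" by (rule scalar_prod_self_nonneg)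
  also have "... = x \<bullet> x - 2 * 1 * (x \<bullet> (M *\<^sub>v x)) + 1 * 1 * ((M *\<^sub>v x) \<bullet> (M *\<^sub>v x))"
   by (rule scalar_prod_diff_smult[OF x Mx[OF x]])
  finally have "2 * (x \<bullet> (M *\<^sub>v x)) \<le> x \<bullet> x + l * (x \<bullet> x)" using l(2)[OF x] by simp
  then show ?thesis using M0[OF x] by (simp add: Lam_def distrib_right)
 qed
 have "(M *\<^sub>v x) \<bullet> (M *\<^sub>v x) \<le> Lam * (x \<bullet> (M *\<^sub>v x))" if x: "x \<in> Rn n" for x
 proof -
  define y where "y = M *\<^sub>v x"
  have y: "y \<in> Rn n" using Mx[OF x] by (simp add: y_def)
  have sy: "(1 / Lam) \<cdot>\<^sub>v y \<in> Rn n" using y by simp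
  have "M *\<^sub>v (x - (1 / Lam) \<cdot>\<^sub>v y) = y - (1 / Lam) \<cdot>\<^sub>v (M *\<^sub>v y)"
   unfolding mult_minus_distrib_mat_vec[OF Mc x sy] y_def[symmetric] mult_mat_vec[OF Mc y] ..
  then have "0 \<le> (x - (1 / Lam) \<cdot>\<^sub>v y) \<bullet> (y - (1 / Lam) \<cdot>\<^sub>v (M *\<^sub>v y))"
   using M0[of "x - (1 / Lam) \<cdot>\<^sub>v y"] x sy by simp
  also have "... = x \<bullet> y - (1 / Lam) * (x \<bullet> (M *\<^sub>v y)) - (1 / Lam) * (y \<bullet> y) + (1 / Lam) * ((1 / Lam) * (y \<bullet> (M *\<^sub>v y)))"
   using x y Mx[OF y] by (simp add: minus_scalar_prod_distrib[of _ n] scalar_prod_minus_distrib[of _ n])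
  also have "x \<bullet> (M *\<^sub>v y) = y \<bullet> y" unfolding mat_vec_scalar_prod_sym[OF Mc Ms x y] y_def[symmetric] ..
  finally have "0 \<le> x \<bullet> y - 2 * ((1 / Lam) * (y \<bullet> y)) + (1 / Lam) * ((1 / Lam) * (y \<bullet> (M *\<^sub>v y)))" by linarith
  moreover have "(1 / Lam) * ((1 / Lam) * (y \<bullet> (M *\<^sub>v y))) \<le> (1 / Lam) * (y \<bullet> y)"
   using form[OF y] Lam by (intro mult_left_mono) (simp_all add: field_simps)
  ultimately have "(1 / Lam) * (y \<bullet> y) \<le> x \<bullet> y" by linarith
  then show ?thesis using Lam unfolding y_def by (simp add: field_simps)
 qed
 then show ?thesis using Lam by blast
qed

lemma sym_pos_def_semidef: "sym_pos_def n A ==> sym_pos_semidef n A"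
 unfolding sym_pos_def_def sym_pos_semidef_def
 by (metis less_eq_real_def mult_mat_vec_carrier scalar_prod_left_zero)

lemma sym_pos_def_det:
 assumes "sym_pos_def n A" shows "det A \<noteq> 0"
proof
 assume "det A = 0"
 then obtain v where "v \<in> Rn n" "v \<noteq> 0\<^sub>v n" "A *\<^sub>v v = 0\<^sub>v n"
  using assms det_0_iff_vec_prod_zero_field[of A n] by (auto simp: sym_pos_def_def)
 moreover have "0 < v \<bullet> (A *\<^sub>v v)" using assms calculation by (auto simp: sym_pos_def_def)
 ultimately show False by simp
qed

lemma minv:
 assumes A: "A \<in> Mat n n" and "det A \<noteq> 0"
 shows "A * minv A = 1\<^sub>m n" "minv A * A = 1\<^sub>m n" "minv A \<in> Mat n n"
proof -
 have "A \<in> Units (ring_mat TYPE(real) n ())" by (rule det_non_zero_imp_unit[OF assms])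
 then obtain B where "mat_inverse A = Some B" using mat_inverse(1)[OF A, where b = "()"] by (cases "mat_inverse A") auto
 then show "A * minv A = 1\<^sub>m n" "minv A * A = 1\<^sub>m n" "minv A \<in> Mat n n"
  using mat_inverse(2)[OF A] by (auto simp: minv_def)
qed

lemma minv_eqI:
 assumes A: "A \<in> Mat n n" and B: "B \<in> Mat n n" and AB: "A * B = 1\<^sub>m n"
 shows "minv A = B"
proof -
 have "det A * det B = 1" using det_mult[OF A B] AB by simp
 then have "det A \<noteq> 0" by auto
 note m = minv[OF A this]
 have "minv A = minv A * (A * B)" using m by (simp add: AB)
 also have "... = minv A * A * B" by (rule assoc_mult_mat[OF m(3) A B, symmetric])
 also have "... = B" using m B by simp
 finally show ?thesis .
qed

text \<open>Let \<open>X = B - C\<close>. From \<open>B * B = C * C\<close> follows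
  \<open>B * X = - (X * C)\<close>, so the traces of \<open>X * B * X\<close> and
  \<open>X * C * X\<close> are opposite. Both are sums of nonnegative forms at the columns of
  \<open>X\<close>, hence all these forms vanish, and definiteness of \<open>A\<close> makes the
  columns zero.\<close>

lemma sym_pos_semidef_sqrt_unique:
 assumes A: "sym_pos_def n A" and B: "sym_pos_semidef n B" "B * B = A" and C: "sym_pos_semidef n C" "C * C = A"
 shows "B = C"
proof -
 \<comment> \<open>A semi-definite root of \<open>A\<close> is definite: by
   \<open>psd_form_bound\<close> a vanishing form forces \<open>M v = 0\<close>, hence
   \<open>A v = 0\<close>.\<close>
 have pd: "v = 0\<^sub>v n" if M: "sym_pos_semidef n M" "M * M = A" and v: "v \<in> Rn n" "v \<bullet> (M *\<^sub>v v) \<le> 0" for M v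
 proof -
  have Mc: "M \<in> Mat n n" using M by (simp add: sym_pos_semidef_def)
  obtain Lam where Lam: "0 < Lam" "(M *\<^sub>v v) \<bullet> (M *\<^sub>v v) \<le> Lam * (v \<bullet> (M *\<^sub>v v))" using psd_form_bound[OF M(1)] v(1) by blast
  have "Lam * (v \<bullet> (M *\<^sub>v v)) \<le> 0" using Lam(1) v(2) by (simp add: mult_le_0_iff)
  then have "(M *\<^sub>v v) \<bullet> (M *\<^sub>v v) = 0" using Lam(2) scalar_prod_self_nonneg[of "M *\<^sub>v v"] by linarith
  then have "M *\<^sub>v v = 0\<^sub>v n" by (rule scalar_prod_self_eq_0[OF mult_mat_vec_carrier[OF Mc v(1)]])
  then have "A *\<^sub>v v = 0\<^sub>v n"
   unfolding M(2)[symmetric] using assoc_mult_mat_vec[OF Mc Mc v(1)] mult_mat_zero_vec[OF Mc] by simp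
  then have "v \<bullet> (A *\<^sub>v v) = 0" using v(1) by simp
  then show ?thesis using A v(1) by (force simp: sym_pos_def_def)
 qed
 have Bc: "B \<in> Mat n n" and Cc: "C \<in> Mat n n" and Bs: "B\<^sup>T = B" and Cs: "C\<^sup>T = C"
  using B C by (auto simp: sym_pos_semidef_def)
 define X where "X = B - C"
 have X: "X \<in> Mat n n" unfolding X_def by (rule minus_carrier_mat[OF Cc])
 have ev: "B $$ (i, j) = B $$ (j, i)" "C $$ (i, j) = C $$ (j, i)" if "i < n" "j < n" for i j
  using that Bs Cs Bc Cc by (metis carrier_matD index_transpose_mat(1))+
 define b c where "b = (%i j. B $$ (i, j))" and "c = (%i j. C $$ (i, j))"
 define x where "x = (%i j. b i j - c i j)"
 have xs: "x i j = x j i" if "i < n" "j < n" for i j using ev[OF that] by (simp add: x_def b_def c_def)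
 have cs: "c i j = c j i" if "i < n" "j < n" for i j using ev[OF that] by (simp add: c_def)
 have mm: "(\<Sum>l<n. b i l * b l j) = (\<Sum>l<n. c i l * c l j)" if "i < n" "j < n" for i j
 proof -
  have "(B * B) $$ (i, j) = (C * C) $$ (i, j)" using B(2) C(2) by simp
  then show ?thesis using that Bc Cc by (simp add: b_def c_def scalar_prod_def lessThan_atLeast0)
 qed
 have comm: "(\<Sum>l<n. b i l * x l j) = - (\<Sum>l<n. x i l * c l j)" if "i < n" "j < n" for i j
  unfolding x_def right_diff_distrib left_diff_distrib sum_subtractf mm[OF that] by simp
 have col: "col X j \<in> Rn n" for j using carrier_matD(1)[OF X] by (intro carrier_vecI) simp
 have quad: "col X j \<bullet> (M *\<^sub>v col X j) = (\<Sum>i<n. \<Sum>l<n. x i j * (M $$ (i, l) * x l j))" if M: "M \<in> Mat n n" and j: "j < n" for M j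
 proof -
  have c1: "col X j $ i = x i j" if "i < n" for i
  proof -
   have "col X j $ i = X $$ (i, j)" using X j that by simp
   also have "... = x i j" unfolding X_def x_def b_def c_def using Bc Cc j that by simp
   finally show ?thesis .
  qed
  define y where "y = M *\<^sub>v col X j"
  have y: "y \<in> Rn n" unfolding y_def by (rule mult_mat_vec_carrier[OF M col])
  have c2: "y $ i = (\<Sum>l<n. M $$ (i, l) * x l j)" if i: "i < n" for i
  proof -
   have "y $ i = (\<Sum>l<n. M $$ (i, l) * col X j $ l)"
    unfolding y_def using M i carrier_vecD[OF col] by (simp add: scalar_prod_def lessThan_atLeast0 del: index_col)
   then show ?thesis by (simp add: c1)
  qed
  have "col X j \<bullet> y = (\<Sum>i<n. col X j $ i * y $ i)" using y by (simp add: scalar_prod_def lessThan_atLeast0 del: index_col)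
  also have "... = (\<Sum>i<n. x i j * (\<Sum>l<n. M $$ (i, l) * x l j))" by (simp add: c1 c2)
  finally show ?thesis unfolding y_def by (simp add: sum_distrib_left)
 qed
 have "(\<Sum>j<n. col X j \<bullet> (B *\<^sub>v col X j)) = (\<Sum>j<n. \<Sum>i<n. x i j * (\<Sum>l<n. b i l * x l j))"
  by (simp add: quad[OF Bc] b_def sum_distrib_left)
 also have "... = - (\<Sum>j<n. \<Sum>i<n. \<Sum>l<n. x i j * (x i l * c l j))"
  by (simp add: comm sum_distrib_left sum_negf)
 \<comment> \<open>Cyclic invariance of the trace, written out: exchange of the sums and the
   symmetry of \<open>x\<close> and \<open>c\<close>.\<close>
 also have "(\<Sum>j<n. \<Sum>i<n. \<Sum>l<n. x i j * (x i l * c l j)) = (\<Sum>i<n. \<Sum>j<n. \<Sum>l<n. x i j * (x i l * c l j))"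
  by (rule sum.swap)
 also have "... = (\<Sum>i<n. \<Sum>j<n. \<Sum>l<n. x j i * (c j l * x l i))"
  by (intro sum.cong refl) (auto simp: xs cs)
 also have "... = (\<Sum>j<n. col X j \<bullet> (C *\<^sub>v col X j))"
  by (simp add: quad[OF Cc] c_def)
 finally have tr: "(\<Sum>j<n. col X j \<bullet> (B *\<^sub>v col X j) + col X j \<bullet> (C *\<^sub>v col X j)) = 0"
  by (simp add: sum.distrib)
 have nonneg: "0 \<le> col X j \<bullet> (B *\<^sub>v col X j)" "0 \<le> col X j \<bullet> (C *\<^sub>v col X j)" for j
  using B(1) C(1) col by (auto simp: sym_pos_semidef_def)
 have "col X j \<bullet> (B *\<^sub>v col X j) + col X j \<bullet> (C *\<^sub>v col X j) = 0" if "j < n" for j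
  using tr sum_nonneg_eq_0_iff[of "{..<n}" "%j. col X j \<bullet> (B *\<^sub>v col X j) + col X j \<bullet> (C *\<^sub>v col X j)"] nonneg that
  by (simp add: add_nonneg_nonneg)
 then have "col X j \<bullet> (B *\<^sub>v col X j) \<le> 0" if "j < n" for j using nonneg(2)[of j] that by (metis add.commute add_le_same_cancel2)
 then have c0: "col X j = 0\<^sub>v n" if "j < n" for j using pd[OF B col] that by blast
 show ?thesis
 proof (rule eq_matI)
  fix i j assume "i < dim_row C" "j < dim_col C"
  then have ij: "i < n" "j < n" using Cc by auto
  have "X $$ (i, j) = col X j $ i" using X ij by simp
  also have "... = 0" using c0[OF ij(2)] ij by simp
  finally show "B $$ (i, j) = C $$ (i, j)" using ij Bc Cc by (simp add: X_def)
 qed (use Bc Cc in auto)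
qed

lemma sqrt_mat_eqI:
 assumes A: "sym_pos_def n A" and B: "sym_pos_semidef n B" "B * B = A"
 shows "sqrt_mat A = B"
 unfolding sqrt_mat_def
proof (rule the_equality)
 have n: "dim_row A = n" using A by (auto simp: sym_pos_def_def)
 show "sym_pos_semidef (dim_row A) B \<and> B * B = A" using B n by simp
 show "C = B" if "sym_pos_semidef (dim_row A) C \<and> C * C = A" for C
  using sym_pos_semidef_sqrt_unique[OF A _ _ B] that n by simp
qed

text \<open>The quotient of consecutive coefficients has absolute value
  \<open>\<bar>a - k\<bar> / (k + 1)\<close>, at most 1. The binomial series is therefore dominated
  by a geometric one.\<close>

lemma gchoose_le_1:
 fixes a :: real assumes "0 \<le> a" "a \<le> 1" shows "\<bar>a gchoose k\<bar> \<le> 1"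
proof (induction k)
 case (Suc k)
 have "(a gchoose Suc k) * real (Suc k) = (a gchoose k) * (a - real k)"
  using gbinomial_mult_1[of a k] by (simp add: algebra_simps)
 then have "\<bar>a gchoose Suc k\<bar> * real (Suc k) = \<bar>a gchoose k\<bar> * \<bar>a - real k\<bar>"
  by (metis abs_mult abs_of_nat)
 also have "... \<le> 1 * real (Suc k)"
  using Suc assms by (intro mult_mono) auto
 finally show ?case by (simp del: of_nat_Suc)
qed simp

text \<open>The square root of \<open>1 - B\<close> is the value at \<open>B\<close> of the binomial series of \<open>(1 - z)\<^sup>a\<close> for \<open>a = 1/2\<close>;
 it is positive semi-definite because it is the square of the symmetric matrix obtained for \<open>a = 1/4\<close>.\<close>

definition binom_mat :: "nat => real mat => real => real mat" where
 "binom_mat n B a = mat n n (%(i, j). \<Sum>k. (a gchoose k) * (- 1) ^ k * (B ^\<^sub>m k) $$ (i, j))"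

section \<open>Powers of a matrix and the binomial series\<close>

lemma mat_power_add:
 assumes "B \<in> Mat n n"
 shows "B ^\<^sub>m (k + l) = B ^\<^sub>m k * B ^\<^sub>m l"
proof (induction l)
 case 0
 show ?case using assms pow_carrier_mat[OF assms, of k] by simp
next
 case (Suc l)
 show ?case using Suc assoc_mult_mat[OF pow_carrier_mat[OF assms, of k] pow_carrier_mat[OF assms, of l] assms] by simp
qed

lemma mat_power_transpose:
 fixes B :: "real mat"
 assumes "B \<in> Mat n n" "B\<^sup>T = B"
 shows "(B ^\<^sub>m k)\<^sup>T = B ^\<^sub>m k"
proof (induction k)
 case 0
 show ?case using assms by simp
next
 case (Suc k)
 have "(B ^\<^sub>m Suc k)\<^sup>T = B * B ^\<^sub>m k"
  using transpose_mult[OF pow_carrier_mat[OF assms(1), of k] assms(1)] Suc assms(2) by simp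
 also have "... = B ^\<^sub>m Suc k" using mat_power_add[OF assms(1), of 1 k] assms(1) by simp
 finally show ?case .
qed

context
 fixes n :: nat and B :: "real mat" and q :: real
 assumes B: "B \<in> Mat n n" and Bs: "B\<^sup>T = B"
  and q: "0 \<le> q" "q < 1" and contr: "!!v. v \<in> Rn n ==> (B *\<^sub>v v) \<bullet> (B *\<^sub>v v) \<le> q * q * (v \<bullet> v)"
begin

text \<open>An entry is bounded by the length of its column, and the column is the image of a unit
  vector under \<open>k\<close> contractions.\<close>

lemma mat_power_bound:
 assumes "i < n" "j < n" shows "\<bar>(B ^\<^sub>m k) $$ (i, j)\<bar> \<le> q ^ k"
proof -
 have P: "B ^\<^sub>m k \<in> Mat n n" for k by (rule pow_carrier_mat[OF B])
 have it: "(B ^\<^sub>m k *\<^sub>v v) \<bullet> (B ^\<^sub>m k *\<^sub>v v) \<le> (q ^ k * q ^ k) * (v \<bullet> v)" if "v \<in> Rn n" for v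
  using that
 proof (induction k arbitrary: v)
  case 0
  then show ?case using B by simp
 next
  case (Suc k)
  have Bv: "B *\<^sub>v v \<in> Rn n" by (rule mult_mat_vec_carrier[OF B Suc.prems])
  have e: "B ^\<^sub>m Suc k *\<^sub>v v = B ^\<^sub>m k *\<^sub>v (B *\<^sub>v v)"
   using assoc_mult_mat_vec[OF P[of k] B Suc.prems] by simp
  have "(B ^\<^sub>m Suc k *\<^sub>v v) \<bullet> (B ^\<^sub>m Suc k *\<^sub>v v) \<le> (q ^ k * q ^ k) * ((B *\<^sub>v v) \<bullet> (B *\<^sub>v v))"
   unfolding e by (rule Suc.IH[OF Bv])
  also have "... \<le> (q ^ k * q ^ k) * (q * q * (v \<bullet> v))"
   using q by (intro mult_left_mono contr Suc.prems) simp
  finally show ?case by (simp add: mult_ac)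
 qed
 define w where "w = B ^\<^sub>m k *\<^sub>v unit_vec n j"
 have wc: "w \<in> Rn n" unfolding w_def by (rule mult_mat_vec_carrier[OF P]) simp
 have wi: "w $ i = (B ^\<^sub>m k) $$ (i, j)"
  using carrier_matD[OF P[of k]] assms by (simp add: w_def scalar_prod_right_unit)
 have "(w $ i)\<^sup>2 \<le> w \<bullet> w"
  unfolding scalar_prod_self_sum[OF wc] power2_eq_square
  using assms(1) by (intro member_le_sum[of i "{..<n}" "%i. w $ i * w $ i"]) auto
 also have "... \<le> (q ^ k)\<^sup>2"
  using it[of "unit_vec n j"] assms(2) by (simp add: w_def power2_eq_square)
 finally show ?thesis unfolding wi using q(1) by (simp add: abs_le_square_iff[symmetric])
qed

lemma summable_binom_mat:
 assumes "0 \<le> a" "a \<le> 1" "i < n" "j < n"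
 shows "summable (%k. norm ((a gchoose k) * (- 1) ^ k * (B ^\<^sub>m k) $$ (i, j)))"
proof (rule summable_comparison_test)
 have "norm (norm ((a gchoose k) * (- 1) ^ k * (B ^\<^sub>m k) $$ (i, j))) \<le> q ^ k" for k
  using mult_mono[OF gchoose_le_1[OF assms(1,2), of k] mat_power_bound[OF assms(3,4), of k]]
  by (simp add: abs_mult power_abs)
 then show "\<exists>N. \<forall>k\<ge>N. norm (norm ((a gchoose k) * (- 1) ^ k * (B ^\<^sub>m k) $$ (i, j))) \<le> q ^ k" by blast
 show "summable (%k. q ^ k)" using q by (intro summable_geometric) simp
qed

text \<open>The Cauchy product of the entry series: Vandermonde's identity adds the binomial
  coefficients, and the matrix powers of complementary degrees multiply to the \<open>k\<close>-th
  power.\<close>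

lemma binom_mat_mult:
 assumes a: "0 \<le> a" "a \<le> 1" and b: "0 \<le> b" "b \<le> 1"
 shows "binom_mat n B a * binom_mat n B b = binom_mat n B (a + b)"
proof (rule eq_matI)
 fix i j assume "i < dim_row (binom_mat n B (a + b))" "j < dim_col (binom_mat n B (a + b))"
 then have ij: "i < n" "j < n" by (simp_all add: binom_mat_def)
 let ?u = "%a k i j. (a gchoose k) * (- 1) ^ k * (B ^\<^sub>m k) $$ (i, j)"
 have P: "B ^\<^sub>m k \<in> Mat n n" for k by (rule pow_carrier_mat[OF B])
 have s: "(%k. \<Sum>p\<le>k. ?u a p i l * ?u b (k - p) l j) sums ((\<Sum>k. ?u a k i l) * (\<Sum>k. ?u b k l j))" if "l < n" for l
  by (intro Cauchy_product_sums summable_binom_mat a b ij that)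
 have "(binom_mat n B a * binom_mat n B b) $$ (i, j) = (\<Sum>l<n. (\<Sum>k. ?u a k i l) * (\<Sum>k. ?u b k l j))"
  using ij by (simp add: binom_mat_def scalar_prod_def lessThan_atLeast0)
 also have "... = (\<Sum>k. \<Sum>l<n. \<Sum>p\<le>k. ?u a p i l * ?u b (k - p) l j)"
  by (rule sums_unique, rule sums_sum, rule s) simp
 also have "(%k. \<Sum>l<n. \<Sum>p\<le>k. ?u a p i l * ?u b (k - p) l j) = (%k. ?u (a + b) k i j)"
 proof
  fix k
  have "(\<Sum>l<n. \<Sum>p\<le>k. ?u a p i l * ?u b (k - p) l j) = (\<Sum>p\<le>k. \<Sum>l<n. ?u a p i l * ?u b (k - p) l j)"
   by (rule sum.swap)
  also have "... = (\<Sum>p\<le>k. (a gchoose p) * (b gchoose (k - p)) * ((- 1) ^ k * (B ^\<^sub>m k) $$ (i, j)))"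
  proof (rule sum.cong)
   fix p assume "p \<in> {..k}"
   then have p: "p + (k - p) = k" by simp
   have m: "(\<Sum>l<n. (B ^\<^sub>m p) $$ (i, l) * (B ^\<^sub>m (k - p)) $$ (l, j)) = (B ^\<^sub>m k) $$ (i, j)"
    using mat_power_add[OF B, of p "k - p"] carrier_matD[OF P[of p]] carrier_matD[OF P[of "k - p"]] ij
    unfolding p by (simp add: scalar_prod_def lessThan_atLeast0)
   have sgn: "(- 1 :: real) ^ p * (- 1) ^ (k - p) = (- 1) ^ k" unfolding power_add[symmetric] p ..
   have "(\<Sum>l<n. ?u a p i l * ?u b (k - p) l j)
    = (\<Sum>l<n. (a gchoose p) * (b gchoose (k - p)) * ((- 1 :: real) ^ p * (- 1) ^ (k - p)) * ((B ^\<^sub>m p) $$ (i, l) * (B ^\<^sub>m (k - p)) $$ (l, j)))"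
    by (intro sum.cong refl) (simp only: mult_ac)
   also have "... = (a gchoose p) * (b gchoose (k - p)) * ((- 1) ^ k * (B ^\<^sub>m k) $$ (i, j))"
    unfolding sgn sum_distrib_left[symmetric] m by (simp only: mult_ac)
   finally show "(\<Sum>l<n. ?u a p i l * ?u b (k - p) l j) = (a gchoose p) * (b gchoose (k - p)) * ((- 1) ^ k * (B ^\<^sub>m k) $$ (i, j))" .
  qed simp
  also have "... = ?u (a + b) k i j"
   unfolding sum_distrib_right[symmetric] atMost_atLeast0 gbinomial_Vandermonde by (simp only: mult_ac)
  finally show "(\<Sum>l<n. \<Sum>p\<le>k. ?u a p i l * ?u b (k - p) l j) = ?u (a + b) k i j" .
 qed
 also have "(\<Sum>k. ?u (a + b) k i j) = binom_mat n B (a + b) $$ (i, j)" using ij by (simp add: binom_mat_def)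
 finally show "(binom_mat n B a * binom_mat n B b) $$ (i, j) = binom_mat n B (a + b) $$ (i, j)" .
qed (simp_all add: binom_mat_def)

lemma binom_mat_1: "binom_mat n B 1 = 1\<^sub>m n - B"
proof (rule eq_matI)
 fix i j assume "i < dim_row (1\<^sub>m n - B)" "j < dim_col (1\<^sub>m n - B)"
 then have ij: "i < n" "j < n" using B by auto
 have g: "(1 :: real) gchoose k = 0" if "k \<notin> {..<2}" for k
  using binomial_gbinomial[of 1 k, where ?'a = real] that by (simp add: binomial_eq_0)
 have "(\<Sum>k. ((1::real) gchoose k) * (- 1) ^ k * (B ^\<^sub>m k) $$ (i, j)) = (\<Sum>k<2. ((1::real) gchoose k) * (- 1) ^ k * (B ^\<^sub>m k) $$ (i, j))"
  by (rule suminf_finite) (simp_all add: g)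
 also have "... = (1\<^sub>m n - B) $$ (i, j)"
  using ij B by (simp add: numeral_2_eq_2)
 finally show "binom_mat n B 1 $$ (i, j) = (1\<^sub>m n - B) $$ (i, j)" using ij by (simp add: binom_mat_def)
qed (use B in \<open>simp_all add: binom_mat_def\<close>)

lemma binom_mat_transpose: "(binom_mat n B a)\<^sup>T = binom_mat n B a"
proof (rule eq_matI)
 fix i j assume "i < dim_row (binom_mat n B a)" "j < dim_col (binom_mat n B a)"
 then have ij: "i < n" "j < n" by (simp_all add: binom_mat_def)
 have "(B ^\<^sub>m k) $$ (j, i) = (B ^\<^sub>m k) $$ (i, j)" for k
  using mat_power_transpose[OF B Bs, of k] pow_carrier_mat[OF B, of k] ij by (metis carrier_matD index_transpose_mat(1))
 then show "(binom_mat n B a)\<^sup>T $$ (i, j) = binom_mat n B a $$ (i, j)" using ij by (simp add: binom_mat_def)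
qed (simp_all add: binom_mat_def)

lemma sqrt_one_minus: "sym_pos_semidef n (binom_mat n B (1 / 2)) \<and> binom_mat n B (1 / 2) * binom_mat n B (1 / 2) = 1\<^sub>m n - B"
proof -
 let ?R = "binom_mat n B (1 / 4)" and ?S = "binom_mat n B (1 / 2)"
 have R: "?R \<in> Mat n n" and S: "?S \<in> Mat n n" by (simp_all add: binom_mat_def)
 have RR: "?R * ?R = ?S" using binom_mat_mult[of "1 / 4" "1 / 4"] by simp
 have "0 \<le> v \<bullet> (?S *\<^sub>v v)" if v: "v \<in> Rn n" for v
 proof -
  have "v \<bullet> (?S *\<^sub>v v) = v \<bullet> (?R *\<^sub>v (?R *\<^sub>v v))"
   unfolding RR[symmetric] assoc_mult_mat_vec[OF R R v] ..
  also have "... = (?R *\<^sub>v v) \<bullet> (?R *\<^sub>v v)"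
   by (rule mat_vec_scalar_prod_sym[OF R binom_mat_transpose v mult_mat_vec_carrier[OF R v]])
  finally show ?thesis using scalar_prod_self_nonneg by simp
 qed
 then show ?thesis
  using S binom_mat_transpose binom_mat_mult[of "1 / 2" "1 / 2"] binom_mat_1 by (simp add: sym_pos_semidef_def)
qed

end

text \<open>After division by a large \<open>Lam\<close> the matrix is \<open>1 - B\<close> with
  \<open>B\<close> a strict contraction, so the binomial series applies. The estimate
  \<open>Lam\<close> bounds the length of \<open>A x\<close> by the form of \<open>A\<close>, which
  keeps \<open>B\<close> from expanding; invertibility of \<open>A\<close> makes the contraction
  strict.\<close>

lemma sqrt_mat_exists:
 assumes A: "sym_pos_def n A"
 shows "\<exists>S. sym_pos_semidef n S \<and> S * S = A"
proof -
 have Ac: "A \<in> Mat n n" and As: "A\<^sup>T = A" using A by (auto simp: sym_pos_def_def)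
 obtain Lam where Lam: "0 < Lam" "!!x. x \<in> Rn n ==> (A *\<^sub>v x) \<bullet> (A *\<^sub>v x) \<le> Lam * (x \<bullet> (A *\<^sub>v x))"
  using psd_form_bound[OF sym_pos_def_semidef[OF A]] by blast
 note mi = minv[OF Ac sym_pos_def_det[OF A]]
 obtain K where K: "0 \<le> K" "!!x. x \<in> Rn n ==> (minv A *\<^sub>v x) \<bullet> (minv A *\<^sub>v x) \<le> K * (x \<bullet> x)"
  using mat_vec_bounded[OF mi(3)] by blast
 have Ax: "A *\<^sub>v x \<in> Rn n" if "x \<in> Rn n" for x by (rule mult_mat_vec_carrier[OF Ac that])
 have low: "x \<bullet> x \<le> K * ((A *\<^sub>v x) \<bullet> (A *\<^sub>v x))" if x: "x \<in> Rn n" for x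
  using K(2)[OF Ax[OF x]] unfolding assoc_mult_mat_vec[OF mi(3) Ac x, symmetric] mi(2) using x by simp
 \<comment> \<open>Enlarging \<open>K\<close> ensures \<open>1 \<le> K' * Lam * Lam\<close>, so that
   the contraction factor \<open>q\<close> is the root of a number in \<open>[0, 1)\<close>.\<close>
 define K' where "K' = K + 1 / (Lam * Lam)"
 have K': "0 < K'" "K \<le> K'" using K(1) Lam(1) by (auto simp: K'_def intro: add_nonneg_pos)
 define q where "q = sqrt (1 - 1 / (K' * Lam * Lam))"
 have kl: "1 \<le> K' * Lam * Lam" using K(1) Lam(1) by (simp add: K'_def field_simps)
 then have q01: "0 \<le> 1 - 1 / (K' * Lam * Lam)" "1 - 1 / (K' * Lam * Lam) < 1" by simp_all
 then have q: "0 \<le> q" "q < 1" "q * q = 1 - 1 / (K' * Lam * Lam)" by (simp_all add: q_def)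
 define B where "B = 1\<^sub>m n - (1 / Lam) \<cdot>\<^sub>m A"
 have B: "B \<in> Mat n n" unfolding B_def by (intro minus_carrier_mat smult_carrier_mat Ac)
 have Aij: "A $$ (i, j) = A $$ (j, i)" if "i < n" "j < n" for i j
  using that As Ac by (metis carrier_matD index_transpose_mat(1))
 have Bs: "B\<^sup>T = B"
 proof (rule eq_matI)
  fix i j assume "i < dim_row B" "j < dim_col B"
  then have ij: "i < n" "j < n" using B by auto
  show "B\<^sup>T $$ (i, j) = B $$ (i, j)" using ij Ac Aij[OF ij] by (simp add: B_def)
 qed (use B in auto)
 have contr: "(B *\<^sub>v x) \<bullet> (B *\<^sub>v x) \<le> q * q * (x \<bullet> x)" if x: "x \<in> Rn n" for x
 proof -
  define y where "y = A *\<^sub>v x"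
  have y: "y \<in> Rn n" using Ax[OF x] by (simp add: y_def)
  have Bx: "B *\<^sub>v x = x - (1 / Lam) \<cdot>\<^sub>v y"
   unfolding B_def y_def using minus_mult_distrib_mat_vec[of "1\<^sub>m n" n n "(1 / Lam) \<cdot>\<^sub>m A" x] smult_mult_mat_vec[OF Ac x] x Ac by simp
  have "(B *\<^sub>v x) \<bullet> (B *\<^sub>v x) = x \<bullet> x - 2 * ((1 / Lam) * (x \<bullet> y)) + (1 / Lam) * ((1 / Lam) * (y \<bullet> y))"
   unfolding Bx scalar_prod_diff_smult[OF x y] by (simp only: mult.assoc)
  moreover have "(1 / Lam) * ((1 / Lam) * (y \<bullet> y)) \<le> (1 / Lam) * (x \<bullet> y)"
   using Lam(2)[OF x] Lam(1) unfolding y_def[symmetric] by (intro mult_left_mono) (simp_all add: field_simps)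
  moreover have "1 / (K' * Lam * Lam) * (x \<bullet> x) \<le> (1 / Lam) * ((1 / Lam) * (y \<bullet> y))"
  proof -
   have "x \<bullet> x \<le> K' * (y \<bullet> y)"
    using low[OF x] mult_right_mono[OF K'(2) scalar_prod_self_nonneg[of y]] unfolding y_def by linarith
   then show ?thesis using K' Lam(1) by (simp add: field_simps)
  qed
  ultimately have "(B *\<^sub>v x) \<bullet> (B *\<^sub>v x) \<le> x \<bullet> x - 1 / (K' * Lam * Lam) * (x \<bullet> x)" by linarith
  also have "... = q * q * (x \<bullet> x)" unfolding q(3) by (simp add: left_diff_distrib)
  finally show ?thesis .
 qed
 define T where "T = binom_mat n B (1 / 2)"
 have T: "sym_pos_semidef n T" "T * T = 1\<^sub>m n - B"
  using sqrt_one_minus[OF B Bs q(1,2) contr] by (simp_all add: T_def)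
 have Tc: "T \<in> Mat n n" and Ts: "T\<^sup>T = T" using T by (auto simp: sym_pos_semidef_def)
 have TT: "T * T = (1 / Lam) \<cdot>\<^sub>m A" unfolding T(2) B_def using Ac by (intro eq_matI) auto
 define S where "S = sqrt Lam \<cdot>\<^sub>m T"
 have "S * S = sqrt Lam \<cdot>\<^sub>m (sqrt Lam \<cdot>\<^sub>m (T * T))"
  unfolding S_def using Tc by (simp add: mult_smult_assoc_mat[of _ n n _ n] mult_smult_distrib[of _ n n _ n])
 also have "... = A" unfolding TT using Ac Lam(1) by (intro eq_matI) (auto simp: mult.assoc[symmetric])
 finally have SS: "S * S = A" .
 have "S\<^sup>T = S"
 proof (rule eq_matI)
  fix i j assume "i < dim_row S" "j < dim_col S"
  then have ij: "i < n" "j < n" using Tc by (auto simp: S_def)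
  have "T $$ (j, i) = T $$ (i, j)" using ij Ts Tc by (metis carrier_matD index_transpose_mat(1))
  then show "S\<^sup>T $$ (i, j) = S $$ (i, j)" using ij Tc by (simp add: S_def)
 qed (use Tc in \<open>auto simp: S_def\<close>)
 moreover have "0 \<le> v \<bullet> (S *\<^sub>v v)" if v: "v \<in> Rn n" for v
 proof -
  have "0 \<le> v \<bullet> (T *\<^sub>v v)" using T(1) v by (simp add: sym_pos_semidef_def)
  then show ?thesis unfolding S_def smult_mult_mat_vec[OF Tc v] using v mult_mat_vec_carrier[OF Tc v] Lam(1) by simp
 qed
 ultimately show ?thesis using SS Tc by (intro exI[of _ S]) (simp add: sym_pos_semidef_def S_def)
qed

lemma sqrt_mat:
 assumes A: "sym_pos_def n A"
 shows "sym_pos_def n (sqrt_mat A)" "sqrt_mat A * sqrt_mat A = A" "det (sqrt_mat A) = sqrt (det A)"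
proof -
 obtain S where S: "sym_pos_semidef n S" "S * S = A" using sqrt_mat_exists[OF A] by blast
 have eq: "sqrt_mat A = S" by (rule sqrt_mat_eqI[OF A S])
 show "sqrt_mat A * sqrt_mat A = A" unfolding eq by (rule S(2))
 have Sc: "S \<in> Mat n n" using S by (simp add: sym_pos_semidef_def)
 have "0 < v \<bullet> (S *\<^sub>v v)" if v: "v \<in> Rn n" "v \<noteq> 0\<^sub>v n" for v
 proof (rule ccontr)
  assume neg: "\<not> 0 < v \<bullet> (S *\<^sub>v v)"
  obtain Lam where Lam: "0 < Lam" "(S *\<^sub>v v) \<bullet> (S *\<^sub>v v) \<le> Lam * (v \<bullet> (S *\<^sub>v v))" using psd_form_bound[OF S(1)] v(1) by blast
  have "Lam * (v \<bullet> (S *\<^sub>v v)) \<le> 0" using Lam(1) neg by (simp add: mult_le_0_iff)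
  then have "(S *\<^sub>v v) \<bullet> (S *\<^sub>v v) = 0" using Lam(2) scalar_prod_self_nonneg[of "S *\<^sub>v v"] by linarith
  then have "S *\<^sub>v v = 0\<^sub>v n" by (rule scalar_prod_self_eq_0[OF mult_mat_vec_carrier[OF Sc v(1)]])
  then have "A *\<^sub>v v = 0\<^sub>v n" unfolding S(2)[symmetric] using assoc_mult_mat_vec[OF Sc Sc v(1)] mult_mat_zero_vec[OF Sc] by simp
  then have "v \<bullet> (A *\<^sub>v v) = 0" using v(1) by simp
  then show False using A v by (force simp: sym_pos_def_def)
 qed
 then show spd: "sym_pos_def n (sqrt_mat A)"
  unfolding eq using S(1) by (simp add: sym_pos_def_def sym_pos_semidef_def)
 \<comment> \<open>This selects the nonnegative root in
   \<open>det S * det S = det A\<close>.\<close>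
 have "0 < det S" using preserves_lborel_sym_pos_def[OF spd] eq by (simp add: preserves_lborel_by_det_def)
 moreover have "det S * det S = det A" using det_mult[OF Sc Sc] S(2) by simp
 ultimately show "det (sqrt_mat A) = sqrt (det A)" unfolding eq by (metis abs_of_pos real_sqrt_abs2)
qed

section \<open>Block matrices\<close>

text \<open>A maximal independent set of columns of \<open>U\<close> has \<open>d\<close> elements
  and forms an invertible square matrix. A vector orthogonal to all columns of \<open>U\<close> is
  orthogonal to these, hence zero.\<close>

lemma full_row_rank_kernel:
 assumes U: "U \<in> Mat d n" and r: "mat_rank U = d" and v: "v \<in> Rn d" and Uv: "U\<^sup>T *\<^sub>v v = 0\<^sub>v n"
 shows "v = 0\<^sub>v d"
proof -
 interpret vec_space "TYPE(real)" d .
 have rU: "rank U = d" using r U by simp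
 obtain S where S: "maximal S (%T. T \<subseteq> set (cols U) \<and> lin_indpt T)"
  using maximal_exists[of "(%T. T \<subseteq> set (cols U) \<and> lin_indpt T)" "card (set (cols U))" "{}"]
  by (meson List.finite_set card_mono empty_iff empty_subsetI finite_lin_indpt2 rev_finite_subset)
 then have sub: "S \<subseteq> set (cols U)" and li: "lin_indpt S" by (auto simp: maximal_def)
 have cS: "card S = d" using rank_card_indpt[OF U S] rU by simp
 have "finite S" using sub finite_subset by blast
 then obtain vs where vs: "set vs = S" "distinct vs" using finite_distinct_list by blast
 have len: "length vs = d" using vs cS distinct_card by fastforce
 have "set vs \<subseteq> Rn d" using vs(1) sub cols_dim[of U] U by auto
 define M where "M = mat_of_cols d vs"
 have cM: "cols M = vs" unfolding M_def by (rule cols_mat_of_cols) fact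
 have M: "M \<in> Mat d d" unfolding M_def len[symmetric] by (rule mat_of_cols_carrier(1))
 have "rank M = d" using lin_indpt_full_rank[OF M] cM vs li by simp
 then have dM: "det M\<^sup>T \<noteq> 0" using det_rank_iff[OF M] det_transpose[OF M] by simp
 have "M\<^sup>T *\<^sub>v v = 0\<^sub>v d"
 proof (rule eq_vecI)
  fix i assume "i < dim_vec (0\<^sub>v d :: real vec)"
  then have i: "i < d" by simp
  have "vs ! i \<in> S" using vs(1) len i nth_mem by blast
  moreover have "cols M ! i = col M i" using M i by (intro cols_nth) simp
  ultimately have "col M i \<in> set (cols U)" using sub unfolding cM by auto
  then obtain j where j: "j < n" "col M i = col U j" using U by (auto simp: cols_def)
  have "(M\<^sup>T *\<^sub>v v) $ i = col M i \<bullet> v" using M i by simp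
  also have "... = (U\<^sup>T *\<^sub>v v) $ j" using U j by simp
  finally show "(M\<^sup>T *\<^sub>v v) $ i = 0\<^sub>v d $ i" using Uv i j by simp
 qed (use M in simp)
 then show ?thesis using det_0_iff_vec_prod_zero_field[of "M\<^sup>T" d] dM M v by auto
qed

lemma sym_pos_def_congruence:
 assumes A: "sym_pos_def n A" and U: "U \<in> Mat d n"
  and ker: "!!v. v \<in> Rn d ==> U\<^sup>T *\<^sub>v v = 0\<^sub>v n ==> v = 0\<^sub>v d"
 shows "sym_pos_def d (U * A * U\<^sup>T)"
 unfolding sym_pos_def_def
proof (intro conjI ballI impI)
 have Ac: "A \<in> Mat n n" and As: "A\<^sup>T = A" using A by (auto simp: sym_pos_def_def)
 have UA: "U * A \<in> Mat d n" and UT: "U\<^sup>T \<in> Mat n d" using U Ac by auto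
 show "U * A * U\<^sup>T \<in> Mat d d" using UA UT by simp
 show "(U * A * U\<^sup>T)\<^sup>T = U * A * U\<^sup>T"
  unfolding transpose_mult[OF UA UT] transpose_mult[OF U Ac] As
  using assoc_mult_mat[OF U Ac UT] by simp
 fix v :: "real vec" assume v: "v \<in> Rn d" "v \<noteq> 0\<^sub>v d"
 have Uv: "U\<^sup>T *\<^sub>v v \<in> Rn n" by (rule mult_mat_vec_carrier[OF UT v(1)])
 have AUv: "A *\<^sub>v (U\<^sup>T *\<^sub>v v) \<in> Rn n" by (rule mult_mat_vec_carrier[OF Ac Uv])
 have "v \<bullet> (U * A * U\<^sup>T *\<^sub>v v) = v \<bullet> (U *\<^sub>v (A *\<^sub>v (U\<^sup>T *\<^sub>v v)))"
  unfolding assoc_mult_mat_vec[OF UA UT v(1)] assoc_mult_mat_vec[OF U Ac Uv] ..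
 also have "... = (U\<^sup>T *\<^sub>v v) \<bullet> (A *\<^sub>v (U\<^sup>T *\<^sub>v v))"
  using scalar_prod_transpose[OF UT v(1) AUv] by simp
 also have "0 < ..." using A Uv ker[OF v(1)] v(2) by (auto simp: sym_pos_def_def)
 finally show "0 < v \<bullet> (U * A * U\<^sup>T *\<^sub>v v)" .
qed

lemma minv_transpose:
 assumes A: "A \<in> Mat n n" "A\<^sup>T = A" "det A \<noteq> 0"
 shows "(minv A)\<^sup>T = minv A"
proof -
 note m = minv[OF A(1,3)]
 have "A * (minv A)\<^sup>T = 1\<^sub>m n"
  using transpose_mult[OF m(3) A(1)] m(2) A(2) by simp
 then show ?thesis using minv_eqI[OF A(1), of "(minv A)\<^sup>T"] m(3) by simp
qed

section \<open>Block rows and block diagonal matrices\<close>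

context
 fixes d :: "nat => nat"
begin

abbreviation (input) offset :: "nat => nat" where "offset i \<equiv> \<Sum>j<i. d j"

lemma offset_less: "i < m ==> r < d i ==> offset i + r < offset m"
proof (induction m)
 case (Suc m)
 then show ?case by (cases "i = m") auto
qed simp

lemma offset_cases:
 assumes "l < offset m"
 obtains i r where "i < m" "r < d i" "l = offset i + r"
proof -
 have "\<exists>i<m. \<exists>r<d i. l = offset i + r" using assms
 proof (induction m)
  case (Suc m)
  show ?case
  proof (cases "l < offset m")
   case True
   then show ?thesis using Suc.IH less_SucI by blast
  next
   case False
   then have "l - offset m < d m \<and> l = offset m + (l - offset m)" using Suc.prems by simp
   then show ?thesis using lessI by blast
  qed
 qed simp
 then show ?thesis using that by blast
qed

lemma sum_offset: "(\<Sum>l<offset m. g l) = (\<Sum>i<m. \<Sum>r<d i. g (offset i + r) :: real)"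
proof (induction m)
 case (Suc m)
 have "(\<Sum>l<a + b. g l) = (\<Sum>l<a. g l) + (\<Sum>r<b. g (a + r))" for a b by (induction b) simp_all
 then show ?case using Suc by simp
qed simp

lemma stack_rows_carrier:
 assumes "!!i. i < m ==> B i \<in> Mat (d i) k"
 shows "stack_rows k m B \<in> Mat (offset m) k"
  and "i < m ==> r < d i ==> j < k ==> stack_rows k m B $$ (offset i + r, j) = B i $$ (r, j)"
proof -
 have lenm: "length (concat (map (%i. rows (B i)) [0..<m])) = offset m" if "!!i. i < m ==> dim_row (B i) = d i" for m
  using that by (induction m) simp_all
 then have len: "length (concat (map (%i. rows (B i)) [0..<m])) = offset m" using assms carrier_matD(1) by blast
 then show "stack_rows k m B \<in> Mat (offset m) k" unfolding stack_rows_def by (metis mat_of_rows_carrier(1))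
 have nth: "concat (map (%i. rows (B i)) [0..<m]) ! (offset i + r) = row (B i) r" if "i < m" "r < d i" for i r
  using that assms
 proof (induction m)
  case (Suc m)
  have len: "length (concat (map (%i. rows (B i)) [0..<m])) = offset m"
   using Suc.prems(3) by (intro lenm) (metis carrier_matD(1) less_SucI)
  have dm: "dim_row (B m) = d m" using Suc.prems(3)[of m] by auto
  show ?case
  proof (cases "i = m")
   case True
   then show ?thesis using Suc.prems(2) len dm by (simp add: nth_append)
  next
   case False
   then have i: "i < m" using Suc.prems(1) by simp
   show ?thesis
    using Suc.IH[OF i Suc.prems(2,3)] offset_less[OF i Suc.prems(2)] len by (simp add: nth_append)
  qed
 qed simp
 show "stack_rows k m B $$ (offset i + r, j) = B i $$ (r, j)" if "i < m" "r < d i" "j < k"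
  unfolding stack_rows_def using that offset_less[OF that(1,2)] nth[OF that(1,2)] assms[OF that(1)] len
  by (simp add: mat_of_rows_index)
qed

lemma diag_block_carrier:
 assumes "!!i. i < m ==> f i \<in> Mat (d i) (d i)"
 shows "diag_block_mat (map f [0..<m]) \<in> Mat (offset m) (offset m)"
  and "i < m ==> j < m ==> r < d i ==> t < d j ==>
   diag_block_mat (map f [0..<m]) $$ (offset i + r, offset j + t) = (if i = j then f i $$ (r, t) else 0)"
proof -
 have c: "diag_block_mat (map f [0..<m]) \<in> Mat (offset m) (offset m)" if "!!i. i < m ==> f i \<in> Mat (d i) (d i)" for m
  using that
 proof (induction m)
  case (Suc m)
  show ?case using Suc.IH Suc.prems[of m] Suc.prems
   by (simp add: diag_block_mat_last Let_def)
 qed simp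
 show "diag_block_mat (map f [0..<m]) \<in> Mat (offset m) (offset m)" by (rule c[OF assms])
 show "diag_block_mat (map f [0..<m]) $$ (offset i + r, offset j + t) = (if i = j then f i $$ (r, t) else 0)"
  if "i < m" "j < m" "r < d i" "t < d j"
  using that assms
 proof (induction m)
  case (Suc m)
  let ?A = "diag_block_mat (map f [0..<m])"
  have A: "?A \<in> Mat (offset m) (offset m)" using c Suc.prems(5) by simp
  have fm: "f m \<in> Mat (d m) (d m)" using Suc.prems(5) by simp
  have e: "diag_block_mat (map f [0..<Suc m]) $$ (p, q) = (if p < offset m then if q < offset m then ?A $$ (p, q) else 0
    else if q < offset m then 0 else f m $$ (p - offset m, q - offset m))"
   if "p < offset m + d m" "q < offset m + d m" for p q
   using that A fm by (simp add: diag_block_mat_last Let_def)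
  have b: "offset l + s < offset m + d m \<and> (offset l + s < offset m \<longleftrightarrow> l \<noteq> m)" if "l < Suc m" "s < d l" for l s
   using that offset_less[of l m s] by (cases "l = m") auto
  show ?case
   using e[of "offset i + r" "offset j + t"] b[OF Suc.prems(1,3)] b[OF Suc.prems(2,4)] Suc.IH[OF _ _ Suc.prems(3,4,5)] Suc.prems(1,2)
   by (cases "i = m"; cases "j = m") (auto simp: less_Suc_eq)
 qed simp
qed

lemma block_mat_eqI:
 assumes "X \<in> Mat (offset m) k" "Y \<in> Mat (offset m) k"
  and "!!i r j. i < m ==> r < d i ==> j < k ==> X $$ (offset i + r, j) = Y $$ (offset i + r, j)"
 shows "X = Y"
proof (rule eq_matI)
 fix l j assume "l < dim_row Y" "j < dim_col Y"
 then have l: "l < offset m" "j < k" using assms(2) by auto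
 then show "X $$ (l, j) = Y $$ (l, j)" using assms(3) by (elim offset_cases) simp
qed (use assms in auto)

lemma mult_mat_entry:
 "X \<in> Mat a b ==> Y \<in> Mat b e ==> i < a ==> j < e ==> (X * Y) $$ (i, j) = (\<Sum>l<b. X $$ (i, l) * Y $$ (l, j))"
 by (simp add: scalar_prod_def lessThan_atLeast0)

lemma diag_mult_stack:
 assumes f: "!!i. i < m ==> f i \<in> Mat (d i) (d i)" and B: "!!i. i < m ==> B i \<in> Mat (d i) k"
 shows "diag_block_mat (map f [0..<m]) * stack_rows k m B = stack_rows k m (%i. f i * B i)"
proof (rule block_mat_eqI)
 have fB: "f i * B i \<in> Mat (d i) k" if "i < m" for i using f[OF that] B[OF that] by simp
 have D: "diag_block_mat (map f [0..<m]) \<in> Mat (offset m) (offset m)" by (rule diag_block_carrier(1)[OF f])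
 have S: "stack_rows k m B \<in> Mat (offset m) k" by (rule stack_rows_carrier(1)[OF B])
 show "diag_block_mat (map f [0..<m]) * stack_rows k m B \<in> Mat (offset m) k" by (rule mult_carrier_mat[OF D S])
 show "stack_rows k m (%i. f i * B i) \<in> Mat (offset m) k" by (rule stack_rows_carrier(1)[OF fB])
 fix i r j assume i: "i < m" "r < d i" "j < k"
 have "(diag_block_mat (map f [0..<m]) * stack_rows k m B) $$ (offset i + r, j)
  = (\<Sum>i'<m. \<Sum>t<d i'. diag_block_mat (map f [0..<m]) $$ (offset i + r, offset i' + t) * stack_rows k m B $$ (offset i' + t, j))"
  unfolding mult_mat_entry[OF D S offset_less[OF i(1,2)] i(3)] by (rule sum_offset)
 also have "... = (\<Sum>i'<m. if i = i' then \<Sum>t<d i'. f i $$ (r, t) * B i' $$ (t, j) else 0)"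
 proof (rule sum.cong)
  fix i' assume "i' \<in> {..<m}"
  then have i': "i' < m" by simp
  have "diag_block_mat (map f [0..<m]) $$ (offset i + r, offset i' + t) * stack_rows k m B $$ (offset i' + t, j)
   = (if i = i' then f i $$ (r, t) * B i' $$ (t, j) else 0)" if "t < d i'" for t
   using diag_block_carrier(2)[OF f i(1) i' i(2) that] stack_rows_carrier(2)[OF B i' that i(3)] by simp
  then show "(\<Sum>t<d i'. diag_block_mat (map f [0..<m]) $$ (offset i + r, offset i' + t) * stack_rows k m B $$ (offset i' + t, j))
   = (if i = i' then \<Sum>t<d i'. f i $$ (r, t) * B i' $$ (t, j) else 0)" by simp
 qed simp
 also have "... = (\<Sum>t<d i. f i $$ (r, t) * B i $$ (t, j))" using i(1) by simp
 also have "... = (f i * B i) $$ (r, j)" using mult_mat_entry[OF f[OF i(1)] B[OF i(1)] i(2,3)] by simp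
 also have "... = stack_rows k m (%i. f i * B i) $$ (offset i + r, j)" using stack_rows_carrier(2)[OF fB i] by simp
 finally show "(diag_block_mat (map f [0..<m]) * stack_rows k m B) $$ (offset i + r, j) = stack_rows k m (%i. f i * B i) $$ (offset i + r, j)" .
qed

lemma stack_mult:
 assumes B: "!!i. i < m ==> B i \<in> Mat (d i) k" and C: "C \<in> Mat k e"
 shows "stack_rows k m B * C = stack_rows e m (%i. B i * C)"
proof (rule block_mat_eqI)
 have BC: "B i * C \<in> Mat (d i) e" if "i < m" for i using B[OF that] C by simp
 have S: "stack_rows k m B \<in> Mat (offset m) k" by (rule stack_rows_carrier(1)[OF B])
 show "stack_rows k m B * C \<in> Mat (offset m) e" by (rule mult_carrier_mat[OF S C])
 show "stack_rows e m (%i. B i * C) \<in> Mat (offset m) e" by (rule stack_rows_carrier(1)[OF BC])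
 fix i r j assume i: "i < m" "r < d i" "j < e"
 show "(stack_rows k m B * C) $$ (offset i + r, j) = stack_rows e m (%i. B i * C) $$ (offset i + r, j)"
  using stack_rows_carrier(2)[OF B i(1,2)] stack_rows_carrier(2)[OF BC i] mult_mat_entry[OF B[OF i(1)] C i(2,3)]
  unfolding mult_mat_entry[OF S C offset_less[OF i(1,2)] i(3)] by simp
qed

lemma stack_mult_transpose:
 assumes B: "!!i. i < m ==> B i \<in> Mat (d i) k" and i: "i < m" "j < m" "r < d i" "t < d j"
 shows "(stack_rows k m B * (stack_rows k m B)\<^sup>T) $$ (offset i + r, offset j + t) = (B i * (B j)\<^sup>T) $$ (r, t)"
proof -
 have S: "stack_rows k m B \<in> Mat (offset m) k" by (rule stack_rows_carrier(1)[OF B])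
 have T: "(stack_rows k m B)\<^sup>T \<in> Mat k (offset m)" "(B j)\<^sup>T \<in> Mat k (d j)" using S B[OF i(2)] by simp_all
 show ?thesis
  unfolding mult_mat_entry[OF S T(1) offset_less[OF i(1,3)] offset_less[OF i(2,4)]] mult_mat_entry[OF B[OF i(1)] T(2) i(3,4)]
 proof (rule sum.cong)
  fix l assume "l \<in> {..<k}"
  then have l: "l < k" by simp
  have "(stack_rows k m B)\<^sup>T $$ (l, offset j + t) = stack_rows k m B $$ (offset j + t, l)" "(B j)\<^sup>T $$ (l, t) = B j $$ (t, l)"
   using S B[OF i(2)] l i offset_less[OF i(2,4)] by simp_all
  then show "stack_rows k m B $$ (offset i + r, l) * (stack_rows k m B)\<^sup>T $$ (l, offset j + t) = B i $$ (r, l) * (B j)\<^sup>T $$ (l, t)"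
   using stack_rows_carrier(2)[OF B i(1,3) l] stack_rows_carrier(2)[OF B i(2,4) l] by simp
 qed simp
qed

lemma stack_mult_vec:
 assumes B: "!!i. i < m ==> B i \<in> Mat (d i) k" and i: "i < m" "r < d i" and x: "x \<in> Rn k"
 shows "(stack_rows k m B *\<^sub>v x) $ (offset i + r) = (B i *\<^sub>v x) $ r"
proof -
 have S: "stack_rows k m B \<in> Mat (offset m) k" by (rule stack_rows_carrier(1)[OF B])
 show ?thesis
  using S B[OF i(1)] i offset_less[OF i] x stack_rows_carrier(2)[OF B i] by (simp add: scalar_prod_def)
qed

lemma one_mat_offset:
 assumes "i < m" "j < m" "r < d i" "t < d j"
 shows "(1\<^sub>m (offset m) :: real mat) $$ (offset i + r, offset j + t) = (if i = j then 1\<^sub>m (d i) $$ (r, t) else 0)"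
proof -
 have "offset i + r \<noteq> offset j + t" if "i < j" "r < d i" for i j r t
  using offset_less[OF that] by linarith
 then have "offset i + r = offset j + t \<longleftrightarrow> i = j \<and> r = t"
  using assms(3,4) by (metis add_left_cancel linorder_neqE_nat)
 then show ?thesis using assms offset_less[OF assms(1,3)] offset_less[OF assms(2,4)] by auto
qed

lemma diag_mult_diag:
 fixes f g :: "nat => real mat"
 assumes f: "!!i. i < m ==> f i \<in> Mat (d i) (d i)" and g: "!!i. i < m ==> g i \<in> Mat (d i) (d i)"
 shows "diag_block_mat (map f [0..<m]) * diag_block_mat (map g [0..<m]) = diag_block_mat (map (%i. f i * g i) [0..<m])"
proof (rule block_mat_eqI)
 let ?f = "diag_block_mat (map f [0..<m])" and ?g = "diag_block_mat (map g [0..<m])"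
 have fg: "f i * g i \<in> Mat (d i) (d i)" if "i < m" for i using f[OF that] g[OF that] by simp
 have F: "?f \<in> Mat (offset m) (offset m)" by (rule diag_block_carrier(1)[OF f])
 have G: "?g \<in> Mat (offset m) (offset m)" by (rule diag_block_carrier(1)[OF g])
 show "?f * ?g \<in> Mat (offset m) (offset m)" by (rule mult_carrier_mat[OF F G])
 show "diag_block_mat (map (%i. f i * g i) [0..<m]) \<in> Mat (offset m) (offset m)" by (rule diag_block_carrier(1)[OF fg])
 fix i r l assume i: "i < m" "r < d i" and l: "l < offset m"
 from l obtain j t where j: "j < m" "t < d j" "l = offset j + t" by (rule offset_cases)
 have "(?f * ?g) $$ (offset i + r, l) = (\<Sum>i'<m. \<Sum>s<d i'. ?f $$ (offset i + r, offset i' + s) * ?g $$ (offset i' + s, l))"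
  unfolding mult_mat_entry[OF F G offset_less[OF i(1,2)] l] by (rule sum_offset)
 also have "... = (\<Sum>i'<m. if i = i' then \<Sum>s<d i'. f i $$ (r, s) * (if i' = j then g i' $$ (s, t) else 0) else 0)"
 proof (rule sum.cong)
  fix i' assume "i' \<in> {..<m}"
  then have i': "i' < m" by simp
  have "?f $$ (offset i + r, offset i' + s) * ?g $$ (offset i' + s, l)
   = (if i = i' then f i $$ (r, s) * (if i' = j then g i' $$ (s, t) else 0) else 0)" if "s < d i'" for s
   using diag_block_carrier(2)[OF f i(1) i' i(2) that] diag_block_carrier(2)[OF g i' j(1) that j(2)] unfolding j(3) by simp
  then show "(\<Sum>s<d i'. ?f $$ (offset i + r, offset i' + s) * ?g $$ (offset i' + s, l))
   = (if i = i' then \<Sum>s<d i'. f i $$ (r, s) * (if i' = j then g i' $$ (s, t) else 0) else 0)" by simp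
 qed simp
 also have "... = (if i = j then \<Sum>s<d i. f i $$ (r, s) * g i $$ (s, t) else 0)" using i(1) by simp
 also have "... = (if i = j then (f i * g i) $$ (r, t) else 0)"
  using mult_mat_entry[OF f[OF i(1)] g[OF i(1)] i(2)] j(2) by auto
 also have "... = diag_block_mat (map (%i. f i * g i) [0..<m]) $$ (offset i + r, l)"
  unfolding j(3) using diag_block_carrier(2)[OF fg i(1) j(1) i(2) j(2)] by simp
 finally show "(?f * ?g) $$ (offset i + r, l) = diag_block_mat (map (%i. f i * g i) [0..<m]) $$ (offset i + r, l)" .
qed

lemma diag_one: "diag_block_mat (map (%i. 1\<^sub>m (d i) :: real mat) [0..<m]) = 1\<^sub>m (offset m)"
proof (rule block_mat_eqI)
 have c: "(1\<^sub>m (d i) :: real mat) \<in> Mat (d i) (d i)" for i by simp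
 show "diag_block_mat (map (%i. 1\<^sub>m (d i) :: real mat) [0..<m]) \<in> Mat (offset m) (offset m)" by (rule diag_block_carrier(1)[OF c])
 fix i r l assume i: "i < m" "r < d i" and l: "l < offset m"
 from l obtain j t where j: "j < m" "t < d j" "l = offset j + t" by (rule offset_cases)
 show "diag_block_mat (map (%i. 1\<^sub>m (d i) :: real mat) [0..<m]) $$ (offset i + r, l) = 1\<^sub>m (offset m) $$ (offset i + r, l)"
  unfolding j(3) diag_block_carrier(2)[OF c i(1) j(1) i(2) j(2)] one_mat_offset[OF i(1) j(1) i(2) j(2)] ..
qed simp

text \<open>A square root is recognised by being positive semi-definite, so the candidate for
  \<open>sqrt_mat CA\<close>, given block by block, has to pass this test. The form splits into the
  forms of the blocks.\<close>

lemma diag_block_psd: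
 assumes f: "!!i. i < m ==> sym_pos_semidef (d i) (f i)"
 shows "sym_pos_semidef (offset m) (diag_block_mat (map f [0..<m]))"
 unfolding sym_pos_semidef_def
proof (intro conjI ballI)
 let ?D = "diag_block_mat (map f [0..<m])"
 have fc: "f i \<in> Mat (d i) (d i)" if "i < m" for i using f[OF that] by (simp add: sym_pos_semidef_def)
 show D: "?D \<in> Mat (offset m) (offset m)" by (rule diag_block_carrier(1)[OF fc])
 show "?D\<^sup>T = ?D"
 proof (rule block_mat_eqI)
  fix i r l assume i: "i < m" "r < d i" and l: "l < offset m"
  from l obtain j t where j: "j < m" "t < d j" "l = offset j + t" by (rule offset_cases)
  have "?D\<^sup>T $$ (offset i + r, l) = ?D $$ (l, offset i + r)" using D l offset_less[OF i] by simp
  also have "... = (if j = i then f j $$ (t, r) else 0)" unfolding j(3) by (rule diag_block_carrier(2)[OF fc j(1) i(1) j(2) i(2)])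
  also have "... = (if i = j then f i $$ (r, t) else 0)"
  proof (cases "i = j")
   case True
   have "(f i)\<^sup>T $$ (r, t) = f i $$ (t, r)" using fc[OF i(1)] i(2) j(2) True by simp
   then show ?thesis using f[OF i(1)] True by (simp add: sym_pos_semidef_def)
  qed simp
  also have "... = ?D $$ (offset i + r, l)" unfolding j(3) by (rule diag_block_carrier(2)[OF fc i(1) j(1) i(2) j(2), symmetric])
  finally show "?D\<^sup>T $$ (offset i + r, l) = ?D $$ (offset i + r, l)" .
 qed (use D in simp_all)
 fix v :: "real vec" assume v: "v \<in> Rn (offset m)"
 define w where "w = (%i. vec (d i) (%r. v $ (offset i + r)))"
 have blk: "(?D *\<^sub>v v) $ (offset i + r) = (f i *\<^sub>v w i) $ r" if i: "i < m" "r < d i" for i r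
 proof -
  have "(?D *\<^sub>v v) $ (offset i + r) = (\<Sum>l<offset m. ?D $$ (offset i + r, l) * v $ l)"
   using D v offset_less[OF i] by (simp add: scalar_prod_def lessThan_atLeast0)
  also have "... = (\<Sum>i'<m. \<Sum>t<d i'. ?D $$ (offset i + r, offset i' + t) * v $ (offset i' + t))" by (rule sum_offset)
  also have "... = (\<Sum>i'<m. if i = i' then \<Sum>t<d i'. f i $$ (r, t) * v $ (offset i' + t) else 0)"
  proof (rule sum.cong)
   fix i' assume "i' \<in> {..<m}"
   then have i': "i' < m" by simp
   have "?D $$ (offset i + r, offset i' + t) * v $ (offset i' + t) = (if i = i' then f i $$ (r, t) * v $ (offset i' + t) else 0)" if "t < d i'" for t
    using diag_block_carrier(2)[OF fc i(1) i' i(2) that] by simp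
   then show "(\<Sum>t<d i'. ?D $$ (offset i + r, offset i' + t) * v $ (offset i' + t))
    = (if i = i' then \<Sum>t<d i'. f i $$ (r, t) * v $ (offset i' + t) else 0)" by simp
  qed simp
  also have "... = (\<Sum>t<d i. f i $$ (r, t) * v $ (offset i + t))" using i(1) by simp
  also have "... = (f i *\<^sub>v w i) $ r"
   using fc[OF i(1)] i(2) by (simp add: scalar_prod_def lessThan_atLeast0 w_def)
  finally show ?thesis .
 qed
 have "v \<bullet> (?D *\<^sub>v v) = (\<Sum>l<offset m. v $ l * (?D *\<^sub>v v) $ l)"
  using D by (simp add: scalar_prod_def lessThan_atLeast0)
 also have "... = (\<Sum>i<m. \<Sum>r<d i. v $ (offset i + r) * (?D *\<^sub>v v) $ (offset i + r))" by (rule sum_offset)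
 also have "... = (\<Sum>i<m. w i \<bullet> (f i *\<^sub>v w i))"
 proof (rule sum.cong)
  fix i assume "i \<in> {..<m}"
  then have i: "i < m" by simp
  define y where "y = f i *\<^sub>v w i"
  have y: "y \<in> Rn (d i)"
   unfolding y_def by (rule mult_mat_vec_carrier[OF fc[OF i]]) (simp add: w_def)
  have "w i \<bullet> y = (\<Sum>r<d i. w i $ r * y $ r)" using y by (simp add: scalar_prod_def lessThan_atLeast0)
  then show "(\<Sum>r<d i. v $ (offset i + r) * (?D *\<^sub>v v) $ (offset i + r)) = w i \<bullet> (f i *\<^sub>v w i)"
   unfolding y_def using blk[OF i] by (simp add: w_def)
 qed simp
 also have "0 \<le> ..." using f by (intro sum_nonneg) (simp add: sym_pos_semidef_def w_def)
 finally show "0 \<le> v \<bullet> (?D *\<^sub>v v)" .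
qed

end

text \<open>Both traces equal the sum of the squared entries. Comparing them gives
  \<open>n \<le> N\<close> and the trace identity for the numbers \<open>c i\<close> in
  \<open>normalisation\<close>.\<close>

lemma sum_mat_squares:
 assumes "X \<in> Mat a b"
 shows "(\<Sum>l<a. (X * X\<^sup>T) $$ (l, l)) = (\<Sum>l<a. \<Sum>c<b. X $$ (l, c) * X $$ (l, c) :: real)"
  and "(\<Sum>c<b. (X\<^sup>T * X) $$ (c, c)) = (\<Sum>l<a. \<Sum>c<b. X $$ (l, c) * X $$ (l, c) :: real)"
proof -
 have T: "X\<^sup>T \<in> Mat b a" using assms by simp
 show "(\<Sum>l<a. (X * X\<^sup>T) $$ (l, l)) = (\<Sum>l<a. \<Sum>c<b. X $$ (l, c) * X $$ (l, c))"
 proof (rule sum.cong)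
  fix l assume "l \<in> {..<a}"
  then have l: "l < a" by simp
  show "(X * X\<^sup>T) $$ (l, l) = (\<Sum>c<b. X $$ (l, c) * X $$ (l, c))"
   unfolding mult_mat_entry[OF assms T l l] using assms l by (intro sum.cong) simp_all
 qed simp
 have "(\<Sum>c<b. (X\<^sup>T * X) $$ (c, c)) = (\<Sum>c<b. \<Sum>l<a. X $$ (l, c) * X $$ (l, c))"
 proof (rule sum.cong)
  fix c assume "c \<in> {..<b}"
  then have c: "c < b" by simp
  show "(X\<^sup>T * X) $$ (c, c) = (\<Sum>l<a. X $$ (l, c) * X $$ (l, c))"
   unfolding mult_mat_entry[OF T assms c c] using assms c by (intro sum.cong) simp_all
 qed simp
 then show "(\<Sum>c<b. (X\<^sup>T * X) $$ (c, c)) = (\<Sum>l<a. \<Sum>c<b. X $$ (l, c) * X $$ (l, c))"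
  by (simp only: sum.swap[of _ "{..<b}"])
qed

lemma sym_pos_def_minv:
 assumes A: "sym_pos_def n A"
 shows "sym_pos_semidef n (minv A)" "minv A * A = 1\<^sub>m n" "A * minv A = 1\<^sub>m n" "minv A \<in> Mat n n"
proof -
 have Ac: "A \<in> Mat n n" and As: "A\<^sup>T = A" using A by (auto simp: sym_pos_def_def)
 have dA: "det A \<noteq> 0" by (rule sym_pos_def_det[OF A])
 note m = minv[OF Ac dA]
 show "minv A * A = 1\<^sub>m n" "A * minv A = 1\<^sub>m n" "minv A \<in> Mat n n" by (rule m)+
 have "0 \<le> v \<bullet> (minv A *\<^sub>v v)" if v: "v \<in> Rn n" for v
 proof -
  define w where "w = minv A *\<^sub>v v"
  have w: "w \<in> Rn n" unfolding w_def by (rule mult_mat_vec_carrier[OF m(3) v])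
  have "A *\<^sub>v w = v" unfolding w_def assoc_mult_mat_vec[OF Ac m(3) v, symmetric] m(1) using v by simp
  then have "v \<bullet> w = w \<bullet> (A *\<^sub>v w)" using comm_scalar_prod[OF v w] by simp
  also have "0 \<le> ..." using sym_pos_def_semidef[OF A] w by (simp add: sym_pos_semidef_def)
  finally show ?thesis by (simp add: w_def)
 qed
 then show "sym_pos_semidef n (minv A)"
  using m(3) minv_transpose[OF Ac As dA] by (simp add: sym_pos_semidef_def)
qed

lemma sym_pos_semidef_smult:
 assumes M: "sym_pos_semidef n M" and a: "0 \<le> a"
 shows "sym_pos_semidef n (a \<cdot>\<^sub>m M)"
proof -
 have Mc: "M \<in> Mat n n" and Ms: "M\<^sup>T = M" using M by (auto simp: sym_pos_semidef_def)
 have "(a \<cdot>\<^sub>m M)\<^sup>T = a \<cdot>\<^sub>m M\<^sup>T" by (intro eq_matI) auto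
 moreover have "0 \<le> v \<bullet> ((a \<cdot>\<^sub>m M) *\<^sub>v v)" if v: "v \<in> Rn n" for v
  using M v a mult_mat_vec_carrier[OF Mc v] unfolding smult_mult_mat_vec[OF Mc v] by (simp add: sym_pos_semidef_def)
 ultimately show ?thesis using Mc Ms by (simp add: sym_pos_semidef_def)
qed

text \<open>The congruence \<open>x = \<surd>A x'\<close> turns the hypotheses on \<open>U\<close> and \<open>W\<close> into the orthogonality of the
 square matrix with blocks \<open>V\<close> and \<open>W\<close>.\<close>

lemma normalisation:
 fixes m n :: nat and d :: "nat => nat" and U W :: "nat => real mat" and c :: "nat => real" and A :: "real mat"
 defines "N \<equiv> offset d m" and "Ai \<equiv> %i. U i * A * (U i)\<^sup>T"
 defines "CA \<equiv> diag_block_mat (map (%i. c i \<cdot>\<^sub>m minv (Ai i)) [0..<m])"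
 assumes U: "!!i. i < m ==> U i \<in> Mat (d i) n" and rank: "!!i. i < m ==> mat_rank (U i) = d i"
  and c: "!!i. i < m ==> 0 < c i" and A: "sym_pos_def n A"
  and UCU: "(stack_rows n m U)\<^sup>T * CA * stack_rows n m U = minv A"
  and W: "!!i. i < m ==> W i \<in> Mat (d i) (N - n)"
  and WW: "sqrt_mat CA * stack_rows n m U * A * (stack_rows n m U)\<^sup>T * sqrt_mat CA
   + stack_rows (N - n) m W * (stack_rows (N - n) m W)\<^sup>T = 1\<^sub>m N"
 obtains V where "!!i. i < m ==> sym_pos_def (d i) (Ai i)" and "n \<le> N" and "(\<Sum>i<m. c i * real (d i)) = real n"
  and "!!i. i < m ==> V i \<in> Mat (d i) n"
  and "!!i. i < m ==> sqrt_mat (Ai i) * V i = sqrt (c i) \<cdot>\<^sub>m (U i * sqrt_mat A)"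
  and "!!i j. i < m ==> j < m ==> V i * (V j)\<^sup>T + W i * (W j)\<^sup>T = (if i = j then 1\<^sub>m (d i) else 0\<^sub>m (d i) (d j))"
  and "!!i. i < m ==> V i * (V i)\<^sup>T = c i \<cdot>\<^sub>m 1\<^sub>m (d i)"
  and "!!x y. x \<in> Rn n ==> y \<in> Rn (N - n) ==>
   (\<Sum>i<m. (V i *\<^sub>v x + W i *\<^sub>v y) \<bullet> (V i *\<^sub>v x + W i *\<^sub>v y)) = x \<bullet> x + y \<bullet> y"
proof -
 have Aspd: "sym_pos_def (d i) (Ai i)" if "i < m" for i
  unfolding Ai_def by (rule sym_pos_def_congruence[OF A U[OF that] full_row_rank_kernel[OF U[OF that] rank[OF that]]])
 define S where "S = sqrt_mat A"
 define Si where "Si = (%i. sqrt_mat (Ai i))"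
 have S: "sym_pos_def n S" "S * S = A" using sqrt_mat[OF A] by (simp_all add: S_def)
 have Si: "sym_pos_def (d i) (Si i)" "Si i * Si i = Ai i" if "i < m" for i using sqrt_mat[OF Aspd[OF that]] by (simp_all add: Si_def)
 have Sc: "S \<in> Mat n n" and Ss: "S\<^sup>T = S" using S by (auto simp: sym_pos_def_def)
 have Sic: "Si i \<in> Mat (d i) (d i)" if "i < m" for i using Si[OF that] by (auto simp: sym_pos_def_def)
 have Ac: "A \<in> Mat n n" using A by (simp add: sym_pos_def_def)
 define T where "T = (%i. minv (Si i))"
 have T: "sym_pos_semidef (d i) (T i)" "T i * Si i = 1\<^sub>m (d i)" "Si i * T i = 1\<^sub>m (d i)" "T i \<in> Mat (d i) (d i)" if "i < m" for i
  using sym_pos_def_minv[OF Si(1)[OF that]] by (simp_all add: T_def)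
 have Tc: "T i \<in> Mat (d i) (d i)" and Ts: "(T i)\<^sup>T = T i" if "i < m" for i using T(1,4)[OF that] by (auto simp: sym_pos_semidef_def)
 \<comment> \<open>\<open>T i\<close> is the inverse square root of \<open>Ai i\<close>, so
   \<open>D i\<close> squares to the \<open>i\<close>-th block of \<open>CA\<close>.\<close>
 define D where "D = (%i. sqrt (c i) \<cdot>\<^sub>m T i)"
 have Dc: "D i \<in> Mat (d i) (d i)" if "i < m" for i using Tc[OF that] by (simp add: D_def)
 have Dpsd: "sym_pos_semidef (d i) (D i)" if "i < m" for i
  unfolding D_def using c[OF that] by (intro sym_pos_semidef_smult T(1)[OF that]) simp
 have smm: "(a \<cdot>\<^sub>m X) * (b \<cdot>\<^sub>m Y) = (a * b) \<cdot>\<^sub>m (X * Y)" if "X \<in> Mat p q" "Y \<in> Mat q r" for a b :: real and X Y p q r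
  using that by (intro eq_matI) (auto simp: mult_mat_entry[of _ p q _ r] sum_distrib_left mult_ac)
 have TT: "T i * T i = minv (Ai i)" if i: "i < m" for i
 proof (rule minv_eqI[symmetric])
  show "Ai i \<in> Mat (d i) (d i)" using Aspd[OF i] by (simp add: sym_pos_def_def)
  show "T i * T i \<in> Mat (d i) (d i)" using Tc[OF i] by simp
  have "Ai i * (T i * T i) = Si i * (Si i * (T i * T i))"
   unfolding Si(2)[OF i, symmetric] by (rule assoc_mult_mat[OF Sic[OF i] Sic[OF i] mult_carrier_mat[OF Tc[OF i] Tc[OF i]]])
  also have "Si i * (T i * T i) = Si i * T i * T i" by (rule assoc_mult_mat[OF Sic[OF i] Tc[OF i] Tc[OF i], symmetric])
  also have "... = T i" unfolding T(3)[OF i] using Tc[OF i] by simp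
  finally show "Ai i * (T i * T i) = 1\<^sub>m (d i)" unfolding T(3)[OF i] .
 qed
 have cc: "sqrt (c i) * sqrt (c i) = c i" if "i < m" for i using c[OF that] by simp
 have DD: "D i * D i = c i \<cdot>\<^sub>m minv (Ai i)" if "i < m" for i
  unfolding D_def smm[OF Tc[OF that] Tc[OF that]] TT[OF that] cc[OF that] ..
 define Db where "Db = diag_block_mat (map D [0..<m])"
 have Dbc: "Db \<in> Mat N N" unfolding Db_def N_def by (rule diag_block_carrier(1)[OF Dc])
 have DbDb: "Db * Db = CA"
 proof -
  have "Db * Db = diag_block_mat (map (%i. D i * D i) [0..<m])" unfolding Db_def by (rule diag_mult_diag[OF Dc Dc])
  also have "map (%i. D i * D i) [0..<m] = map (%i. c i \<cdot>\<^sub>m minv (Ai i)) [0..<m]" by (simp add: DD)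
  finally show ?thesis unfolding CA_def .
 qed
 have Dbpsd: "sym_pos_semidef N Db" unfolding Db_def N_def by (rule diag_block_psd[OF Dpsd])
 then have Dbs: "Db\<^sup>T = Db" by (simp add: sym_pos_semidef_def)
 have CAspd: "sym_pos_def N CA"
 proof -
  \<comment> \<open>The inverse of \<open>D i\<close>: it makes \<open>Db\<close> injective and
    hence \<open>CA\<close>, the square of \<open>Db\<close>, definite.\<close>
  define E where "E = (%i. (1 / sqrt (c i)) \<cdot>\<^sub>m Si i)"
  have Ec: "E i \<in> Mat (d i) (d i)" if "i < m" for i using Sic[OF that] by (simp add: E_def)
  have ED: "E i * D i = 1\<^sub>m (d i)" if i: "i < m" for i
  proof -
   have "E i * D i = (1 / sqrt (c i) * sqrt (c i)) \<cdot>\<^sub>m 1\<^sub>m (d i)"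
    unfolding E_def D_def smm[OF Sic[OF i] Tc[OF i]] T(3)[OF i] ..
   then show ?thesis using c[OF i] by (intro eq_matI) auto
  qed
  define Eb where "Eb = diag_block_mat (map E [0..<m])"
  have Ebc: "Eb \<in> Mat N N" unfolding Eb_def N_def by (rule diag_block_carrier(1)[OF Ec])
  have "Eb * Db = diag_block_mat (map (%i. E i * D i) [0..<m])" unfolding Eb_def Db_def by (rule diag_mult_diag[OF Ec Dc])
  also have "map (%i. E i * D i) [0..<m] = map (%i. 1\<^sub>m (d i)) [0..<m]" by (simp add: ED)
  finally have EbDb: "Eb * Db = 1\<^sub>m N" unfolding diag_one N_def .
  show ?thesis unfolding sym_pos_def_def
  proof (intro conjI ballI impI)
   show "CA \<in> Mat N N" unfolding DbDb[symmetric] by (rule mult_carrier_mat[OF Dbc Dbc])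
   show "CA\<^sup>T = CA" unfolding DbDb[symmetric] transpose_mult[OF Dbc Dbc] Dbs ..
   fix v :: "real vec" assume v: "v \<in> Rn N" "v \<noteq> 0\<^sub>v N"
   have Dv: "Db *\<^sub>v v \<in> Rn N" by (rule mult_mat_vec_carrier[OF Dbc v(1)])
   have "v \<bullet> (CA *\<^sub>v v) = (Db *\<^sub>v v) \<bullet> (Db *\<^sub>v v)"
    unfolding DbDb[symmetric] assoc_mult_mat_vec[OF Dbc Dbc v(1)]
    by (rule mat_vec_scalar_prod_sym[OF Dbc Dbs v(1) Dv])
   moreover have "(Db *\<^sub>v v) \<bullet> (Db *\<^sub>v v) \<noteq> 0"
   proof
    assume "(Db *\<^sub>v v) \<bullet> (Db *\<^sub>v v) = 0"
    then have z: "Db *\<^sub>v v = 0\<^sub>v N" by (rule scalar_prod_self_eq_0[OF Dv])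
    have "v = Eb *\<^sub>v (Db *\<^sub>v v)" unfolding assoc_mult_mat_vec[OF Ebc Dbc v(1), symmetric] EbDb using v(1) by simp
    then show False using v(2) mult_mat_zero_vec[OF Ebc] unfolding z by simp
   qed
   ultimately show "0 < v \<bullet> (CA *\<^sub>v v)" using scalar_prod_self_nonneg[of "Db *\<^sub>v v"] by simp
  qed
 qed
 have sqCA: "sqrt_mat CA = Db" by (rule sqrt_mat_eqI[OF CAspd Dbpsd DbDb])
 define Uf where "Uf = stack_rows n m U"
 define Wf where "Wf = stack_rows (N - n) m W"
 have Uf: "Uf \<in> Mat N n" unfolding Uf_def N_def by (rule stack_rows_carrier(1)[OF U])
 have Wf: "Wf \<in> Mat N (N - n)" unfolding Wf_def using stack_rows_carrier(1)[of m W d "N - n"] W by (simp add: N_def)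
 define P where "P = Db * Uf"
 have P: "P \<in> Mat N n" unfolding P_def by (rule mult_carrier_mat[OF Dbc Uf])
 have PT: "P\<^sup>T \<in> Mat n N" using P by simp
 have UT: "Uf\<^sup>T \<in> Mat n N" using Uf by simp
 have PTe: "P\<^sup>T = Uf\<^sup>T * Db" unfolding P_def transpose_mult[OF Dbc Uf] Dbs ..
 \<comment> \<open>\<open>X\<close> is \<open>sqrt_mat CA * Ufull * sqrt_mat A\<close>. The two
   matrix hypotheses become \<open>X * X\<^sup>T + W * W\<^sup>T = 1\<close> and
   \<open>X\<^sup>T * X = 1\<close>.\<close>
 define X where "X = P * S"
 have X: "X \<in> Mat N n" unfolding X_def by (rule mult_carrier_mat[OF P Sc])
 have XT: "X\<^sup>T = S * P\<^sup>T" unfolding X_def transpose_mult[OF P Sc] Ss ..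
 have SPT: "S * P\<^sup>T \<in> Mat n N" by (rule mult_carrier_mat[OF Sc PT])
 have XXT: "X * X\<^sup>T + Wf * Wf\<^sup>T = 1\<^sub>m N"
 proof -
  have "X * X\<^sup>T = P * (S * (S * P\<^sup>T))" unfolding XT unfolding X_def by (rule assoc_mult_mat[OF P Sc SPT])
  also have "S * (S * P\<^sup>T) = A * P\<^sup>T" unfolding S(2)[symmetric] by (rule assoc_mult_mat[OF Sc Sc PT, symmetric])
  also have "P * (A * P\<^sup>T) = P * A * P\<^sup>T" by (rule assoc_mult_mat[OF P Ac PT, symmetric])
  also have "... = P * A * Uf\<^sup>T * Db" unfolding PTe by (rule assoc_mult_mat[OF mult_carrier_mat[OF P Ac] UT Dbc, symmetric])
  finally show ?thesis using WW unfolding sqCA Uf_def[symmetric] Wf_def[symmetric] P_def by simp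
 qed
 have XTX: "X\<^sup>T * X = 1\<^sub>m n"
 proof -
  have DU: "Db * Uf \<in> Mat N n" by (rule mult_carrier_mat[OF Dbc Uf])
  have "P\<^sup>T * P = Uf\<^sup>T * (Db * (Db * Uf))" unfolding PTe unfolding P_def by (rule assoc_mult_mat[OF UT Dbc DU])
  also have "Db * (Db * Uf) = CA * Uf" unfolding DbDb[symmetric] by (rule assoc_mult_mat[OF Dbc Dbc Uf, symmetric])
  also have "Uf\<^sup>T * (CA * Uf) = Uf\<^sup>T * CA * Uf"
   using CAspd by (intro assoc_mult_mat[OF UT _ Uf, symmetric]) (simp add: sym_pos_def_def)
  also have "... = minv A" using UCU unfolding Uf_def .
  finally have PP: "P\<^sup>T * P = minv A" .
  note mA = sym_pos_def_minv[OF A]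
  \<comment> \<open>Multiplied by the invertible \<open>S\<close> on the left, the claim
    \<open>S * minv A * S = 1\<close> follows from \<open>S * S = A\<close>; afterwards
    \<open>S\<close> is cancelled.\<close>
  have SAS: "S * (S * (minv A * S)) = S"
  proof -
   have "S * (S * (minv A * S)) = S * S * (minv A * S)"
    by (rule assoc_mult_mat[OF Sc Sc mult_carrier_mat[OF mA(4) Sc], symmetric])
   also have "S * S = A" by (rule S(2))
   also have "A * (minv A * S) = A * minv A * S" by (rule assoc_mult_mat[OF Ac mA(4) Sc, symmetric])
   also have "... = S" unfolding mA(3) using Sc by simp
   finally show ?thesis .
  qed
  note mS = sym_pos_def_minv[OF S(1)]
  have Y: "S * (minv A * S) \<in> Mat n n" using Sc mA(4) by simp
  have "S * (minv A * S) = minv S * S * (S * (minv A * S))" unfolding mS(2) by (rule left_mult_one_mat[OF Y, symmetric])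
  also have "... = minv S * (S * (S * (minv A * S)))" by (rule assoc_mult_mat[OF mS(4) Sc Y])
  also have "... = 1\<^sub>m n" unfolding SAS mS(2) ..
  finally have one: "S * (minv A * S) = 1\<^sub>m n" .
  have "X\<^sup>T * X = S * (P\<^sup>T * (P * S))" unfolding XT unfolding X_def by (rule assoc_mult_mat[OF Sc PT mult_carrier_mat[OF P Sc]])
  also have "P\<^sup>T * (P * S) = P\<^sup>T * P * S" by (rule assoc_mult_mat[OF PT P Sc, symmetric])
  finally show ?thesis unfolding PP one .
 qed
 have trX: "(\<Sum>l<N. \<Sum>e<n. X $$ (l, e) * X $$ (l, e)) = real n"
  unfolding sum_mat_squares(2)[OF X, symmetric] XTX by simp
 \<comment> \<open>In traces, \<open>N\<close> is \<open>n\<close> plus the sum of the squared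
   entries of \<open>W\<close>. This makes the difference \<open>N - n\<close> of natural numbers a
   genuine one.\<close>
 have nN: "n \<le> N"
 proof -
  have XXc: "X * X\<^sup>T \<in> Mat N N" "Wf * Wf\<^sup>T \<in> Mat N N" using X Wf by auto
  have "(\<Sum>l<N. (X * X\<^sup>T) $$ (l, l)) + (\<Sum>l<N. (Wf * Wf\<^sup>T) $$ (l, l)) = (\<Sum>l<N. (X * X\<^sup>T + Wf * Wf\<^sup>T) $$ (l, l))"
   unfolding sum.distrib[symmetric] using X Wf by (intro sum.cong refl) (simp del: index_mult_mat(1))
  also have "... = real N" unfolding XXT by simp
  finally have "real n + (\<Sum>l<N. \<Sum>e<N - n. Wf $$ (l, e) * Wf $$ (l, e)) = real N"
   unfolding sum_mat_squares(1)[OF X] sum_mat_squares(1)[OF Wf] trX .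
  moreover have "0 \<le> (\<Sum>l<N. \<Sum>e<N - n. Wf $$ (l, e) * Wf $$ (l, e))" by (intro sum_nonneg) simp
  ultimately show ?thesis by linarith
 qed
 define V where "V = (%i. D i * U i * S)"
 have DUc: "D i * U i \<in> Mat (d i) n" if "i < m" for i by (rule mult_carrier_mat[OF Dc[OF that] U[OF that]])
 have Vc: "V i \<in> Mat (d i) n" if "i < m" for i unfolding V_def by (rule mult_carrier_mat[OF DUc[OF that] Sc])
 have XV: "X = stack_rows n m V"
 proof -
  have "P = stack_rows n m (%i. D i * U i)" unfolding P_def Db_def Uf_def by (rule diag_mult_stack[OF Dc U])
  then show ?thesis unfolding X_def V_def using stack_mult[OF DUc Sc] by simp
 qed
 have orth: "V i * (V j)\<^sup>T + W i * (W j)\<^sup>T = (if i = j then 1\<^sub>m (d i) else 0\<^sub>m (d i) (d j))" if ij: "i < m" "j < m" for i j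
 proof (rule eq_matI)
  fix r t assume "r < dim_row (if i = j then 1\<^sub>m (d i) else 0\<^sub>m (d i) (d j) :: real mat)" "t < dim_col (if i = j then 1\<^sub>m (d i) else 0\<^sub>m (d i) (d j) :: real mat)"
  then have rt: "r < d i" "t < d j" by (auto split: if_splits)
  have o: "offset d i + r < N" "offset d j + t < N" unfolding N_def by (rule offset_less[where d = d, OF ij(1) rt(1)] offset_less[where d = d, OF ij(2) rt(2)])+
  have v: "(X * X\<^sup>T) $$ (offset d i + r, offset d j + t) = (V i * (V j)\<^sup>T) $$ (r, t)"
   unfolding XV by (rule stack_mult_transpose[where d = d, OF Vc ij rt])
  have w: "(Wf * Wf\<^sup>T) $$ (offset d i + r, offset d j + t) = (W i * (W j)\<^sup>T) $$ (r, t)"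
   unfolding Wf_def by (rule stack_mult_transpose[where d = d, OF W ij rt])
  have e: "(X * X\<^sup>T + Wf * Wf\<^sup>T) $$ (offset d i + r, offset d j + t) = (V i * (V j)\<^sup>T) $$ (r, t) + (W i * (W j)\<^sup>T) $$ (r, t)"
   using v w o X Wf by simp
  have one: "(1\<^sub>m N :: real mat) $$ (offset d i + r, offset d j + t) = (if i = j then 1\<^sub>m (d i) $$ (r, t) else 0)"
   unfolding N_def by (rule one_mat_offset[where d = d, OF ij rt])
  have "(V i * (V j)\<^sup>T + W i * (W j)\<^sup>T) $$ (r, t) = (V i * (V j)\<^sup>T) $$ (r, t) + (W i * (W j)\<^sup>T) $$ (r, t)"
   using Vc[OF ij(1)] Vc[OF ij(2)] W[OF ij(1)] W[OF ij(2)] rt by simp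
  also have "... = (if i = j then 1\<^sub>m (d i) $$ (r, t) else 0)" using e one unfolding XXT by simp
  finally show "(V i * (V j)\<^sup>T + W i * (W j)\<^sup>T) $$ (r, t) = (if i = j then 1\<^sub>m (d i) else 0\<^sub>m (d i) (d j)) $$ (r, t)"
   using rt by simp
 qed (use Vc W ij in \<open>auto split: if_splits\<close>)
 have VV: "V i * (V i)\<^sup>T = c i \<cdot>\<^sub>m 1\<^sub>m (d i)" if i: "i < m" for i
 proof -
  have Ds: "(D i)\<^sup>T = D i" using Dpsd[OF i] by (simp add: sym_pos_semidef_def)
  have UiT: "(U i)\<^sup>T \<in> Mat n (d i)" using U[OF i] by simp
  have DUT: "(D i * U i)\<^sup>T \<in> Mat n (d i)" using DUc[OF i] by simp
  have "V i * (V i)\<^sup>T = (D i * U i) * (S * (S * (D i * U i)\<^sup>T))"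
   unfolding V_def transpose_mult[OF DUc[OF i] Sc] Ss by (rule assoc_mult_mat[OF DUc[OF i] Sc mult_carrier_mat[OF Sc DUT]])
  also have "S * (S * (D i * U i)\<^sup>T) = A * (D i * U i)\<^sup>T" unfolding S(2)[symmetric] by (rule assoc_mult_mat[OF Sc Sc DUT, symmetric])
  also have "... = A * ((U i)\<^sup>T * D i)" unfolding transpose_mult[OF Dc[OF i] U[OF i]] Ds ..
  also have "... = A * (U i)\<^sup>T * D i" by (rule assoc_mult_mat[OF Ac UiT Dc[OF i], symmetric])
  also have "D i * U i * (A * (U i)\<^sup>T * D i) = D i * (U i * (A * (U i)\<^sup>T * D i))"
   by (rule assoc_mult_mat[OF Dc[OF i] U[OF i] mult_carrier_mat[OF mult_carrier_mat[OF Ac UiT] Dc[OF i]]])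
  also have "U i * (A * (U i)\<^sup>T * D i) = U i * (A * (U i)\<^sup>T) * D i"
   by (rule assoc_mult_mat[OF U[OF i] mult_carrier_mat[OF Ac UiT] Dc[OF i], symmetric])
  also have "U i * (A * (U i)\<^sup>T) = Ai i" unfolding Ai_def by (rule assoc_mult_mat[OF U[OF i] Ac UiT, symmetric])
  also have "D i * (Ai i * D i) = (sqrt (c i) * sqrt (c i)) \<cdot>\<^sub>m (T i * (Ai i * T i))"
  proof -
   have Aic: "Ai i \<in> Mat (d i) (d i)" using Aspd[OF i] by (simp add: sym_pos_def_def)
   have "Ai i * D i = sqrt (c i) \<cdot>\<^sub>m (Ai i * T i)" unfolding D_def by (rule mult_smult_distrib[OF Aic Tc[OF i]])
   then show ?thesis using smm[OF Tc[OF i] mult_carrier_mat[OF Aic Tc[OF i]], of "sqrt (c i)" "sqrt (c i)"] by (simp add: D_def)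
  qed
  also have "Ai i * T i = Si i * (Si i * T i)" unfolding Si(2)[OF i, symmetric] by (rule assoc_mult_mat[OF Sic[OF i] Sic[OF i] Tc[OF i]])
  also have "T i * (Si i * (Si i * T i)) = 1\<^sub>m (d i)" unfolding T(3)[OF i] using T(2)[OF i] Sic[OF i] by simp
  finally show ?thesis unfolding cc[OF i] .
 qed
 have SV: "sqrt_mat (Ai i) * V i = sqrt (c i) \<cdot>\<^sub>m (U i * sqrt_mat A)" if i: "i < m" for i
 proof -
  have US: "U i * S \<in> Mat (d i) n" by (rule mult_carrier_mat[OF U[OF i] Sc])
  have "V i = D i * (U i * S)" unfolding V_def by (rule assoc_mult_mat[OF Dc[OF i] U[OF i] Sc])
  then have "Si i * V i = Si i * D i * (U i * S)" using assoc_mult_mat[OF Sic[OF i] Dc[OF i] US] by simp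
  also have "Si i * D i = sqrt (c i) \<cdot>\<^sub>m 1\<^sub>m (d i)" unfolding D_def mult_smult_distrib[OF Sic[OF i] Tc[OF i]] T(3)[OF i] ..
  also have "... * (U i * S) = sqrt (c i) \<cdot>\<^sub>m (1\<^sub>m (d i) * (U i * S))" by (rule mult_smult_assoc_mat[OF one_carrier_mat US])
  also have "1\<^sub>m (d i) * (U i * S) = U i * S" by (rule left_mult_one_mat[OF US])
  finally show ?thesis by (simp add: Si_def S_def)
 qed
 have cd: "(\<Sum>i<m. c i * real (d i)) = real n"
 proof -
  have "(\<Sum>l<N. \<Sum>e<n. X $$ (l, e) * X $$ (l, e)) = (\<Sum>i<m. \<Sum>r<d i. \<Sum>e<n. X $$ (offset d i + r, e) * X $$ (offset d i + r, e))"
   unfolding N_def by (rule sum_offset)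
  also have "... = (\<Sum>i<m. \<Sum>r<d i. \<Sum>e<n. V i $$ (r, e) * V i $$ (r, e))"
   unfolding XV using stack_rows_carrier(2)[OF Vc] by (intro sum.cong refl) simp
  also have "... = (\<Sum>i<m. c i * real (d i))"
  proof (rule sum.cong)
   fix i assume "i \<in> {..<m}"
   then have i: "i < m" by simp
   show "(\<Sum>r<d i. \<Sum>e<n. V i $$ (r, e) * V i $$ (r, e)) = c i * real (d i)"
    unfolding sum_mat_squares(1)[OF Vc[OF i], symmetric] VV[OF i] by simp
  qed simp
  finally show ?thesis unfolding trX ..
 qed
 have norm: "(\<Sum>i<m. (V i *\<^sub>v x + W i *\<^sub>v y) \<bullet> (V i *\<^sub>v x + W i *\<^sub>v y)) = x \<bullet> x + y \<bullet> y"
  if x: "x \<in> Rn n" and y: "y \<in> Rn (N - n)" for x y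
 proof -
  \<comment> \<open>\<open>H\<close> is square because \<open>n \<le> N\<close>, and its rows are
    orthonormal; a right inverse of a square matrix is a left inverse, so \<open>H\<close> is an
    isometry.\<close>
  define H where "H = hcat X Wf"
  have H: "H \<in> Mat N N" using hcat_carrier[OF X Wf] nN by (simp add: H_def)
  have HT: "H\<^sup>T \<in> Mat N N" using H by simp
  have "H * H\<^sup>T = 1\<^sub>m N" unfolding H_def hcat_mult_transpose[OF X Wf X Wf] by (rule XXT)
  then have HH: "H\<^sup>T * H = 1\<^sub>m N" by (rule mat_mult_left_right_inverse[OF H HT])
  define z where "z = X *\<^sub>v x + Wf *\<^sub>v y"
  have xy: "x @\<^sub>v y \<in> Rn N" using append_carrier_vec[OF x y] nN by simp
  have zH: "z = H *\<^sub>v (x @\<^sub>v y)" unfolding H_def z_def by (rule hcat_mult_vec[OF X Wf x y, symmetric])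
  have zc: "z \<in> Rn N" unfolding zH by (rule mult_mat_vec_carrier[OF H xy])
  have "z \<bullet> z = (x @\<^sub>v y) \<bullet> (H\<^sup>T *\<^sub>v (H *\<^sub>v (x @\<^sub>v y)))"
   using scalar_prod_transpose[OF H xy zc] unfolding zH by simp
  also have "H\<^sup>T *\<^sub>v (H *\<^sub>v (x @\<^sub>v y)) = x @\<^sub>v y"
   unfolding assoc_mult_mat_vec[OF HT H xy, symmetric] HH using xy by simp
  also have "(x @\<^sub>v y) \<bullet> (x @\<^sub>v y) = x \<bullet> x + y \<bullet> y" by (rule scalar_prod_append[OF x y x y])
  finally have zz: "z \<bullet> z = x \<bullet> x + y \<bullet> y" .
  have "z \<bullet> z = (\<Sum>l<offset d m. z $ l * z $ l)" using scalar_prod_self_sum[OF zc] unfolding N_def .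
  also have "... = (\<Sum>i<m. \<Sum>r<d i. z $ (offset d i + r) * z $ (offset d i + r))" by (rule sum_offset)
  also have "... = (\<Sum>i<m. (V i *\<^sub>v x + W i *\<^sub>v y) \<bullet> (V i *\<^sub>v x + W i *\<^sub>v y))"
  proof (rule sum.cong)
   fix i assume "i \<in> {..<m}"
   then have i: "i < m" by simp
   have u: "V i *\<^sub>v x + W i *\<^sub>v y \<in> Rn (d i)"
    by (intro add_carrier_vec mult_mat_vec_carrier[OF Vc[OF i] x] mult_mat_vec_carrier[OF W[OF i] y])
   have "z $ (offset d i + r) = (V i *\<^sub>v x + W i *\<^sub>v y) $ r" if r: "r < d i" for r
   proof -
    have o: "offset d i + r < N" unfolding N_def by (rule offset_less[where d = d, OF i r])
    have "z $ (offset d i + r) = (X *\<^sub>v x) $ (offset d i + r) + (Wf *\<^sub>v y) $ (offset d i + r)"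
     unfolding z_def using o Wf by simp
    also have "(X *\<^sub>v x) $ (offset d i + r) = (V i *\<^sub>v x) $ r" unfolding XV by (rule stack_mult_vec[where d = d, OF Vc i r x])
    also have "(Wf *\<^sub>v y) $ (offset d i + r) = (W i *\<^sub>v y) $ r" unfolding Wf_def by (rule stack_mult_vec[where d = d, OF W i r y])
    finally show ?thesis using W[OF i] r by simp
   qed
   then show "(\<Sum>r<d i. z $ (offset d i + r) * z $ (offset d i + r)) = (V i *\<^sub>v x + W i *\<^sub>v y) \<bullet> (V i *\<^sub>v x + W i *\<^sub>v y)"
    unfolding scalar_prod_self_sum[OF u] by simp
  qed simp
  finally show ?thesis using zz by simp
 qed
 show ?thesis by (rule that[OF Aspd nN cd Vc SV orth VV norm])
qed

section \<open>The change of variables\<close>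

lemma smult_scalar_prod_self: "u \<in> Rn k ==> (t \<cdot>\<^sub>v u) \<bullet> (t \<cdot>\<^sub>v u) = (t * t) * (u \<bullet> (u :: real vec))"
 by simp

text \<open>The power sends 0 to 0 and \<infinity> to \<infinity> and nonzero values to nonzero
  values, so the convention for \<infinity> times 0 is respected.\<close>

lemma ennreal_powr_mult: "ennreal_powr (x * y) p = ennreal_powr x p * ennreal_powr y p"
proof -
 have z: "ennreal_powr 0 p = 0" by (simp add: ennreal_powr_def)
 have t: "ennreal_powr (top_class.top * y) p = ennreal_powr top_class.top p * ennreal_powr y p" for y
 proof (cases "y = 0")
  case True
  then show ?thesis using z by simp
 next
  case False
  have "ennreal_powr y p \<noteq> 0"
  proof (cases y rule: ennreal_powr_cases)
   case (real r)
   then show ?thesis using False by (auto simp: ennreal_powr_ennreal)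
  qed simp
  then show ?thesis using False by (simp add: ennreal_top_mult)
 qed
 show ?thesis
 proof (cases x rule: ennreal_powr_cases)
  case top
  then show ?thesis using t by simp
 next
  case (real r)
  note x = real
  show ?thesis
  proof (cases y rule: ennreal_powr_cases)
   case top
   then show ?thesis using t[of x] by (simp add: mult.commute)
  next
   case (real q)
   then show ?thesis using x by (simp add: ennreal_mult'[symmetric] ennreal_powr_ennreal powr_mult)
  qed
 qed
qed

lemma ennreal_powr_prod: "ennreal_powr (\<Prod>i<m. x i) p = (\<Prod>i<m::nat. ennreal_powr (x i) p)"
 by (induction m) (simp_all add: ennreal_powr_mult ennreal_powr_def[of 1])

text \<open>Lets the two instances of the comparison share one middle term: the outer one is stated
  for \<rho>-th powers with rescaled weights.\<close>

lemma norm_product_powr: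
 assumes "0 < r" "!!i. i < m ==> 0 < s i"
 shows "norm_product m d (1 / r) (%i. r * s i) (%i u. psi i u powr r) = ennreal_powr (norm_product m d 1 s psi) r"
 unfolding norm_product_def ennreal_powr_prod ennreal_powr_powr
proof (rule prod.cong)
 fix i assume "i \<in> {..<m}"
 then have "0 < s i" using assms by simp
 then have "1 / r * (r * s i) = 1 * s i" "r * (1 / (r * s i)) = 1 / s i" using assms(1) by simp_all
 then show "ennreal_powr (\<integral>\<^sup>+ u. ennreal ((psi i (sqrt (1 / r * (r * s i)) \<cdot>\<^sub>v u) powr r) powr (1 / (r * s i))) \<partial>gauss (d i)) (r * s i)
  = ennreal_powr (\<integral>\<^sup>+ u. ennreal (psi i (sqrt (1 * s i) \<cdot>\<^sub>v u) powr (1 / s i)) \<partial>gauss (d i)) (s i * r)"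
  unfolding powr_powr by (simp only: mult.commute)
qed simp

section \<open>Scalings and null sets\<close>

lemma sym_pos_def_smult:
 assumes M: "sym_pos_def n M" and a: "0 < a"
 shows "sym_pos_def n (a \<cdot>\<^sub>m M)"
proof -
 have Mc: "M \<in> Mat n n" and Ms: "M\<^sup>T = M" using M by (auto simp: sym_pos_def_def)
 have "(a \<cdot>\<^sub>m M)\<^sup>T = a \<cdot>\<^sub>m M\<^sup>T" by (intro eq_matI) auto
 moreover have "0 < v \<bullet> ((a \<cdot>\<^sub>m M) *\<^sub>v v)" if v: "v \<in> Rn n" "v \<noteq> 0\<^sub>v n" for v
  using M v a mult_mat_vec_carrier[OF Mc v(1)] unfolding smult_mult_mat_vec[OF Mc v(1)] by (simp add: sym_pos_def_def)
 ultimately show ?thesis using Mc Ms by (simp add: sym_pos_def_def)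
qed

lemma sym_pos_def_one: "sym_pos_def n (1\<^sub>m n)"
 unfolding sym_pos_def_def
proof (intro conjI ballI impI)
 fix v :: "real vec" assume v: "v \<in> Rn n" "v \<noteq> 0\<^sub>v n"
 have "v \<bullet> v \<noteq> 0" using scalar_prod_self_eq_0[OF v(1)] v(2) by blast
 then show "0 < v \<bullet> (1\<^sub>m n *\<^sub>v v)" using scalar_prod_self_nonneg[of v] v(1) by simp
qed simp_all

lemma nn_integral_lborel_vec_scale:
 assumes a: "0 < a" and g: "g \<in> borel_fun k"
 shows "ennreal (a ^ k) * (\<integral>\<^sup>+ v. g (a \<cdot>\<^sub>v v) \<partial>leb k) = (\<integral>\<^sup>+ v. g v \<partial>leb k)"
proof -
 have "(\<integral>\<^sup>+ v. g (a \<cdot>\<^sub>v v) \<partial>leb k) = (\<integral>\<^sup>+ v. g ((a \<cdot>\<^sub>m 1\<^sub>m k) *\<^sub>v v) \<partial>leb k)"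
  by (intro nn_integral_cong) (simp add: smult_mult_mat_vec[of _ k k])
 then show ?thesis
  using preserves_lborel_by_detD[OF preserves_lborel_sym_pos_def[OF sym_pos_def_smult[OF sym_pos_def_one a]] g] by simp
qed

text \<open>Polar decomposition \<open>Q = P * B\<close> with \<open>P\<close> the square root of
  \<open>Q * Q\<^sup>T\<close>, invertible because \<open>Q\<^sup>T\<close> is injective. The factor
  \<open>P\<close> is treated by change of variables and the coisometry \<open>B\<close> by
  invariance of the Gaussian, whose density is positive and so detects Lebesgue null sets.\<close>

lemma null_preimage:
 assumes Q: "Q \<in> Mat d N" and ker: "!!v. v \<in> Rn d ==> Q\<^sup>T *\<^sub>v v = 0\<^sub>v N ==> v = 0\<^sub>v d"
  and Z: "Z \<in> null_sets (leb d)"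
 shows "{z \<in> Rn N. Q *\<^sub>v z \<in> Z} \<in> null_sets (leb N)"
proof -
 define G where "G = Q * 1\<^sub>m N * Q\<^sup>T"
 have QT: "Q\<^sup>T \<in> Mat N d" using Q by simp
 have G: "sym_pos_def d G" unfolding G_def by (rule sym_pos_def_congruence[OF sym_pos_def_one Q ker])
 have GQ: "G = Q * Q\<^sup>T" unfolding G_def using Q by simp
 define P where "P = sqrt_mat G"
 have P: "sym_pos_def d P" "P * P = G" using sqrt_mat[OF G] by (simp_all add: P_def)
 note mP = sym_pos_def_minv[OF P(1)]
 have Pc: "P \<in> Mat d d" and Ps: "P\<^sup>T = P" using P by (auto simp: sym_pos_def_def)
 have mPs: "(minv P)\<^sup>T = minv P" using mP(1) by (simp add: sym_pos_semidef_def)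
 define B where "B = minv P * Q"
 have B: "B \<in> Mat d N" unfolding B_def by (rule mult_carrier_mat[OF mP(4) Q])
 have BB: "B * B\<^sup>T = 1\<^sub>m d"
 proof -
  have "B * B\<^sup>T = minv P * (Q * (Q\<^sup>T * minv P))"
   unfolding B_def transpose_mult[OF mP(4) Q] mPs by (rule assoc_mult_mat[OF mP(4) Q mult_carrier_mat[OF QT mP(4)]])
  also have "Q * (Q\<^sup>T * minv P) = P * P * minv P" unfolding P(2) GQ by (rule assoc_mult_mat[OF Q QT mP(4), symmetric])
  also have "... = P * (P * minv P)" by (rule assoc_mult_mat[OF Pc Pc mP(4)])
  also have "... = P" unfolding mP(3) using Pc by simp
  finally show ?thesis unfolding mP(2) .
 qed
 have QB: "P *\<^sub>v (B *\<^sub>v z) = Q *\<^sub>v z" if z: "z \<in> Rn N" for z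
 proof -
  have "P * B = P * minv P * Q" unfolding B_def by (rule assoc_mult_mat[OF Pc mP(4) Q, symmetric])
  also have "... = Q" unfolding mP(3) using Q by simp
  finally show ?thesis using assoc_mult_mat_vec[OF Pc B z] by simp
 qed
 have Zs: "Z \<in> sets (leb d)" and Z0: "emeasure (leb d) Z = 0" using Z by auto
 define h where "h = (indicator Z :: real vec => ennreal)"
 have h: "h \<in> borel_fun d" unfolding h_def using Zs by simp
 have hP: "(%u. h (P *\<^sub>v u)) \<in> borel_fun d"
  by (rule measurable_compose[OF measurable_mat_lborel_vec[OF Pc] h])
 have hQ: "(%z. h (Q *\<^sub>v z)) \<in> borel_fun N"
  by (rule measurable_compose[OF measurable_mat_lborel_vec[OF Q] h])
 have "ennreal (det P) * (\<integral>\<^sup>+ u. h (P *\<^sub>v u) \<partial>leb d) = 0"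
  unfolding preserves_lborel_by_detD[OF preserves_lborel_sym_pos_def[OF P(1)] h]
  unfolding h_def using Zs Z0 by simp
 moreover have "0 < det P" using preserves_lborel_sym_pos_def[OF P(1)] by (simp add: preserves_lborel_by_det_def)
 ultimately have "(\<integral>\<^sup>+ u. h (P *\<^sub>v u) \<partial>leb d) = 0" by simp
 then have "AE u in leb d. h (P *\<^sub>v u) = 0" using nn_integral_0_iff_AE[OF hP] by simp
 then have "(\<integral>\<^sup>+ u. ennreal (exp (- (u \<bullet> u)) / gauss_int ^ d) * h (P *\<^sub>v u) \<partial>leb d) = (\<integral>\<^sup>+ u. 0 \<partial>leb d)"
  by (intro nn_integral_cong_AE) auto
 then have "(\<integral>\<^sup>+ u. h (P *\<^sub>v u) \<partial>gauss d) = 0" unfolding nn_integral_gauss_vec[OF hP] by simp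
 then have "(\<integral>\<^sup>+ z. h (P *\<^sub>v (B *\<^sub>v z)) \<partial>gauss N) = 0"
  using nn_integral_gauss_vec_coisometry[OF B BB hP] by simp
 moreover have "(\<integral>\<^sup>+ z. h (P *\<^sub>v (B *\<^sub>v z)) \<partial>gauss N) = (\<integral>\<^sup>+ z. h (Q *\<^sub>v z) \<partial>gauss N)"
  by (intro nn_integral_cong) (simp add: QB)
 ultimately have "(\<integral>\<^sup>+ z. ennreal (exp (- (z \<bullet> z))) * h (Q *\<^sub>v z) \<partial>leb N) = 0"
  unfolding gauss_vec_lborel_vec[OF hQ] by simp
 moreover have "(%z. ennreal (exp (- (z \<bullet> z))) * h (Q *\<^sub>v z)) \<in> borel_fun N"
  using hQ measurable_scalar_prod_self[of N] by simp
 ultimately have ae: "AE z in leb N. ennreal (exp (- (z \<bullet> z))) * h (Q *\<^sub>v z) = 0"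
  using nn_integral_0_iff_AE by blast
 let ?M = "{z \<in> Rn N. Q *\<^sub>v z \<in> Z}"
 have Ms: "?M \<in> sets (leb N)"
 proof -
  have "?M = (%z. Q *\<^sub>v z) -` Z \<inter> space (leb N)" by auto
  then show ?thesis using measurable_sets[OF measurable_mat_lborel_vec[OF Q] Zs] by simp
 qed
 have "AE z in leb N. z \<notin> ?M"
  using ae by eventually_elim (auto simp: h_def)
 then show ?thesis using AE_iff_null_sets[OF Ms] by simp
qed

text \<open>Both orders occur: the left quantity of the inequality integrates \<open>y\<close>
  inside, the right one \<open>x\<close>.\<close>

lemma AE_lborel_vec_append:
 assumes M: "M \<in> null_sets (leb (a + b))"
 shows "AE x in leb a. AE y in leb b. x @\<^sub>v y \<notin> M"
  and "AE y in leb b. AE x in leb a. x @\<^sub>v y \<notin> M"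
proof -
 interpret A: sigma_finite_measure "leb a" by (rule sigma_finite_lborel_vec)
 interpret B: sigma_finite_measure "leb b" by (rule sigma_finite_lborel_vec)
 interpret pair_sigma_finite "leb a" "leb b" ..
 have Ms: "M \<in> sets (leb (a + b))" and M0: "emeasure (leb (a + b)) M = 0" using M by auto
 have g: "(indicator M :: real vec => ennreal) \<in> borel_fun (a + b)" using Ms by simp
 define G where "G = (%x y. indicator M (x @\<^sub>v y) :: ennreal)"
 have mG: "case_prod G \<in> borel_measurable (leb a \<Otimes>\<^sub>M leb b)"
  unfolding G_def by (rule measurable_mat_append[OF g])
 have mG': "(%(y, x). G x y) \<in> borel_measurable (leb b \<Otimes>\<^sub>M leb a)"
  using measurable_compose[OF measurable_pair_swap' mG] by (simp add: case_prod_beta)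
 have z: "(\<integral>\<^sup>+ x. \<integral>\<^sup>+ y. G x y \<partial>leb b \<partial>leb a) = 0"
  unfolding G_def nn_integral_lborel_vec_append[OF g, symmetric] using Ms M0 by simp
 then have z': "(\<integral>\<^sup>+ y. \<integral>\<^sup>+ x. G x y \<partial>leb a \<partial>leb b) = 0"
  using nn_integral_lborel_vec_Fubini[OF mG] by simp
 have x0: "AE x in leb a. (\<integral>\<^sup>+ y. G x y \<partial>leb b) = 0"
  using z nn_integral_0_iff_AE[OF B.borel_measurable_nn_integral[OF mG]] by simp
 show "AE x in leb a. AE y in leb b. x @\<^sub>v y \<notin> M"
 proof (rule AE_mp[OF x0], rule AE_I2, rule impI)
  fix x assume x: "x \<in> space (leb a)" and z: "(\<integral>\<^sup>+ y. G x y \<partial>leb b) = 0"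
  have "G x \<in> borel_fun b" using measurable_compose[OF measurable_Pair1'[OF x] mG] by simp
  then have "AE y in leb b. G x y = 0" using z nn_integral_0_iff_AE[of "G x"] by simp
  then show "AE y in leb b. x @\<^sub>v y \<notin> M" by eventually_elim (auto simp: G_def)
 qed
 have y0: "AE y in leb b. (\<integral>\<^sup>+ x. G x y \<partial>leb a) = 0"
  using z' nn_integral_0_iff_AE[OF A.borel_measurable_nn_integral[OF mG']] by simp
 show "AE y in leb b. AE x in leb a. x @\<^sub>v y \<notin> M"
 proof (rule AE_mp[OF y0], rule AE_I2, rule impI)
  fix y assume y: "y \<in> space (leb b)" and z: "(\<integral>\<^sup>+ x. G x y \<partial>leb a) = 0"
  have "(%x. G x y) \<in> borel_fun a" using measurable_compose[OF measurable_Pair1'[OF y] mG'] by simp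
  then have "AE x in leb a. G x y = 0" using z nn_integral_0_iff_AE[of "%x. G x y"] by simp
  then show "AE x in leb a. x @\<^sub>v y \<notin> M" by eventually_elim (auto simp: G_def)
 qed
qed

section \<open>The three quantities as Gaussian integrals\<close>

lemma measurable_prod_affine:
 assumes P: "!!i. i < m ==> P i \<in> Mat (d i) a" and R: "!!i. i < m ==> R i \<in> Mat (d i) b"
  and psi: "!!i. i < m ==> psi i \<in> borel_fun (d i)" and f: "f \<in> M \<rightarrow>\<^sub>M leb a" and g: "g \<in> M \<rightarrow>\<^sub>M leb b"
 shows "(%z. ennreal (\<Prod>i<m. psi i (P i *\<^sub>v f z + R i *\<^sub>v g z))) \<in> borel_measurable M"
proof -
 have "(%z. \<Prod>i<m. psi i (P i *\<^sub>v f z + R i *\<^sub>v g z)) \<in> borel_measurable M"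
 proof (rule borel_measurable_prod)
  fix i assume "i \<in> {..<m}"
  then have i: "i < m" by simp
  show "(%z. psi i (P i *\<^sub>v f z + R i *\<^sub>v g z)) \<in> borel_measurable M"
   by (rule measurable_compose[OF measurable_vec_add[OF measurable_mult_mat_vec[OF P[OF i] f] measurable_mult_mat_vec[OF R[OF i] g]] psi[OF i]])
 qed
 then show ?thesis by simp
qed

lemma measurable_inner_nn_integral:
 assumes P: "!!i. i < m ==> P i \<in> Mat (d i) a" and R: "!!i. i < m ==> R i \<in> Mat (d i) b"
  and psi: "!!i. i < m ==> psi i \<in> borel_fun (d i)"
  and L: "sigma_finite_measure L" "sets L = sets (leb b)"
 shows "(%x. \<integral>\<^sup>+ y. ennreal (\<Prod>i<m. psi i (P i *\<^sub>v x + R i *\<^sub>v y)) \<partial>L) \<in> borel_fun a"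
proof -
 interpret sigma_finite_measure L by (rule L(1))
 have "snd \<in> leb a \<Otimes>\<^sub>M L \<rightarrow>\<^sub>M leb b"
  using measurable_snd[of "leb a" L] measurable_cong_sets[OF refl L(2)] by blast
 from measurable_prod_affine[OF P R psi measurable_fst this]
 have "(%z. ennreal (\<Prod>i<m. psi i (P i *\<^sub>v fst z + R i *\<^sub>v snd z))) \<in> borel_measurable (leb a \<Otimes>\<^sub>M L)" .
 then show ?thesis by (intro borel_measurable_nn_integral) (simp add: case_prod_beta)
qed

text \<open>What the computation retains of the original data: \<open>S\<close> and
  \<open>Si i\<close> stand for the square roots of \<open>A\<close> and \<open>A\<^sub>i\<close>,
  and \<open>k\<close> for \<open>N - n\<close>.\<close>

locale normalised =
 fixes m n k :: nat and d :: "nat => nat" and U V W Si :: "nat => real mat" and S :: "real mat" and c :: "nat => real" and \<rho> :: real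
 assumes U: "!!i. i < m ==> U i \<in> Mat (d i) n" and V: "!!i. i < m ==> V i \<in> Mat (d i) n"
  and W: "!!i. i < m ==> W i \<in> Mat (d i) k"
  and S: "sym_pos_def n S" and Si: "!!i. i < m ==> sym_pos_def (d i) (Si i)"
  and c: "!!i. i < m ==> 0 < c i" and d: "!!i. i < m ==> 0 < d i" and \<rho>: "0 < \<rho>"
  and SV: "!!i. i < m ==> Si i * V i = sqrt (c i) \<cdot>\<^sub>m (U i * S)"
  and orth: "!!i j. i < m ==> j < m ==> V i * (V j)\<^sup>T + W i * (W j)\<^sup>T = (if i = j then 1\<^sub>m (d i) else 0\<^sub>m (d i) (d j))"
  and VV: "!!i. i < m ==> V i * (V i)\<^sup>T = c i \<cdot>\<^sub>m 1\<^sub>m (d i)"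
  and isometry: "!!x y. x \<in> Rn n ==> y \<in> Rn k ==>
   (\<Sum>i<m. (V i *\<^sub>v x + W i *\<^sub>v y) \<bullet> (V i *\<^sub>v x + W i *\<^sub>v y)) = x \<bullet> x + y \<bullet> y"
  and trace: "(\<Sum>i<m. c i * real (d i)) = real n"
begin

text \<open>The reciprocal of \<open>p i\<close>, written so that the contributions of
  \<open>x\<close> and of the rescaled \<open>y\<close> to the covariance are visible.\<close>

definition s :: "nat => real" where "s i = c i + (1 - c i) / \<rho>"

text \<open>The scaling of \<open>y\<close> that turns the weight
  \<open>exp (- \<rho> * (y \<bullet> y))\<close> into the Gaussian one.\<close>

definition a :: real where "a = 1 / sqrt \<rho>"

definition Y :: "nat => real mat" where "Y i = (1 / sqrt (c i)) \<cdot>\<^sub>m (Si i * W i)"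

text \<open>The Gaussian \<open>exp (- u \<bullet> u)\<close> is split off each \<open>g i\<close> after the change of variables.\<close>

definition phi :: "(nat => real vec => real) => nat => real vec => real" where
 "phi g i u = g i ((1 / sqrt (c i)) \<cdot>\<^sub>v (Si i *\<^sub>v u)) * exp (u \<bullet> u)"

text \<open>The first two factors come from \<open>x = S x'\<close> and the Gaussian mass in
  \<open>x\<close>; the last one comes from the scaling and the mass in \<open>y\<close>, under the
  outer power \<open>1 / \<rho>\<close>.\<close>

definition K :: real where "K = det S * gauss_int ^ n * (a ^ k * gauss_int ^ k) powr (1 / \<rho>)"

lemma a: "0 < a" "a * a = 1 / \<rho>"
 using \<rho> by (simp_all add: a_def)

lemma Sc: "S \<in> Mat n n" and Sic: "i < m ==> Si i \<in> Mat (d i) (d i)"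
 using S Si by (auto simp: sym_pos_def_def)

lemma Y: "i < m ==> Y i \<in> Mat (d i) k"
 using mult_carrier_mat[OF Sic W] by (simp add: Y_def)

lemma aW: "i < m ==> a \<cdot>\<^sub>m W i \<in> Mat (d i) k"
 using W by simp

lemma det_S: "0 < det S"
 using preserves_lborel_sym_pos_def[OF S] by (simp add: preserves_lborel_by_det_def)

lemma argument_eq:
 assumes i: "i < m" and x: "x \<in> Rn n" and y: "y \<in> Rn k"
 shows "U i *\<^sub>v (S *\<^sub>v x) + Y i *\<^sub>v y = (1 / sqrt (c i)) \<cdot>\<^sub>v (Si i *\<^sub>v (V i *\<^sub>v x + W i *\<^sub>v y))"
proof -
 have Vx: "V i *\<^sub>v x \<in> Rn (d i)" and Wy: "W i *\<^sub>v y \<in> Rn (d i)"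
  by (rule mult_mat_vec_carrier[OF V[OF i] x] mult_mat_vec_carrier[OF W[OF i] y])+
 have USc: "U i * S \<in> Mat (d i) n" by (rule mult_carrier_mat[OF U[OF i] Sc])
 have "Si i *\<^sub>v (V i *\<^sub>v x) = sqrt (c i) \<cdot>\<^sub>v (U i *\<^sub>v (S *\<^sub>v x))"
  unfolding assoc_mult_mat_vec[OF Sic[OF i] V[OF i] x, symmetric] SV[OF i] smult_mult_mat_vec[OF USc x] assoc_mult_mat_vec[OF U[OF i] Sc x] ..
 then have 1: "(1 / sqrt (c i)) \<cdot>\<^sub>v (Si i *\<^sub>v (V i *\<^sub>v x)) = U i *\<^sub>v (S *\<^sub>v x)"
  using c[OF i] by (simp add: smult_smult_assoc)
 have 2: "(1 / sqrt (c i)) \<cdot>\<^sub>v (Si i *\<^sub>v (W i *\<^sub>v y)) = Y i *\<^sub>v y"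
  unfolding Y_def smult_mult_mat_vec[OF mult_carrier_mat[OF Sic[OF i] W[OF i]] y] assoc_mult_mat_vec[OF Sic[OF i] W[OF i] y] ..
 show ?thesis
  unfolding mult_add_distrib_mat_vec[OF Sic[OF i] Vx Wy]
   smult_add_distrib_vec[OF mult_mat_vec_carrier[OF Sic[OF i] Vx] mult_mat_vec_carrier[OF Sic[OF i] Wy]] 1 2 ..
qed

text \<open>The factors \<open>exp (u \<bullet> u)\<close> introduced by \<open>phi\<close> multiply
  to \<open>exp (x \<bullet> x + y \<bullet> y)\<close> because the blocks together form an
  isometry; so the Gaussian weight separates in \<open>x\<close> and \<open>y\<close>.\<close>

lemma prod_eq:
 assumes x: "x \<in> Rn n" and y: "y \<in> Rn k"
 shows "(\<Prod>i<m. g i (U i *\<^sub>v (S *\<^sub>v x) + Y i *\<^sub>v y))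
  = exp (- (x \<bullet> x)) * (exp (- (y \<bullet> y)) * (\<Prod>i<m. phi g i (V i *\<^sub>v x + W i *\<^sub>v y)))"
proof -
 have "(\<Prod>i<m. phi g i (V i *\<^sub>v x + W i *\<^sub>v y))
  = (\<Prod>i<m. g i (U i *\<^sub>v (S *\<^sub>v x) + Y i *\<^sub>v y)) * exp (\<Sum>i<m. (V i *\<^sub>v x + W i *\<^sub>v y) \<bullet> (V i *\<^sub>v x + W i *\<^sub>v y))"
  by (simp add: phi_def argument_eq[OF _ x y] prod.distrib exp_sum)
 then show ?thesis unfolding isometry[OF x y] by (simp add: exp_add exp_minus field_simps)
qed

lemma measurable_phi:
 assumes "i < m" "g i \<in> borel_fun (d i)"
 shows "phi g i \<in> borel_fun (d i)"
proof -
 have 1: "(%u. (1 / sqrt (c i)) \<cdot>\<^sub>v (Si i *\<^sub>v u)) \<in> leb (d i) \<rightarrow>\<^sub>M leb (d i)"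
  by (rule measurable_vec_smult[OF measurable_mat_lborel_vec[OF Sic[OF assms(1)]] borel_measurable_const])
 show ?thesis unfolding phi_def[abs_def]
  using measurable_compose[OF 1 assms(2)] measurable_scalar_prod_self[of "d i"] by simp
qed

context
 fixes g :: "nat => real vec => real"
 assumes g: "!!i. i < m ==> g i \<in> borel_fun (d i)" and g0: "!!i u. 0 \<le> g i u"
begin

lemma phi_nonneg: "0 \<le> phi g i u"
 using g0 by (simp add: phi_def)

lemma phi_meas: "i < m ==> phi g i \<in> borel_fun (d i)"
 using measurable_phi g by blast

text \<open>The weight in \<open>x\<close> is absorbed by the inner Gaussian. The weight in
  \<open>y\<close> leaves the inner integral, is raised to the power \<rho>, and is normalised by
  scaling \<open>y\<close> with \<open>a\<close>.\<close>

lemma rhs_eq: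
 "ennreal_powr (\<integral>\<^sup>+ y. ennreal_powr (\<integral>\<^sup>+ x. ennreal (\<Prod>i<m. g i (U i *\<^sub>v x + Y i *\<^sub>v y)) \<partial>leb n) \<rho> \<partial>leb k) (1 / \<rho>)
  = ennreal K * ennreal_powr (nested_integral m k n (%i. a \<cdot>\<^sub>m W i) V \<rho> (phi g)) (1 / \<rho>)"
proof -
 define Psi where "Psi = (%y. \<integral>\<^sup>+ x. ennreal (\<Prod>i<m. phi g i (W i *\<^sub>v y + V i *\<^sub>v x)) \<partial>gauss n)"
 have Psim: "Psi \<in> borel_fun k"
  unfolding Psi_def by (rule measurable_inner_nn_integral[OF W V phi_meas sigma_finite_gauss_vec]) simp_all
 define C where "C = det S * gauss_int ^ n"
 have C: "0 < C" using det_S gauss_int_pos by (simp add: C_def)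
 have swap: "V i *\<^sub>v x + W i *\<^sub>v y = W i *\<^sub>v y + V i *\<^sub>v x" if "i < m" "x \<in> Rn n" "y \<in> Rn k" for i x y
  by (rule comm_add_vec[OF mult_mat_vec_carrier[OF V[OF that(1)] that(2)] mult_mat_vec_carrier[OF W[OF that(1)] that(3)]])
 have inner: "(\<integral>\<^sup>+ x. ennreal (\<Prod>i<m. g i (U i *\<^sub>v x + Y i *\<^sub>v y)) \<partial>leb n) = ennreal (C * exp (- (y \<bullet> y))) * Psi y"
  if y: "y \<in> Rn k" for y
 proof -
  have m1: "(%x. ennreal (\<Prod>i<m. g i (U i *\<^sub>v x + Y i *\<^sub>v y))) \<in> borel_fun n"
   by (rule measurable_prod_affine[OF U Y g measurable_ident_sets[OF refl] measurable_vec_const[OF y]])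
  have m2: "(%x. ennreal (\<Prod>i<m. phi g i (W i *\<^sub>v y + V i *\<^sub>v x))) \<in> borel_fun n"
   by (rule measurable_prod_affine[OF W V phi_meas measurable_vec_const[OF y] measurable_ident_sets[OF refl]])
  have m3: "(%x. ennreal (exp (- (y \<bullet> y))) * ennreal (\<Prod>i<m. phi g i (W i *\<^sub>v y + V i *\<^sub>v x))) \<in> borel_fun n"
   by (intro borel_measurable_times_ennreal m2 measurable_const) simp
  have "(\<integral>\<^sup>+ x. ennreal (\<Prod>i<m. g i (U i *\<^sub>v (S *\<^sub>v x) + Y i *\<^sub>v y)) \<partial>leb n)
   = (\<integral>\<^sup>+ x. ennreal (exp (- (x \<bullet> x))) * (ennreal (exp (- (y \<bullet> y))) * ennreal (\<Prod>i<m. phi g i (W i *\<^sub>v y + V i *\<^sub>v x))) \<partial>leb n)"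
  proof (rule nn_integral_cong)
   fix x assume "x \<in> space (leb n)"
   then have x: "x \<in> Rn n" by simp
   show "ennreal (\<Prod>i<m. g i (U i *\<^sub>v (S *\<^sub>v x) + Y i *\<^sub>v y))
    = ennreal (exp (- (x \<bullet> x))) * (ennreal (exp (- (y \<bullet> y))) * ennreal (\<Prod>i<m. phi g i (W i *\<^sub>v y + V i *\<^sub>v x)))"
    unfolding prod_eq[OF x y] using swap[OF _ x y] by (simp add: ennreal_mult')
  qed
  also have "... = ennreal (gauss_int ^ n) * (ennreal (exp (- (y \<bullet> y))) * Psi y)"
  proof -
   have "(\<integral>\<^sup>+ x. ennreal (exp (- (y \<bullet> y))) * ennreal (\<Prod>i<m. phi g i (W i *\<^sub>v y + V i *\<^sub>v x)) \<partial>gauss n) = ennreal (exp (- (y \<bullet> y))) * Psi y"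
    unfolding Psi_def by (rule nn_integral_cmult) (simp only: measurable_gauss_vec m2)
   then show ?thesis using gauss_vec_lborel_vec[OF m3] by simp
  qed
  finally show ?thesis
   using preserves_lborel_by_detD[OF preserves_lborel_sym_pos_def[OF S] m1] det_S gauss_int_pos
   by (simp add: C_def ennreal_mult' mult.assoc)
 qed
 define h where "h = (%y::real vec. ennreal (exp (- \<rho> * (y \<bullet> y))) * ennreal_powr (Psi y) \<rho>)"
 have em: "(%y. ennreal (exp (- \<rho> * (y \<bullet> y)))) \<in> borel_fun k"
  using measurable_scalar_prod_self[of k] by simp
 have hm: "h \<in> borel_fun k"
  unfolding h_def by (intro borel_measurable_times_ennreal em measurable_ennreal_powr Psim)
 have "(\<integral>\<^sup>+ y. ennreal_powr (\<integral>\<^sup>+ x. ennreal (\<Prod>i<m. g i (U i *\<^sub>v x + Y i *\<^sub>v y)) \<partial>leb n) \<rho> \<partial>leb k)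
  = (\<integral>\<^sup>+ y. ennreal (C powr \<rho>) * h y \<partial>leb k)"
 proof (rule nn_integral_cong)
  fix y assume "y \<in> space (leb k)"
  then have y: "y \<in> Rn k" by simp
  have "(C * exp (- (y \<bullet> y))) powr \<rho> = C powr \<rho> * exp (- \<rho> * (y \<bullet> y))"
   using C by (simp add: powr_mult exp_powr_real mult.commute)
  then show "ennreal_powr (\<integral>\<^sup>+ x. ennreal (\<Prod>i<m. g i (U i *\<^sub>v x + Y i *\<^sub>v y)) \<partial>leb n) \<rho> = ennreal (C powr \<rho>) * h y"
   unfolding inner[OF y] h_def ennreal_powr_cmult[OF mult_pos_pos[OF C exp_gt_zero]]
   by (simp only: ennreal_mult' powr_ge_zero mult.assoc)
 qed
 also have "... = ennreal (C powr \<rho>) * (\<integral>\<^sup>+ y. h y \<partial>leb k)" by (rule nn_integral_cmult[OF hm])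
 also have "(\<integral>\<^sup>+ y. h y \<partial>leb k) = ennreal (a ^ k) * (\<integral>\<^sup>+ y. h (a \<cdot>\<^sub>v y) \<partial>leb k)"
  by (rule nn_integral_lborel_vec_scale[OF a(1) hm, symmetric])
 also have "(\<integral>\<^sup>+ y. h (a \<cdot>\<^sub>v y) \<partial>leb k) = (\<integral>\<^sup>+ y. ennreal (exp (- (y \<bullet> y))) * ennreal_powr (Psi (a \<cdot>\<^sub>v y)) \<rho> \<partial>leb k)"
 proof (rule nn_integral_cong)
  fix y assume "y \<in> space (leb k)"
  then have "(a \<cdot>\<^sub>v y) \<bullet> (a \<cdot>\<^sub>v y) = (a * a) * (y \<bullet> y)" by simp
  then have "- \<rho> * ((a \<cdot>\<^sub>v y) \<bullet> (a \<cdot>\<^sub>v y)) = - (y \<bullet> y)" using \<rho> unfolding a(2) by simp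
  then show "h (a \<cdot>\<^sub>v y) = ennreal (exp (- (y \<bullet> y))) * ennreal_powr (Psi (a \<cdot>\<^sub>v y)) \<rho>" unfolding h_def by (simp only:)
 qed
 also have "... = ennreal (gauss_int ^ k) * (\<integral>\<^sup>+ y. ennreal_powr (Psi (a \<cdot>\<^sub>v y)) \<rho> \<partial>gauss k)"
  by (intro gauss_vec_lborel_vec measurable_ennreal_powr
    measurable_compose[OF measurable_vec_smult[OF measurable_ident_sets[OF refl] borel_measurable_const] Psim])
 also have "(\<integral>\<^sup>+ y. ennreal_powr (Psi (a \<cdot>\<^sub>v y)) \<rho> \<partial>gauss k) = nested_integral m k n (%i. a \<cdot>\<^sub>m W i) V \<rho> (phi g)"
  unfolding nested_integral_def
 proof (rule nn_integral_cong)
  fix y :: "real vec" assume "y \<in> space (gauss k)"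
  then have y: "y \<in> Rn k" by simp
  have "W i *\<^sub>v (a \<cdot>\<^sub>v y) = (a \<cdot>\<^sub>m W i) *\<^sub>v y" if "i < m" for i
   unfolding smult_mult_mat_vec[OF W[OF that] y] by (rule mult_mat_vec[OF W[OF that] y])
  then show "ennreal_powr (Psi (a \<cdot>\<^sub>v y)) \<rho> = ennreal_powr (\<integral>\<^sup>+ x. ennreal (\<Prod>i<m. phi g i (a \<cdot>\<^sub>m W i *\<^sub>v y + V i *\<^sub>v x)) \<partial>gauss n) \<rho>"
   unfolding Psi_def by simp
 qed
 finally have "(\<integral>\<^sup>+ y. ennreal_powr (\<integral>\<^sup>+ x. ennreal (\<Prod>i<m. g i (U i *\<^sub>v x + Y i *\<^sub>v y)) \<partial>leb n) \<rho> \<partial>leb k)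
  = ennreal (C powr \<rho> * (a ^ k * gauss_int ^ k)) * nested_integral m k n (%i. a \<cdot>\<^sub>m W i) V \<rho> (phi g)"
  using a(1) gauss_int_pos by (simp add: ennreal_mult' mult.assoc)
 moreover have "0 < C powr \<rho> * (a ^ k * gauss_int ^ k)" using C a(1) gauss_int_pos by simp
 moreover have "(C powr \<rho> * (a ^ k * gauss_int ^ k)) powr (1 / \<rho>) = K"
  using C a(1) gauss_int_pos \<rho> det_S by (simp add: powr_mult powr_powr K_def C_def)
 ultimately show ?thesis by (simp add: ennreal_powr_cmult)
qed

text \<open>Here the integrand is raised to \<rho> before integration, so the weight in
  \<open>y\<close> is rescaled inside. The weight in \<open>x\<close> acquires the exponent \<rho>,
  which the outer power \<open>1 / \<rho>\<close> undoes.\<close>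

lemma lhs_eq:
 "(\<integral>\<^sup>+ x. ennreal_powr (\<integral>\<^sup>+ y. ennreal ((\<Prod>i<m. g i (U i *\<^sub>v x + Y i *\<^sub>v y)) powr \<rho>) \<partial>leb k) (1 / \<rho>) \<partial>leb n)
  = ennreal K * nested_integral m n k V (%i. a \<cdot>\<^sub>m W i) (1 / \<rho>) (%i u. phi g i u powr \<rho>)"
proof -
 let ?phi = "%i u. phi g i u powr \<rho>"
 have gm: "(%u. g i u powr \<rho>) \<in> borel_fun (d i)" "?phi i \<in> borel_fun (d i)" if "i < m" for i
  using g[OF that] phi_meas[OF that] by simp_all
 have pp: "(\<Prod>i<m. z i) powr \<rho> = (\<Prod>i<m. z i powr \<rho>)" if "!!i. 0 \<le> z i" for z :: "nat => real" and m
  using that by (induction m) (simp_all add: powr_mult prod_nonneg)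
 define H where "H = (%x. ennreal_powr (\<integral>\<^sup>+ y. ennreal (\<Prod>i<m. g i (U i *\<^sub>v x + Y i *\<^sub>v y) powr \<rho>) \<partial>leb k) (1 / \<rho>))"
 have Hm: "H \<in> borel_fun n"
  unfolding H_def
  by (intro measurable_ennreal_powr measurable_inner_nn_integral[where psi = "%i u. g i u powr \<rho>", OF U Y gm(1) sigma_finite_lborel_vec]) simp_all
 define Th where "Th = (%x. \<integral>\<^sup>+ y. ennreal (\<Prod>i<m. ?phi i (V i *\<^sub>v x + (a \<cdot>\<^sub>m W i) *\<^sub>v y)) \<partial>gauss k)"
 have Thm: "Th \<in> borel_fun n"
  unfolding Th_def by (rule measurable_inner_nn_integral[where psi = ?phi, OF V aW gm(2) sigma_finite_gauss_vec]) simp_all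
 define Q where "Q = a ^ k * gauss_int ^ k"
 have Q: "0 < Q" using a(1) gauss_int_pos by (simp add: Q_def)
 have inner: "H (S *\<^sub>v x) = ennreal (exp (- (x \<bullet> x))) * (ennreal (Q powr (1 / \<rho>)) * ennreal_powr (Th x) (1 / \<rho>))"
  if x: "x \<in> Rn n" for x
 proof -
  define p where "p = (%y. ennreal (exp (- \<rho> * (y \<bullet> y))) * ennreal (\<Prod>i<m. ?phi i (V i *\<^sub>v x + W i *\<^sub>v y)))"
  have pm: "p \<in> borel_fun k"
   unfolding p_def
  proof (intro borel_measurable_times_ennreal)
   show "(%y. ennreal (exp (- \<rho> * (y \<bullet> y)))) \<in> borel_fun k" using measurable_scalar_prod_self[of k] by simp
   show "(%y. ennreal (\<Prod>i<m. ?phi i (V i *\<^sub>v x + W i *\<^sub>v y))) \<in> borel_fun k"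
    by (rule measurable_prod_affine[where psi = ?phi, OF V W gm(2) measurable_vec_const[OF x] measurable_ident_sets[OF refl]])
  qed
  have "(\<integral>\<^sup>+ y. ennreal (\<Prod>i<m. g i (U i *\<^sub>v (S *\<^sub>v x) + Y i *\<^sub>v y) powr \<rho>) \<partial>leb k)
   = (\<integral>\<^sup>+ y. ennreal (exp (- \<rho> * (x \<bullet> x))) * p y \<partial>leb k)"
  proof (rule nn_integral_cong)
   fix y assume "y \<in> space (leb k)"
   then have y: "y \<in> Rn k" by simp
   have "(\<Prod>i<m. g i (U i *\<^sub>v (S *\<^sub>v x) + Y i *\<^sub>v y) powr \<rho>) = (\<Prod>i<m. g i (U i *\<^sub>v (S *\<^sub>v x) + Y i *\<^sub>v y)) powr \<rho>"
    by (rule pp[symmetric]) (rule g0)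
   also have "... = exp (- \<rho> * (x \<bullet> x)) * (exp (- \<rho> * (y \<bullet> y)) * (\<Prod>i<m. ?phi i (V i *\<^sub>v x + W i *\<^sub>v y)))"
    unfolding prod_eq[OF x y] using pp[of "%i. phi g i (V i *\<^sub>v x + W i *\<^sub>v y)" m, OF phi_nonneg]
    by (simp add: powr_mult prod_nonneg phi_nonneg exp_powr_real mult.commute[of \<rho>])
   finally have e: "(\<Prod>i<m. g i (U i *\<^sub>v (S *\<^sub>v x) + Y i *\<^sub>v y) powr \<rho>)
    = exp (- \<rho> * (x \<bullet> x)) * (exp (- \<rho> * (y \<bullet> y)) * (\<Prod>i<m. ?phi i (V i *\<^sub>v x + W i *\<^sub>v y)))" .
   show "ennreal (\<Prod>i<m. g i (U i *\<^sub>v (S *\<^sub>v x) + Y i *\<^sub>v y) powr \<rho>) = ennreal (exp (- \<rho> * (x \<bullet> x))) * p y"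
    unfolding e p_def by (simp add: ennreal_mult')
  qed
  also have "... = ennreal (exp (- \<rho> * (x \<bullet> x))) * (\<integral>\<^sup>+ y. p y \<partial>leb k)" by (rule nn_integral_cmult[OF pm])
  also have "(\<integral>\<^sup>+ y. p y \<partial>leb k) = ennreal (a ^ k) * (\<integral>\<^sup>+ y. p (a \<cdot>\<^sub>v y) \<partial>leb k)"
   by (rule nn_integral_lborel_vec_scale[OF a(1) pm, symmetric])
  also have "(\<integral>\<^sup>+ y. p (a \<cdot>\<^sub>v y) \<partial>leb k)
   = (\<integral>\<^sup>+ y. ennreal (exp (- (y \<bullet> y))) * ennreal (\<Prod>i<m. ?phi i (V i *\<^sub>v x + (a \<cdot>\<^sub>m W i) *\<^sub>v y)) \<partial>leb k)"
  proof (rule nn_integral_cong)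
   fix y assume "y \<in> space (leb k)"
   then have y: "y \<in> Rn k" by simp
   then have "(a \<cdot>\<^sub>v y) \<bullet> (a \<cdot>\<^sub>v y) = (a * a) * (y \<bullet> y)" by simp
   then have e: "- \<rho> * ((a \<cdot>\<^sub>v y) \<bullet> (a \<cdot>\<^sub>v y)) = - (y \<bullet> y)" using \<rho> unfolding a(2) by simp
   have "W i *\<^sub>v (a \<cdot>\<^sub>v y) = (a \<cdot>\<^sub>m W i) *\<^sub>v y" if "i < m" for i
    unfolding smult_mult_mat_vec[OF W[OF that] y] by (rule mult_mat_vec[OF W[OF that] y])
   then show "p (a \<cdot>\<^sub>v y) = ennreal (exp (- (y \<bullet> y))) * ennreal (\<Prod>i<m. ?phi i (V i *\<^sub>v x + (a \<cdot>\<^sub>m W i) *\<^sub>v y))"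
    unfolding p_def e by simp
  qed
  also have "... = ennreal (gauss_int ^ k) * Th x"
   unfolding Th_def
   by (rule gauss_vec_lborel_vec, rule measurable_prod_affine[where psi = ?phi, OF V aW gm(2) measurable_vec_const[OF x] measurable_ident_sets[OF refl]])
  finally have i: "(\<integral>\<^sup>+ y. ennreal (\<Prod>i<m. g i (U i *\<^sub>v (S *\<^sub>v x) + Y i *\<^sub>v y) powr \<rho>) \<partial>leb k)
   = ennreal (exp (- \<rho> * (x \<bullet> x)) * Q) * Th x"
   using a(1) gauss_int_pos by (simp add: Q_def ennreal_mult' mult.assoc)
  have "(exp (- \<rho> * (x \<bullet> x)) * Q) powr (1 / \<rho>) = exp (- (x \<bullet> x)) * Q powr (1 / \<rho>)"
   using Q \<rho> by (simp add: powr_mult exp_powr_real)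
  then show ?thesis
   unfolding H_def i ennreal_powr_cmult[OF mult_pos_pos[OF exp_gt_zero Q]]
   by (simp only: ennreal_mult' exp_ge_zero mult.assoc)
 qed
 have t: "(%x. ennreal_powr (Th x) (1 / \<rho>)) \<in> borel_fun n" by (rule measurable_ennreal_powr[OF Thm])
 have t2: "(%x. ennreal (Q powr (1 / \<rho>)) * ennreal_powr (Th x) (1 / \<rho>)) \<in> borel_fun n"
  by (intro borel_measurable_times_ennreal t measurable_const) simp
 have "(\<integral>\<^sup>+ x. ennreal_powr (\<integral>\<^sup>+ y. ennreal ((\<Prod>i<m. g i (U i *\<^sub>v x + Y i *\<^sub>v y)) powr \<rho>) \<partial>leb k) (1 / \<rho>) \<partial>leb n)
  = (\<integral>\<^sup>+ x. H x \<partial>leb n)"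
  unfolding H_def using pp[OF g0] by simp
 also have "... = ennreal (det S) * (\<integral>\<^sup>+ x. H (S *\<^sub>v x) \<partial>leb n)"
  by (rule preserves_lborel_by_detD[OF preserves_lborel_sym_pos_def[OF S] Hm, symmetric])
 also have "(\<integral>\<^sup>+ x. H (S *\<^sub>v x) \<partial>leb n) = (\<integral>\<^sup>+ x. ennreal (exp (- (x \<bullet> x))) * (ennreal (Q powr (1 / \<rho>)) * ennreal_powr (Th x) (1 / \<rho>)) \<partial>leb n)"
  by (intro nn_integral_cong inner) simp
 also have "... = ennreal (gauss_int ^ n) * (\<integral>\<^sup>+ x. ennreal (Q powr (1 / \<rho>)) * ennreal_powr (Th x) (1 / \<rho>) \<partial>gauss n)"
  by (rule gauss_vec_lborel_vec[OF t2])
 also have "(\<integral>\<^sup>+ x. ennreal (Q powr (1 / \<rho>)) * ennreal_powr (Th x) (1 / \<rho>) \<partial>gauss n)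
  = ennreal (Q powr (1 / \<rho>)) * (\<integral>\<^sup>+ x. ennreal_powr (Th x) (1 / \<rho>) \<partial>gauss n)"
  by (rule nn_integral_cmult) (simp only: measurable_gauss_vec t)
 also have "(\<integral>\<^sup>+ x. ennreal_powr (Th x) (1 / \<rho>) \<partial>gauss n) = nested_integral m n k V (%i. a \<cdot>\<^sub>m W i) (1 / \<rho>) ?phi"
  unfolding nested_integral_def Th_def ..
 finally show ?thesis
  using det_S gauss_int_pos by (simp add: K_def Q_def[symmetric] ennreal_mult' mult.assoc)
qed

lemma Lp_eq:
 assumes i: "i < m" and p: "0 < p"
 shows "ennreal_powr (\<integral>\<^sup>+ z. ennreal (g i z powr p) \<partial>leb (d i)) (1 / p)
  = ennreal (((1 / sqrt (c i * p)) ^ d i * det (Si i) * gauss_int ^ d i) powr (1 / p))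
   * ennreal_powr (\<integral>\<^sup>+ u. ennreal (phi g i (sqrt (1 / p) \<cdot>\<^sub>v u) powr p) \<partial>gauss (d i)) (1 / p)"
proof -
 \<comment> \<open>Besides \<open>1 / sqrt (c i)\<close> from \<open>phi\<close>, this contains
   \<open>sqrt (1 / p)\<close>, chosen so that the \<open>p\<close>-th power of the split-off factor
   is exactly \<open>exp (u \<bullet> u)\<close>.\<close>
 define t where "t = 1 / sqrt (c i * p)"
 have t: "0 < t" "t = 1 / sqrt (c i) * sqrt (1 / p)" using c[OF i] p by (simp_all add: t_def real_sqrt_mult real_sqrt_divide)
 have M: "preserves_lborel_by_det (d i) (t \<cdot>\<^sub>m Si i)"
  by (rule preserves_lborel_sym_pos_def[OF sym_pos_def_smult[OF Si[OF i] t(1)]])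
 have dM: "det (t \<cdot>\<^sub>m Si i) = t ^ d i * det (Si i)" using Sic[OF i] by simp
 have D: "0 < t ^ d i * det (Si i)" using M unfolding preserves_lborel_by_det_def dM by blast
 let ?h = "%u. ennreal (phi g i (sqrt (1 / p) \<cdot>\<^sub>v u) powr p)"
 have gm: "(%z. ennreal (g i z powr p)) \<in> borel_fun (d i)" using g[OF i] by simp
 have hm: "?h \<in> borel_fun (d i)"
  using measurable_compose[OF measurable_vec_smult[OF measurable_ident_sets[OF refl] borel_measurable_const] phi_meas[OF i]] by simp
 have "(\<integral>\<^sup>+ u. ennreal (g i ((t \<cdot>\<^sub>m Si i) *\<^sub>v u) powr p) \<partial>leb (d i)) = (\<integral>\<^sup>+ u. ennreal (exp (- (u \<bullet> u))) * ?h u \<partial>leb (d i))"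
 proof (rule nn_integral_cong)
  fix u assume "u \<in> space (leb (d i))"
  then have u: "u \<in> Rn (d i)" by simp
  have arg: "(t \<cdot>\<^sub>m Si i) *\<^sub>v u = (1 / sqrt (c i)) \<cdot>\<^sub>v (Si i *\<^sub>v (sqrt (1 / p) \<cdot>\<^sub>v u))"
   unfolding smult_mult_mat_vec[OF Sic[OF i] u] mult_mat_vec[OF Sic[OF i] u] smult_smult_assoc t(2) ..
  have sq: "(sqrt (1 / p) \<cdot>\<^sub>v u) \<bullet> (sqrt (1 / p) \<cdot>\<^sub>v u) = (u \<bullet> u) / p"
  proof -
   have "(sqrt (1 / p) \<cdot>\<^sub>v u) \<bullet> (sqrt (1 / p) \<cdot>\<^sub>v u) = (sqrt (1 / p) * sqrt (1 / p)) * (u \<bullet> u)" by (rule smult_scalar_prod_self[OF u])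
   also have "sqrt (1 / p) * sqrt (1 / p) = 1 / p" using p by simp
   finally show ?thesis by simp
  qed
  have "phi g i (sqrt (1 / p) \<cdot>\<^sub>v u) powr p = g i ((t \<cdot>\<^sub>m Si i) *\<^sub>v u) powr p * exp (u \<bullet> u)"
   unfolding phi_def arg sq using p g0 by (simp add: powr_mult exp_powr_real)
  then have "g i ((t \<cdot>\<^sub>m Si i) *\<^sub>v u) powr p = exp (- (u \<bullet> u)) * phi g i (sqrt (1 / p) \<cdot>\<^sub>v u) powr p" by (simp add: exp_minus field_simps)
  then show "ennreal (g i ((t \<cdot>\<^sub>m Si i) *\<^sub>v u) powr p) = ennreal (exp (- (u \<bullet> u))) * ?h u" by (simp add: ennreal_mult')
 qed
 then have "(\<integral>\<^sup>+ z. ennreal (g i z powr p) \<partial>leb (d i)) = ennreal (t ^ d i * det (Si i)) * (ennreal (gauss_int ^ d i) * (\<integral>\<^sup>+ u. ?h u \<partial>gauss (d i)))"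
  using preserves_lborel_by_detD[OF M gm] unfolding dM gauss_vec_lborel_vec[OF hm] by simp
 also have "... = ennreal (t ^ d i * det (Si i) * gauss_int ^ d i) * (\<integral>\<^sup>+ u. ?h u \<partial>gauss (d i))"
  unfolding ennreal_mult'[OF less_imp_le[OF D], of "gauss_int ^ d i"] by (simp only: mult.assoc)
 finally have e: "(\<integral>\<^sup>+ z. ennreal (g i z powr p) \<partial>leb (d i)) = ennreal (t ^ d i * det (Si i) * gauss_int ^ d i) * (\<integral>\<^sup>+ u. ?h u \<partial>gauss (d i))" .
 have "0 < t ^ d i * det (Si i) * gauss_int ^ d i" using D gauss_int_pos by simp
 then show ?thesis unfolding e t_def[symmetric] by (rule ennreal_powr_cmult)
qed

end

end

section \<open>The constant function 1 and the constant \<Gamma>\<close>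

lemma nested_integral_one:
 assumes "!!i. i < m ==> P i \<in> Mat (d i) n" "!!i. i < m ==> R i \<in> Mat (d i) k"
  and one: "!!i u. i < m ==> u \<in> Rn (d i) ==> psi i u = 1"
 shows "nested_integral m n k P R r psi = 1"
proof -
 have "ennreal_powr (\<integral>\<^sup>+ y. ennreal (\<Prod>i<m. psi i (P i *\<^sub>v x + R i *\<^sub>v y)) \<partial>gauss k) r = 1" if x: "x \<in> Rn n" for x
 proof -
  have "(\<integral>\<^sup>+ y. ennreal (\<Prod>i<m. psi i (P i *\<^sub>v x + R i *\<^sub>v y)) \<partial>gauss k) = (\<integral>\<^sup>+ y. 1 \<partial>gauss k)"
  proof (rule nn_integral_cong)
   fix y :: "real vec" assume "y \<in> space (gauss k)"
   then have y: "y \<in> Rn k" by simp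
   have "psi i (P i *\<^sub>v x + R i *\<^sub>v y) = 1" if "i < m" for i
    by (rule one[OF that add_carrier_vec[OF mult_mat_vec_carrier[OF assms(1)[OF that] x] mult_mat_vec_carrier[OF assms(2)[OF that] y]]])
   then show "ennreal (\<Prod>i<m. psi i (P i *\<^sub>v x + R i *\<^sub>v y)) = 1" by simp
  qed
  also have "... = 1" by (simp add: emeasure_gauss_vec_space)
  finally show ?thesis by (simp add: ennreal_powr_def)
 qed
 then have "nested_integral m n k P R r psi = (\<integral>\<^sup>+ x. 1 \<partial>gauss n)"
  unfolding nested_integral_def by (intro nn_integral_cong) simp
 then show ?thesis by (simp add: emeasure_gauss_vec_space)
qed

lemma norm_product_one:
 assumes one: "!!i u. i < m ==> u \<in> Rn (d i) ==> psi i u = 1"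
 shows "norm_product m d kap s psi = 1"
 unfolding norm_product_def
proof (rule prod.neutral, rule ballI)
 fix i assume "i \<in> {..<m}"
 then have i: "i < m" by simp
 have "(\<integral>\<^sup>+ u. ennreal (psi i (sqrt (kap * s i) \<cdot>\<^sub>v u) powr (1 / s i)) \<partial>gauss (d i)) = (\<integral>\<^sup>+ u. 1 \<partial>gauss (d i))"
  by (intro nn_integral_cong) (simp add: one[OF i])
 also have "... = 1" by (simp add: emeasure_gauss_vec_space)
 finally show "ennreal_powr (\<integral>\<^sup>+ u. ennreal (psi i (sqrt (kap * s i) \<cdot>\<^sub>v u) powr (1 / s i)) \<partial>gauss (d i)) (s i) = 1"
  by (simp add: ennreal_powr_def)
qed

lemma ennreal_powr_le_cancel:
 assumes "ennreal_powr x p \<le> ennreal_powr y p" "0 < p"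
 shows "x \<le> y"
 using ennreal_powr_mono[OF assms(1), of "1 / p"] assms(2) by (simp add: ennreal_powr_powr ennreal_powr_one)

text \<open>Factor by factor the powers of \<open>x i\<close> and \<open>D i\<close> cancel, and
  only powers of \<open>G\<close> remain. The hypothesis on the sum of \<open>d i / p i\<close> says
  that their total exponent is the one on the right; the scaling of \<open>y\<close> accounts for
  the power of \<rho>.\<close>

lemma constant_identity:
 fixes x D p :: "nat => real" and G \<rho> DA :: real
 assumes x: "!!i. i < m ==> 0 < x i" and D: "!!i. i < m ==> 0 < D i" and G: "0 < G" and \<rho>: "0 < \<rho>" and DA: "0 < DA"
  and sum: "(\<Sum>i<m. real (d i) / p i) = real n + real k / \<rho>"
 shows "DA powr (1 / 2) / \<rho> powr (real k / (2 * \<rho>)) * (\<Prod>i<m. x i powr (real (d i) / (2 * p i)) / D i powr (1 / (2 * p i)))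
  * (\<Prod>i<m. ((1 / sqrt (x i)) ^ d i * sqrt (D i) * G ^ d i) powr (1 / p i))
  = sqrt DA * G ^ n * ((1 / sqrt \<rho>) ^ k * G ^ k) powr (1 / \<rho>)"
proof -
 have pw: "(1 / sqrt t) ^ l = t powr (- (real l / 2))" if t: "0 < t" for t :: real and l
 proof -
  have "1 / sqrt t = t powr (- (1 / 2))" using t by (simp add: powr_minus_divide powr_half_sqrt)
  then have "(1 / sqrt t) ^ l = (t powr (- (1 / 2))) powr real l" using t by (simp add: powr_realpow)
  then show ?thesis by (simp add: powr_powr)
 qed
 have Gp: "G ^ l = G powr real l" for l using G by (simp add: powr_realpow)
 have fac: "x i powr (real (d i) / (2 * p i)) / D i powr (1 / (2 * p i)) * ((1 / sqrt (x i)) ^ d i * sqrt (D i) * G ^ d i) powr (1 / p i)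
  = G powr (real (d i) / p i)" if i: "i < m" for i
 proof -
  have "((1 / sqrt (x i)) ^ d i * sqrt (D i) * G ^ d i) powr (1 / p i)
   = (x i powr (- (real (d i) / 2))) powr (1 / p i) * (D i powr (1 / 2)) powr (1 / p i) * (G powr real (d i)) powr (1 / p i)"
   unfolding pw[OF x[OF i]] Gp using D[OF i] G by (simp add: powr_mult powr_half_sqrt)
  also have "... = x i powr (- (real (d i) / (2 * p i))) * D i powr (1 / (2 * p i)) * G powr (real (d i) / p i)"
   unfolding powr_powr by simp
  finally have e: "((1 / sqrt (x i)) ^ d i * sqrt (D i) * G ^ d i) powr (1 / p i)
   = x i powr (- (real (d i) / (2 * p i))) * D i powr (1 / (2 * p i)) * G powr (real (d i) / p i)" .
  have "x i powr (real (d i) / (2 * p i)) * x i powr (- (real (d i) / (2 * p i))) = 1"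
   unfolding powr_add[symmetric] using x[OF i] by simp
  moreover have "D i powr (1 / (2 * p i)) \<noteq> 0" using D[OF i] by simp
  ultimately show ?thesis unfolding e by (simp add: field_simps)
 qed
 have "(\<Prod>i<m. x i powr (real (d i) / (2 * p i)) / D i powr (1 / (2 * p i)))
  * (\<Prod>i<m. ((1 / sqrt (x i)) ^ d i * sqrt (D i) * G ^ d i) powr (1 / p i)) = (\<Prod>i<m. G powr (real (d i) / p i))"
  unfolding prod.distrib[symmetric] by (intro prod.cong refl fac) simp
 also have "... = G powr (real n + real k / \<rho>)"
  unfolding sum[symmetric] using G by (simp add: powr_sum)
 also have "... = G ^ n * G powr (real k / \<rho>)" unfolding powr_add Gp ..
 finally have P: "(\<Prod>i<m. x i powr (real (d i) / (2 * p i)) / D i powr (1 / (2 * p i)))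
  * (\<Prod>i<m. ((1 / sqrt (x i)) ^ d i * sqrt (D i) * G ^ d i) powr (1 / p i)) = G ^ n * G powr (real k / \<rho>)" .
 have "((1 / sqrt \<rho>) ^ k * G ^ k) powr (1 / \<rho>) = (\<rho> powr (- (real k / 2))) powr (1 / \<rho>) * (G powr real k) powr (1 / \<rho>)"
  unfolding pw[OF \<rho>] Gp by (simp add: powr_mult)
 also have "... = \<rho> powr (- (real k / (2 * \<rho>))) * G powr (real k / \<rho>)" unfolding powr_powr by simp
 also have "\<rho> powr (- (real k / (2 * \<rho>))) = 1 / \<rho> powr (real k / (2 * \<rho>))" by (rule powr_minus_divide)
 finally have R: "((1 / sqrt \<rho>) ^ k * G ^ k) powr (1 / \<rho>) = 1 / \<rho> powr (real k / (2 * \<rho>)) * G powr (real k / \<rho>)" .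
 have "DA powr (1 / 2) = sqrt DA" using DA by (simp add: powr_half_sqrt)
 then show ?thesis unfolding R mult.assoc[of "DA powr (1 / 2) / \<rho> powr (real k / (2 * \<rho>))"] P by simp
qed

section \<open>Verification of the hypotheses of the comparison\<close>

context normalised
begin

lemma WW: "i < m ==> W i * (W i)\<^sup>T = (1 - c i) \<cdot>\<^sub>m 1\<^sub>m (d i)"
proof (rule eq_matI)
 assume i: "i < m"
 fix r t assume "r < dim_row ((1 - c i) \<cdot>\<^sub>m 1\<^sub>m (d i))" "t < dim_col ((1 - c i) \<cdot>\<^sub>m 1\<^sub>m (d i))"
 then have rt: "r < d i" "t < d i" by auto
 define X where "X = W i * (W i)\<^sup>T"
 have X: "X \<in> Mat (d i) (d i)" using W[OF i] by (auto simp: X_def)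
 have "(V i * (V i)\<^sup>T + X) $$ (r, t) = (1\<^sub>m (d i) :: real mat) $$ (r, t)" using orth[OF i i] by (simp add: X_def)
 then have "X $$ (r, t) = ((1 - c i) \<cdot>\<^sub>m 1\<^sub>m (d i)) $$ (r, t)"
  unfolding VV[OF i] using X rt by (cases "r = t") auto
 then show "(W i * (W i)\<^sup>T) $$ (r, t) = ((1 - c i) \<cdot>\<^sub>m 1\<^sub>m (d i)) $$ (r, t)" unfolding X_def .
qed (use W in auto)

text \<open>A diagonal entry of \<open>W i * (W i)\<^sup>T\<close> is a sum of squares and equals
  \<open>1 - c i\<close>; such an entry exists since \<open>d i\<close> is positive. This makes the
  weights \<open>s i\<close> positive for every \<rho>.\<close>

lemma c_le_1:
 assumes i: "i < m" shows "c i \<le> 1"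
proof -
 have T: "(W i)\<^sup>T \<in> Mat k (d i)" using W[OF i] by simp
 have "0 \<le> (\<Sum>l<k. W i $$ (0, l) * (W i)\<^sup>T $$ (l, 0))" using W[OF i] d[OF i] by (intro sum_nonneg) simp
 also have "... = (W i * (W i)\<^sup>T) $$ (0, 0)" by (rule mult_mat_entry[OF W[OF i] T d[OF i] d[OF i], symmetric])
 also have "... = 1 - c i" unfolding WW[OF i] using d[OF i] by simp
 finally show ?thesis by simp
qed

lemma s_pos: "i < m ==> 0 < s i"
 using c[of i] c_le_1[of i] \<rho> by (simp add: s_def add_pos_nonneg)

text \<open>The sum of \<open>c i\<close> from the first block and \<open>(1 - c i) / \<rho>\<close>
  from the rescaled second block; the two orders serve the two instances.\<close>

lemma cov:
 assumes i: "i < m"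
 shows "V i * (V i)\<^sup>T + (a \<cdot>\<^sub>m W i) * (a \<cdot>\<^sub>m W i)\<^sup>T = s i \<cdot>\<^sub>m 1\<^sub>m (d i)"
  and "(a \<cdot>\<^sub>m W i) * (a \<cdot>\<^sub>m W i)\<^sup>T + V i * (V i)\<^sup>T = s i \<cdot>\<^sub>m 1\<^sub>m (d i)"
proof -
 have WT: "(W i)\<^sup>T \<in> Mat k (d i)" using W[OF i] by simp
 have t: "(a \<cdot>\<^sub>m W i)\<^sup>T = a \<cdot>\<^sub>m (W i)\<^sup>T" by (intro eq_matI) auto
 have e: "(a \<cdot>\<^sub>m W i) * (a \<cdot>\<^sub>m W i)\<^sup>T = a \<cdot>\<^sub>m (a \<cdot>\<^sub>m ((1 - c i) \<cdot>\<^sub>m 1\<^sub>m (d i)))"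
  unfolding t mult_smult_assoc_mat[OF W[OF i] smult_carrier_mat[OF WT]] mult_smult_distrib[OF W[OF i] WT] WW[OF i] ..
 have f: "a * (a * (1 - c i)) = (1 - c i) / \<rho>" unfolding mult.assoc[symmetric] a(2) by simp
 show "V i * (V i)\<^sup>T + (a \<cdot>\<^sub>m W i) * (a \<cdot>\<^sub>m W i)\<^sup>T = s i \<cdot>\<^sub>m 1\<^sub>m (d i)" "(a \<cdot>\<^sub>m W i) * (a \<cdot>\<^sub>m W i)\<^sup>T + V i * (V i)\<^sup>T = s i \<cdot>\<^sub>m 1\<^sub>m (d i)"
  unfolding e VV[OF i] using f by (intro eq_matI; auto simp: s_def)+
qed

lemma orth_form:
 assumes ij: "i < m" "j < m" and u: "u \<in> Rn (d i)" and v: "v \<in> Rn (d j)"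
 shows "((V i)\<^sup>T *\<^sub>v u) \<bullet> ((V j)\<^sup>T *\<^sub>v v) + ((W i)\<^sup>T *\<^sub>v u) \<bullet> ((W j)\<^sup>T *\<^sub>v v) = (if i = j then u \<bullet> v else 0)"
proof -
 have VT: "(V i)\<^sup>T \<in> Mat n (d i)" and WT: "(W i)\<^sup>T \<in> Mat k (d i)" using V[OF ij(1)] W[OF ij(1)] by simp_all
 have Vu: "(V i)\<^sup>T *\<^sub>v u \<in> Rn n" and Wu: "(W i)\<^sup>T *\<^sub>v u \<in> Rn k"
  by (rule mult_mat_vec_carrier[OF VT u] mult_mat_vec_carrier[OF WT u])+
 have "((V i)\<^sup>T *\<^sub>v u) \<bullet> ((V j)\<^sup>T *\<^sub>v v) + ((W i)\<^sup>T *\<^sub>v u) \<bullet> ((W j)\<^sup>T *\<^sub>v v)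
  = (V j *\<^sub>v ((V i)\<^sup>T *\<^sub>v u)) \<bullet> v + (W j *\<^sub>v ((W i)\<^sup>T *\<^sub>v u)) \<bullet> v"
  unfolding scalar_prod_transpose[OF V[OF ij(2)] Vu v] scalar_prod_transpose[OF W[OF ij(2)] Wu v] ..
 also have "... = (V j *\<^sub>v ((V i)\<^sup>T *\<^sub>v u) + W j *\<^sub>v ((W i)\<^sup>T *\<^sub>v u)) \<bullet> v"
  by (rule add_scalar_prod_distrib[OF mult_mat_vec_carrier[OF V[OF ij(2)] Vu] mult_mat_vec_carrier[OF W[OF ij(2)] Wu] v, symmetric])
 also have "V j *\<^sub>v ((V i)\<^sup>T *\<^sub>v u) + W j *\<^sub>v ((W i)\<^sup>T *\<^sub>v u) = (V j * (V i)\<^sup>T + W j * (W i)\<^sup>T) *\<^sub>v u"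
  unfolding add_mult_distrib_mat_vec[OF mult_carrier_mat[OF V[OF ij(2)] VT] mult_carrier_mat[OF W[OF ij(2)] WT] u]
   assoc_mult_mat_vec[OF V[OF ij(2)] VT u] assoc_mult_mat_vec[OF W[OF ij(2)] WT u] ..
 also have "... = (if j = i then u else 0\<^sub>v (d j))"
  unfolding orth[OF ij(2,1)] using u by (auto simp: zero_mult_mat_vec)
 also have "... \<bullet> v = (if i = j then u \<bullet> v else 0)" using v by auto
 finally show ?thesis .
qed

lemma aW_form:
 assumes ij: "i < m" "j < m" and u: "u \<in> Rn (d i)" and v: "v \<in> Rn (d j)"
 shows "((a \<cdot>\<^sub>m W i)\<^sup>T *\<^sub>v u) \<bullet> ((a \<cdot>\<^sub>m W j)\<^sup>T *\<^sub>v v) = 1 / \<rho> * (((W i)\<^sup>T *\<^sub>v u) \<bullet> ((W j)\<^sup>T *\<^sub>v v))"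
proof -
 have WT: "(W i)\<^sup>T \<in> Mat k (d i)" "(W j)\<^sup>T \<in> Mat k (d j)" using W[OF ij(1)] W[OF ij(2)] by simp_all
 have t: "(a \<cdot>\<^sub>m X)\<^sup>T = a \<cdot>\<^sub>m X\<^sup>T" for X by (intro eq_matI) auto
 have "((a \<cdot>\<^sub>m W i)\<^sup>T *\<^sub>v u) \<bullet> ((a \<cdot>\<^sub>m W j)\<^sup>T *\<^sub>v v) = a * (a * (((W i)\<^sup>T *\<^sub>v u) \<bullet> ((W j)\<^sup>T *\<^sub>v v)))"
  unfolding t smult_mult_mat_vec[OF WT(1) u] smult_mult_mat_vec[OF WT(2) v]
  using mult_mat_vec_carrier[OF WT(1) u] mult_mat_vec_carrier[OF WT(2) v] by simp
 then show ?thesis unfolding mult.assoc[symmetric] a(2) .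
qed

text \<open>With \<open>r = 1 / \<rho>\<close> both blocks of the weighted orthogonality carry the
  factor \<open>1 / \<rho>\<close>, so \<open>kap\<close> is \<open>1 / \<rho>\<close> and the
  weights must be \<open>\<rho> * s i\<close> to match the covariance.\<close>

lemma nested_outer: "nested m n k d V (%i. a \<cdot>\<^sub>m W i) (1 / \<rho>) (1 / \<rho>) (%i. \<rho> * s i)"
proof (unfold_locales)
 show "1 / \<rho> * (((V i)\<^sup>T *\<^sub>v u) \<bullet> ((V j)\<^sup>T *\<^sub>v v)) + ((a \<cdot>\<^sub>m W i)\<^sup>T *\<^sub>v u) \<bullet> ((a \<cdot>\<^sub>m W j)\<^sup>T *\<^sub>v v)
  = (if i = j then 1 / \<rho> * (u \<bullet> v) else 0)"
  if "i < m" "j < m" "u \<in> Rn (d i)" "v \<in> Rn (d j)" for i j u v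
  unfolding aW_form[OF that] distrib_left[symmetric] orth_form[OF that] by simp
 show "V i * (V i)\<^sup>T + a \<cdot>\<^sub>m W i * (a \<cdot>\<^sub>m W i)\<^sup>T = (1 / \<rho> * (\<rho> * s i)) \<cdot>\<^sub>m 1\<^sub>m (d i)" if "i < m" for i
  unfolding cov(1)[OF that] using \<rho> by simp
qed (use V aW \<rho> s_pos in auto)

text \<open>Here the rescaled block is the outer one, and the weight \<rho> undoes its scaling, so
  \<open>kap = 1\<close>.\<close>

lemma nested_inner: "nested m k n d (%i. a \<cdot>\<^sub>m W i) V \<rho> 1 s"
proof (unfold_locales)
 show "\<rho> * (((a \<cdot>\<^sub>m W i)\<^sup>T *\<^sub>v u) \<bullet> ((a \<cdot>\<^sub>m W j)\<^sup>T *\<^sub>v v)) + ((V i)\<^sup>T *\<^sub>v u) \<bullet> ((V j)\<^sup>T *\<^sub>v v)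
  = (if i = j then 1 * (u \<bullet> v) else 0)"
  if "i < m" "j < m" "u \<in> Rn (d i)" "v \<in> Rn (d j)" for i j u v
  unfolding aW_form[OF that] using orth_form[OF that] \<rho> by (simp add: add.commute)
 show "a \<cdot>\<^sub>m W i * (a \<cdot>\<^sub>m W i)\<^sup>T + V i * (V i)\<^sup>T = (1 * s i) \<cdot>\<^sub>m 1\<^sub>m (d i)" if "i < m" for i
  unfolding cov(2)[OF that] by simp
qed (use V aW \<rho> s_pos in auto)

lemma sum_s:
 assumes "k + n = (\<Sum>i<m. d i)"
 shows "(\<Sum>i<m. real (d i) * s i) = real n + real k / \<rho>"
proof -
 have "(\<Sum>i<m. real (d i) * s i) = (\<Sum>i<m. c i * real (d i)) + ((\<Sum>i<m. real (d i)) - (\<Sum>i<m. c i * real (d i))) / \<rho>"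
  unfolding s_def sum_subtractf[symmetric] sum_divide_distrib sum.distrib[symmetric]
  by (intro sum.cong refl) (simp add: algebra_simps diff_divide_distrib)
 also have "(\<Sum>i<m. real (d i)) = real k + real n" unfolding of_nat_sum[symmetric] assms[symmetric] by simp
 finally show ?thesis unfolding trace by simp
qed

end

text \<open>Borel representatives of the functions leave the three quantities unchanged; these then
  equal \<open>K\<close> times \<open>N1\<close>, \<open>N3\<close> and \<open>N2\<close>, and the
  comparison applies to each neighbouring pair. At \<rho> = 1 both directions hold, so antisymmetry
  gives equality.\<close>

theorem theorem5:
  fixes m n N :: nat and d :: "nat \<Rightarrow> nat"
    and U W :: "nat \<Rightarrow> real mat" and Ufull Wfull :: "real mat"
    and c :: "nat \<Rightarrow> real"
    and A :: "real mat" and Ai :: "nat \<Rightarrow> real mat" and CA :: "real mat"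
    and \<rho> \<Gamma> :: real and p :: "nat \<Rightarrow> real"
    and f :: "nat \<Rightarrow> real vec \<Rightarrow> real"
    and F :: "real vec \<Rightarrow> real vec \<Rightarrow> real"
    and lhs mid rhs :: ennreal
  assumes "0 < m" and "0 < n" and "\<And>i. i < m \<Longrightarrow> 0 < d i"
    and "\<And>i. i < m \<Longrightarrow> U i \<in> carrier_mat (d i) n"
    and "\<And>i. i < m \<Longrightarrow> mat_rank (U i) = d i"
    and "N = (\<Sum>i<m. d i)"
    and "Ufull = stack_rows n m U"
    and "\<And>i. i < m \<Longrightarrow> 0 < c i"
    and "sym_pos_def n A"
    and "\<And>i. i < m \<Longrightarrow> Ai i = U i * A * (U i)\<^sup>T"
    and "CA = diag_block_mat (map (\<lambda>i. c i \<cdot>\<^sub>m minv (Ai i)) [0..<m])"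
    and "Ufull\<^sup>T * CA * Ufull = minv A"
    and "\<And>i. i < m \<Longrightarrow> W i \<in> carrier_mat (d i) (N - n)"
    and "Wfull = stack_rows (N - n) m W"
    and "mat_rank Wfull = N - n"
    and "sqrt_mat CA * Ufull * A * Ufull\<^sup>T * sqrt_mat CA + Wfull * Wfull\<^sup>T = 1\<^sub>m N"
    and "0 < \<rho>"
    and "\<And>i. i < m \<Longrightarrow> p i = 1 / (c i * (1 + (1 - c i) / (\<rho> * c i)))"
    and "\<Gamma> = det A powr (1 / 2) / \<rho> powr (real (N - n) / (2 * \<rho>)) *
           (\<Prod>i<m. (c i * p i) powr (real (d i) / (2 * p i)) / det (Ai i) powr (1 / (2 * p i)))"
    and "\<And>i x. i < m \<Longrightarrow> x \<in> carrier_vec (d i) \<Longrightarrow> 0 \<le> f i x"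
    and "\<And>i. i < m \<Longrightarrow> f i \<in> borel_measurable (lebesgue_vec (d i))"
    and "\<And>x y. x \<in> carrier_vec n \<Longrightarrow> y \<in> carrier_vec (N - n) \<Longrightarrow>
           F x y = (\<Prod>i<m. f i (U i *\<^sub>v x + (1 / sqrt (c i)) \<cdot>\<^sub>v ((sqrt_mat (Ai i) * W i) *\<^sub>v y)))"
    and "lhs = (\<integral>\<^sup>+ x. ennreal_powr (\<integral>\<^sup>+ y. ennreal (F x y powr \<rho>) \<partial>lebesgue_vec (N - n)) (1 / \<rho>)
           \<partial>lebesgue_vec n)"
    and "mid = ennreal \<Gamma> * (\<Prod>i<m. Lp_norm (d i) (p i) (f i))"
    and "rhs = ennreal_powr (\<integral>\<^sup>+ y. ennreal_powr (\<integral>\<^sup>+ x. ennreal (F x y) \<partial>lebesgue_vec n) \<rho>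
           \<partial>lebesgue_vec (N - n)) (1 / \<rho>)"
  shows "(1 \<le> \<rho> \<longrightarrow> lhs \<ge> mid \<and> mid \<ge> rhs) \<and>
         (\<rho> \<le> 1 \<longrightarrow> lhs \<le> mid \<and> mid \<le> rhs) \<and>
         (\<rho> = 1 \<or> (\<forall>i<m. \<forall>x\<in>carrier_vec (d i). f i x = exp (- c i * (x \<bullet> (minv (Ai i) *\<^sub>v x)))) \<longrightarrow>
            lhs = mid \<and> mid = rhs)"
proof -
 note m = assms(1) and d = assms(3) and U = assms(4) and rank = assms(5) and N = assms(6) and c = assms(8) and A = assms(9)
  and Ai = assms(10) and W = assms(13) and \<rho> = assms(17) and p = assms(18) and f0 = assms(20) and fm = assms(21) and F = assms(22)
 have CA: "CA = diag_block_mat (map (%i. c i \<cdot>\<^sub>m minv (U i * A * (U i)\<^sup>T)) [0..<m])"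
  unfolding assms(11) by (rule arg_cong[of _ _ diag_block_mat]) (simp add: Ai)
 have UCU: "(stack_rows n m U)\<^sup>T * CA * stack_rows n m U = minv A" using assms(12) unfolding assms(7) .
 have WW: "sqrt_mat CA * stack_rows n m U * A * (stack_rows n m U)\<^sup>T * sqrt_mat CA
  + stack_rows (N - n) m W * (stack_rows (N - n) m W)\<^sup>T = 1\<^sub>m N" using assms(16) unfolding assms(7,14) .
 obtain V where Aspd: "!!i. i < m ==> sym_pos_def (d i) (U i * A * (U i)\<^sup>T)" and nN: "n \<le> (\<Sum>i<m. d i)"
  and cd: "(\<Sum>i<m. c i * real (d i)) = real n" and V: "!!i. i < m ==> V i \<in> Mat (d i) n"
  and SV: "!!i. i < m ==> sqrt_mat (U i * A * (U i)\<^sup>T) * V i = sqrt (c i) \<cdot>\<^sub>m (U i * sqrt_mat A)"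
  and orth: "!!i j. i < m ==> j < m ==> V i * (V j)\<^sup>T + W i * (W j)\<^sup>T = (if i = j then 1\<^sub>m (d i) else 0\<^sub>m (d i) (d j))"
  and VV: "!!i. i < m ==> V i * (V i)\<^sup>T = c i \<cdot>\<^sub>m 1\<^sub>m (d i)"
  and isometry: "!!x y. x \<in> Rn n ==> y \<in> Rn (N - n) ==>
   (\<Sum>i<m. (V i *\<^sub>v x + W i *\<^sub>v y) \<bullet> (V i *\<^sub>v x + W i *\<^sub>v y)) = x \<bullet> x + y \<bullet> y"
  using normalisation[where m = m and d = d and n = n and U = U and W = W and c = c and A = A, folded N CA, OF U rank c A UCU W WW]
  unfolding N by blast
 define k where "k = N - n"
 have kn: "k + n = (\<Sum>i<m. d i)" using nN N by (simp add: k_def)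
 define Si where "Si = (%i. sqrt_mat (Ai i))"
 have Aspd': "sym_pos_def (d i) (Ai i)" if "i < m" for i using Aspd[OF that] Ai[OF that] by simp
 have SiP: "sym_pos_def (d i) (Si i)" "Si i * Si i = Ai i" "det (Si i) = sqrt (det (Ai i))" if "i < m" for i
  unfolding Si_def by (rule sqrt_mat[OF Aspd'[OF that]])+
 have SA: "sym_pos_def n (sqrt_mat A)" "det (sqrt_mat A) = sqrt (det A)" by (rule sqrt_mat[OF A])+
 interpret normalised m n k d U V W Si "sqrt_mat A" c \<rho>
 proof
  show "Si i * V i = sqrt (c i) \<cdot>\<^sub>m (U i * sqrt_mat A)" if "i < m" for i
   using SV[OF that] Ai[OF that] by (simp add: Si_def)
 qed (use U V W SA(1) SiP(1) c d \<rho> orth VV isometry cd in \<open>simp_all add: k_def\<close>)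
 have ps: "p i = 1 / s i" if i: "i < m" for i
 proof -
  have "c i * (1 + (1 - c i) / (\<rho> * c i)) = s i" using c[OF i] \<rho> by (simp add: s_def field_simps)
  then show ?thesis unfolding p[OF i] by simp
 qed
 have pp: "0 < p i" if "i < m" for i using ps[OF that] s_pos[OF that] by simp
 \<comment> \<open>In this case the representative has to agree with \<open>f i\<close> at every
   vector of dimension \<open>d i\<close>, not only almost everywhere, since equality is derived
   from \<open>phi g i\<close> being 1 at all such vectors.\<close>
 define gaussian where "gaussian \<longleftrightarrow> (\<forall>i<m. \<forall>x\<in>Rn (d i). f i x = exp (- c i * (x \<bullet> (minv (Ai i) *\<^sub>v x))))"
 have "\<exists>g. g \<in> borel_fun (d i) \<and> (\<forall>u. 0 \<le> g u) \<and> (AE u in leb (d i). f i u = g u)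
   \<and> (gaussian \<longrightarrow> (\<forall>u\<in>Rn (d i). g u = f i u))" if i: "i < m" for i
 proof (cases gaussian)
  case True
  define g where "g = (%u::real vec. exp (- c i * (u \<bullet> (minv (Ai i) *\<^sub>v u))))"
  have mc: "minv (Ai i) \<in> Mat (d i) (d i)" by (rule sym_pos_def_minv(4)[OF Aspd'[OF i]])
  have "(%u. u \<bullet> (minv (Ai i) *\<^sub>v u)) \<in> borel_fun (d i)"
   by (rule measurable_scalar_prod[OF measurable_ident_sets[OF refl] measurable_mat_lborel_vec[OF mc]])
  then have "g \<in> borel_fun (d i)" unfolding g_def by simp
  moreover have "g u = f i u" if "u \<in> Rn (d i)" for u using True i that by (simp add: gaussian_def g_def)
  moreover have "AE u in leb (d i). f i u = g u" by (rule AE_I2) (use calculation(2) in simp)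
  moreover have "0 \<le> g u" for u by (simp add: g_def)
  ultimately show ?thesis by blast
 next
  case False
  obtain g' where g': "g' \<in> borel_fun (d i)" "AE u in leb (d i). f i u = g' u"
   using completion_ex_borel_measurable_real[of "f i" "leb (d i)"] fm[OF i] unfolding lebesgue_vec_def by blast
  define g where "g = (%u. max 0 (g' u))"
  have "g \<in> borel_fun (d i)" unfolding g_def using g'(1) by simp
  moreover have "AE u in leb (d i). f i u = g u"
   using g'(2) AE_space
  proof eventually_elim
   case (elim u)
   then show ?case using f0[OF i, of u] by (simp add: g_def)
  qed
  moreover have "0 \<le> g u" for u by (simp add: g_def)
  ultimately show ?thesis using False by blast
 qed
 then have "\<forall>i. \<exists>g. i < m \<longrightarrow> g \<in> borel_fun (d i) \<and> (\<forall>u. 0 \<le> g u) \<and> (AE u in leb (d i). f i u = g u)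
   \<and> (gaussian \<longrightarrow> (\<forall>u\<in>Rn (d i). g u = f i u))" by blast
 from choice[OF this] obtain g' where g': "!!i. i < m ==> g' i \<in> borel_fun (d i) \<and> (\<forall>u. 0 \<le> g' i u)
   \<and> (AE u in leb (d i). f i u = g' i u) \<and> (gaussian \<longrightarrow> (\<forall>u\<in>Rn (d i). g' i u = f i u))" by blast
 \<comment> \<open>The value 0 beyond \<open>m\<close> makes \<open>g\<close> nonnegative at all
   indices, as the context of \<open>lhs_eq\<close> and \<open>rhs_eq\<close> asks.\<close>
 define g where "g = (%i u. if i < m then g' i u else 0)"
 have gi: "g i = g' i" if "i < m" for i using that by (simp add: g_def)
 have gm: "g i \<in> borel_fun (d i)" if "i < m" for i using g'[OF that] gi[OF that] by simp
 have g0: "0 \<le> g i u" for i u using g'[of i] by (simp add: g_def)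
 have gf: "AE u in leb (d i). f i u = g i u" if "i < m" for i using g'[OF that] gi[OF that] by simp
 have gG: "g i u = f i u" if "gaussian" "i < m" "u \<in> Rn (d i)" for i u using g'[OF that(2)] gi[OF that(2)] that by simp
 have "\<exists>Z. Z \<in> null_sets (leb (d i)) \<and> {u \<in> Rn (d i). f i u \<noteq> g i u} \<subseteq> Z" if i: "i < m" for i
  using gf[OF i] by (rule AE_E) (auto intro: null_setsI)
 then have "\<forall>i. \<exists>Z. i < m \<longrightarrow> Z \<in> null_sets (leb (d i)) \<and> {u \<in> Rn (d i). f i u \<noteq> g i u} \<subseteq> Z" by blast
 from choice[OF this] obtain Z where Z: "!!i. i < m ==> Z i \<in> null_sets (leb (d i)) \<and> {u \<in> Rn (d i). f i u \<noteq> g i u} \<subseteq> Z i" by blast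
 \<comment> \<open>The argument of \<open>f i\<close> is the image of the pair under
   \<open>Q i\<close>, which is onto already because of the block \<open>U i\<close>. Hence the
   exceptional sets pull back to a null set \<open>M\<close> of pairs.\<close>
 define Q where "Q = (%i. hcat (U i) (Y i))"
 have Q: "Q i \<in> Mat (d i) (n + k)" if "i < m" for i unfolding Q_def by (rule hcat_carrier[OF U[OF that] Y[OF that]])
 define M where "M = (\<Union>i\<in>{..<m}. {z \<in> Rn (n + k). Q i *\<^sub>v z \<in> Z i})"
 have M: "M \<in> null_sets (leb (n + k))"
  unfolding M_def
 proof (rule null_sets_UN')
  fix i assume "i \<in> {..<m}"
  then have i: "i < m" by simp
  have ker: "v = 0\<^sub>v (d i)" if v: "v \<in> Rn (d i)" and Qv: "(Q i)\<^sup>T *\<^sub>v v = 0\<^sub>v (n + k)" for v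
  proof (rule full_row_rank_kernel[OF U[OF i] rank[OF i] v])
   have UTc: "(U i)\<^sup>T \<in> Mat n (d i)" using U[OF i] by simp
   have Uv: "(U i)\<^sup>T *\<^sub>v v \<in> Rn n" by (rule mult_mat_vec_carrier[OF UTc v])
   have app: "((U i)\<^sup>T *\<^sub>v v) @\<^sub>v ((Y i)\<^sup>T *\<^sub>v v) = 0\<^sub>v (n + k)"
    using Qv transpose_hcat_mult_vec[OF U[OF i] Y[OF i] v] by (simp add: Q_def)
   show "(U i)\<^sup>T *\<^sub>v v = 0\<^sub>v n"
   proof (rule eq_vecI)
    fix l assume "l < dim_vec (0\<^sub>v n :: real vec)"
    then have l: "l < n" by simp
    have "((U i)\<^sup>T *\<^sub>v v) $ l = (((U i)\<^sup>T *\<^sub>v v) @\<^sub>v ((Y i)\<^sup>T *\<^sub>v v)) $ l"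
     using l carrier_vecD[OF Uv] by (simp only: index_append_vec) (simp add: carrier_vecD[OF Uv])
    then show "((U i)\<^sup>T *\<^sub>v v) $ l = 0\<^sub>v n $ l" unfolding app using l by simp
   qed (use carrier_vecD[OF Uv] in simp)
  qed
  show "{z \<in> Rn (n + k). Q i *\<^sub>v z \<in> Z i} \<in> null_sets (leb (n + k))"
   by (rule null_preimage[OF Q[OF i] ker]) (use Z[OF i] in blast)+
 qed simp
 have Feq: "F x y = (\<Prod>i<m. g i (U i *\<^sub>v x + Y i *\<^sub>v y))"
  if x: "x \<in> Rn n" and y: "y \<in> Rn k" and xy: "x @\<^sub>v y \<notin> M" for x y
  unfolding F[OF x y[unfolded k_def]]
 proof (rule prod.cong)
  fix i assume "i \<in> {..<m}"
  then have i: "i < m" by simp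
  have z: "x @\<^sub>v y \<in> Rn (n + k)" by (rule append_carrier_vec[OF x y])
  have Qe: "Q i *\<^sub>v (x @\<^sub>v y) = U i *\<^sub>v x + Y i *\<^sub>v y" unfolding Q_def by (rule hcat_mult_vec[OF U[OF i] Y[OF i] x y])
  have "Q i *\<^sub>v (x @\<^sub>v y) \<notin> Z i" using xy z i by (auto simp: M_def)
  moreover have "Q i *\<^sub>v (x @\<^sub>v y) \<in> Rn (d i)" by (rule mult_mat_vec_carrier[OF Q[OF i] z])
  ultimately have "f i (Q i *\<^sub>v (x @\<^sub>v y)) = g i (Q i *\<^sub>v (x @\<^sub>v y))" using Z[OF i] by blast
  moreover have "Y i *\<^sub>v y = (1 / sqrt (c i)) \<cdot>\<^sub>v ((sqrt_mat (Ai i) * W i) *\<^sub>v y)"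
   unfolding Y_def unfolding Si_def
   by (rule smult_mult_mat_vec[OF mult_carrier_mat[OF Sic[OF i, unfolded Si_def] assms(13)[OF i]] y[unfolded k_def]])
  ultimately show "f i (U i *\<^sub>v x + (1 / sqrt (c i)) \<cdot>\<^sub>v (sqrt_mat (Ai i) * W i *\<^sub>v y)) = g i (U i *\<^sub>v x + Y i *\<^sub>v y)"
   unfolding Qe by simp
 qed simp
 define N1 where "N1 = nested_integral m n k V (%i. a \<cdot>\<^sub>m W i) (1 / \<rho>) (%i u. phi g i u powr \<rho>)"
 define N2 where "N2 = ennreal_powr (nested_integral m k n (%i. a \<cdot>\<^sub>m W i) V \<rho> (phi g)) (1 / \<rho>)"
 define N3 where "N3 = norm_product m d 1 s (phi g)"
 have L: "lhs = ennreal K * N1"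
 proof -
  have "lhs = (\<integral>\<^sup>+ x. ennreal_powr (\<integral>\<^sup>+ y. ennreal (F x y powr \<rho>) \<partial>leb k) (1 / \<rho>) \<partial>leb n)"
   unfolding assms(23) lebesgue_vec_def nn_integral_completion k_def ..
  also have "... = (\<integral>\<^sup>+ x. ennreal_powr (\<integral>\<^sup>+ y. ennreal ((\<Prod>i<m. g i (U i *\<^sub>v x + Y i *\<^sub>v y)) powr \<rho>) \<partial>leb k) (1 / \<rho>) \<partial>leb n)"
  proof (rule nn_integral_cong_AE)
   show "AE x in leb n. ennreal_powr (\<integral>\<^sup>+ y. ennreal (F x y powr \<rho>) \<partial>leb k) (1 / \<rho>)
    = ennreal_powr (\<integral>\<^sup>+ y. ennreal ((\<Prod>i<m. g i (U i *\<^sub>v x + Y i *\<^sub>v y)) powr \<rho>) \<partial>leb k) (1 / \<rho>)"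
    using AE_lborel_vec_append(1)[OF M] AE_space
   proof eventually_elim
    case (elim x)
    then have x: "x \<in> Rn n" by simp
    have "AE y in leb k. ennreal (F x y powr \<rho>) = ennreal ((\<Prod>i<m. g i (U i *\<^sub>v x + Y i *\<^sub>v y)) powr \<rho>)"
     using elim(1) AE_space
    proof eventually_elim
     case (elim y)
     then show ?case using Feq[OF x, of y] by simp
    qed
    then show ?case by (intro arg_cong[of _ _ "%t. ennreal_powr t (1 / \<rho>)"] nn_integral_cong_AE)
   qed
  qed
  also have "... = ennreal K * N1" unfolding N1_def by (rule lhs_eq[OF gm g0])
  finally show ?thesis .
 qed
 have R: "rhs = ennreal K * N2"
 proof -
  have "rhs = ennreal_powr (\<integral>\<^sup>+ y. ennreal_powr (\<integral>\<^sup>+ x. ennreal (F x y) \<partial>leb n) \<rho> \<partial>leb k) (1 / \<rho>)"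
   unfolding assms(25) lebesgue_vec_def nn_integral_completion k_def ..
  also have "(\<integral>\<^sup>+ y. ennreal_powr (\<integral>\<^sup>+ x. ennreal (F x y) \<partial>leb n) \<rho> \<partial>leb k)
   = (\<integral>\<^sup>+ y. ennreal_powr (\<integral>\<^sup>+ x. ennreal (\<Prod>i<m. g i (U i *\<^sub>v x + Y i *\<^sub>v y)) \<partial>leb n) \<rho> \<partial>leb k)"
  proof (rule nn_integral_cong_AE)
   show "AE y in leb k. ennreal_powr (\<integral>\<^sup>+ x. ennreal (F x y) \<partial>leb n) \<rho>
    = ennreal_powr (\<integral>\<^sup>+ x. ennreal (\<Prod>i<m. g i (U i *\<^sub>v x + Y i *\<^sub>v y)) \<partial>leb n) \<rho>"
    using AE_lborel_vec_append(2)[OF M] AE_space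
   proof eventually_elim
    case (elim y)
    then have y: "y \<in> Rn k" by simp
    have "AE x in leb n. ennreal (F x y) = ennreal (\<Prod>i<m. g i (U i *\<^sub>v x + Y i *\<^sub>v y))"
     using elim(1) AE_space
    proof eventually_elim
     case (elim x)
     then show ?case using Feq[OF _ y, of x] by simp
    qed
    then show ?case by (intro arg_cong[of _ _ "%t. ennreal_powr t \<rho>"] nn_integral_cong_AE)
   qed
  qed
  also have "ennreal_powr (\<integral>\<^sup>+ y. ennreal_powr (\<integral>\<^sup>+ x. ennreal (\<Prod>i<m. g i (U i *\<^sub>v x + Y i *\<^sub>v y)) \<partial>leb n) \<rho> \<partial>leb k) (1 / \<rho>)
   = ennreal K * N2" unfolding N2_def by (rule rhs_eq[OF gm g0])
  finally show ?thesis .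
 qed
 have detAi: "0 < det (Ai i)" if "i < m" for i
  using preserves_lborel_sym_pos_def[OF Aspd'[OF that]] by (simp add: preserves_lborel_by_det_def)
 have detA: "0 < det A" using preserves_lborel_sym_pos_def[OF A] by (simp add: preserves_lborel_by_det_def)
 have Mid: "mid = ennreal K * N3"
 proof -
  define z where "z = (%i. ((1 / sqrt (c i * p i)) ^ d i * sqrt (det (Ai i)) * gauss_int ^ d i) powr (1 / p i))"
  have "Lp_norm (d i) (p i) (f i) = ennreal (z i)
   * ennreal_powr (\<integral>\<^sup>+ u. ennreal (phi g i (sqrt (1 * s i) \<cdot>\<^sub>v u) powr (1 / s i)) \<partial>gauss (d i)) (s i)" if i: "i < m" for i
  proof -
   have "(\<integral>\<^sup>+ x. ennreal (f i x powr p i) \<partial>leb (d i)) = (\<integral>\<^sup>+ x. ennreal (g i x powr p i) \<partial>leb (d i))"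
    by (rule nn_integral_cong_AE) (use gf[OF i] in eventually_elim, simp)
   then have "Lp_norm (d i) (p i) (f i) = ennreal_powr (\<integral>\<^sup>+ x. ennreal (g i x powr p i) \<partial>leb (d i)) (1 / p i)"
    unfolding Lp_norm_def lebesgue_vec_def nn_integral_completion by simp
   also have "... = ennreal (z i) * ennreal_powr (\<integral>\<^sup>+ u. ennreal (phi g i (sqrt (1 / p i) \<cdot>\<^sub>v u) powr p i) \<partial>gauss (d i)) (1 / p i)"
    unfolding z_def SiP(3)[OF i, symmetric] by (rule Lp_eq[OF gm g0 i pp[OF i]])
   finally show ?thesis unfolding ps[OF i] by simp
  qed
  then have "(\<Prod>i<m. Lp_norm (d i) (p i) (f i)) = (\<Prod>i<m. ennreal (z i)) * N3"
   unfolding N3_def norm_product_def by (simp add: prod.distrib)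
  also have "(\<Prod>i<m. ennreal (z i)) = ennreal (\<Prod>i<m. z i)" by (rule prod_ennreal) (simp add: z_def)
  finally have mid: "mid = ennreal \<Gamma> * (ennreal (\<Prod>i<m. z i) * N3)" unfolding assms(24) by simp
  have "(\<Sum>i<m. real (d i) / p i) = real n + real k / \<rho>" using sum_s[OF kn] ps by simp
  \<comment> \<open>The exponent count that \<open>constant_identity\<close> needs: the sum of the
    \<open>d i * s i\<close>, with \<open>1 / p i = s i\<close>.\<close>
  note sum = this[unfolded k_def]
  have cp: "0 < c i * p i" if "i < m" for i using assms(8)[OF that] pp[OF that] by simp
  have "\<Gamma> * (\<Prod>i<m. z i) = K"
   unfolding assms(19) z_def K_def SA(2) a_def unfolding k_def
   by (rule constant_identity[where x = "%i. c i * p i" and D = "%i. det (Ai i)", OF cp detAi gauss_int_pos assms(17) detA sum])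
  moreover have "0 \<le> \<Gamma>" unfolding assms(19) by (intro mult_nonneg_nonneg prod_nonneg) auto
  ultimately have "ennreal K = ennreal \<Gamma> * ennreal (\<Prod>i<m. z i)" using ennreal_mult' by metis
  then show ?thesis unfolding mid by (simp only: mult.assoc)
 qed
 have phim: "phi g i \<in> borel_fun (d i)" if "i < m" for i by (rule measurable_phi[where g = g, OF that gm[OF that]])
 have phi0: "0 \<le> phi g i u" for i u unfolding phi_def by (intro mult_nonneg_nonneg g0) simp
 have np: "norm_product m d (1 / \<rho>) (%i. \<rho> * s i) (%i u. phi g i u powr \<rho>) = ennreal_powr N3 \<rho>"
  unfolding N3_def by (rule norm_product_powr[OF \<rho> s_pos])
 \<comment> \<open>The instance has exponent \<open>1 / \<rho>\<close>, so it compares \<rho>-th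
   powers, and its direction is opposite to that of \<open>inner\<close>; together they put
   \<open>N3\<close> between \<open>N1\<close> and \<open>N2\<close>.\<close>
 have outer: "(1 \<le> 1 / \<rho> \<longrightarrow> N1 \<le> N3) \<and> (1 / \<rho> \<le> 1 \<longrightarrow> N3 \<le> N1)"
 proof -
  have mm: "(%u. phi g i u powr \<rho>) \<in> borel_fun (d i)" if "i < m" for i using phim[OF that] by simp
  have e: "1 / (1 / \<rho>) = \<rho>" by simp
  have "ennreal_powr N1 \<rho> \<le> ennreal_powr N3 \<rho>" if "1 \<le> 1 / \<rho>"
   using nested.nested_inequality(1)[OF nested_outer, of "%i u. phi g i u powr \<rho>"] mm that unfolding np N1_def[symmetric] e by simp
  moreover have "ennreal_powr N3 \<rho> \<le> ennreal_powr N1 \<rho>" if "1 / \<rho> \<le> 1"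
   using nested.nested_inequality(2)[OF nested_outer, of "%i u. phi g i u powr \<rho>"] mm that unfolding np N1_def[symmetric] e by simp
  ultimately show ?thesis using ennreal_powr_le_cancel assms(17) by blast
 qed
 have inner: "(1 \<le> \<rho> \<longrightarrow> N2 \<le> N3) \<and> (\<rho> \<le> 1 \<longrightarrow> N3 \<le> N2)"
  unfolding N2_def N3_def
  using nested.nested_inequality[OF nested_inner, of "phi g"] phim phi0 by blast
 have mono: "ennreal K * x \<le> ennreal K * y" if "x \<le> y" for x y by (rule mult_left_mono[OF that]) simp
 have r1: "1 / \<rho> \<le> 1 \<longleftrightarrow> 1 \<le> \<rho>" "1 \<le> 1 / \<rho> \<longleftrightarrow> \<rho> \<le> 1" using assms(17) by (simp_all add: field_simps)
 have i: "1 \<le> \<rho> \<longrightarrow> mid \<le> lhs \<and> rhs \<le> mid" and ii: "\<rho> \<le> 1 \<longrightarrow> lhs \<le> mid \<and> mid \<le> rhs"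
  unfolding L R Mid using inner outer[unfolded r1] by (blast intro: mono)+
 have gauss_eq: "lhs = mid \<and> mid = rhs" if gs: gaussian
 proof -
  \<comment> \<open>For \<open>v = Si i u\<close> the form of the inverse of \<open>Ai i\<close> at
    \<open>v\<close> is \<open>u \<bullet> u\<close>, as \<open>Si i\<close> squares to
    \<open>Ai i\<close>. The factor \<open>c i\<close> cancels the scaling, and
    \<open>exp (u \<bullet> u)\<close> in \<open>phi\<close> cancels the Gaussian.\<close>
  have one: "phi g i u = 1" if i: "i < m" and u: "u \<in> Rn (d i)" for i u
  proof -
   have Ac: "Ai i \<in> Mat (d i) (d i)" using Aspd'[OF i] by (simp add: sym_pos_def_def)
   note mA = sym_pos_def_minv[OF Aspd'[OF i]] and mS = sym_pos_def_minv[OF SiP(1)[OF i]]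
   have Ss: "(Si i)\<^sup>T = Si i" using SiP(1)[OF i] by (simp add: sym_pos_def_def)
   define v where "v = Si i *\<^sub>v u"
   have v: "v \<in> Rn (d i)" unfolding v_def by (rule mult_mat_vec_carrier[OF Sic[OF i] u])
   define w where "w = minv (Ai i) *\<^sub>v v"
   have w: "w \<in> Rn (d i)" unfolding w_def by (rule mult_mat_vec_carrier[OF mA(4) v])
   have Sw: "Si i *\<^sub>v w \<in> Rn (d i)" by (rule mult_mat_vec_carrier[OF Sic[OF i] w])
   have cancel: "minv (Si i) *\<^sub>v (Si i *\<^sub>v t) = t" if t: "t \<in> Rn (d i)" for t
    unfolding assoc_mult_mat_vec[OF mS(4) Sic[OF i] t, symmetric] mS(2) using t by simp
   have "Si i *\<^sub>v (Si i *\<^sub>v w) = Ai i *\<^sub>v w"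
    unfolding SiP(2)[OF i, symmetric] by (rule assoc_mult_mat_vec[OF Sic[OF i] Sic[OF i] w, symmetric])
   also have "... = v" unfolding w_def assoc_mult_mat_vec[OF Ac mA(4) v, symmetric] mA(3) using v by simp
   finally have sv: "Si i *\<^sub>v (Si i *\<^sub>v w) = v" .
   have "Si i *\<^sub>v w = minv (Si i) *\<^sub>v (Si i *\<^sub>v (Si i *\<^sub>v w))" by (rule cancel[OF Sw, symmetric])
   also have "... = minv (Si i) *\<^sub>v (Si i *\<^sub>v u)" unfolding sv v_def ..
   also have "... = u" by (rule cancel[OF u])
   finally have Sw_u: "Si i *\<^sub>v w = u" .
   have "u \<bullet> (Si i *\<^sub>v w) = v \<bullet> w" unfolding v_def by (rule mat_vec_scalar_prod_sym[OF Sic[OF i] Ss u w])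
   then have vw: "v \<bullet> (minv (Ai i) *\<^sub>v v) = u \<bullet> u" unfolding Sw_u unfolding w_def by (rule sym)
   let ?t = "1 / sqrt (c i)"
   have tv: "?t \<cdot>\<^sub>v v \<in> Rn (d i)" using v by simp
   have "(?t \<cdot>\<^sub>v v) \<bullet> (minv (Ai i) *\<^sub>v (?t \<cdot>\<^sub>v v)) = ?t * (?t * (v \<bullet> w))"
    unfolding mult_mat_vec[OF mA(4) v] w_def[symmetric] using v w by simp
   also have "... = (?t * ?t) * (u \<bullet> u)" using vw by (simp only: mult.assoc w_def)
   also have "?t * ?t = 1 / c i" using c[OF i] by simp
   finally have e: "c i * ((?t \<cdot>\<^sub>v v) \<bullet> (minv (Ai i) *\<^sub>v (?t \<cdot>\<^sub>v v))) = u \<bullet> u" using c[OF i] by simp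
   have "g i (?t \<cdot>\<^sub>v v) = f i (?t \<cdot>\<^sub>v v)" by (rule gG[OF gs i tv])
   also have "... = exp (- c i * ((?t \<cdot>\<^sub>v v) \<bullet> (minv (Ai i) *\<^sub>v (?t \<cdot>\<^sub>v v))))"
    using gs i tv unfolding gaussian_def by blast
   also have "... = exp (- (u \<bullet> u))" unfolding mult_minus_left e ..
   finally show ?thesis unfolding phi_def v_def[symmetric] by (simp add: exp_minus)
  qed
  have "N1 = 1" unfolding N1_def by (rule nested_integral_one[where d = d, OF V aW]) (simp_all add: one)
  moreover have "N2 = 1"
  proof -
   have "nested_integral m k n (%i. a \<cdot>\<^sub>m W i) V \<rho> (phi g) = 1" by (rule nested_integral_one[where d = d, OF aW V one])
   then show ?thesis by (simp add: N2_def ennreal_powr_def)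
  qed
  moreover have "N3 = 1" unfolding N3_def by (rule norm_product_one[OF one])
  ultimately show ?thesis unfolding L R Mid by simp
 qed
 show ?thesis
  using i ii gauss_eq unfolding gaussian_def[symmetric] by (auto intro: antisym)
qed

end
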